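(* Let $d\ge1$, $T>0$, $\gamma>1$, $h(\rho)=\rho^\gamma$, and let $\kappa(\rho)=C_\kappa>0$ be constant. Let $(\rho,u)$ be a solution on $[0,T]\times\mathbb{T}^d$, with initial data $(\rho_0,u_0)$, of the Euler system $$\rho_t+\mathrm{div}_x(\rho u)=0,\qquad(\rho u)_t+\mathrm{div}_x(\rho u\otimes u)=-\rho\nabla_x\big(h'(\rho)\big),$$ satisfying $\rho\in C^0([0,T],C^3(\mathbb{T}^d,\mathbb{R}_+))\cap C^1((0,T),C^1(\mathbb{T}^d,\mathbb{R}_+))$ and $u\in C^0([0,T],C^2(\mathbb{T}^d,\mathbb{R}^d))\cap C^1((0,T),C^0(\mathbb{T}^d,\mathbb{R}^d))$. Let $\{(\rho^\varepsilon,u^\varepsilon)\}_{\varepsilon>0}$ be a family of (conservative or dissipative) weak solutions, each satisfying the finite mass and finite energy assumption (H), of the Euler-Korteweg system with capillarity $\varepsilon\kappa$, $$\rho^\varepsilon_t+\mathrm{div}_x(\rho^\varepsilon u^\varepsilon)=0,\qquad(\rho^\varepsilon u^\varepsilon)_t+\mathrm{div}_x(\rho^\varepsilon u^\varepsilon\otimes u^\varepsilon)=-\rho^\varepsilon\nabla_x\Big(h'(\rho^\varepsilon)+\tfrac{\varepsilon\kappa'(\rho^\varepsilon)}2|\nabla_x\rho^\varepsilon|^2-\mathrm{div}_x(\varepsilon\kappa(\rho^\varepsilon)\nabla_x\rho^\varepsilon)\Big),$$ having the same initial data $(\rho_0,u_0)$. Then there exists a constant $C>0$ depending on $T$ and $(\rho,u)$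 (and not on $\varepsilon$) such that $$\int_{\mathbb{T}^d}h(\rho^\varepsilon(t,\cdot)|\rho(t,\cdot))+\frac{\rho^\varepsilon(t,\cdot)}2\big|u^\varepsilon(t,\cdot)-u(t,\cdot)\big|^2\,dx\le C\varepsilon^2$$ for almost all $t\in[0,T]$.
   Context: $\mathbb{T}^d$ is the $d$-dimensional flat torus, $\mathbb{R}_+=(0,\infty)$, and $h(\rho|\bar\rho):=h(\rho)-h(\bar\rho)-h'(\bar\rho)(\rho-\bar\rho)$. The data $\gamma,C_\kappa,d$ are fixed. Momentum is $m^\varepsilon=\rho^\varepsilon u^\varepsilon$, and the same initial data means $\rho^\varepsilon(0,\cdot)=\rho_0$, $m^\varepsilon(0,\cdot)=\rho_0u_0$. Weak solutions of the Euler-Korteweg system with capillarity $\varepsilon\kappa$: put $p(\rho)=\rho h'(\rho)-h(\rho)$ and $$S=\Big[-p(\rho)-\varepsilon\tfrac{\rho\kappa'(\rho)+\kappa(\rho)}2|\nabla_x\rho|^2+\varepsilon\,\mathrm{div}_x(\rho\kappa(\rho)\nabla_x\rho)\Big]\mathbb{I}-\varepsilon\kappa(\rho)\nabla_x\rho\otimes\nabla_x\rho.$$ A pair $(\rho,m)$ with $\rho\in C([0,\infty);L^1(\mathbb{T}^d))$, $\rho\ge0$, $m\in C([0,\infty);L^1(\mathbb{T}^d,\mathbb{R}^d))$ is a weak solution if $\frac{m\otimes m}\rho,S\in L^1_{loc}((0,\infty)\times\mathbb{T}^d)^{d\times d}$ and $$-\iint\big(\rho\psi_t+m\cdot\nabla_x\psi\big)dx\,dt=\int\rho(0,x)\psi(0,x)\,dx\quad\forall\psi\in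 C^1_c([0,\infty);C^1(\mathbb{T}^d)),$$ $$-\iint\Big(m\cdot\varphi_t+\tfrac{m\otimes m}\rho:\nabla_x\varphi-S:\nabla_x\varphi\Big)dx\,dt=\int m(0,x)\cdot\varphi(0,x)\,dx\quad\forall\varphi\in C^1_c([0,\infty);(C^1(\mathbb{T}^d))^d).$$ It is dissipative if in addition $E:=\frac12\frac{|m|^2}\rho+h(\rho)+\frac{\varepsilon\kappa(\rho)}2|\nabla_x\rho|^2\in C([0,\infty);L^1(\mathbb{T}^d))$ and $-\iint E\,\dot\theta(t)\,dx\,dt\le\int E|_{t=0}\,\theta(0)\,dx$ for all non-negative $\theta\in W^{1,\infty}[0,\infty)$ compactly supported in $[0,\infty)$; it is conservative if this holds with equality. Assumption (H): $\sup_{t\in(0,\infty)}\int_{\mathbb{T}^d}\rho\,dx<\infty$ and $\sup_{t\in(0,\infty)}\int_{\mathbb{T}^d}E\,dx<\infty$. *)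

theory Defs
  imports "HOL-Analysis.Analysis"
begin

section \<open>Functions on the flat torus\<close>

text \<open>
  The torus of dimension \<open>d = CARD('n)\<close> is the quotient of \<open>real ^ 'n\<close> by the integer lattice:
  functions on it are 1-periodic functions, integrals over it are integrals over the unit cube.
\<close>

definition torus_fun :: "(real ^ 'n \<Rightarrow> 'b) \<Rightarrow> bool" where
  "torus_fun f \<longleftrightarrow> (\<forall>x i. f (x + axis i 1) = f x)"

definition torus_cell :: "(real ^ 'n) set" where
  "torus_cell = cbox 0 1"

definition pd :: "'n \<Rightarrow> (real ^ 'n \<Rightarrow> 'b::real_normed_vector) \<Rightarrow> real ^ 'n \<Rightarrow> 'b" where
  "pd i f x = frechet_derivative f (at x) (axis i 1)"

primrec pds :: "'n list \<Rightarrow> (real ^ 'n \<Rightarrow> 'b::real_normed_vector) \<Rightarrow> real ^ 'n \<Rightarrow> 'b" where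
  "pds [] f = f"
| "pds (i # is) f = pd i (pds is f)"

definition grad :: "(real ^ 'n \<Rightarrow> real) \<Rightarrow> real ^ 'n \<Rightarrow> real ^ 'n" where
  "grad f x = (\<chi> i. pd i f x)"

definition div_vec :: "(real ^ 'n \<Rightarrow> real ^ 'n) \<Rightarrow> real ^ 'n \<Rightarrow> real" where
  "div_vec F x = (\<Sum>i\<in>UNIV. pd i (\<lambda>y. F y $ i) x)"

definition div_mat :: "(real ^ 'n \<Rightarrow> real ^ 'n ^ 'n) \<Rightarrow> real ^ 'n \<Rightarrow> real ^ 'n" where
  "div_mat A x = (\<chi> i. \<Sum>j\<in>UNIV. pd j (\<lambda>y. A y $ i $ j) x)"

definition outer :: "real ^ 'n \<Rightarrow> real ^ 'n \<Rightarrow> real ^ 'n ^ 'n" where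
  "outer a b = (\<chi> i j. a $ i * b $ j)"

primrec Ck :: "nat \<Rightarrow> (real ^ 'n \<Rightarrow> 'b::real_normed_vector) \<Rightarrow> bool" where
  "Ck 0 f \<longleftrightarrow> continuous_on UNIV f"
| "Ck (Suc k) f \<longleftrightarrow> (\<forall>x. f differentiable (at x)) \<and> (\<forall>i. Ck k (pd i f))"

definition Ck_torus :: "nat \<Rightarrow> (real ^ 'n \<Rightarrow> 'b::real_normed_vector) \<Rightarrow> bool" where
  "Ck_torus k f \<longleftrightarrow> torus_fun f \<and> Ck k f"

text \<open>Convergence in the norm of \<open>C^k\<close>: uniform convergence of all partial derivatives of order
  at most \<open>k\<close>.\<close>

definition Ck_tendsto ::
    "nat \<Rightarrow> ('t \<Rightarrow> real ^ 'n \<Rightarrow> 'b::real_normed_vector) \<Rightarrow> (real ^ 'n \<Rightarrow> 'b) \<Rightarrow> 't filter \<Rightarrow> bool" where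
  "Ck_tendsto k f l F \<longleftrightarrow>
     (\<forall>is. length is \<le> k \<longrightarrow> uniform_limit UNIV (\<lambda>s. pds is (f s)) (pds is l) F)"

text \<open>The classes \<open>C^0(I; C^k)\<close> and \<open>C^1(I; C^k)\<close> of maps from a time interval \<open>I\<close> into the Banach
  space \<open>C^k\<close> of the torus. The time derivative is named explicitly in \<open>C1_Ck_deriv\<close>.\<close>

definition C0_Ck :: "real set \<Rightarrow> nat \<Rightarrow> (real \<Rightarrow> real ^ 'n \<Rightarrow> 'b::real_normed_vector) \<Rightarrow> bool" where
  "C0_Ck I k f \<longleftrightarrow> (\<forall>t\<in>I. Ck_torus k (f t)) \<and> (\<forall>t\<in>I. Ck_tendsto k f (f t) (at t within I))"

definition C1_Ck_deriv ::
    "real set \<Rightarrow> nat \<Rightarrow> (real \<Rightarrow> real ^ 'n \<Rightarrow> 'b::real_normed_vector) \<Rightarrow> (real \<Rightarrow> real ^ 'n \<Rightarrow> 'b) \<Rightarrow> bool"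
where
  "C1_Ck_deriv I k f f' \<longleftrightarrow> C0_Ck I k f \<and> C0_Ck I k f' \<and>
     (\<forall>t\<in>I. Ck_tendsto k (\<lambda>s x. (f s x - f t x) /\<^sub>R (s - t)) (f' t) (at t within I))"

definition C1_Ck :: "real set \<Rightarrow> nat \<Rightarrow> (real \<Rightarrow> real ^ 'n \<Rightarrow> 'b::real_normed_vector) \<Rightarrow> bool" where
  "C1_Ck I k f \<longleftrightarrow> (\<exists>f'. C1_Ck_deriv I k f f')"

text \<open>Test functions in \<open>C^1_c([0,\<infinity>); C^1)\<close>, together with their time derivative.\<close>

definition test_fun ::
    "(real \<Rightarrow> real ^ 'n \<Rightarrow> 'b::real_normed_vector) \<Rightarrow> (real \<Rightarrow> real ^ 'n \<Rightarrow> 'b) \<Rightarrow> bool" where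
  "test_fun \<phi> \<phi>' \<longleftrightarrow> C1_Ck_deriv {0..} 1 \<phi> \<phi>' \<and> (\<exists>R. \<forall>t\<ge>R. \<forall>x. \<phi> t x = 0)"

text \<open>Functions of time and space on \<open>[0,\<infinity>)\<close> times the torus are represented by jointly Borel
  measurable functions, so that space-time integrals make sense. This is no restriction: every
  element of \<open>C([0,\<infinity>); L^1)\<close> has such a representative with the correct slice at every time
  (take the limit of averages over shrinking balls in space where it exists, and 0 elsewhere).\<close>

definition st_measurable ::
    "(real \<Rightarrow> real ^ 'n \<Rightarrow> 'b::{second_countable_topology,real_normed_vector}) \<Rightarrow> bool" where
  "st_measurable f \<longleftrightarrow> set_borel_measurable borel ({0..} \<times> UNIV) (\<lambda>(t, x). f t x)"

definition C0_L1 ::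
    "(real \<Rightarrow> real ^ 'n \<Rightarrow> 'b::{second_countable_topology,banach}) \<Rightarrow> bool" where
  "C0_L1 f \<longleftrightarrow> st_measurable f \<and>
     (\<forall>t\<ge>0. torus_fun (f t) \<and> set_integrable lborel torus_cell (f t)) \<and>
     (\<forall>t\<ge>0. ((\<lambda>s. LINT x:torus_cell|lborel. norm (f s x - f t x)) \<longlongrightarrow> 0) (at t within {0..}))"

definition L1_loc ::
    "(real \<Rightarrow> real ^ 'n \<Rightarrow> 'b::{second_countable_topology,banach}) \<Rightarrow> bool" where
  "L1_loc f \<longleftrightarrow>
     (\<forall>a b. 0 < a \<and> a < b \<longrightarrow> set_integrable lborel ({a..b} \<times> torus_cell) (\<lambda>(t, x). f t x))"

definition weak_grad :: "(real ^ 'n \<Rightarrow> real) \<Rightarrow> (real ^ 'n \<Rightarrow> real ^ 'n) \<Rightarrow> bool" where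
  "weak_grad f g \<longleftrightarrow> torus_fun g \<and>
     set_integrable lborel torus_cell f \<and> set_integrable lborel torus_cell g \<and>
     (\<forall>\<phi>. Ck_torus 1 \<phi> \<longrightarrow>
        (LINT x:torus_cell|lborel. f x *\<^sub>R grad \<phi> x) = - (LINT x:torus_cell|lborel. \<phi> x *\<^sub>R g x))"

definition weak_div :: "(real ^ 'n \<Rightarrow> real ^ 'n) \<Rightarrow> (real ^ 'n \<Rightarrow> real) \<Rightarrow> bool" where
  "weak_div F q \<longleftrightarrow> torus_fun q \<and>
     set_integrable lborel torus_cell F \<and> set_integrable lborel torus_cell q \<and>
     (\<forall>\<phi>. Ck_torus 1 \<phi> \<longrightarrow>
        (LINT x:torus_cell|lborel. F x \<bullet> grad \<phi> x) = - (LINT x:torus_cell|lborel. \<phi> x * q x))"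

text \<open>\<open>W1inf \<theta> \<theta>'\<close>: \<open>\<theta>\<close> is the continuous representative of an element of \<open>W^{1,\<infinity>}\<close> on \<open>[0,\<infinity>)\<close>
  (so that \<open>\<theta> 0\<close> is meaningful) and \<open>\<theta>'\<close> is its weak derivative.\<close>

definition W1inf :: "(real \<Rightarrow> real) \<Rightarrow> (real \<Rightarrow> real) \<Rightarrow> bool" where
  "W1inf \<theta> \<theta>' \<longleftrightarrow> continuous_on {0..} \<theta> \<and> bounded (\<theta> ` {0..}) \<and>
     set_borel_measurable borel {0..} \<theta>' \<and> (\<exists>B. AE t in lborel. 0 \<le> t \<longrightarrow> \<bar>\<theta>' t\<bar> \<le> B) \<and>
     (\<forall>\<eta> \<eta>'. (\<forall>t. (\<eta> has_real_derivative \<eta>' t) (at t)) \<and> continuous_on UNIV \<eta>' \<and>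
            (\<exists>a b. 0 < a \<and> (\<forall>t. t \<notin> {a..b} \<longrightarrow> \<eta> t = 0)) \<longrightarrow>
        (LINT t:{0..}|lborel. \<theta> t * \<eta>' t) = - (LINT t:{0..}|lborel. \<theta>' t * \<eta> t))"

section \<open>Classical solutions of the Euler system\<close>

definition euler_classical ::
    "(real \<Rightarrow> real) \<Rightarrow> real \<Rightarrow> (real \<Rightarrow> real ^ 'n \<Rightarrow> real) \<Rightarrow> (real \<Rightarrow> real ^ 'n \<Rightarrow> real ^ 'n) \<Rightarrow> bool"
where
  "euler_classical h T \<rho> u \<longleftrightarrow> (\<forall>t\<in>{0<..<T}. \<forall>x.
     deriv (\<lambda>s. \<rho> s x) t + div_vec (\<lambda>y. \<rho> t y *\<^sub>R u t y) x = 0 \<and>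
     vector_derivative (\<lambda>s. \<rho> s x *\<^sub>R u s x) (at t) + div_mat (\<lambda>y. \<rho> t y *\<^sub>R outer (u t y) (u t y)) x
       = - (\<rho> t x *\<^sub>R grad (\<lambda>y. deriv h (\<rho> t y)) x))"

section \<open>Weak solutions of the Euler-Korteweg system\<close>

text \<open>The arguments \<open>r, g, q\<close> of \<open>stress\<close> are the values at a point of the density, of its weak
  gradient, and of the weak divergence of \<open>\<rho> \<kappa>(\<rho>) \<nabla>\<rho>\<close>.\<close>

definition pressure :: "(real \<Rightarrow> real) \<Rightarrow> real \<Rightarrow> real" where
  "pressure h r = r * deriv h r - h r"

definition stress ::
    "(real \<Rightarrow> real) \<Rightarrow> (real \<Rightarrow> real) \<Rightarrow> real \<Rightarrow> real \<Rightarrow> real ^ 'n \<Rightarrow> real \<Rightarrow> real ^ 'n ^ 'n" where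
  "stress h \<kappa> \<epsilon> r g q =
     (- pressure h r - \<epsilon> * ((r * deriv \<kappa> r + \<kappa> r) / 2) * (norm g)\<^sup>2 + \<epsilon> * q) *\<^sub>R mat 1
     - (\<epsilon> * \<kappa> r) *\<^sub>R outer g g"

definition energy_density ::
    "(real \<Rightarrow> real) \<Rightarrow> (real \<Rightarrow> real) \<Rightarrow> real \<Rightarrow> real \<Rightarrow> real ^ 'n \<Rightarrow> real ^ 'n \<Rightarrow> real" where
  "energy_density h \<kappa> \<epsilon> r m g = 1 / 2 * ((norm m)\<^sup>2 / r) + h r + \<epsilon> * \<kappa> r / 2 * (norm g)\<^sup>2"

text \<open>Quotients by the density are 0 in HOL where the density vanishes. This agrees with the
  convention \<open>0/0 = 0\<close>, but a non-zero momentum in vacuum, for which \<open>m \<otimes> m / \<rho>\<close> is infinite,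
  has to be excluded explicitly.\<close>

definition no_vacuum_momentum :: "(real ^ 'n \<Rightarrow> real) \<Rightarrow> (real ^ 'n \<Rightarrow> real ^ 'n) \<Rightarrow> bool" where
  "no_vacuum_momentum r m \<longleftrightarrow> (AE x in lborel. r x = 0 \<longrightarrow> m x = 0)"

text \<open>\<open>EK_weak h \<kappa> \<epsilon> \<rho> m g q\<close>: \<open>(\<rho>, m)\<close> is a weak solution for the capillarity \<open>\<epsilon> \<kappa>\<close>, where
  \<open>g = \<nabla>\<rho>\<close> and \<open>q = div (\<rho> \<kappa>(\<rho>) \<nabla>\<rho>)\<close> in the weak sense. Since a non-integrable function has integral
  0 in HOL, the integrability up to time 0 that is implicit in writing the momentum identity is
  required explicitly; in the mass identity it follows from \<open>C0_L1\<close>. The inner product of matrices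
  is the Frobenius product.\<close>

definition EK_weak ::
    "(real \<Rightarrow> real) \<Rightarrow> (real \<Rightarrow> real) \<Rightarrow> real \<Rightarrow> (real \<Rightarrow> real ^ 'n \<Rightarrow> real) \<Rightarrow> (real \<Rightarrow> real ^ 'n \<Rightarrow> real ^ 'n)
      \<Rightarrow> (real \<Rightarrow> real ^ 'n \<Rightarrow> real ^ 'n) \<Rightarrow> (real \<Rightarrow> real ^ 'n \<Rightarrow> real) \<Rightarrow> bool"
where
  "EK_weak h \<kappa> \<epsilon> \<rho> m g q \<longleftrightarrow>
     C0_L1 \<rho> \<and> (\<forall>t\<ge>0. AE x in lborel. 0 \<le> \<rho> t x) \<and> C0_L1 m \<and>
     st_measurable g \<and> st_measurable q \<and>
     (AE t in lborel. 0 < t \<longrightarrow>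
        weak_grad (\<rho> t) (g t) \<and>
        weak_div (\<lambda>x. (\<rho> t x * \<kappa> (\<rho> t x)) *\<^sub>R g t x) (q t) \<and>
        no_vacuum_momentum (\<rho> t) (m t)) \<and>
     L1_loc (\<lambda>t x. outer (m t x) (m t x) /\<^sub>R \<rho> t x) \<and>
     L1_loc (\<lambda>t x. stress h \<kappa> \<epsilon> (\<rho> t x) (g t x) (q t x)) \<and>
     (\<forall>\<psi> \<psi>'. test_fun \<psi> \<psi>' \<longrightarrow>
        - (LINT (t, x):{0..} \<times> torus_cell|lborel. \<rho> t x * \<psi>' t x + m t x \<bullet> grad (\<psi> t) x)
        = (LINT x:torus_cell|lborel. \<rho> 0 x * \<psi> 0 x)) \<and>
     (\<forall>\<phi> \<phi>'. test_fun \<phi> \<phi>' \<longrightarrow>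
        (let F = (\<lambda>(t, x). m t x \<bullet> \<phi>' t x
                    + (outer (m t x) (m t x) /\<^sub>R \<rho> t x) \<bullet> jacobian (\<phi> t) (at x)
                    - stress h \<kappa> \<epsilon> (\<rho> t x) (g t x) (q t x) \<bullet> jacobian (\<phi> t) (at x))
         in set_integrable lborel ({0..} \<times> torus_cell) F \<and>
            - (LINT z:{0..} \<times> torus_cell|lborel. F z)
            = (LINT x:torus_cell|lborel. m 0 x \<bullet> \<phi> 0 x)))"

definition EK_weak_solution ::
    "(real \<Rightarrow> real) \<Rightarrow> (real \<Rightarrow> real) \<Rightarrow> real \<Rightarrow> (real \<Rightarrow> real ^ 'n \<Rightarrow> real) \<Rightarrow> (real \<Rightarrow> real ^ 'n \<Rightarrow> real ^ 'n)
      \<Rightarrow> bool"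
where
  "EK_weak_solution h \<kappa> \<epsilon> \<rho> m \<longleftrightarrow> (\<exists>g q. EK_weak h \<kappa> \<epsilon> \<rho> m g q)"

text \<open>The total energy is a continuous curve in \<open>L^1\<close> whose value at every time, in particular at
  time 0, is given by the formula; hence the density has a weak gradient at every time.\<close>

definition EK_energy ::
    "(real \<Rightarrow> real) \<Rightarrow> (real \<Rightarrow> real) \<Rightarrow> real \<Rightarrow> (real \<Rightarrow> real ^ 'n \<Rightarrow> real) \<Rightarrow> (real \<Rightarrow> real ^ 'n \<Rightarrow> real ^ 'n)
      \<Rightarrow> (real \<Rightarrow> real ^ 'n \<Rightarrow> real) \<Rightarrow> bool"
where
  "EK_energy h \<kappa> \<epsilon> \<rho> m E \<longleftrightarrow> (\<exists>g. st_measurable g \<and>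
     (\<forall>t\<ge>0. weak_grad (\<rho> t) (g t) \<and> no_vacuum_momentum (\<rho> t) (m t)) \<and>
     E = (\<lambda>t x. energy_density h \<kappa> \<epsilon> (\<rho> t x) (m t x) (g t x)))"

definition EK_dissipative ::
    "(real \<Rightarrow> real) \<Rightarrow> (real \<Rightarrow> real) \<Rightarrow> real \<Rightarrow> (real \<Rightarrow> real ^ 'n \<Rightarrow> real) \<Rightarrow> (real \<Rightarrow> real ^ 'n \<Rightarrow> real ^ 'n)
      \<Rightarrow> bool"
where
  "EK_dissipative h \<kappa> \<epsilon> \<rho> m \<longleftrightarrow> EK_weak_solution h \<kappa> \<epsilon> \<rho> m \<and>
     (\<exists>E. EK_energy h \<kappa> \<epsilon> \<rho> m E \<and> C0_L1 E \<and>
        (\<forall>\<theta> \<theta>'. W1inf \<theta> \<theta>' \<and> (\<forall>t\<ge>0. 0 \<le> \<theta> t) \<and> (\<exists>R. \<forall>t\<ge>R. \<theta> t = 0) \<longrightarrow>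
           - (LINT (t, x):{0..} \<times> torus_cell|lborel. E t x * \<theta>' t)
           \<le> (LINT x:torus_cell|lborel. E 0 x * \<theta> 0)))"

definition EK_conservative ::
    "(real \<Rightarrow> real) \<Rightarrow> (real \<Rightarrow> real) \<Rightarrow> real \<Rightarrow> (real \<Rightarrow> real ^ 'n \<Rightarrow> real) \<Rightarrow> (real \<Rightarrow> real ^ 'n \<Rightarrow> real ^ 'n)
      \<Rightarrow> bool"
where
  "EK_conservative h \<kappa> \<epsilon> \<rho> m \<longleftrightarrow> EK_weak_solution h \<kappa> \<epsilon> \<rho> m \<and>
     (\<exists>E. EK_energy h \<kappa> \<epsilon> \<rho> m E \<and> C0_L1 E \<and>
        (\<forall>\<theta> \<theta>'. W1inf \<theta> \<theta>' \<and> (\<forall>t\<ge>0. 0 \<le> \<theta> t) \<and> (\<exists>R. \<forall>t\<ge>R. \<theta> t = 0) \<longrightarrow>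
           - (LINT (t, x):{0..} \<times> torus_cell|lborel. E t x * \<theta>' t)
           = (LINT x:torus_cell|lborel. E 0 x * \<theta> 0)))"

definition finite_mass_energy ::
    "(real \<Rightarrow> real) \<Rightarrow> (real \<Rightarrow> real) \<Rightarrow> real \<Rightarrow> (real \<Rightarrow> real ^ 'n \<Rightarrow> real) \<Rightarrow> (real \<Rightarrow> real ^ 'n \<Rightarrow> real ^ 'n)
      \<Rightarrow> bool"
where
  "finite_mass_energy h \<kappa> \<epsilon> \<rho> m \<longleftrightarrow>
     (\<forall>t>0. set_integrable lborel torus_cell (\<rho> t)) \<and>
     bdd_above ((\<lambda>t. LINT x:torus_cell|lborel. \<rho> t x) ` {0<..}) \<and>
     (\<exists>E. EK_energy h \<kappa> \<epsilon> \<rho> m E \<and>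
        (\<forall>t>0. set_integrable lborel torus_cell (E t)) \<and>
        bdd_above ((\<lambda>t. LINT x:torus_cell|lborel. E t x) ` {0<..}))"

definition rel_enthalpy :: "(real \<Rightarrow> real) \<Rightarrow> real \<Rightarrow> real \<Rightarrow> real" where
  "rel_enthalpy h r s = h r - h s - deriv h s * (r - s)"

end

theory Submission
  imports Defs
begin

text \<open>
  The energy of \<open>(\<rho>\<^sup>\<epsilon>, m\<^sup>\<epsilon>)\<close> relative to the classical solution \<open>(\<rho>, u)\<close>, capillary part
  \<open>\<epsilon>\<kappa>/2 |\<nabla>\<rho>\<^sup>\<epsilon> - \<nabla>\<rho>|\<^sup>2\<close> included, satisfies a Gronwall inequality with a source of order
  \<open>\<epsilon>\<^sup>2\<close>. To derive it with few test functions, the fields of the classical solution are frozen at a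
  time \<open>t\<close> while the weak solution is taken at time \<open>s\<close>: the momentum equation of the weak solution is tested with \<open>u(t)\<close> alone, all
  remaining terms are differentiable at \<open>s = t\<close>, and this controls the upper right Dini derivative of
  the diagonal \<open>s = t\<close>. The capillary stress contributes quadratic terms in \<open>\<nabla>\<rho>\<^sup>\<epsilon> - \<nabla>\<rho>\<close>,
  which are absorbed, and one term linear in \<open>\<rho>\<^sup>\<epsilon> u\<^sup>\<epsilon> - \<rho>\<^sup>\<epsilon> u\<close> of size \<open>\<epsilon>\<close>,
  which Young's inequality turns into \<open>\<epsilon>\<^sup>2\<close>. The difference \<open>\<rho>\<^sup>\<epsilon> - \<rho>\<close> that
  also occurs has mean zero and is bounded through its gradient by the Poincare inequality.
\<close>

section \<open>Calculus on the torus\<close>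

text \<open>Admissible test functions are C^1 on all of [0,infinity) with values in C^1, while
  \<open>u\<close> is given on [0,T] and its difference quotients in time are only assumed to
  converge in C^0; hence the freezing. The Laplacian of \<rho> is not known to be differentiable in
  time. Its pairing with \<open>\<rho>\<^sup>\<epsilon>\<close> nevertheless is, on the diagonal:
  the product of the two increments is o(s - t) by the mass balance, and the term carrying the
  increment of the Laplacian alone is integrated by parts once. The weak momentum flux is controlled
  for almost every time only, so the Dini derivative comes from integrating an almost-everywhere
  bound whose right-hand side is continuous in s. The energy balance enters solely as a comparison
  with time 0: Gronwall is applied to the relative energy with the total energy at time t replaced
  by the initial one. This quantity dominates the relative energy, is continuous, and vanishes
  initially because equal initial densities have equal weak gradients. That uniqueness, and the
  Poincare inequality for weak gradients, rest on approximation by periodic C^1 functions.\<close>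

lemma has_derivative_pd:
  fixes f :: "real ^ 'n \<Rightarrow> 'b::real_normed_vector"
  assumes "f differentiable (at x)"
  shows "(f has_derivative (\<lambda>h. \<Sum>i\<in>UNIV. h $ i *\<^sub>R pd i f x)) (at x)"
proof -
  let ?D = "frechet_derivative f (at x)"
  have D: "(f has_derivative ?D) (at x)"
    using assms frechet_derivative_works by blast
  then have lin: "linear ?D"
    by (rule has_derivative_linear)
  have "?D h = (\<Sum>i\<in>UNIV. h $ i *\<^sub>R pd i f x)" for h
  proof -
    have "?D h = ?D (\<Sum>i\<in>UNIV. h $ i *\<^sub>R axis i 1)"
      using basis_expansion[of h] by (simp add: scalar_mult_eq_scaleR)
    also have "\<dots> = (\<Sum>i\<in>UNIV. h $ i *\<^sub>R pd i f x)"
      by (simp add: linear_sum[OF lin] linear_scale[OF lin] pd_def)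
    finally show ?thesis .
  qed
  then have "?D = (\<lambda>h. \<Sum>i\<in>UNIV. h $ i *\<^sub>R pd i f x)" by blast
  then show ?thesis using D by simp
qed

lemma pd_eqI: "(f has_derivative D) (at x) \<Longrightarrow> pd i f x = D (axis i 1)"
  unfolding pd_def using frechet_derivative_at by metis

lemma has_derivative_imp_differentiable: "(f has_derivative D) (at x) \<Longrightarrow> f differentiable (at x)"
  by (auto simp: differentiable_def)

lemma axis_nth_scaleR:
  fixes c :: "'n::finite \<Rightarrow> 'b::real_vector"
  shows "(\<Sum>j\<in>UNIV. (axis i (1::real) $ j) *\<^sub>R c j) = c i"
proof -
  have "(\<Sum>j\<in>UNIV. (axis i (1::real) $ j) *\<^sub>R c j) = (\<Sum>j\<in>UNIV. if j = i then c j else 0)"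
    by (rule sum.cong) (auto simp: axis_def)
  then show ?thesis by simp
qed

lemma line_derivative:
  fixes f :: "real ^ 'n \<Rightarrow> 'b::real_normed_vector"
  assumes "\<And>x. f differentiable (at x)"
  shows "((\<lambda>s. f (x + s *\<^sub>R y)) has_vector_derivative (\<Sum>i\<in>UNIV. y $ i *\<^sub>R pd i f (x + s *\<^sub>R y))) (at s within S)"
proof -
  have f: "(f has_derivative (\<lambda>h. \<Sum>i\<in>UNIV. h $ i *\<^sub>R pd i f (x + s *\<^sub>R y))) (at (x + s *\<^sub>R y))"
    by (rule has_derivative_pd) (rule assms)
  have g: "((\<lambda>s. x + s *\<^sub>R y) has_derivative (\<lambda>h. h *\<^sub>R y)) (at s within S)"
    by (auto intro!: derivative_eq_intros)
  have "((\<lambda>s. f (x + s *\<^sub>R y)) has_derivative (\<lambda>h. \<Sum>i\<in>UNIV. (h *\<^sub>R y) $ i *\<^sub>R pd i f (x + s *\<^sub>R y))) (at s within S)"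
    by (rule has_derivative_compose[OF g f])
  then show ?thesis
    by (simp add: has_vector_derivative_def scaleR_sum_right)
qed

lemma axis_derivative:
  fixes f :: "real ^ 'n \<Rightarrow> 'b::real_normed_vector"
  assumes "\<And>x. f differentiable (at x)"
  shows "((\<lambda>s. f (x + s *\<^sub>R axis i 1)) has_vector_derivative pd i f (x + s *\<^sub>R axis i 1)) (at s within S)"
  using line_derivative[OF assms, of x "axis i 1" s S] by (simp add: axis_nth_scaleR)

lemma torus_funD: "torus_fun f \<Longrightarrow> f (x + axis i 1) = f x"
  by (simp add: torus_fun_def)

lemma torus_fun_int_shift:
  fixes f :: "real ^ 'n \<Rightarrow> 'b"
  assumes "torus_fun f"
  shows "f (x + (\<chi> i. of_int (k i))) = f x"
proof -
  have one: "f (x + of_int j *\<^sub>R axis i 1) = f x" for x j i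
  proof (induction j rule: int_induct[where k = 0])
    case (step1 j)
    have "x + of_int (j + 1) *\<^sub>R axis i 1 = x + of_int j *\<^sub>R axis i (1::real) + axis i 1"
      by (simp add: algebra_simps)
    then show ?case using step1 torus_funD[OF assms] by metis
  next
    case (step2 j)
    have "x + of_int j *\<^sub>R axis i 1 = x + of_int (j - 1) *\<^sub>R axis i (1::real) + axis i 1"
      by (simp add: algebra_simps)
    then show ?case using step2 torus_funD[OF assms] by metis
  qed simp
  have "f (x + (\<Sum>i\<in>S. of_int (k i) *\<^sub>R axis i 1)) = f x" if "finite S" for S
    using that
  proof (induction S)
    case (insert a S)
    then show ?case
      using one[of "x + (\<Sum>i\<in>S. of_int (k i) *\<^sub>R axis i 1)" "k a" a] by (simp add: algebra_simps)
  qed simp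
  moreover have "(\<Sum>i\<in>UNIV. of_int (k i) *\<^sub>R axis i 1) = ((\<chi> i. of_int (k i)) :: real ^ 'n)"
    using basis_expansion[of "(\<chi> i. of_int (k i)) :: real ^ 'n"] by (simp add: scalar_mult_eq_scaleR)
  ultimately show ?thesis by (metis finite)
qed

lemma torus_fun_cell_rep:
  fixes f :: "real ^ 'n \<Rightarrow> 'b"
  assumes "torus_fun f"
  obtains y where "y \<in> torus_cell" "f y = f x"
proof
  let ?y = "x + (\<chi> i. of_int (- \<lfloor>x $ i\<rfloor>))"
  show "f ?y = f x" by (rule torus_fun_int_shift[OF assms])
  show "?y \<in> torus_cell"
    by (auto simp: torus_cell_def mem_box_cart) linarith+
qed

lemma compact_torus_cell: "compact (torus_cell :: (real^'n) set)"
  by (simp add: torus_cell_def)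

lemma torus_fun_bounded:
  fixes f :: "real ^ 'n \<Rightarrow> 'b::real_normed_vector"
  assumes "torus_fun f" "continuous_on UNIV f"
  obtains B where "0 \<le> B" "\<And>x. norm (f x) \<le> B"
proof -
  have "bounded (f ` torus_cell)"
    by (intro compact_imp_bounded compact_continuous_image compact_torus_cell)
      (use assms continuous_on_subset in blast)
  then obtain B where B: "\<And>x. x \<in> torus_cell \<Longrightarrow> norm (f x) \<le> B"
    by (auto simp: bounded_iff)
  have "norm (f x) \<le> B" for x
    by (metis B assms(1) torus_fun_cell_rep)
  moreover from this[of 0] have "0 \<le> B" using norm_ge_zero order_trans by blast
  ultimately show ?thesis using that by blast
qed

lemma pd_shift:
  fixes f :: "real ^ 'n \<Rightarrow> 'b::real_normed_vector"
  assumes "f differentiable (at (x + y))"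
  shows "pd i (\<lambda>x. f (x + y)) x = pd i f (x + y)"
    and "(\<lambda>x. f (x + y)) differentiable (at x)"
proof -
  have g: "((\<lambda>x. x + y) has_derivative (\<lambda>h. h)) (at x)"
    by (auto intro!: derivative_eq_intros)
  have "((\<lambda>x. f (x + y)) has_derivative (\<lambda>h. \<Sum>i\<in>UNIV. h $ i *\<^sub>R pd i f (x + y))) (at x)"
    by (rule has_derivative_compose[OF g]) (rule has_derivative_pd[OF assms])
  from pd_eqI[OF this, of i] has_derivative_imp_differentiable[OF this]
  show "pd i (\<lambda>x. f (x + y)) x = pd i f (x + y)" "(\<lambda>x. f (x + y)) differentiable (at x)"
    by (simp_all add: axis_nth_scaleR)
qed

lemma torus_fun_pd:
  fixes f :: "real ^ 'n \<Rightarrow> 'b::real_normed_vector"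
  assumes "torus_fun f" "\<And>x. f differentiable (at x)"
  shows "torus_fun (pd i f)"
  unfolding torus_fun_def
proof (intro allI)
  fix x j
  have "(\<lambda>x. f (x + axis j 1)) = f" using assms(1) by (auto simp: torus_fun_def)
  then show "pd i f (x + axis j 1) = pd i f x"
    using pd_shift(1)[OF assms(2), of i "axis j 1" x] by simp
qed

lemma pd_diff_rules:
  fixes f g :: "real ^ 'n \<Rightarrow> 'b::real_normed_vector"
  assumes "f differentiable (at x)" "g differentiable (at x)"
  shows "pd i (\<lambda>x. f x + g x) x = pd i f x + pd i g x"
    and "pd i (\<lambda>x. f x - g x) x = pd i f x - pd i g x"
    and "pd i (\<lambda>x. c *\<^sub>R f x) x = c *\<^sub>R pd i f x"
    and "pd i (\<lambda>x. - f x) x = - pd i f x"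
proof -
  note d = has_derivative_pd[OF assms(1)] has_derivative_pd[OF assms(2)]
  show "pd i (\<lambda>x. f x + g x) x = pd i f x + pd i g x"
    by (subst pd_eqI[OF has_derivative_add[OF d]]) (simp add: axis_nth_scaleR)
  show "pd i (\<lambda>x. f x - g x) x = pd i f x - pd i g x"
    by (subst pd_eqI[OF has_derivative_diff[OF d]]) (simp add: axis_nth_scaleR)
  show "pd i (\<lambda>x. c *\<^sub>R f x) x = c *\<^sub>R pd i f x"
    by (subst pd_eqI[OF has_derivative_scaleR_right[OF d(1)]]) (simp add: axis_nth_scaleR)
  show "pd i (\<lambda>x. - f x) x = - pd i f x"
    by (subst pd_eqI[OF has_derivative_minus[OF d(1)]]) (simp add: axis_nth_scaleR)
qed

lemmas pd_add = pd_diff_rules(1) and pd_diff = pd_diff_rules(2)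
lemma pd_scaleR:
  fixes f :: "real ^ 'n \<Rightarrow> 'b::real_normed_vector"
  shows "f differentiable (at x) \<Longrightarrow> pd i (\<lambda>x. c *\<^sub>R f x) x = c *\<^sub>R pd i f x"
  by (rule pd_diff_rules(3))
lemma pd_uminus:
  fixes f :: "real ^ 'n \<Rightarrow> 'b::real_normed_vector"
  shows "f differentiable (at x) \<Longrightarrow> pd i (\<lambda>x. - f x) x = - pd i f x"
  by (rule pd_diff_rules(4))

lemma pd_cmult:
  fixes f :: "real ^ 'n \<Rightarrow> real"
  shows "f differentiable (at x) \<Longrightarrow> pd i (\<lambda>x. c * f x) x = c * pd i f x"
  using pd_scaleR[of f x i c] by simp

lemma pd_const: "pd i (\<lambda>x. c) x = 0"
  by (subst pd_eqI[OF has_derivative_const]) simp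

lemma pd_sum:
  fixes f :: "'a \<Rightarrow> real ^ 'n \<Rightarrow> 'b::real_normed_vector"
  assumes "\<And>a. a \<in> A \<Longrightarrow> f a differentiable (at x)"
  shows "pd i (\<lambda>x. \<Sum>a\<in>A. f a x) x = (\<Sum>a\<in>A. pd i (f a) x)"
proof -
  have "((\<lambda>x. \<Sum>a\<in>A. f a x) has_derivative (\<lambda>h. \<Sum>a\<in>A. \<Sum>i\<in>UNIV. h $ i *\<^sub>R pd i (f a) x)) (at x)"
    by (rule has_derivative_sum) (rule has_derivative_pd[OF assms])
  from pd_eqI[OF this] show ?thesis by (simp add: axis_nth_scaleR)
qed

lemma pd_mult:
  fixes f g :: "real ^ 'n \<Rightarrow> real"
  assumes "f differentiable (at x)" "g differentiable (at x)"
  shows "pd i (\<lambda>x. f x * g x) x = f x * pd i g x + pd i f x * g x"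
proof -
  note d = has_derivative_pd[OF assms(1)] has_derivative_pd[OF assms(2)]
  show ?thesis
    using axis_nth_scaleR[of i "\<lambda>j. pd j f x"] axis_nth_scaleR[of i "\<lambda>j. pd j g x"]
    by (subst pd_eqI[OF has_derivative_mult[OF d]]) simp
qed

lemma pd_compose:
  fixes f :: "real ^ 'n \<Rightarrow> real"
  assumes "f differentiable (at x)" "(F has_real_derivative F') (at (f x))"
  shows "pd i (\<lambda>x. F (f x)) x = F' * pd i f x"
    and "(\<lambda>x. F (f x)) differentiable (at x)"
proof -
  have "((\<lambda>x. F (f x)) has_derivative (\<lambda>h. F' * (\<Sum>i\<in>UNIV. h $ i *\<^sub>R pd i f x))) (at x)"
    by (rule has_derivative_compose[OF has_derivative_pd[OF assms(1)]])
      (use assms(2) in \<open>simp add: has_field_derivative_def\<close>)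
  from pd_eqI[OF this, of i] has_derivative_imp_differentiable[OF this]
  show "pd i (\<lambda>x. F (f x)) x = F' * pd i f x" "(\<lambda>x. F (f x)) differentiable (at x)"
    using axis_nth_scaleR[of i "\<lambda>j. pd j f x"] by simp_all
qed

lemma pd_nth:
  fixes f :: "real ^ 'n \<Rightarrow> real ^ 'm"
  assumes "f differentiable (at x)"
  shows "pd i (\<lambda>x. f x $ j) x = pd i f x $ j"
    and "(\<lambda>x. f x $ j) differentiable (at x)"
proof -
  have "((\<lambda>x. f x $ j) has_derivative (\<lambda>h. (\<Sum>i\<in>UNIV. h $ i *\<^sub>R pd i f x) $ j)) (at x)"
    by (rule bounded_linear.has_derivative[OF bounded_linear_vec_nth has_derivative_pd[OF assms]])
  from pd_eqI[OF this, of i] has_derivative_imp_differentiable[OF this]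
  show "pd i (\<lambda>x. f x $ j) x = pd i f x $ j" "(\<lambda>x. f x $ j) differentiable (at x)"
    using axis_nth_scaleR[of i "\<lambda>j. pd j f x"] by simp_all
qed

lemma jacobian_nth:
  fixes f :: "real ^ 'n \<Rightarrow> real ^ 'm"
  assumes "f differentiable (at x)"
  shows "jacobian f (at x) $ i $ j = pd j f x $ i"
  by (simp add: jacobian_def matrix_def pd_def)

subsection \<open>Differentiability classes\<close>

text \<open>Spelled with \<open>Suc 0\<close> because the simplifier rewrites the \<open>1\<close>
  of the test function classes to this form.\<close>

abbreviation C1p :: "(real ^ 'n \<Rightarrow> 'b::real_normed_vector) \<Rightarrow> bool" where
  "C1p \<equiv> Ck_torus (Suc 0)"

lemma C1p_iff: "C1p f \<longleftrightarrow> torus_fun f \<and> (\<forall>x. f differentiable (at x)) \<and> (\<forall>i. continuous_on UNIV (pd i f))"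
  by (auto simp: Ck_torus_def)

lemma C1pI:
  assumes "torus_fun f" "\<And>x. f differentiable (at x)" "\<And>i x. pd i f x = D i x"
    "\<And>i. continuous_on UNIV (D i)"
  shows "C1p f"
proof -
  have "pd i f = D i" for i using assms(3) by blast
  then show ?thesis using assms by (auto simp: C1p_iff)
qed

lemma C1pD:
  assumes "C1p f"
  shows "torus_fun f" "f differentiable (at x)" "continuous_on UNIV (pd i f)"
    "continuous_on UNIV f" "torus_fun (pd i f)"
  using assms by (auto simp: C1p_iff torus_fun_pd continuous_at_imp_continuous_on
      differentiable_imp_continuous_within)

lemma Ck_mono: "Ck (Suc k) f \<Longrightarrow> Ck k f"
proof (induction k arbitrary: f)
  case 0
  then show ?case
    by (auto simp: continuous_at_imp_continuous_on differentiable_imp_continuous_within)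
qed auto

lemma Ck_torus_mono: "Ck_torus (Suc k) f \<Longrightarrow> Ck_torus k f"
  by (auto simp: Ck_torus_def intro: Ck_mono simp del: Ck.simps)

lemma Ck_torus_pd: "Ck_torus (Suc k) f \<Longrightarrow> Ck_torus k (pd i f)"
  by (auto simp: Ck_torus_def torus_fun_pd)

lemma C1p_add: "C1p f \<Longrightarrow> C1p g \<Longrightarrow> C1p (\<lambda>x. f x + g x)"
  by (rule C1pI[OF _ _ pd_add]) (auto simp: C1p_iff torus_fun_def intro!: continuous_intros)

lemma C1p_diff: "C1p f \<Longrightarrow> C1p g \<Longrightarrow> C1p (\<lambda>x. f x - g x)"
  by (rule C1pI[OF _ _ pd_diff]) (auto simp: C1p_iff torus_fun_def intro!: continuous_intros)

lemma C1p_scaleR: "C1p f \<Longrightarrow> C1p (\<lambda>x. c *\<^sub>R f x)"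
  by (rule C1pI[OF _ _ pd_scaleR]) (auto simp: C1p_iff torus_fun_def intro!: continuous_intros)

lemma C1p_uminus: "C1p f \<Longrightarrow> C1p (\<lambda>x. - f x)"
  using C1p_scaleR[of f "-1"] by simp

lemma C1p_const: "C1p (\<lambda>x. c)"
  by (rule C1pI[OF _ _ pd_const]) (auto simp: torus_fun_def)

lemma C1p_mult:
  fixes f g :: "real ^ 'n \<Rightarrow> real"
  shows "C1p f \<Longrightarrow> C1p g \<Longrightarrow> C1p (\<lambda>x. f x * g x)"
  by (rule C1pI[OF _ _ pd_mult])
    (auto simp: C1pD(2) C1pD(3,4) torus_funD[OF C1pD(1)] torus_fun_def intro!: continuous_intros)

lemma C1p_cmult: "C1p f \<Longrightarrow> C1p (\<lambda>x. c * f x :: real)"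
  using C1p_scaleR[of f c] by simp

lemma C1p_sum: "(\<And>a. a \<in> A \<Longrightarrow> C1p (f a)) \<Longrightarrow> C1p (\<lambda>x. \<Sum>a\<in>A. f a x)"
  by (induction A rule: infinite_finite_induct) (auto intro: C1p_add C1p_const)

lemma C1p_compose:
  assumes "C1p f" "\<And>x. (F has_real_derivative F' (f x)) (at (f x))" "continuous_on (range f) F'"
  shows "C1p (\<lambda>x. F (f x))"
proof (rule C1pI[where D = "\<lambda>i x. F' (f x) * pd i f x"])
  have "continuous_on UNIV (\<lambda>x. F' (f x))"
    by (rule continuous_on_compose2[OF assms(3) C1pD(4)[OF assms(1)]]) auto
  then show "continuous_on UNIV (\<lambda>x. F' (f x) * pd i f x)" for i
    by (intro continuous_intros C1pD(3) assms(1))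
  show "(\<lambda>x. F (f x)) differentiable (at x)" for x
    by (rule pd_compose(2)[OF C1pD(2)[OF assms(1)] assms(2)])
  show "torus_fun (\<lambda>x. F (f x))"
    using C1pD(1)[OF assms(1)] by (simp add: torus_fun_def)
  show "pd i (\<lambda>x. F (f x)) x = F' (f x) * pd i f x" for i x
    by (rule pd_compose(1)[OF C1pD(2)[OF assms(1)] assms(2)])
qed

lemma C1p_shift:
  fixes f :: "real ^ 'n \<Rightarrow> 'b::real_normed_vector"
  assumes f: "C1p f"
  shows "C1p (\<lambda>x. f (x + y))"
proof (rule C1pI[OF _ _ pd_shift(1)])
  have "f (x + axis i 1 + y) = f (x + y)" for x i
    using torus_funD[OF C1pD(1)[OF f], of "x + y" i] by (simp add: algebra_simps)
  then show "torus_fun (\<lambda>x. f (x + y))" by (simp add: torus_fun_def)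
  show "continuous_on UNIV (\<lambda>x. pd i f (x + y))" for i
    by (rule continuous_on_compose2[OF C1pD(3)[OF f]]) (auto intro!: continuous_intros)
qed (auto simp: pd_shift(2) C1pD(2)[OF f])

subsection \<open>Integration over the torus\<close>

text \<open>The invariant measure of the torus, realised on the closed unit cube: opposite faces are
  both present but null, the total mass is 1, and set integrals over the cell become ordinary
  Bochner integrals over a finite measure space.\<close>

definition tor :: "(real ^ 'n) measure" where
  "tor = restrict_space lborel torus_cell"

lemma torus_cell_sets [measurable, simp]: "torus_cell \<in> sets borel"
  by (simp add: torus_cell_def)

lemma set_integrable_tor:
  fixes f :: "real ^ 'n \<Rightarrow> 'b::{banach, second_countable_topology}"
  shows "set_integrable lborel torus_cell f \<longleftrightarrow> integrable tor f"
  by (simp add: tor_def set_integrable_def integrable_restrict_space)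

lemma set_integral_tor:
  fixes f :: "real ^ 'n \<Rightarrow> 'b::{banach, second_countable_topology}"
  shows "(LINT x:torus_cell|lborel. f x) = (LINT x|tor. f x)"
  by (simp add: tor_def set_lebesgue_integral_def integral_restrict_space)

lemma space_tor [simp]: "space tor = torus_cell"
  by (simp add: tor_def space_restrict_space)

lemma sets_tor: "sets tor = sets (restrict_space borel torus_cell)"
  by (simp add: tor_def sets_restrict_space)

lemma borel_measurable_tor_iff:
  fixes f :: "real ^ 'n \<Rightarrow> 'b::real_normed_vector"
  shows "f \<in> borel_measurable tor \<longleftrightarrow> (\<lambda>x. indicator torus_cell x *\<^sub>R f x) \<in> borel_measurable borel"
  by (simp add: tor_def borel_measurable_restrict_space_iff)

lemma AE_tor_iff:
  fixes P :: "real ^ 'n \<Rightarrow> bool"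
  shows "(AE x in tor. P x) \<longleftrightarrow> (AE x in lborel. x \<in> torus_cell \<longrightarrow> P x)"
  unfolding tor_def by (rule AE_restrict_space_iff) simp

lemma AE_torI:
  fixes P :: "real ^ 'n \<Rightarrow> bool"
  shows "(AE x in lborel. P x) \<Longrightarrow> AE x in tor. P x"
  unfolding AE_tor_iff by auto

interpretation tor: finite_measure tor
proof
  have "emeasure lborel (torus_cell :: (real ^ 'a) set) < \<infinity>"
    unfolding torus_cell_def by (rule emeasure_compact_finite) simp
  then show "emeasure (tor :: (real ^ 'a) measure) (space tor) \<noteq> \<infinity>"
    by (simp add: tor_def emeasure_restrict_space space_restrict_space)
qed

lemma measure_tor: "measure (tor :: (real ^ 'n) measure) torus_cell = 1"
proof -
  have "(\<Prod>b\<in>Basis. (1::real^'n) \<bullet> b) = 1"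
    by (rule prod.neutral) (auto simp: Basis_vec_def inner_axis)
  moreover have "b \<in> Basis \<Longrightarrow> 0 \<le> (1::real^'n) \<bullet> b" for b
    by (auto simp: Basis_vec_def inner_axis)
  ultimately have "measure lborel (cbox 0 (1::real^'n)) = 1"
    by (simp add: content_cbox_if box_eq_empty)
      (metis (no_types, lifting) not_le)
  then show ?thesis
    by (simp add: tor_def measure_restrict_space torus_cell_def)
qed

lemma continuous_imp_measurable_tor:
  fixes f :: "real ^ 'n \<Rightarrow> 'b::{real_normed_vector}"
  assumes "continuous_on torus_cell f"
  shows "f \<in> borel_measurable tor"
proof -
  have "borel_measurable tor = (borel_measurable (restrict_space borel torus_cell) :: (real ^ 'n \<Rightarrow> 'b) set)"
    by (rule measurable_cong_sets[OF sets_tor refl])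
  then show ?thesis using borel_measurable_continuous_on_restrict[OF assms] by blast
qed

lemma continuous_bounded_cell:
  fixes f :: "real ^ 'n \<Rightarrow> 'b::real_normed_vector"
  assumes "continuous_on torus_cell f"
  obtains B where "0 \<le> B" "\<And>x. x \<in> torus_cell \<Longrightarrow> norm (f x) \<le> B"
proof -
  have "bounded (f ` torus_cell)"
    by (intro compact_imp_bounded compact_continuous_image compact_torus_cell assms)
  then obtain B where B: "\<And>x. x \<in> torus_cell \<Longrightarrow> norm (f x) \<le> B"
    by (auto simp: bounded_iff)
  show ?thesis by (rule that[of "max B 0"]) (use B in \<open>auto simp: le_max_iff_disj\<close>)
qed

lemma continuous_imp_integrable_tor:
  fixes f :: "real ^ 'n \<Rightarrow> 'b::{second_countable_topology, banach}"
  assumes "continuous_on torus_cell f"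
  shows "integrable tor f"
proof -
  obtain B where B: "0 \<le> B" "\<And>x. x \<in> torus_cell \<Longrightarrow> norm (f x) \<le> B"
    by (rule continuous_bounded_cell[OF assms]) blast
  show ?thesis
  proof (rule tor.integrable_const_bound)
    show "AE x in tor. norm (f x) \<le> B" using B(2) by (intro AE_I2) simp
    show "f \<in> borel_measurable tor" by (rule continuous_imp_measurable_tor[OF assms])
  qed
qed

lemma integral_tor_HK:
  fixes f :: "real ^ 'n \<Rightarrow> real"
  assumes "integrable tor f"
  shows "(LINT x|tor. f x) = integral (cbox 0 1) f"
proof -
  have "(LINT x:torus_cell|lborel. f x) = integral torus_cell f"
    by (rule set_borel_integral_eq_integral(2)) (use assms in \<open>simp only: set_integrable_tor\<close>)
  then show ?thesis by (simp only: set_integral_tor) (simp add: torus_cell_def)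
qed

lemma integrable_bounded_inner:
  fixes a F :: "real ^ 'n \<Rightarrow> 'b::euclidean_space"
  assumes a: "integrable tor a" and F: "continuous_on torus_cell F"
  shows "integrable tor (\<lambda>x. a x \<bullet> F x)"
proof -
  obtain B where B: "0 \<le> B" "\<And>x. x \<in> torus_cell \<Longrightarrow> norm (F x) \<le> B"
    by (rule continuous_bounded_cell[OF F]) blast
  note [measurable] = borel_measurable_integrable[OF a] continuous_imp_measurable_tor[OF F]
  show ?thesis
  proof (rule Bochner_Integration.integrable_bound)
    show "integrable tor (\<lambda>x. B * norm (a x))" using a by simp
    have "norm (a x \<bullet> F x) \<le> norm (B * norm (a x))" if "x \<in> torus_cell" for x
    proof -
      have "norm (a x \<bullet> F x) \<le> norm (a x) * norm (F x)" by (simp add: Cauchy_Schwarz_ineq2)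
      also have "\<dots> \<le> norm (a x) * B" using B(2)[OF that] by (intro mult_left_mono) auto
      finally show ?thesis using B(1) by (simp add: mult.commute)
    qed
    then show "AE x in tor. norm (a x \<bullet> F x) \<le> norm (B * norm (a x))" by (intro AE_I2) simp
  qed measurable
qed

lemma integrable_bounded_mult:
  fixes a F :: "real ^ 'n \<Rightarrow> real"
  assumes "integrable tor a" "continuous_on torus_cell F"
  shows "integrable tor (\<lambda>x. a x * F x)"
  using integrable_bounded_inner[OF assms] by simp

text \<open>A cube shifted by \<open>s\<close> along one axis leaves the unit cube by a slab of
  thickness \<open>s\<close>. Periodicity carries this slab back by one period onto the slab that
  was vacated, so the two pieces recombine to the cube.\<close>

lemma integral_shift_axis:
  fixes f :: "real ^ 'n \<Rightarrow> real"
  assumes "torus_fun f" "continuous_on UNIV f" "0 \<le> s" "s \<le> 1"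
  shows "integral (cbox 0 1) (\<lambda>x. f (x + s *\<^sub>R axis i 1)) = integral (cbox 0 1) f"
proof -
  define c :: "real ^ 'n" where "c = s *\<^sub>R axis i 1"
  have io: "f integrable_on cbox a b" for a b
    by (rule integrable_continuous) (use assms continuous_on_subset in blast)
  have cn: "c $ j = (if j = i then s else 0)" for j by (auto simp: c_def axis_def)
  have ei: "axis i (1::real) \<in> Basis" by simp
  have inn: "x \<bullet> axis i 1 = x $ i" for x :: "real ^ 'n" by (simp add: inner_axis)
  have split: "integral (cbox a b) f = integral (cbox a b \<inter> {x. x $ i \<le> t}) f + integral (cbox a b \<inter> {x. x $ i \<ge> t}) f" for a b t
  proof -
    have "f integrable_on (cbox a b \<inter> {x. x \<bullet> axis i 1 \<le> t})" "f integrable_on (cbox a b \<inter> {x. x \<bullet> axis i 1 \<ge> t})"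
      unfolding interval_split[OF ei] by (rule io)+
    then show ?thesis
      using has_integral_split[OF _ _ ei, of f _ a b t] unfolding inn
      by (meson has_integral_integral integral_unique)
  qed
  have box: "x \<in> cbox p q \<longleftrightarrow> p $ i \<le> x $ i \<and> x $ i \<le> q $ i \<and> (\<forall>j. j \<noteq> i \<longrightarrow> p $ j \<le> x $ j \<and> x $ j \<le> q $ j)"
    for x p q :: "real ^ 'n"
    unfolding mem_box_cart by metis
  have an: "axis i (1::real) $ j = (if j = i then 1 else 0)" for j
    by (auto simp: axis_def)
  \<comment> \<open>The shifted cube is cut at \<open>x $ i = 1\<close>: the inner piece already
    lies in the unit cube, the outer one is translated back by \<open>axis i 1\<close> onto the part
    with \<open>x $ i \<le> s\<close>.\<close>
  have e1: "cbox c (1 + c) \<inter> {x. x $ i \<le> 1} = cbox 0 1 \<inter> {x. x $ i \<ge> s}"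
    using assms(3) by (auto simp: box cn)
  have e2: "cbox c (1 + c) \<inter> {x. x $ i \<ge> 1} = cbox (axis i 1) (1 + c)"
    using assms(3,4) by (auto simp: box cn an)
  have e3: "cbox 0 (1 + c - axis i 1) = cbox 0 1 \<inter> {x. x $ i \<le> s}"
    using assms(3,4) by (auto simp: box cn an)
  have "integral (cbox 0 1) (\<lambda>x. f (x + c)) = integral (cbox c (1 + c)) f"
    using integral_shift_cbox[of c c "1 + c" f] by simp
  also have "\<dots> = integral (cbox 0 1 \<inter> {x. x $ i \<ge> s}) f + integral (cbox (axis i 1) (1 + c)) f"
    using split[of c "1 + c" 1] unfolding e1 e2 .
  also have "integral (cbox (axis i 1) (1 + c)) f = integral (cbox 0 (1 + c - axis i 1)) (\<lambda>x. f (x + axis i 1))"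
    using integral_shift_cbox[of "axis i 1" "axis i 1" "1 + c" f] by simp
  also have "(\<lambda>x. f (x + axis i 1)) = f" using assms(1) by (simp add: torus_fun_def)
  also have "cbox 0 (1 + c - axis i 1) = cbox 0 1 \<inter> {x. x $ i \<le> s}" by (rule e3)
  finally show ?thesis using split[of 0 1 s] by (simp add: c_def)
qed

text \<open>The shift is carried out one axis at a time, by induction over the set of axes already
  treated.\<close>

lemma integral_tor_shift:
  fixes f :: "real ^ 'n \<Rightarrow> real"
  assumes f: "torus_fun f" "continuous_on UNIV f" and y: "y \<in> torus_cell"
  shows "(LINT x|tor. f (x + y)) = (LINT x|tor. f x)"
proof -
  have cont: "continuous_on S (\<lambda>x. f (x + z))" for S z
    by (rule continuous_on_compose2[OF f(2)]) (auto intro!: continuous_intros)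
  have "integral (cbox 0 1) (\<lambda>x. f (x + (\<Sum>i\<in>S. y $ i *\<^sub>R axis i 1))) = integral (cbox 0 1) f" if "finite S" for S
    using that
  proof (induction S)
    case (insert a S)
    let ?z = "\<Sum>i\<in>S. y $ i *\<^sub>R axis i 1"
    have "f (x + axis i 1 + ?z) = f (x + ?z)" for x i
      using torus_funD[OF f(1), of "x + ?z" i] by (simp add: algebra_simps)
    then have "torus_fun (\<lambda>x. f (x + ?z))" by (simp add: torus_fun_def)
    then have "integral (cbox 0 1) (\<lambda>x. f (x + y $ a *\<^sub>R axis a 1 + ?z)) = integral (cbox 0 1) (\<lambda>x. f (x + ?z))"
      using y by (intro integral_shift_axis cont) (auto simp: torus_cell_def mem_box_cart)
    then show ?case using insert by (simp add: algebra_simps)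
  qed simp
  from this[of UNIV] have "integral (cbox 0 1) (\<lambda>x. f (x + y)) = integral (cbox 0 1) f"
    using basis_expansion[of y] by (simp add: scalar_mult_eq_scaleR)
  moreover have "integrable tor f" "integrable tor (\<lambda>x. f (x + y))"
    by (rule continuous_imp_integrable_tor, use f(2) continuous_on_subset in blast,
        rule continuous_imp_integrable_tor, rule cont)
  ultimately show ?thesis by (simp add: integral_tor_HK)
qed

subsection \<open>Curves of functions on the torus\<close>

lemma continuous_on_slice:
  assumes "continuous_on (S \<times> K) (\<lambda>(s, x). F s x)" "s \<in> S"
  shows "continuous_on K (F s)"
proof -
  have "continuous_on K (\<lambda>x. case (s, x) of (s, x) \<Rightarrow> F s x)"
    by (rule continuous_on_compose2[OF assms(1)]) (use assms(2) in \<open>auto intro!: continuous_intros\<close>)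
  then show ?thesis by simp
qed

lemma uniform_on_cell:
  fixes F :: "real \<Rightarrow> real ^ 'n \<Rightarrow> 'b::real_normed_vector"
  assumes "continuous_on (S \<times> torus_cell) (\<lambda>(s, x). F s x)" "s0 \<in> S" "0 < e"
  shows "\<exists>d>0. \<forall>s\<in>S. \<bar>s - s0\<bar> < d \<longrightarrow> (\<forall>x\<in>torus_cell. norm (F s x - F s0 x) \<le> e)"
proof -
  obtain X0 where X0: "s0 \<in> X0" "open X0"
    "\<forall>s\<in>X0 \<inter> S. \<forall>x\<in>torus_cell. dist ((\<lambda>(s, x). F s x) (s, x)) ((\<lambda>(s, x). F s x) (s0, x)) \<le> e"
    using continuous_on_prod_compactE[OF assms(1) compact_torus_cell assms(2,3)] .
  then obtain d where "0 < d" "ball s0 d \<subseteq> X0" using open_contains_ball by blast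
  then show ?thesis using X0(3)
    by (intro exI[of _ d]) (auto simp: dist_norm subset_iff abs_minus_commute)
qed

text \<open>The mean value inequality is applied to \<open>q s x - s *\<^sub>R q' s0 x\<close>,
  whose derivative is at most \<open>e\<close> near \<open>s0\<close> for all \<open>x\<close> at
  once, by compactness of the cell. The uniformity in \<open>x\<close> is what survives pairing with
  a function that is only integrable.\<close>

lemma uniform_derivative_on_cell:
  fixes q q' :: "real \<Rightarrow> real ^ 'n \<Rightarrow> 'b::real_normed_vector"
  assumes S: "convex S" "s0 \<in> S"
    and d: "\<And>s x. s \<in> S \<Longrightarrow> x \<in> torus_cell \<Longrightarrow> ((\<lambda>s. q s x) has_vector_derivative q' s x) (at s within S)"
    and c: "continuous_on (S \<times> torus_cell) (\<lambda>(s, x). q' s x)" and e: "0 < e"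
  shows "\<exists>d>0. \<forall>s\<in>S. \<bar>s - s0\<bar> < d \<longrightarrow>
    (\<forall>x\<in>torus_cell. norm (q s x - q s0 x - (s - s0) *\<^sub>R q' s0 x) \<le> e * \<bar>s - s0\<bar>)"
proof -
  obtain \<delta> where \<delta>: "0 < \<delta>"
    "\<And>s x. s \<in> S \<Longrightarrow> \<bar>s - s0\<bar> < \<delta> \<Longrightarrow> x \<in> torus_cell \<Longrightarrow> norm (q' s x - q' s0 x) \<le> e"
    using uniform_on_cell[OF c S(2) e] by blast
  have "norm (q s x - q s0 x - (s - s0) *\<^sub>R q' s0 x) \<le> e * \<bar>s - s0\<bar>"
    if s: "s \<in> S" "\<bar>s - s0\<bar> < \<delta>" and x: "x \<in> torus_cell" for s x
  proof -
    let ?U = "S \<inter> ball s0 \<delta>"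
    have "norm ((q s x - s *\<^sub>R q' s0 x) - (q s0 x - s0 *\<^sub>R q' s0 x)) \<le> e * norm (s - s0)"
    proof (rule differentiable_bound[of ?U])
      show "convex ?U" using S(1) by (intro convex_Int convex_ball)
      show "((\<lambda>s. q s x - s *\<^sub>R q' s0 x) has_derivative (\<lambda>h. h *\<^sub>R (q' t x - q' s0 x))) (at t within ?U)"
        if "t \<in> ?U" for t
      proof -
        have "((\<lambda>s. q s x) has_derivative (\<lambda>h. h *\<^sub>R q' t x)) (at t within ?U)"
          using has_derivative_subset[OF d[unfolded has_vector_derivative_def]] that x by blast
        then show ?thesis by (auto intro!: derivative_eq_intros simp: scaleR_diff_right)
      qed
      show "onorm (\<lambda>h. h *\<^sub>R (q' t x - q' s0 x)) \<le> e" if "t \<in> ?U" for t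
      proof (rule onorm_le)
        fix h :: real
        have "norm (q' t x - q' s0 x) \<le> e"
          by (rule \<delta>(2)) (use that x in \<open>auto simp: dist_norm abs_minus_commute\<close>)
        then have "\<bar>h\<bar> * norm (q' t x - q' s0 x) \<le> \<bar>h\<bar> * e" by (rule mult_left_mono) simp
        then show "norm (h *\<^sub>R (q' t x - q' s0 x)) \<le> e * norm h" by (simp only: norm_scaleR real_norm_def mult.commute[of e])
      qed
      show "s \<in> ?U" "s0 \<in> ?U" using s S(2) \<delta>(1) by (auto simp: dist_norm abs_minus_commute)
    qed
    then show ?thesis by (simp add: algebra_simps)
  qed
  then show ?thesis using \<delta>(1) by blast
qed

lemma integral_abs_le:
  fixes a F :: "real ^ 'n \<Rightarrow> 'b::euclidean_space"
  assumes a: "integrable tor a" and F: "F \<in> borel_measurable tor"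
    and B: "\<And>x. x \<in> torus_cell \<Longrightarrow> norm (F x) \<le> B"
  shows "\<bar>LINT x|tor. a x \<bullet> F x\<bar> \<le> B * (LINT x|tor. norm (a x))"
proof -
  have "0 \<in> torus_cell" by (simp add: torus_cell_def mem_box_cart)
  then have B0: "0 \<le> B" using order_trans[OF norm_ge_zero B] by blast
  have le: "norm (a x \<bullet> F x) \<le> B * norm (a x)" if "x \<in> torus_cell" for x
  proof -
    have "norm (a x \<bullet> F x) \<le> norm (a x) * norm (F x)" by (simp add: Cauchy_Schwarz_ineq2)
    also have "\<dots> \<le> norm (a x) * B" using B[OF that] by (intro mult_left_mono) auto
    finally show ?thesis by (simp add: mult.commute)
  qed
  note [measurable] = borel_measurable_integrable[OF a] F
  have i: "integrable tor (\<lambda>x. B * norm (a x))" using a by simp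
  have "integrable tor (\<lambda>x. a x \<bullet> F x)"
  proof (rule Bochner_Integration.integrable_bound[OF i])
    have "norm (a x \<bullet> F x) \<le> norm (B * norm (a x))" if "x \<in> torus_cell" for x
      using le[OF that] B0 by simp
    then show "AE x in tor. norm (a x \<bullet> F x) \<le> norm (B * norm (a x))" by (intro AE_I2) simp
  qed measurable
  from Bochner_Integration.integral_norm_bound_integral[OF this i] le
  have "norm (LINT x|tor. a x \<bullet> F x) \<le> (LINT x|tor. B * norm (a x))" by simp
  then show ?thesis by simp
qed

text \<open>Continuity in L^1 at the single time \<open>s0\<close> from within \<open>S\<close>;
  integrability is asked for on all of \<open>S\<close> so that nearby slices can be
  integrated.\<close>

definition L1_cont_at :: "(real \<Rightarrow> real ^ 'n \<Rightarrow> 'b::euclidean_space) \<Rightarrow> real \<Rightarrow> real set \<Rightarrow> bool" where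
  "L1_cont_at a s0 S \<longleftrightarrow> (\<forall>s\<in>S. integrable tor (a s)) \<and>
     ((\<lambda>s. LINT x|tor. norm (a s x - a s0 x)) \<longlongrightarrow> 0) (at s0 within S)"

lemma L1_cont_at_const: "integrable tor a \<Longrightarrow> L1_cont_at (\<lambda>_. a) s0 S"
  by (simp add: L1_cont_at_def)

lemma L1_cont_at_subset: "L1_cont_at a s0 S \<Longrightarrow> S' \<subseteq> S \<Longrightarrow> L1_cont_at a s0 S'"
  unfolding L1_cont_at_def by (meson subsetD tendsto_within_subset)

text \<open>The difference of the pairings splits into the increment of \<open>a\<close> against a
  bounded \<open>F s\<close>, and \<open>a s0\<close> against a uniformly small increment of
  \<open>F\<close>.\<close>

lemma L1_cont_pairing:
  fixes a F :: "real \<Rightarrow> real ^ 'n \<Rightarrow> 'b::euclidean_space"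
  assumes a: "L1_cont_at a s0 S" and s0: "s0 \<in> S"
    and F: "continuous_on (S \<times> torus_cell) (\<lambda>(s, x). F s x)"
  shows "((\<lambda>s. LINT x|tor. a s x \<bullet> F s x) \<longlongrightarrow> (LINT x|tor. a s0 x \<bullet> F s0 x)) (at s0 within S)"
proof -
  have Fc: "continuous_on torus_cell (F s)" if "s \<in> S" for s
    using continuous_on_slice[OF F] that by blast
  obtain B where B: "0 \<le> B" "\<And>x. x \<in> torus_cell \<Longrightarrow> norm (F s0 x) \<le> B"
    by (rule continuous_bounded_cell[OF Fc[OF s0]]) blast
  have ai: "integrable tor (a s)" if "s \<in> S" for s using a that by (simp add: L1_cont_at_def)
  define A where "A = (LINT x|tor. norm (a s0 x))"
  have A0: "0 \<le> A" by (simp add: A_def)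
  define N where "N s = (LINT x|tor. norm (a s x - a s0 x))" for s
  have N: "(N \<longlongrightarrow> 0) (at s0 within S)" using a by (simp add: L1_cont_at_def N_def[abs_def])
  have N0: "0 \<le> N s" for s by (simp add: N_def)
  show ?thesis
    unfolding tendsto_iff
  proof (intro allI impI)
    fix e :: real assume e: "0 < e"
    \<comment> \<open>The cap 1 keeps \<open>F s\<close> below \<open>B + 1\<close>; the other entry
      makes the second summand at most \<open>e / 2\<close>. The first summand gets
      \<open>e / 4\<close>, so the total is strictly below \<open>e\<close>.\<close>
    define e1 where "e1 = min 1 (e / (2 * (A + 1)))"
    have e1: "0 < e1" "e1 \<le> 1" using e A0 by (auto simp: e1_def)
    have "e1 * (A + 1) \<le> e / (2 * (A + 1)) * (A + 1)"
      using A0 by (intro mult_right_mono) (auto simp: e1_def)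
    also have "\<dots> = e / 2" using A0 by (simp add: field_simps add_nonneg_eq_0_iff)
    finally have e1A: "e1 * (A + 1) \<le> e / 2" .
    obtain d where d: "0 < d" "\<And>s x. s \<in> S \<Longrightarrow> \<bar>s - s0\<bar> < d \<Longrightarrow> x \<in> torus_cell \<Longrightarrow> norm (F s x - F s0 x) \<le> e1"
      using uniform_on_cell[OF F s0 e1(1)] by blast
    have "\<forall>\<^sub>F s in at s0 within S. dist (N s) 0 < e / (4 * (B + 1))"
      using N e B(1) by (intro tendstoD) auto
    moreover have "\<forall>\<^sub>F s in at s0 within S. s \<in> S \<and> \<bar>s - s0\<bar> < d"
      unfolding eventually_at using d(1) by (intro exI[of _ d]) (auto simp: dist_norm)
    ultimately show "\<forall>\<^sub>F s in at s0 within S. dist (LINT x|tor. a s x \<bullet> F s x) (LINT x|tor. a s0 x \<bullet> F s0 x) < e"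
    proof eventually_elim
      fix s assume Ns: "dist (N s) 0 < e / (4 * (B + 1))" and s: "s \<in> S \<and> \<bar>s - s0\<bar> < d"
      note i = ai[OF conjunct1[OF s]] ai[OF s0]
      have FB: "norm (F s x) \<le> B + 1" if "x \<in> torus_cell" for x
        using d(2)[of s x] B(2)[OF that] s that e1(2) norm_triangle_sub[of "F s x" "F s0 x"] by force
      have i1: "integrable tor (\<lambda>x. (a s x - a s0 x) \<bullet> F s x)" "integrable tor (\<lambda>x. a s0 x \<bullet> (F s x - F s0 x))"
        using i s s0 by (auto intro!: integrable_bounded_inner Fc continuous_intros)
      have "(LINT x|tor. a s x \<bullet> F s x) - (LINT x|tor. a s0 x \<bullet> F s0 x)
          = (LINT x|tor. a s x \<bullet> F s x - a s0 x \<bullet> F s0 x)"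
        using i s s0 by (intro Bochner_Integration.integral_diff[symmetric] integrable_bounded_inner Fc) auto
      also have "\<dots> = (LINT x|tor. (a s x - a s0 x) \<bullet> F s x + a s0 x \<bullet> (F s x - F s0 x))"
        by (intro Bochner_Integration.integral_cong) (auto simp: inner_diff_left inner_diff_right)
      also have "\<dots> = (LINT x|tor. (a s x - a s0 x) \<bullet> F s x) + (LINT x|tor. a s0 x \<bullet> (F s x - F s0 x))"
        by (rule Bochner_Integration.integral_add[OF i1])
      finally have eq: "(LINT x|tor. a s x \<bullet> F s x) - (LINT x|tor. a s0 x \<bullet> F s0 x) = \<dots>" .
      have "\<bar>LINT x|tor. (a s x - a s0 x) \<bullet> F s x\<bar> \<le> (B + 1) * N s" unfolding N_def
        by (rule integral_abs_le) (use i s FB in \<open>auto intro!: continuous_imp_measurable_tor Fc\<close>)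
      moreover have "\<bar>LINT x|tor. a s0 x \<bullet> (F s x - F s0 x)\<bar> \<le> e1 * A" unfolding A_def
        by (rule integral_abs_le) (use i s s0 d in \<open>auto intro!: continuous_imp_measurable_tor Fc continuous_intros\<close>)
      moreover have "(B + 1) * N s \<le> e / 4"
        using Ns N0[of s] B(1) by (simp add: field_simps)
      moreover have "e1 * A \<le> e / 2" using e1(1) e1A by (simp add: algebra_simps)
      ultimately show "dist (LINT x|tor. a s x \<bullet> F s x) (LINT x|tor. a s0 x \<bullet> F s0 x) < e"
        unfolding dist_real_def eq using e by linarith
    qed
  qed
qed

text \<open>Only the smooth factor is differentiated here; the factor \<open>a\<close> is merely continuous.\<close>

lemma L1_cont_increment_derivative:
  fixes a q q' :: "real \<Rightarrow> real ^ 'n \<Rightarrow> 'b::euclidean_space"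
  assumes a: "L1_cont_at a s0 S" and S: "convex S" "s0 \<in> S"
    and qc: "\<And>s. s \<in> S \<Longrightarrow> continuous_on torus_cell (q s)"
    and d: "\<And>s x. s \<in> S \<Longrightarrow> x \<in> torus_cell \<Longrightarrow> ((\<lambda>s. q s x) has_vector_derivative q' s x) (at s within S)"
    and c: "continuous_on (S \<times> torus_cell) (\<lambda>(s, x). q' s x)"
  shows "((\<lambda>s. LINT x|tor. a s x \<bullet> (q s x - q s0 x)) has_real_derivative (LINT x|tor. a s0 x \<bullet> q' s0 x)) (at s0 within S)"
proof -
  have ai: "integrable tor (a s)" if "s \<in> S" for s using a that by (simp add: L1_cont_at_def)
  have q'c: "continuous_on torus_cell (q' s)" if "s \<in> S" for s
    using continuous_on_slice[OF c] that by blast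
  have c0: "continuous_on (S \<times> torus_cell) (\<lambda>(s, x). q' s0 x)"
    unfolding split_beta
    by (rule continuous_on_compose2[OF q'c[OF S(2)]]) (auto intro!: continuous_intros)
  have lim: "((\<lambda>s. LINT x|tor. a s x \<bullet> q' s0 x) \<longlongrightarrow> (LINT x|tor. a s0 x \<bullet> q' s0 x)) (at s0 within S)"
    by (rule L1_cont_pairing[OF a S(2) c0])
  \<comment> \<open>The difference quotient is compared with \<open>a s\<close> paired with the
    fixed \<open>q' s0\<close>, not with \<open>a s0\<close>: no rate of convergence is known for
    \<open>a\<close>, so its increment must not be divided by \<open>s - s0\<close>.\<close>
  have "((\<lambda>s. ((LINT x|tor. a s x \<bullet> (q s x - q s0 x)) - (LINT x|tor. a s0 x \<bullet> (q s0 x - q s0 x))) / (s - s0)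
      - (LINT x|tor. a s x \<bullet> q' s0 x)) \<longlongrightarrow> 0) (at s0 within S)"
    unfolding tendsto_iff
  proof (intro allI impI)
    fix e :: real assume e: "0 < e"
    define A where "A = (LINT x|tor. norm (a s0 x))"
    have A0: "0 \<le> A" by (simp add: A_def)
    define e1 where "e1 = e / (2 * (A + 1))"
    have e1: "0 < e1" using e A0 by (auto simp: e1_def)
    have "e1 * (A + 1) = e / 2" using A0 by (simp add: e1_def field_simps add_nonneg_eq_0_iff)
    then have e1A: "e1 * (A + 1) < e" using e by simp
    obtain \<delta> where \<delta>: "0 < \<delta>" "\<And>s x. s \<in> S \<Longrightarrow> \<bar>s - s0\<bar> < \<delta> \<Longrightarrow> x \<in> torus_cell \<Longrightarrow>
        norm (q s x - q s0 x - (s - s0) *\<^sub>R q' s0 x) \<le> e1 * \<bar>s - s0\<bar>"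
      using uniform_derivative_on_cell[OF S d c e1(1)] by blast
    have "((\<lambda>s. LINT x|tor. norm (a s x - a s0 x)) \<longlongrightarrow> 0) (at s0 within S)"
      using a by (simp add: L1_cont_at_def)
    then have "\<forall>\<^sub>F s in at s0 within S. dist (LINT x|tor. norm (a s x - a s0 x)) 0 < 1"
      by (rule tendstoD) simp
    moreover have "\<forall>\<^sub>F s in at s0 within S. s \<in> S \<and> s \<noteq> s0 \<and> \<bar>s - s0\<bar> < \<delta>"
      unfolding eventually_at using \<delta>(1) by (intro exI[of _ \<delta>]) (auto simp: dist_norm)
    ultimately show "\<forall>\<^sub>F s in at s0 within S. dist (((LINT x|tor. a s x \<bullet> (q s x - q s0 x)) - (LINT x|tor. a s0 x \<bullet> (q s0 x - q s0 x))) / (s - s0)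
      - (LINT x|tor. a s x \<bullet> q' s0 x)) 0 < e"
    proof eventually_elim
      fix s assume N: "dist (LINT x|tor. norm (a s x - a s0 x)) 0 < 1" and s: "s \<in> S \<and> s \<noteq> s0 \<and> \<bar>s - s0\<bar> < \<delta>"
      then have sS: "s \<in> S" by simp
      have "(LINT x|tor. norm (a s x)) \<le> (LINT x|tor. norm (a s x - a s0 x) + norm (a s0 x))"
      proof (rule integral_mono)
        fix x show "norm (a s x) \<le> norm (a s x - a s0 x) + norm (a s0 x)"
          using norm_triangle_sub[of "a s x" "a s0 x"] by linarith
      qed (use ai[OF sS] ai[OF S(2)] in auto)
      also have "\<dots> = (LINT x|tor. norm (a s x - a s0 x)) + A"
        unfolding A_def using ai sS S(2) by (intro Bochner_Integration.integral_add) auto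
      also have "\<dots> \<le> A + 1" using N by simp
      finally have As: "(LINT x|tor. norm (a s x)) \<le> A + 1" .
      have "(LINT x|tor. a s x \<bullet> (q s x - q s0 x)) - (s - s0) * (LINT x|tor. a s x \<bullet> q' s0 x)
          = (LINT x|tor. a s x \<bullet> (q s x - q s0 x)) - (LINT x|tor. (s - s0) * (a s x \<bullet> q' s0 x))"
        by simp
      also have "\<dots> = (LINT x|tor. a s x \<bullet> (q s x - q s0 x) - (s - s0) * (a s x \<bullet> q' s0 x))"
        by (intro Bochner_Integration.integral_diff[symmetric] integrable_mult_right integrable_bounded_inner ai sS q'c S(2)
          continuous_intros qc)
      also have "\<dots> = (LINT x|tor. a s x \<bullet> (q s x - q s0 x - (s - s0) *\<^sub>R q' s0 x))"
        by (intro Bochner_Integration.integral_cong) (auto simp: inner_diff_right)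
      finally have "\<bar>(LINT x|tor. a s x \<bullet> (q s x - q s0 x)) - (s - s0) * (LINT x|tor. a s x \<bullet> q' s0 x)\<bar>
          = \<bar>LINT x|tor. a s x \<bullet> (q s x - q s0 x - (s - s0) *\<^sub>R q' s0 x)\<bar>" by simp
      also have "\<dots> \<le> (e1 * \<bar>s - s0\<bar>) * (LINT x|tor. norm (a s x))"
        by (rule integral_abs_le)
          (use \<delta> s S in \<open>auto intro!: ai continuous_imp_measurable_tor continuous_intros qc q'c\<close>)
      also have "\<dots> \<le> (e1 * \<bar>s - s0\<bar>) * (A + 1)" using As e1 by (intro mult_left_mono) auto
      also have "\<dots> < e * \<bar>s - s0\<bar>" using mult_strict_right_mono[OF e1A, of "\<bar>s - s0\<bar>"] s by (simp add: mult.assoc mult.commute)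
      finally have "\<bar>(LINT x|tor. a s x \<bullet> (q s x - q s0 x)) - (s - s0) * (LINT x|tor. a s x \<bullet> q' s0 x)\<bar> / \<bar>s - s0\<bar> < e"
        using s by (simp add: divide_less_eq)
      moreover have "(LINT x|tor. a s x \<bullet> (q s x - q s0 x)) / (s - s0) - (LINT x|tor. a s x \<bullet> q' s0 x)
         = ((LINT x|tor. a s x \<bullet> (q s x - q s0 x)) - (s - s0) * (LINT x|tor. a s x \<bullet> q' s0 x)) / (s - s0)"
        using s by (simp add: field_simps)
      ultimately show "dist (((LINT x|tor. a s x \<bullet> (q s x - q s0 x)) - (LINT x|tor. a s0 x \<bullet> (q s0 x - q s0 x))) / (s - s0)
      - (LINT x|tor. a s x \<bullet> q' s0 x)) 0 < e"
        by (simp add: abs_divide)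
    qed
  qed
  from tendsto_add[OF this lim] show ?thesis
    by (simp add: has_field_derivative_iff)
qed

lemma integral_pairing_derivative:
  fixes a :: "real ^ 'n \<Rightarrow> 'b::euclidean_space" and q q' :: "real \<Rightarrow> real ^ 'n \<Rightarrow> 'b"
  assumes a: "integrable tor a" and S: "convex S" "s0 \<in> S"
    and qc: "\<And>s. s \<in> S \<Longrightarrow> continuous_on torus_cell (q s)"
    and d: "\<And>s x. s \<in> S \<Longrightarrow> x \<in> torus_cell \<Longrightarrow> ((\<lambda>s. q s x) has_vector_derivative q' s x) (at s within S)"
    and c: "continuous_on (S \<times> torus_cell) (\<lambda>(s, x). q' s x)"
  shows "((\<lambda>s. LINT x|tor. a x \<bullet> q s x) has_real_derivative (LINT x|tor. a x \<bullet> q' s0 x)) (at s0 within S)"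
proof -
  have "((\<lambda>s. (LINT x|tor. a x \<bullet> (q s x - q s0 x)) + (LINT x|tor. a x \<bullet> q s0 x)) has_real_derivative
      (LINT x|tor. a x \<bullet> q' s0 x) + 0) (at s0 within S)"
    by (intro derivative_intros L1_cont_increment_derivative[OF L1_cont_at_const[OF a] S qc d c])
  then have D: "((\<lambda>s. (LINT x|tor. a x \<bullet> (q s x - q s0 x)) + (LINT x|tor. a x \<bullet> q s0 x)) has_real_derivative
      (LINT x|tor. a x \<bullet> q' s0 x)) (at s0 within S)" by simp
  have "(LINT x|tor. a x \<bullet> (q s x - q s0 x)) + (LINT x|tor. a x \<bullet> q s0 x) = (LINT x|tor. a x \<bullet> q s x)"
    if "s \<in> S" for s
    using that S(2) by (simp add: inner_diff_right integrable_bounded_inner[OF a qc])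
  then show ?thesis
    by (rule has_field_derivative_transform_within[OF D zero_less_one S(2)])
qed

subsection \<open>Integration by parts\<close>

text \<open>The integral of \<open>f\<close> translated by \<open>s\<close> along an axis does not
  depend on \<open>s\<close> in [0,1]; differentiating under the integral at 0 gives the claim. The
  derivative is one-sided because the translation lemma covers shifts by vectors of the
  cell.\<close>

lemma integral_pd_zero:
  fixes f :: "real ^ 'n \<Rightarrow> real"
  assumes f: "C1p f"
  shows "(LINT x|tor. pd i f x) = 0"
proof -
  let ?q = "\<lambda>s x. f (x + s *\<^sub>R axis i 1)" and ?q' = "\<lambda>s x. pd i f (x + s *\<^sub>R axis i 1)"
  have D: "((\<lambda>s. LINT x|tor. 1 \<bullet> ?q s x) has_real_derivative (LINT x|tor. 1 \<bullet> ?q' 0 x)) (at 0 within {0..1})"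
  proof (rule integral_pairing_derivative)
    show "integrable tor (\<lambda>x. 1 :: real)" by simp
    show "continuous_on torus_cell (?q s)" for s
      by (rule continuous_on_compose2[OF C1pD(4)[OF f]]) (auto intro!: continuous_intros)
    show "((\<lambda>s. ?q s x) has_vector_derivative ?q' s x) (at s within {0..1})" for s x
      by (rule axis_derivative) (rule C1pD(2)[OF f])
    show "continuous_on ({0..1} \<times> torus_cell) (\<lambda>(s, x). ?q' s x)"
      unfolding split_beta by (rule continuous_on_compose2[OF C1pD(3)[OF f]]) (auto intro!: continuous_intros)
  qed auto
  have "(LINT x|tor. ?q s x) = (LINT x|tor. f x)" if "s \<in> {0..1}" for s
    by (rule integral_tor_shift[OF C1pD(1)[OF f] C1pD(4)[OF f]])
      (use that in \<open>auto simp: torus_cell_def mem_box_cart axis_def\<close>)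
  then have "((\<lambda>s. LINT x|tor. f x) has_real_derivative (LINT x|tor. 1 \<bullet> ?q' 0 x)) (at 0 within {0..1})"
    using has_field_derivative_transform_within[OF D, of 1] by simp
  moreover have "((\<lambda>s. LINT x|tor. f x) has_real_derivative 0) (at 0 within {0..1})" by simp
  ultimately have "(LINT x|tor. 1 \<bullet> ?q' 0 x) = 0"
    by (rule has_field_derivative_unique) (simp add: at_within_Icc_at_right)
  then show ?thesis by simp
qed

lemma integral_div_zero:
  fixes F :: "'n \<Rightarrow> real ^ 'n \<Rightarrow> real"
  assumes "\<And>i. C1p (F i)"
  shows "(LINT x|tor. (\<Sum>i\<in>UNIV. pd i (F i) x)) = 0"
proof -
  have "integrable tor (pd i (F i))" for i
    using C1pD(3)[OF assms] continuous_on_subset by (blast intro: continuous_imp_integrable_tor)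
  then show ?thesis by (simp add: integral_pd_zero assms)
qed

subsection \<open>Symmetry of second derivatives\<close>

text \<open>Two applications of the mean value theorem, in direction \<open>i\<close> to the
  difference taken in direction \<open>j\<close>, and afterwards in direction \<open>j\<close>. The
  left side is symmetric in \<open>i\<close> and \<open>j\<close>, the right side is not, and this
  yields the symmetry of second derivatives.\<close>

lemma second_difference:
  fixes f :: "real ^ 'n \<Rightarrow> real"
  assumes f: "\<And>x. f differentiable (at x)" and fi: "\<And>x. pd i f differentiable (at x)" and h: "0 < h"
  shows "\<exists>s t. 0 < s \<and> s < h \<and> 0 < t \<and> t < h \<and>
    f (x + h *\<^sub>R axis i 1 + h *\<^sub>R axis j 1) - f (x + h *\<^sub>R axis i 1) - f (x + h *\<^sub>R axis j 1) + f x
      = h * h * pd j (pd i f) (x + s *\<^sub>R axis i 1 + t *\<^sub>R axis j 1)"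
proof -
  have ax: "((\<lambda>s. g (y + s *\<^sub>R axis k 1)) has_real_derivative pd k g (y + s *\<^sub>R axis k 1)) (at s)"
    if "\<And>x. g differentiable (at x)" for g :: "real ^ 'n \<Rightarrow> real" and y k s
    using axis_derivative[OF that, of y k s UNIV] by (simp add: has_real_derivative_iff_has_vector_derivative)
  define g where "g s = f (x + h *\<^sub>R axis j 1 + s *\<^sub>R axis i 1) - f (x + s *\<^sub>R axis i 1)" for s
  have "\<exists>s>0. s < h \<and> g h - g 0 = (h - 0) * (pd i f (x + h *\<^sub>R axis j 1 + s *\<^sub>R axis i 1) - pd i f (x + s *\<^sub>R axis i 1))"
    using h unfolding g_def by (intro MVT2 DERIV_diff ax f)
  then obtain s where s: "0 < s" "s < h"
    "g h - g 0 = h * (pd i f (x + h *\<^sub>R axis j 1 + s *\<^sub>R axis i 1) - pd i f (x + s *\<^sub>R axis i 1))" by auto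
  have "\<exists>t>0. t < h \<and> pd i f (x + s *\<^sub>R axis i 1 + h *\<^sub>R axis j 1) - pd i f (x + s *\<^sub>R axis i 1 + 0 *\<^sub>R axis j 1)
    = (h - 0) * pd j (pd i f) (x + s *\<^sub>R axis i 1 + t *\<^sub>R axis j 1)"
    using h by (intro MVT2 ax fi)
  then obtain t where t: "0 < t" "t < h" "pd i f (x + s *\<^sub>R axis i 1 + h *\<^sub>R axis j 1) - pd i f (x + s *\<^sub>R axis i 1)
    = h * pd j (pd i f) (x + s *\<^sub>R axis i 1 + t *\<^sub>R axis j 1)" by auto
  have "g h - g 0 = f (x + h *\<^sub>R axis i 1 + h *\<^sub>R axis j 1) - f (x + h *\<^sub>R axis i 1) - f (x + h *\<^sub>R axis j 1) + f x"
    by (simp add: g_def algebra_simps)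
  moreover have "g h - g 0 = h * (h * pd j (pd i f) (x + s *\<^sub>R axis i 1 + t *\<^sub>R axis j 1))"
    using s(3) t(3) by (simp add: algebra_simps)
  ultimately show ?thesis using s(1,2) t(1,2) by (metis mult.assoc)
qed

lemma pd_commute:
  fixes f :: "real ^ 'n \<Rightarrow> real"
  assumes "Ck (Suc (Suc 0)) f"
  shows "pd i (pd j f) x = pd j (pd i f) x"
proof (rule ccontr)
  assume ne: "pd i (pd j f) x \<noteq> pd j (pd i f) x"
  \<comment> \<open>Both mixed derivatives match one and the same second difference up to an error
    below \<open>e\<close>, so they would differ by less than \<open>2 * e\<close>, which is their
    actual distance.\<close>
  define e where "e = \<bar>pd i (pd j f) x - pd j (pd i f) x\<bar> / 2"
  have e: "0 < e" using ne by (simp add: e_def)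
  have f: "f differentiable (at x)" "pd k f differentiable (at x)" "continuous_on UNIV (pd l (pd k f))" for x k l
    using assms by auto
  have "\<exists>d>0. \<forall>y. norm (y - x) < d \<longrightarrow> \<bar>pd l (pd k f) y - pd l (pd k f) x\<bar> < e" for k l
    using continuous_on_eq_continuous_at[of UNIV "pd l (pd k f)"] f(3)[of l k] e
    by (auto simp: continuous_at_eps_delta dist_norm)
  then obtain d where d: "\<And>l k. 0 < d l k" "\<And>l k y. norm (y - x) < d l k \<Longrightarrow> \<bar>pd l (pd k f) y - pd l (pd k f) x\<bar> < e"
    by metis
  define h where "h = min (d i j) (d j i) / 3"
  have h: "0 < h" "2 * h < d i j" "2 * h < d j i" using d(1)[of i j] d(1)[of j i] by (auto simp: h_def)
  have small: "norm (x + s *\<^sub>R axis k 1 + t *\<^sub>R axis l 1 - x) < 2 * h" if "0 < s" "s < h" "0 < t" "t < h"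
    for s t and k l :: 'n
    using norm_triangle_ineq[of "s *\<^sub>R axis k (1::real)" "t *\<^sub>R axis l 1"] that
    by simp
  obtain s t where st: "0 < s" "s < h" "0 < t" "t < h"
    "f (x + h *\<^sub>R axis i 1 + h *\<^sub>R axis j 1) - f (x + h *\<^sub>R axis i 1) - f (x + h *\<^sub>R axis j 1) + f x
      = h * h * pd j (pd i f) (x + s *\<^sub>R axis i 1 + t *\<^sub>R axis j 1)"
    using second_difference[OF f(1,2) h(1), where x = x and i = i and j = j] by blast
  obtain s' t' where st': "0 < s'" "s' < h" "0 < t'" "t' < h"
    "f (x + h *\<^sub>R axis j 1 + h *\<^sub>R axis i 1) - f (x + h *\<^sub>R axis j 1) - f (x + h *\<^sub>R axis i 1) + f x
      = h * h * pd i (pd j f) (x + s' *\<^sub>R axis j 1 + t' *\<^sub>R axis i 1)"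
    using second_difference[OF f(1,2) h(1), where x = x and i = j and j = i] by blast
  have "h * h * pd j (pd i f) (x + s *\<^sub>R axis i 1 + t *\<^sub>R axis j 1) = h * h * pd i (pd j f) (x + s' *\<^sub>R axis j 1 + t' *\<^sub>R axis i 1)"
    using st(5) st'(5) by (simp add: algebra_simps)
  then have "pd j (pd i f) (x + s *\<^sub>R axis i 1 + t *\<^sub>R axis j 1) = pd i (pd j f) (x + s' *\<^sub>R axis j 1 + t' *\<^sub>R axis i 1)"
    using h(1) by simp
  moreover have "\<bar>pd j (pd i f) (x + s *\<^sub>R axis i 1 + t *\<^sub>R axis j 1) - pd j (pd i f) x\<bar> < e"
    by (rule d(2)) (use small[OF st(1-4), of i j] h in linarith)
  moreover have "\<bar>pd i (pd j f) (x + s' *\<^sub>R axis j 1 + t' *\<^sub>R axis i 1) - pd i (pd j f) x\<bar> < e"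
    by (rule d(2)) (use small[OF st'(1-4), of j i] h in linarith)
  ultimately have "\<bar>pd i (pd j f) x - pd j (pd i f) x\<bar> < 2 * e"
    by (simp only: abs_less_iff) linarith
  then show False by (simp add: e_def)
qed

subsection \<open>Density of continuously differentiable functions\<close>

text \<open>A cosine of period 1 in a coordinate where the points differ, centred at
  \<open>x\<close>: it equals 1 there, and otherwise only at integer distance, which the bound below
  1 excludes.\<close>

lemma C1p_separation:
  fixes x y :: "real ^ 'n"
  assumes "x \<noteq> y" "\<And>i. \<bar>x $ i - y $ i\<bar> < 1"
  shows "\<exists>f. C1p f \<and> f x \<noteq> (f y :: real)"
proof -
  obtain i where i: "x $ i \<noteq> y $ i" using assms(1) by (auto simp: vec_eq_iff)
  let ?f = "\<lambda>z :: real ^ 'n. cos (2 * pi * (z $ i - x $ i))"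
  have d: "((\<lambda>z. z $ i - x $ i) has_derivative (\<lambda>h. h $ i)) (at z)" for z :: "real ^ 'n"
    by (auto intro!: derivative_eq_intros bounded_linear.has_derivative[OF bounded_linear_vec_nth])
  have D: "(?f has_derivative (\<lambda>h. - sin (2 * pi * (z $ i - x $ i)) * (2 * pi * h $ i))) (at z)" for z
    by (rule DERIV_compose_FDERIV[OF _ d, THEN has_derivative_eq_rhs]) (auto intro!: derivative_eq_intros)
  have "C1p ?f"
  proof (rule C1pI)
    have "cos (2 * pi * (z $ i + 1 - x $ i)) = ?f z" for z :: "real ^ 'n"
      using cos_periodic[of "2 * pi * (z $ i - x $ i)"] by (simp add: algebra_simps)
    then show "torus_fun ?f" by (auto simp: torus_fun_def axis_def)
    show "?f differentiable at z" for z by (rule has_derivative_imp_differentiable[OF D])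
    show "pd j ?f z = - sin (2 * pi * (z $ i - x $ i)) * (2 * pi * (axis j 1 :: real ^ 'n) $ i)" for j z
      by (rule pd_eqI[OF D])
    show "continuous_on UNIV (\<lambda>z. - sin (2 * pi * (z $ i - x $ i)) * (2 * pi * (axis j 1 :: real ^ 'n) $ i))" for j
      by (intro continuous_intros)
  qed
  moreover have "?f x \<noteq> ?f y"
  proof
    assume "?f x = ?f y"
    then have "cos (2 * pi * (y $ i - x $ i)) = 1" by simp
    then obtain k :: int where "2 * pi * (y $ i - x $ i) = of_int k * (2 * pi)"
      using cos_one_2pi_int[of "2 * pi * (y $ i - x $ i)"] by auto
    then have "2 * pi * (y $ i - x $ i) = 2 * pi * of_int k" by simp
    then have k: "y $ i - x $ i = of_int k" by (simp only: mult_cancel_left) simp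
    then have "\<bar>of_int k :: real\<bar> < 1" using assms(2)[of i] by linarith
    then have "k = 0" by linarith
    then show False using k i by simp
  qed
  ultimately show ?thesis by blast
qed

text \<open>Periodic functions cannot separate opposite faces of the unit cube, so Stone-Weierstrass
  is applied on the smaller cube of side \<open>1 - e\<close>, where distinct points are never
  congruent modulo the lattice.\<close>

lemma C1p_approx_below_one:
  fixes g :: "real ^ 'n \<Rightarrow> real"
  assumes g: "continuous_on UNIV g" and e: "0 < e" "e \<le> 1"
  shows "\<exists>p. C1p p \<and> (\<forall>x. (\<forall>i. 0 \<le> x $ i \<and> x $ i \<le> 1 - e) \<longrightarrow> \<bar>g x - p x\<bar> < e)"
proof -
  let ?S = "cbox 0 ((1 - e) *\<^sub>R 1) :: (real ^ 'n) set"
  have "\<exists>p. C1p p \<and> (\<forall>x\<in>?S. \<bar>g x - p x\<bar> < e)"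
  proof (rule Stone_Weierstrass_HOL)
    show "\<exists>f. C1p f \<and> f x \<noteq> (f y :: real)" if "x \<in> ?S \<and> y \<in> ?S \<and> x \<noteq> y" for x y
    proof (rule C1p_separation)
      have "0 \<le> x $ i" "x $ i \<le> 1 - e" "0 \<le> y $ i" "y $ i \<le> 1 - e" for i
        using that by (auto simp: mem_box_cart)
      then show "\<bar>x $ i - y $ i\<bar> < 1" for i using e(1) by (smt (verit))
    qed (use that in blast)
  qed (use g e continuous_on_subset C1pD(4) in \<open>auto intro: C1p_const C1p_add C1p_mult\<close>)
  then show ?thesis by (auto simp: mem_box_cart)
qed

text \<open>The uniform bound is obtained by a change of variables: \<open>tan (f x / K)\<close> is
  approximated without control of size, and \<open>K * arctan\<close> brings the approximants back
  into a fixed interval while keeping them C^1, which clipping would not.\<close>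

lemma C1p_dense:
  fixes f :: "real ^ 'n \<Rightarrow> real"
  assumes f: "f \<in> borel_measurable tor" and M: "\<And>x. x \<in> torus_cell \<Longrightarrow> \<bar>f x\<bar> \<le> M"
  obtains \<phi> where "\<And>k::nat. C1p (\<phi> k)" "\<And>k x. \<bar>\<phi> k x\<bar> \<le> M + 1"
    "AE x in tor. (\<lambda>k. \<phi> k x) \<longlonglongrightarrow> f x"
proof -
  have "0 \<in> torus_cell" by (simp add: torus_cell_def mem_box_cart)
  then have M0: "0 \<le> M" using M order_trans[OF abs_ge_zero] by blast
  \<comment> \<open>With this choice \<open>K * (pi / 2) = M + 1\<close>, so the range of
    \<open>K * arctan\<close> is the announced one, and \<open>f x / K\<close> stays strictly inside
    the interval on which \<open>arctan\<close> inverts \<open>tan\<close>.\<close>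
  define K where "K = 2 * (M + 1) / pi"
  have K: "0 < K" using M0 by (simp add: K_def)
  define F where "F x = tan (f x / K)" for x
  have cl: "\<bar>K * arctan y\<bar> \<le> M + 1" for y
  proof -
    have "\<bar>arctan y\<bar> \<le> pi / 2" using arctan_bounded[of y] by (auto simp: abs_if)
    then have "K * \<bar>arctan y\<bar> \<le> K * (pi / 2)" using K by (intro mult_left_mono) auto
    also have "K * (pi / 2) = M + 1" by (simp add: K_def)
    finally show ?thesis using K by (simp only: abs_mult abs_of_pos)
  qed
  have F: "K * arctan (F x) = f x" if "x \<in> torus_cell" for x
  proof -
    have "\<bar>f x\<bar> < M + 1" using M[OF that] by linarith
    also have "\<dots> = K * (pi / 2)" by (simp add: K_def)
    finally have "\<bar>f x / K\<bar> < pi / 2" using K by (simp add: divide_less_eq mult.commute)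
    then have "arctan (F x) = f x / K" unfolding F_def by (intro arctan_tan) linarith+
    then show ?thesis using K by simp
  qed
  have "F \<in> borel_measurable tor" unfolding F_def[abs_def] tan_def using f by measurable
  then have "(\<lambda>x. indicator torus_cell x *\<^sub>R F x) \<in> borel_measurable borel"
    by (simp only: borel_measurable_tor_iff)
  then have "(\<lambda>x. indicator torus_cell x *\<^sub>R F x) \<in> borel_measurable lebesgue"
    by (intro measurable_completion) simp
  then have "(\<lambda>x. indicator torus_cell x *\<^sub>R F x) measurable_on UNIV"
    by (rule lebesgue_measurable_imp_measurable_on) simp
  \<comment> \<open>Unfolding \<open>measurable_on\<close> yields continuous functions that converge
    outside a negligible set.\<close>
  then obtain N g where N: "negligible N" and g: "\<And>n. continuous_on UNIV (g n)"
    and lim: "\<And>x. x \<notin> N \<Longrightarrow> (\<lambda>n. g n x) \<longlonglongrightarrow> indicator torus_cell x *\<^sub>R F x"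
    by (auto simp: measurable_on_def)
  have "\<exists>p. C1p p \<and> (\<forall>x. (\<forall>i. 0 \<le> x $ i \<and> x $ i \<le> 1 - 1 / real (Suc n)) \<longrightarrow> \<bar>g n x - p x\<bar> < 1 / real (Suc n))" for n
    by (rule C1p_approx_below_one[OF g]) auto
  then obtain p where p: "\<And>n. C1p (p n)"
    "\<And>n x. (\<And>i. 0 \<le> x $ i \<and> x $ i \<le> 1 - 1 / real (Suc n)) \<Longrightarrow> \<bar>g n x - p n x\<bar> < 1 / real (Suc n)"
    by metis
  show ?thesis
  proof (rule that[of "\<lambda>k x. K * arctan (p k x)"])
    show "C1p (\<lambda>x. K * arctan (p k x))" for k
    proof (rule C1p_cmult, rule C1p_compose[OF p(1)])
      show "(arctan has_real_derivative inverse (1 + (p k x)\<^sup>2)) (at (p k x))" for x by (rule DERIV_arctan)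
      have "1 + y\<^sup>2 \<noteq> 0" for y :: real using zero_le_power2[of y] by linarith
      then show "continuous_on (range (p k)) (\<lambda>y. inverse (1 + y\<^sup>2))" by (auto intro!: continuous_intros)
    qed
    show "\<bar>K * arctan (p k x)\<bar> \<le> M + 1" for k x by (rule cl)
    \<comment> \<open>The faces are discarded as a null set: an interior point lies in the cube of
      side \<open>1 - 1 / real (Suc n)\<close> for all large \<open>n\<close>, where the
      approximation error is below \<open>1 / real (Suc n)\<close>.\<close>
    let ?B = "cbox 0 1 - box 0 1 :: (real ^ 'n) set"
    have "negligible (N \<union> ?B)" using N negligible_frontier_interval by (intro negligible_Un) auto
    then have "AE x in lebesgue. x \<notin> N \<union> ?B" by (intro AE_not_in) (simp add: negligible_iff_null_sets)
    then have AE: "AE x in lborel. x \<notin> N \<union> ?B" by (simp only: AE_completion_iff)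
    have "(\<lambda>k. K * arctan (p k x)) \<longlonglongrightarrow> f x" if x: "x \<notin> N \<union> ?B" "x \<in> torus_cell" for x
    proof -
      have xb: "0 < x $ i" "x $ i < 1" for i
        using x by (auto simp: torus_cell_def mem_box_cart)
      have "\<forall>\<^sub>F n in sequentially. x $ i \<le> 1 - 1 / real (Suc n)" for i
      proof -
        have "(\<lambda>n. 1 - 1 / real (Suc n)) \<longlonglongrightarrow> 1 - 0"
          by (intro tendsto_intros lim_1_over_n[THEN LIMSEQ_Suc] )
        then have "\<forall>\<^sub>F n in sequentially. x $ i < 1 - 1 / real (Suc n)"
          using order_tendstoD(1)[of _ 1 _ "x $ i"] xb by simp
        then show ?thesis by eventually_elim simp
      qed
      then have "\<forall>\<^sub>F n in sequentially. \<forall>i. x $ i \<le> 1 - 1 / real (Suc n)" by (rule eventually_all_finite)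
      then have "\<forall>\<^sub>F n in sequentially. norm (p n x - g n x) \<le> 1 / real (Suc n)"
      proof eventually_elim
        fix n assume "\<forall>i. x $ i \<le> 1 - 1 / real (Suc n)"
        then have "\<bar>g n x - p n x\<bar> < 1 / real (Suc n)" using xb by (intro p(2)) (simp add: less_imp_le)
        then show "norm (p n x - g n x) \<le> 1 / real (Suc n)" by simp
      qed
      then have "(\<lambda>n. p n x - g n x) \<longlonglongrightarrow> 0"
        by (rule Lim_null_comparison) (rule lim_1_over_n[THEN LIMSEQ_Suc])
      from tendsto_add[OF this lim[of x]] x have "(\<lambda>n. p n x) \<longlonglongrightarrow> F x" by simp
      then have "(\<lambda>k. K * arctan (p k x)) \<longlonglongrightarrow> K * arctan (F x)" by (intro tendsto_intros)
      then show ?thesis using F[OF x(2)] by simp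
    qed
    then show "AE x in tor. (\<lambda>k. K * arctan (p k x)) \<longlonglongrightarrow> f x"
      unfolding AE_tor_iff by (intro eventually_mono[OF AE]) blast
  qed
qed

lemma integral_tor_bounded_limit:
  fixes a f :: "real ^ 'n \<Rightarrow> real"
  assumes a: "integrable tor a" and f: "f \<in> borel_measurable tor" and \<phi>: "\<And>k::nat. \<phi> k \<in> borel_measurable tor"
    and B: "\<And>k x. \<bar>\<phi> k x\<bar> \<le> B" and lim: "AE x in tor. (\<lambda>k. \<phi> k x) \<longlonglongrightarrow> f x"
  shows "(\<lambda>k. LINT x|tor. a x * \<phi> k x) \<longlonglongrightarrow> (LINT x|tor. a x * f x)"
proof (rule integral_dominated_convergence)
  note [measurable] = borel_measurable_integrable[OF a] f \<phi>
  show "(\<lambda>x. a x * f x) \<in> borel_measurable tor" "(\<lambda>x. a x * \<phi> k x) \<in> borel_measurable tor" for k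
    by measurable
  show "integrable tor (\<lambda>x. \<bar>a x\<bar> * B)" using a by simp
  show "AE x in tor. (\<lambda>k. a x * \<phi> k x) \<longlonglongrightarrow> a x * f x"
    using lim by eventually_elim (intro tendsto_intros)
  show "AE x in tor. norm (a x * \<phi> k x) \<le> \<bar>a x\<bar> * B" for k
    by (intro AE_I2) (simp add: abs_mult B mult_left_mono)
qed

lemma C1p_measurable: "C1p \<phi> \<Longrightarrow> \<phi> \<in> borel_measurable tor"
  using C1pD(4) continuous_on_subset by (blast intro: continuous_imp_measurable_tor)

text \<open>The test functions approximate \<open>sgn (f x)\<close>, and
  \<open>f x * sgn (f x) = \<bar>f x\<bar>\<close>.\<close>

lemma fundamental_lemma:
  fixes f :: "real ^ 'n \<Rightarrow> real"
  assumes f: "integrable tor f" and z: "\<And>\<phi>. C1p \<phi> \<Longrightarrow> (LINT x|tor. f x * \<phi> x) = 0"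
  shows "AE x in tor. f x = 0"
proof -
  note [measurable] = borel_measurable_integrable[OF f]
  have sm: "(\<lambda>x. sgn (f x)) \<in> borel_measurable tor" by measurable
  obtain \<phi> where \<phi>: "\<And>k::nat. C1p (\<phi> k)" "\<And>k x. \<bar>\<phi> k x\<bar> \<le> 1 + 1"
    "AE x in tor. (\<lambda>k. \<phi> k x) \<longlonglongrightarrow> sgn (f x)"
    by (rule C1p_dense[OF sm, of 1]) (auto simp: abs_sgn_eq)
  have "(\<lambda>k. LINT x|tor. f x * \<phi> k x) \<longlonglongrightarrow> (LINT x|tor. f x * sgn (f x))"
    by (rule integral_tor_bounded_limit[OF f sm C1p_measurable[OF \<phi>(1)] \<phi>(2,3)])
  then have "(LINT x|tor. f x * sgn (f x)) = 0"
    using z[OF \<phi>(1)] LIMSEQ_unique[OF tendsto_const, of 0] by simp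
  then have "(LINT x|tor. \<bar>f x\<bar>) = 0" by (simp add: abs_sgn)
  then show ?thesis
    using integral_nonneg_eq_0_iff_AE[of tor "\<lambda>x. \<bar>f x\<bar>"] f by simp
qed

subsection \<open>Poincare inequality\<close>

lemma norm_torus_cell_le:
  fixes y :: "real ^ 'n"
  assumes "y \<in> torus_cell"
  shows "norm y \<le> real CARD('n)"
proof -
  have "norm y \<le> (\<Sum>i\<in>UNIV. \<bar>y $ i\<bar>)" by (rule norm_le_l1_cart)
  also have "\<dots> \<le> (\<Sum>i\<in>(UNIV :: 'n set). 1)"
    using assms by (intro sum_mono) (auto simp: torus_cell_def mem_box_cart)
  finally show ?thesis by simp
qed

text \<open>Dual form of the bound of a translation difference by the gradient: the translation acts
  on \<phi>, so the derivative along the segment from 0 to \<open>y\<close> can be integrated by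
  parts onto \<open>w\<close>. Young's inequality, translation invariance of the integral of the
  square of \<phi>, and \<open>norm y \<le> real CARD('n)\<close> give the right-hand side.\<close>

lemma weak_gradient_translation_estimate:
  fixes f :: "real ^ 'n \<Rightarrow> real" and w :: "real ^ 'n \<Rightarrow> real ^ 'n"
  assumes f: "integrable tor f" and w: "integrable tor w" and w2: "integrable tor (\<lambda>x. (norm (w x))\<^sup>2)"
    and weak: "\<And>\<phi> i. C1p \<phi> \<Longrightarrow> (LINT x|tor. f x * pd i \<phi> x) = - (LINT x|tor. \<phi> x * w x $ i)"
    and \<phi>: "C1p \<phi>" and y: "y \<in> torus_cell"
  shows "(LINT x|tor. f x * \<phi> x) \<le> (LINT x|tor. f x * \<phi> (x + y))
    + ((real CARD('n))\<^sup>2 * (LINT x|tor. (norm (w x))\<^sup>2) + (LINT x|tor. (\<phi> x)\<^sup>2)) / 2"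
proof -
  define D where "D = real CARD('n)"
  define R where "R = (D\<^sup>2 * (LINT x|tor. (norm (w x))\<^sup>2) + (LINT x|tor. (\<phi> x)\<^sup>2)) / 2"
  let ?q = "\<lambda>s x. \<phi> (x + s *\<^sub>R y)"
  let ?q' = "\<lambda>s x. \<Sum>i\<in>UNIV. y $ i *\<^sub>R pd i \<phi> (x + s *\<^sub>R y)"
  define b where "b s = (LINT x|tor. f x * \<phi> (x + s *\<^sub>R y))" for s
  have q: "C1p (?q s)" for s by (rule C1p_shift[OF \<phi>])
  have qc: "continuous_on S (?q s)" for S s using C1pD(4)[OF q] continuous_on_subset by blast
  have D: "(b has_real_derivative (LINT x|tor. f x * ?q' s x)) (at s within {0..1})" if s: "s \<in> {0..1}" for s
    unfolding b_def inner_real_def[symmetric]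
  proof (rule integral_pairing_derivative[OF f _ s])
    show "((\<lambda>s. ?q s x) has_vector_derivative ?q' s x) (at s within {0..1})" for s x
      by (rule line_derivative) (rule C1pD(2)[OF \<phi>])
    have "continuous_on ({0..1} \<times> torus_cell) (\<lambda>(s, x). pd i \<phi> (x + s *\<^sub>R y))" for i
      unfolding split_beta by (rule continuous_on_compose2[OF C1pD(3)[OF \<phi>]]) (auto intro!: continuous_intros)
    then show "continuous_on ({0..1} \<times> torus_cell) (\<lambda>(s, x). ?q' s x)"
      unfolding split_beta by (intro continuous_intros)
  qed (auto intro: qc)
  have bnd: "- (LINT x|tor. f x * ?q' s x) \<le> R" if s: "s \<in> {0..1}" for s
  proof -
    have pdq: "pd i (?q s) x = pd i \<phi> (x + s *\<^sub>R y)" for i x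
      by (rule pd_shift(1)) (rule C1pD(2)[OF \<phi>])
    have pc: "continuous_on torus_cell (pd i (?q s))" for i
      using C1pD(3)[OF q] continuous_on_subset by blast
    have wi: "integrable tor (\<lambda>x. w x $ i)" for i
      using integrable_bounded_inner[OF w continuous_on_const[of _ "axis i 1"]] by (simp add: inner_axis)
    have iw: "integrable tor (\<lambda>x. ?q s x * w x $ i)" for i
      using integrable_bounded_mult[OF wi qc] by (simp add: mult.commute)
    have "(LINT x|tor. f x * ?q' s x) = (LINT x|tor. (\<Sum>i\<in>UNIV. y $ i * (f x * pd i (?q s) x)))"
      by (intro Bochner_Integration.integral_cong) (auto simp: pdq sum_distrib_left algebra_simps)
    also have "\<dots> = (\<Sum>i\<in>UNIV. y $ i * (LINT x|tor. f x * pd i (?q s) x))"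
      by (simp add: integrable_bounded_mult[OF f pc])
    also have "\<dots> = (\<Sum>i\<in>UNIV. - (y $ i * (LINT x|tor. ?q s x * w x $ i)))"
      by (intro sum.cong refl) (simp only: weak[OF q] mult_minus_right)
    also have "\<dots> = - (LINT x|tor. (\<Sum>i\<in>UNIV. y $ i * (?q s x * w x $ i)))"
      by (simp add: iw sum_negf)
    finally have "- (LINT x|tor. f x * ?q' s x) = (LINT x|tor. (\<Sum>i\<in>UNIV. y $ i * (?q s x * w x $ i)))" by simp
    also have "\<dots> \<le> (LINT x|tor. (D\<^sup>2 * (norm (w x))\<^sup>2 + (?q s x)\<^sup>2) / 2)"
    proof (rule integral_mono)
      show "integrable tor (\<lambda>x. \<Sum>i\<in>UNIV. y $ i * (?q s x * w x $ i))" by (simp add: iw)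
      show "integrable tor (\<lambda>x. (D\<^sup>2 * (norm (w x))\<^sup>2 + (?q s x)\<^sup>2) / 2)"
        by (intro integrable_divide Bochner_Integration.integrable_add integrable_mult_right w2
          continuous_imp_integrable_tor[OF continuous_on_power[OF qc]])
      fix x
      have "(\<Sum>i\<in>UNIV. y $ i * (?q s x * w x $ i)) = ?q s x * (y \<bullet> w x)"
        by (simp add: inner_vec_def sum_distrib_left algebra_simps)
      also have "\<dots> \<le> \<bar>?q s x\<bar> * (D * norm (w x))"
      proof -
        have "\<bar>y \<bullet> w x\<bar> \<le> norm y * norm (w x)" by (rule Cauchy_Schwarz_ineq2)
        also have "\<dots> \<le> D * norm (w x)" unfolding D_def by (intro mult_right_mono norm_torus_cell_le y) auto
        finally have "\<bar>?q s x\<bar> * \<bar>y \<bullet> w x\<bar> \<le> \<bar>?q s x\<bar> * (D * norm (w x))" by (intro mult_left_mono) auto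
        then show ?thesis using abs_ge_self[of "?q s x * (y \<bullet> w x)"] by (simp add: abs_mult)
      qed
      also have "\<dots> \<le> (D\<^sup>2 * (norm (w x))\<^sup>2 + (?q s x)\<^sup>2) / 2"
        using sum_squares_bound[of "\<bar>?q s x\<bar>" "D * norm (w x)"] by (simp add: power_mult_distrib algebra_simps)
      finally show "(\<Sum>i\<in>UNIV. y $ i * (?q s x * w x $ i)) \<le> (D\<^sup>2 * (norm (w x))\<^sup>2 + (?q s x)\<^sup>2) / 2" .
    qed
    also have "\<dots> = (D\<^sup>2 * (LINT x|tor. (norm (w x))\<^sup>2) + (LINT x|tor. (?q s x)\<^sup>2)) / 2"
      using w2 continuous_imp_integrable_tor[OF continuous_on_power[OF qc]] by simp
    also have "(LINT x|tor. (?q s x)\<^sup>2) = (LINT x|tor. (\<phi> x)\<^sup>2)"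
    proof (rule integral_tor_shift)
      show "torus_fun (\<lambda>x. (\<phi> x)\<^sup>2)" using C1pD(1)[OF \<phi>] by (simp add: torus_fun_def)
      show "continuous_on UNIV (\<lambda>x. (\<phi> x)\<^sup>2)" using C1pD(4)[OF \<phi>] by (intro continuous_intros)
      show "s *\<^sub>R y \<in> torus_cell" using s y by (auto simp: torus_cell_def mem_box_cart mult_le_one)
    qed
    finally show ?thesis by (simp add: R_def)
  qed
  have "\<exists>\<xi>\<in>{0..1}. b 1 - b 0 = (LINT x|tor. f x * ?q' \<xi> x) * (1 - 0)"
    by (rule mvt_very_simple) (use D in \<open>auto simp: has_field_derivative_def\<close>)
  then obtain \<xi> where "\<xi> \<in> {0..1}" "b 1 - b 0 = (LINT x|tor. f x * ?q' \<xi> x)" by auto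
  then have "b 0 \<le> b 1 + R" using bnd[of \<xi>] by auto
  then show ?thesis by (simp add: b_def R_def D_def)
qed

text \<open>The translation estimate is averaged over \<open>y\<close> in the cell. The average of
  \<open>\<phi> (x + y)\<close> over \<open>y\<close> is the mean of \<phi>, the same for every
  \<open>x\<close>, and a constant integrates to 0 against \<open>f\<close>.\<close>

lemma poincare_dual:
  fixes f :: "real ^ 'n \<Rightarrow> real" and w :: "real ^ 'n \<Rightarrow> real ^ 'n"
  assumes f: "integrable tor f" and w: "integrable tor w" and w2: "integrable tor (\<lambda>x. (norm (w x))\<^sup>2)"
    and weak: "\<And>\<phi> i. C1p \<phi> \<Longrightarrow> (LINT x|tor. f x * pd i \<phi> x) = - (LINT x|tor. \<phi> x * w x $ i)"
    and mean: "(LINT x|tor. f x) = 0" and \<phi>: "C1p \<phi>"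
  shows "(LINT x|tor. f x * \<phi> x)
    \<le> ((real CARD('n))\<^sup>2 * (LINT x|tor. (norm (w x))\<^sup>2) + (LINT x|tor. (\<phi> x)\<^sup>2)) / 2"
proof -
  define R where "R = ((real CARD('n))\<^sup>2 * (LINT x|tor. (norm (w x))\<^sup>2) + (LINT x|tor. (\<phi> x)\<^sup>2)) / 2"
  interpret pt: pair_sigma_finite "tor :: (real ^ 'n) measure" "tor :: (real ^ 'n) measure" ..
  note c = C1pD(4)[OF \<phi>]
  have [measurable]: "\<phi> \<in> borel_measurable borel" by (rule borel_measurable_continuous_onI[OF c])
  have [measurable]: "(\<lambda>x. x) \<in> measurable tor borel"
    by (rule continuous_imp_measurable_tor) (rule continuous_on_id)
  note [measurable] = borel_measurable_integrable[OF f]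
  have shift: "(LINT y|tor. F (x + y)) = (LINT y|tor. F y)"
    if "x \<in> torus_cell" "torus_fun F" "continuous_on UNIV F" for x and F :: "real ^ 'n \<Rightarrow> real"
    using integral_tor_shift[OF that(2,3,1)] by (simp add: add.commute)
  have ci: "integrable tor (\<lambda>y. \<phi> (x + y))" for x
    by (rule continuous_imp_integrable_tor, rule continuous_on_compose2[OF c]) (auto intro!: continuous_intros)
  \<comment> \<open>The inner integral of \<open>\<bar>\<phi> (x + y)\<bar>\<close> over
    \<open>y\<close> is independent of \<open>x\<close>, so the integrability of \<open>f\<close>
    suffices for exchanging the order of integration.\<close>
  have P: "integrable (tor \<Otimes>\<^sub>M tor) (\<lambda>(x, y). f x * \<phi> (x + y))"
  proof (rule pt.Fubini_integrable)
    have "integrable tor (\<lambda>x. \<bar>f x\<bar> * (LINT y|tor. \<bar>\<phi> y\<bar>))" using f by simp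
    then show "integrable tor (\<lambda>x. LINT y|tor. norm (case (x, y) of (x, y) \<Rightarrow> f x * \<phi> (x + y)))"
    proof (rule Bochner_Integration.integrable_cong[OF refl, THEN iffD1, rotated])
      fix x :: "real ^ 'n" assume "x \<in> space tor"
      then have "(LINT y|tor. \<bar>\<phi> (x + y)\<bar>) = (LINT y|tor. \<bar>\<phi> y\<bar>)"
        using C1pD(1)[OF \<phi>] c by (intro shift[of x "\<lambda>x. \<bar>\<phi> x\<bar>"]) (auto simp: torus_fun_def intro!: continuous_intros)
      then show "\<bar>f x\<bar> * (LINT y|tor. \<bar>\<phi> y\<bar>) = (LINT y|tor. norm (case (x, y) of (x, y) \<Rightarrow> f x * \<phi> (x + y)))"
        by (simp add: abs_mult)
    qed
    show "AE x in tor. integrable tor (\<lambda>y. case (x, y) of (x, y) \<Rightarrow> f x * \<phi> (x + y))"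
      by (simp add: ci)
  qed measurable
  have "(LINT x|tor. f x * \<phi> x) = (LINT y|(tor :: (real ^ 'n) measure). (LINT x|tor. f x * \<phi> x))"
    by (simp add: measure_tor)
  also have "\<dots> \<le> (LINT y|tor. (LINT x|tor. f x * \<phi> (x + y)) + R)"
  proof (rule integral_mono)
    show "integrable tor (\<lambda>y. (LINT x|tor. f x * \<phi> (x + y)) + R)"
      using pt.integrable_snd[OF P] by simp
  qed (use weak_gradient_translation_estimate[OF f w w2 weak \<phi>] in \<open>auto simp: R_def\<close>)
  also have "\<dots> = (LINT y|tor. (LINT x|tor. f x * \<phi> (x + y))) + R"
    using pt.integrable_snd[OF P] by (simp add: measure_tor)
  also have "(LINT y|tor. (LINT x|tor. f x * \<phi> (x + y))) = (LINT x|tor. (LINT y|tor. f x * \<phi> (x + y)))"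
    by (rule pt.Fubini_integral[OF P])
  also have "\<dots> = (LINT x|tor. f x * (LINT y|tor. \<phi> y))"
    by (intro Bochner_Integration.integral_cong) (auto simp: shift[OF _ C1pD(1)[OF \<phi>] c])
  also have "\<dots> = 0" by (simp add: mean)
  finally show ?thesis by (simp add: R_def)
qed

text \<open>Square integrability is part of the conclusion, so \<open>f\<close> cannot be its own
  test function. The dual estimate, extended by approximation to bounded measurable functions, is
  applied to truncations of \<open>f\<close> instead; half of the integral of the squared truncation
  is absorbed, and monotone convergence passes to \<open>f\<close>. The constant is the square of a
  crude bound for the diameter of the cell.\<close>

lemma poincare:
  fixes f :: "real ^ 'n \<Rightarrow> real" and w :: "real ^ 'n \<Rightarrow> real ^ 'n"
  assumes f: "integrable tor f" and w: "integrable tor w" and w2: "integrable tor (\<lambda>x. (norm (w x))\<^sup>2)"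
    and weak: "\<And>\<phi> i. C1p \<phi> \<Longrightarrow> (LINT x|tor. f x * pd i \<phi> x) = - (LINT x|tor. \<phi> x * w x $ i)"
    and mean: "(LINT x|tor. f x) = 0"
  shows "integrable tor (\<lambda>x. (f x)\<^sup>2)"
    and "(LINT x|tor. (f x)\<^sup>2) \<le> (real CARD('n))\<^sup>2 * (LINT x|tor. (norm (w x))\<^sup>2)"
proof -
  define W where "W = (real CARD('n))\<^sup>2 * (LINT x|tor. (norm (w x))\<^sup>2)"
  note fm [measurable] = borel_measurable_integrable[OF f]
  \<comment> \<open>Cut to 0 instead of to the level \<open>M\<close>, so that
    \<open>f x * g M x\<close> is exactly \<open>(g M x)\<^sup>2\<close>.\<close>
  define g where "g M x = (if \<bar>f x\<bar> \<le> real M then f x else 0)" for M :: nat and x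
  have gm [measurable]: "g M \<in> borel_measurable tor" for M unfolding g_def[abs_def] by measurable
  have gb: "\<bar>g M x\<bar> \<le> real M" for M x by (simp add: g_def)
  have g2i: "integrable tor (\<lambda>x. (g M x)\<^sup>2)" for M
  proof (rule tor.integrable_const_bound)
    show "AE x in tor. norm ((g M x)\<^sup>2) \<le> (real M)\<^sup>2"
      using gb by (intro AE_I2) (simp add: abs_le_square_iff[symmetric])
  qed measurable
  have le: "(LINT x|tor. (g M x)\<^sup>2) \<le> W" for M
  proof -
    obtain \<phi> where \<phi>: "\<And>k::nat. C1p (\<phi> k)" "\<And>k x. \<bar>\<phi> k x\<bar> \<le> real M + 1"
      "AE x in tor. (\<lambda>k. \<phi> k x) \<longlonglongrightarrow> g M x"
      by (rule C1p_dense[OF gm gb]) blast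
    note pm = C1p_measurable[OF \<phi>(1)]
    have l1: "(\<lambda>k. LINT x|tor. f x * \<phi> k x) \<longlonglongrightarrow> (LINT x|tor. f x * g M x)"
      by (rule integral_tor_bounded_limit[OF f gm pm \<phi>(2,3)])
    have "(\<lambda>k. LINT x|tor. 1 * (\<phi> k x)\<^sup>2) \<longlonglongrightarrow> (LINT x|tor. 1 * (g M x)\<^sup>2)"
    proof (rule integral_tor_bounded_limit)
      show "\<bar>(\<phi> k x)\<^sup>2\<bar> \<le> (real M + 1)\<^sup>2" for k x
        using \<phi>(2)[of k x] by (simp add: abs_le_square_iff[symmetric])
      show "AE x in tor. (\<lambda>k. (\<phi> k x)\<^sup>2) \<longlonglongrightarrow> (g M x)\<^sup>2"
        using \<phi>(3) by eventually_elim (intro tendsto_intros)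
      show "(\<lambda>x. (\<phi> k x)\<^sup>2) \<in> borel_measurable tor" for k using pm by measurable
    qed auto
    then have l2: "(\<lambda>k. (W + (LINT x|tor. (\<phi> k x)\<^sup>2)) / 2) \<longlonglongrightarrow> (W + (LINT x|tor. (g M x)\<^sup>2)) / 2"
      by (intro tendsto_intros) simp_all
    have "(LINT x|tor. f x * g M x) \<le> (W + (LINT x|tor. (g M x)\<^sup>2)) / 2"
      by (rule LIMSEQ_le[OF l1 l2]) (use poincare_dual[OF f w w2 weak mean \<phi>(1)] in \<open>auto simp: W_def\<close>)
    moreover have "f x * g M x = (g M x)\<^sup>2" for x by (simp add: g_def power2_eq_square)
    ultimately show ?thesis by simp
  qed
  have nn: "(\<integral>\<^sup>+x. ennreal ((f x)\<^sup>2) \<partial>tor) \<le> ennreal W"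
  proof -
    have "(\<integral>\<^sup>+x. ennreal ((f x)\<^sup>2) \<partial>tor) = (\<integral>\<^sup>+x. (SUP M. ennreal ((g M x)\<^sup>2)) \<partial>tor)"
    proof (rule nn_integral_cong)
      fix x
      obtain M0 :: nat where "\<bar>f x\<bar> \<le> real M0" using real_arch_simple by blast
      then have "g M0 x = f x" by (simp add: g_def)
      moreover have "(g M x)\<^sup>2 \<le> (f x)\<^sup>2" for M by (simp add: g_def)
      ultimately show "ennreal ((f x)\<^sup>2) = (SUP M. ennreal ((g M x)\<^sup>2))"
        by (intro antisym SUP_least SUP_upper2[of M0]) (auto intro: ennreal_leI)
    qed
    also have "\<dots> = (SUP M. \<integral>\<^sup>+x. ennreal ((g M x)\<^sup>2) \<partial>tor)"
      by (rule nn_integral_monotone_convergence_SUP)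
        (auto simp: incseq_def le_fun_def g_def intro!: ennreal_leI)
    also have "\<dots> \<le> ennreal W"
      using le by (intro SUP_least) (simp add: nn_integral_eq_integral[OF g2i] ennreal_leI)
    finally show ?thesis .
  qed
  show int: "integrable tor (\<lambda>x. (f x)\<^sup>2)"
    by (rule integrableI_nonneg) (use nn in \<open>auto simp: le_less_trans[OF _ ennreal_less_top]\<close>)
  have "0 \<le> W" by (simp add: W_def)
  then show "(LINT x|tor. (f x)\<^sup>2) \<le> (real CARD('n))\<^sup>2 * (LINT x|tor. (norm (w x))\<^sup>2)"
    using nn unfolding W_def[symmetric] by (simp add: nn_integral_eq_integral[OF int])
qed

section \<open>The relative energy inequality at a fixed time\<close>

definition lap :: "(real ^ 'n \<Rightarrow> real) \<Rightarrow> real ^ 'n \<Rightarrow> real" where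
  "lap f x = (\<Sum>i\<in>UNIV. pd i (pd i f) x)"

definition hess :: "(real ^ 'n \<Rightarrow> real) \<Rightarrow> real ^ 'n \<Rightarrow> real ^ 'n ^ 'n" where
  "hess f x = (\<chi> i j. pd j (pd i f) x)"

lemma Ck_nth:
  fixes f :: "real ^ 'n \<Rightarrow> real ^ 'm"
  shows "Ck k f \<Longrightarrow> Ck k (\<lambda>x. f x $ j)"
proof (induction k arbitrary: f)
  case (Suc k)
  have "pd i (\<lambda>x. f x $ j) = (\<lambda>x. pd i f x $ j)" for i
    using Suc.prems by (auto simp: fun_eq_iff pd_nth)
  then show ?case using Suc by (auto simp: pd_nth)
qed (auto intro: continuous_intros)

lemma Ck_torus_nth:
  fixes f :: "real ^ 'n \<Rightarrow> real ^ 'm"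
  shows "Ck_torus k f \<Longrightarrow> Ck_torus k (\<lambda>x. f x $ j)"
  by (auto simp: Ck_torus_def Ck_nth torus_fun_def)

lemma pd_pd_commute:
  fixes f :: "real ^ 'n \<Rightarrow> real"
  shows "Ck_torus (Suc (Suc 0)) f \<Longrightarrow> pd i (pd j f) x = pd j (pd i f) x"
  by (rule pd_commute) (simp add: Ck_torus_def)

lemma pd_sum_mult:
  fixes a b :: "'a \<Rightarrow> real ^ 'n \<Rightarrow> real"
  assumes "\<And>j. C1p (a j)" "\<And>j. C1p (b j)"
  shows "pd i (\<lambda>x. \<Sum>j\<in>A. a j x * b j x) x = (\<Sum>j\<in>A. a j x * pd i (b j) x + pd i (a j) x * b j x)"
proof -
  have "pd i (\<lambda>x. \<Sum>j\<in>A. a j x * b j x) x = (\<Sum>j\<in>A. pd i (\<lambda>x. a j x * b j x) x)"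
    by (rule pd_sum) (rule C1pD(2)[OF C1p_mult[OF assms]])
  then show ?thesis by (simp add: pd_mult[OF C1pD(2)[OF assms(1)] C1pD(2)[OF assms(2)]])
qed

lemma inner_matrix_sum:
  fixes M :: "real ^ 'n ^ 'n" and a b :: "real ^ 'n"
  shows "a \<bullet> (M *v b) = (\<Sum>i\<in>UNIV. \<Sum>j\<in>UNIV. a $ i * (M $ i $ j * b $ j))"
  by (simp add: inner_vec_def matrix_vector_mult_def sum_distrib_left)

text \<open>The smooth fields \<open>P\<close>, \<open>U\<close> play the role of \<open>\<rho>\<close>, \<open>u\<close> at a fixed time.\<close>

locale smooth_state =
  fixes P :: "real ^ 'n \<Rightarrow> real" and U :: "real ^ 'n \<Rightarrow> real ^ 'n"
  assumes P3: "Ck_torus (Suc (Suc (Suc 0))) P" and U2: "Ck_torus (Suc (Suc 0)) U"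
    and P_pos: "\<And>x. 0 < P x"
begin

abbreviation "Uc i \<equiv> \<lambda>x. U x $ i"
abbreviation "J x \<equiv> jacobian U (at x)"
abbreviation "d \<equiv> div_vec U"

lemma C1p_P: "C1p P" "C1p (pd i P)" "C1p (pd j (pd i P))"
  using P3 by (auto intro: Ck_torus_mono Ck_torus_pd)

lemma P2: "Ck_torus (Suc (Suc 0)) P" and pdP2: "Ck_torus (Suc (Suc 0)) (pd i P)"
  using P3 by (auto intro: Ck_torus_mono Ck_torus_pd)

lemma Uc2: "Ck_torus (Suc (Suc 0)) (Uc i)"
  by (rule Ck_torus_nth[OF U2])

lemma C1p_U: "C1p U" "C1p (Uc i)" "C1p (pd j (Uc i))"
  using U2 Uc2 by (auto intro: Ck_torus_mono Ck_torus_pd)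

lemma J_nth: "J x $ i $ j = pd j (Uc i) x"
  using jacobian_nth[OF C1pD(2)[OF C1p_U(1)]] pd_nth(1)[OF C1pD(2)[OF C1p_U(1)]] by simp

lemma C1p_d: "C1p d"
proof -
  have "d = (\<lambda>x. \<Sum>i\<in>UNIV. pd i (Uc i) x)" by (auto simp: div_vec_def)
  then show ?thesis using C1p_sum[of UNIV "\<lambda>i. pd i (Uc i)"] C1p_U(3) by simp
qed

lemma pd_d: "pd j d x = (\<Sum>i\<in>UNIV. pd i (pd j (Uc i)) x)"
proof -
  have "d = (\<lambda>x. \<Sum>i\<in>UNIV. pd i (Uc i) x)" by (auto simp: div_vec_def)
  then have "pd j d x = (\<Sum>i\<in>UNIV. pd j (pd i (Uc i)) x)"
    using pd_sum[of UNIV "\<lambda>i. pd i (Uc i)" x j] C1pD(2)[OF C1p_U(3)] by simp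
  then show ?thesis by (simp add: pd_pd_commute[OF Uc2, of j])
qed

lemma C1p_lap: "C1p (lap P)"
  using C1p_sum[of UNIV "\<lambda>i. pd i (pd i P)"] C1p_P(3) by (simp add: lap_def[abs_def])

text \<open>Symmetry is applied to the C^2 function \<open>pd i P\<close>; it leaves
  \<open>pd i\<close> outermost, the shape in which a divergence appears in the Korteweg
  identity.\<close>

lemma pd_lap: "pd j (lap P) x = (\<Sum>i\<in>UNIV. pd i (pd j (pd i P)) x)"
proof -
  have "pd j (lap P) x = (\<Sum>i\<in>UNIV. pd j (pd i (pd i P)) x)"
    using pd_sum[of UNIV "\<lambda>i. pd i (pd i P)" x j] C1pD(2)[OF C1p_P(3)] by (simp add: lap_def[abs_def])
  then show ?thesis by (simp add: pd_pd_commute[OF pdP2, of j])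
qed

lemma div_PU: "div_vec (\<lambda>y. P y *\<^sub>R U y) x = U x \<bullet> grad P x + P x * d x"
proof -
  have "div_vec (\<lambda>y. P y *\<^sub>R U y) x = (\<Sum>i\<in>UNIV. P x * pd i (Uc i) x + pd i P x * U x $ i)"
    unfolding div_vec_def
    by (intro sum.cong refl) (simp add: pd_mult[OF C1pD(2)[OF C1p_P(1)] C1pD(2)[OF C1p_U(2)]])
  then show ?thesis
    by (simp add: div_vec_def inner_vec_def grad_def sum.distrib sum_distrib_left mult.commute)
qed

lemma div_PU_sum: "div_vec (\<lambda>y. P y *\<^sub>R U y) = (\<lambda>x. (\<Sum>j\<in>UNIV. U x $ j * pd j P x) + P x * d x)"
  by (auto simp: div_PU inner_vec_def grad_def)

lemma C1p_div_PU: "C1p (div_vec (\<lambda>y. P y *\<^sub>R U y))"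
  unfolding div_PU_sum by (intro C1p_add C1p_sum C1p_mult C1p_U C1p_P C1p_d)

text \<open>By the mass equation the divergence of \<open>P y *\<^sub>R U y\<close> is minus the
  time derivative of the density, so this is the term through which the motion of the gradient of
  the density enters.\<close>

lemma grad_div_PU:
  "w \<bullet> grad (div_vec (\<lambda>y. P y *\<^sub>R U y)) x =
    w \<bullet> (hess P x *v U x) + grad P x \<bullet> (J x *v w) + d x * (grad P x \<bullet> w) + P x * (grad d x \<bullet> w)"
proof -
  have "pd i (div_vec (\<lambda>y. P y *\<^sub>R U y)) x
      = (\<Sum>j\<in>UNIV. U x $ j * pd i (pd j P) x + pd i (Uc j) x * pd j P x) + (P x * pd i d x + pd i P x * d x)" for i
    unfolding div_PU_sum
    by (subst pd_add) (auto intro!: C1pD(2) C1p_sum C1p_mult C1p_U C1p_P C1p_d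
      simp: pd_sum_mult[OF C1p_U(2) C1p_P(2)] pd_mult[OF C1pD(2)[OF C1p_P(1)] C1pD(2)[OF C1p_d]])
  then have e: "grad (div_vec (\<lambda>y. P y *\<^sub>R U y)) x $ i
      = (\<Sum>j\<in>UNIV. U x $ j * pd j (pd i P) x) + (\<Sum>j\<in>UNIV. pd i (Uc j) x * pd j P x) + (P x * pd i d x + pd i P x * d x)" for i
    by (simp add: grad_def sum.distrib pd_pd_commute[OF P2, of i])
  have "w \<bullet> grad (div_vec (\<lambda>y. P y *\<^sub>R U y)) x
    = (\<Sum>i\<in>UNIV. \<Sum>j\<in>UNIV. w $ i * (U x $ j * pd j (pd i P) x)) + (\<Sum>i\<in>UNIV. \<Sum>j\<in>UNIV. w $ i * (pd i (Uc j) x * pd j P x))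
      + (\<Sum>i\<in>UNIV. w $ i * (P x * pd i d x)) + (\<Sum>i\<in>UNIV. w $ i * (pd i P x * d x))"
    by (simp add: inner_vec_def e sum.distrib distrib_left sum_distrib_left)
  also have "(\<Sum>i\<in>UNIV. \<Sum>j\<in>UNIV. w $ i * (pd i (Uc j) x * pd j P x)) = grad P x \<bullet> (J x *v w)"
    unfolding inner_matrix_sum by (subst sum.swap) (simp add: J_nth grad_def mult_ac)
  also have "(\<Sum>i\<in>UNIV. \<Sum>j\<in>UNIV. w $ i * (U x $ j * pd j (pd i P) x)) = w \<bullet> (hess P x *v U x)"
    unfolding inner_matrix_sum by (simp add: hess_def mult_ac)
  also have "(\<Sum>i\<in>UNIV. w $ i * (P x * pd i d x)) = P x * (grad d x \<bullet> w)"
    by (simp add: inner_vec_def grad_def sum_distrib_left mult_ac)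
  also have "(\<Sum>i\<in>UNIV. w $ i * (pd i P x * d x)) = d x * (grad P x \<bullet> w)"
    by (simp add: inner_vec_def grad_def sum_distrib_left mult_ac)
  finally show ?thesis by simp
qed

lemma cont_cell: "continuous_on torus_cell f" if "C1p f" for f :: "real ^ 'n \<Rightarrow> 'b::real_normed_vector"
  using C1pD(4)[OF that] continuous_on_subset by blast

lemma grad_continuous: "continuous_on torus_cell (grad f)" if "C1p f" for f
proof -
  have "continuous_on UNIV (grad f)" unfolding grad_def[abs_def]
    by (intro continuous_on_vec_lambda C1pD(3)[OF that])
  then show ?thesis using continuous_on_subset by blast
qed

lemma J_continuous: "continuous_on torus_cell (\<lambda>x. J x)"
proof -
  have e: "(\<lambda>x. J x) = (\<lambda>x. \<chi> i j. pd j (Uc i) x)" by (auto simp: vec_eq_iff J_nth)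
  have "continuous_on UNIV (\<lambda>x. (\<chi> i j. pd j (Uc i) x) :: real ^ 'n ^ 'n)"
    by (intro continuous_on_vec_lambda C1pD(3)[OF C1p_U(2)])
  then show ?thesis unfolding e using continuous_on_subset by blast
qed

lemma hess_continuous: "continuous_on torus_cell (hess P)"
proof -
  have "continuous_on UNIV (hess P)" unfolding hess_def[abs_def]
    by (intro continuous_on_vec_lambda C1pD(4)[OF C1p_P(3)])
  then show ?thesis using continuous_on_subset by blast
qed

lemma matvec_continuous:
  fixes A :: "real ^ 'n \<Rightarrow> real ^ 'n ^ 'n"
  assumes "continuous_on S A" "continuous_on S b"
  shows "continuous_on S (\<lambda>x. A x *v b x)"
  unfolding matrix_vector_mult_def by (intro continuous_intros continuous_on_vec_lambda assms)

lemma weak_gradient_vector_field: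
  fixes g :: "real ^ 'n \<Rightarrow> real ^ 'n" and r :: "real ^ 'n \<Rightarrow> real"
  assumes g: "integrable tor g" and r: "integrable tor r"
    and weak: "\<And>\<phi> i. C1p \<phi> \<Longrightarrow> (LINT x|tor. r x * pd i \<phi> x) = - (LINT x|tor. \<phi> x * g x $ i)"
    and \<Phi>: "\<And>i. C1p (\<Phi> i)"
  shows "(LINT x|tor. g x \<bullet> (\<chi> i. \<Phi> i x)) = - (LINT x|tor. r x * (\<Sum>i\<in>UNIV. pd i (\<Phi> i) x))"
proof -
  have gi: "integrable tor (\<lambda>x. g x $ i)" for i
    using integrable_bounded_inner[OF g continuous_on_const[of _ "axis i 1"]] by (simp add: inner_axis)
  have i1: "integrable tor (\<lambda>x. \<Phi> i x * g x $ i)" for i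
    using integrable_bounded_mult[OF gi cont_cell[OF \<Phi>]] by (simp add: mult.commute)
  have pc: "continuous_on torus_cell (pd i (\<Phi> i))" for i
    using C1pD(3)[OF \<Phi>] continuous_on_subset by blast
  have "(LINT x|tor. g x \<bullet> (\<chi> i. \<Phi> i x)) = (\<Sum>i\<in>UNIV. LINT x|tor. \<Phi> i x * g x $ i)"
    by (simp add: inner_vec_def i1 mult.commute)
  also have "\<dots> = - (\<Sum>i\<in>UNIV. LINT x|tor. r x * pd i (\<Phi> i) x)"
    using weak[OF \<Phi>] by (simp add: sum_negf)
  also have "(\<Sum>i\<in>UNIV. LINT x|tor. r x * pd i (\<Phi> i) x) = (LINT x|tor. r x * (\<Sum>i\<in>UNIV. pd i (\<Phi> i) x))"
    by (simp add: sum_distrib_left integrable_bounded_mult[OF r pc])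
  finally show ?thesis .
qed

text \<open>The Korteweg stress identity \<open>\<rho> \<nabla>\<Delta>\<rho> = div K\<close>, polarised and tested with \<open>U\<close>.\<close>

lemma korteweg_cross_identity:
  fixes g :: "real ^ 'n \<Rightarrow> real ^ 'n" and r :: "real ^ 'n \<Rightarrow> real"
  assumes g: "integrable tor g" and r: "integrable tor r"
    and weak: "\<And>\<phi> i. C1p \<phi> \<Longrightarrow> (LINT x|tor. r x * pd i \<phi> x) = - (LINT x|tor. \<phi> x * g x $ i)"
  shows "(LINT x|tor. r x * (U x \<bullet> grad (lap P) x - grad P x \<bullet> grad d x)
    + g x \<bullet> (hess P x *v U x - J x *v grad P x)) = 0"
proof -
  \<comment> \<open>The field \<open>hess P x *v U x - J x *v grad P x\<close>. In its divergence
    the products of second derivatives of \<open>P\<close> with first derivatives of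
    \<open>U\<close> cancel by symmetry; third derivatives of \<open>P\<close> and second
    derivatives of \<open>U\<close> remain.\<close>
  let ?\<Phi> = "\<lambda>i x. (\<Sum>j\<in>UNIV. pd j (pd i P) x * U x $ j) - (\<Sum>j\<in>UNIV. pd j (Uc i) x * pd j P x)"
  have \<Phi>: "C1p (?\<Phi> i)" for i
    by (intro C1p_diff C1p_sum C1p_mult C1p_U C1p_P)
  have vec: "(\<chi> i. ?\<Phi> i x) = hess P x *v U x - J x *v grad P x" for x
    by (simp add: vec_eq_iff matrix_vector_mult_def hess_def J_nth grad_def)
  have pdi: "pd i (?\<Phi> i) x = (\<Sum>j\<in>UNIV. pd j (pd i P) x * pd i (Uc j) x + pd i (pd j (pd i P)) x * U x $ j)
     - (\<Sum>j\<in>UNIV. pd j (Uc i) x * pd i (pd j P) x + pd i (pd j (Uc i)) x * pd j P x)" for i x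
    by (subst pd_diff) (auto intro!: C1pD(2) C1p_sum C1p_mult C1p_U C1p_P
        simp: pd_sum_mult[OF C1p_P(3) C1p_U(2)] pd_sum_mult[OF C1p_U(3) C1p_P(2)])
  have div: "(\<Sum>i\<in>UNIV. pd i (?\<Phi> i) x) = U x \<bullet> grad (lap P) x - grad P x \<bullet> grad d x" for x
  proof -
    have "(\<Sum>i\<in>UNIV. pd i (?\<Phi> i) x)
      = (\<Sum>i\<in>UNIV. \<Sum>j\<in>UNIV. pd j (pd i P) x * pd i (Uc j) x) + (\<Sum>i\<in>UNIV. \<Sum>j\<in>UNIV. pd i (pd j (pd i P)) x * U x $ j)
      - (\<Sum>i\<in>UNIV. \<Sum>j\<in>UNIV. pd j (Uc i) x * pd i (pd j P) x) - (\<Sum>i\<in>UNIV. \<Sum>j\<in>UNIV. pd i (pd j (Uc i)) x * pd j P x)"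
      by (simp add: pdi sum.distrib sum_subtractf)
    also have "(\<Sum>i\<in>UNIV. \<Sum>j\<in>UNIV. pd j (pd i P) x * pd i (Uc j) x) = (\<Sum>i\<in>UNIV. \<Sum>j\<in>UNIV. pd j (Uc i) x * pd i (pd j P) x)"
      by (subst sum.swap) (simp add: mult.commute)
    also have "(\<Sum>i\<in>UNIV. \<Sum>j\<in>UNIV. pd i (pd j (pd i P)) x * U x $ j) = U x \<bullet> grad (lap P) x"
      by (subst sum.swap) (simp add: inner_vec_def grad_def pd_lap sum_distrib_left mult.commute)
    also have "(\<Sum>i\<in>UNIV. \<Sum>j\<in>UNIV. pd i (pd j (Uc i)) x * pd j P x) = grad P x \<bullet> grad d x"
      by (subst sum.swap) (simp add: inner_vec_def grad_def pd_d sum_distrib_left mult.commute)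
    finally show ?thesis by simp
  qed
  have i1: "integrable tor (\<lambda>x. r x * (U x \<bullet> grad (lap P) x - grad P x \<bullet> grad d x))"
    by (intro integrable_bounded_mult r continuous_intros grad_continuous C1p_lap C1p_P C1p_d cont_cell C1p_U)
  have i2: "integrable tor (\<lambda>x. g x \<bullet> (hess P x *v U x - J x *v grad P x))"
    by (intro integrable_bounded_inner g continuous_intros matvec_continuous hess_continuous J_continuous
        cont_cell C1p_U grad_continuous C1p_P)
  show ?thesis
    using weak_gradient_vector_field[where \<Phi> = ?\<Phi>, OF g r weak \<Phi>] i1 i2 unfolding vec div by simp
qed

text \<open>The integrand is the divergence of half the squared norm of \<open>grad P\<close> times
  \<open>U\<close>.\<close>

lemma korteweg_quadratic_identity:
  "(LINT x|tor. (grad P x \<bullet> grad P x) * d x / 2 + grad P x \<bullet> (hess P x *v U x)) = 0"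
proof -
  let ?F = "\<lambda>i x. (1/2 * (\<Sum>j\<in>UNIV. pd j P x * pd j P x)) * U x $ i"
  have c: "C1p (\<lambda>x. 1/2 * (\<Sum>j\<in>UNIV. pd j P x * pd j P x))"
    by (intro C1p_cmult C1p_sum C1p_mult C1p_P)
  have pc: "pd i (\<lambda>x. 1/2 * (\<Sum>j\<in>UNIV. pd j P x * pd j P x)) x = (\<Sum>j\<in>UNIV. pd j P x * pd i (pd j P) x)" for i x
    by (subst pd_cmult) (auto intro!: C1pD(2) C1p_sum C1p_mult C1p_P simp: pd_sum_mult[OF C1p_P(2) C1p_P(2)] sum_distrib_left mult_ac)
  have "(\<Sum>i\<in>UNIV. pd i (?F i) x) = (grad P x \<bullet> grad P x) * d x / 2 + grad P x \<bullet> (hess P x *v U x)" for x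
  proof -
    have "(\<Sum>i\<in>UNIV. pd i (?F i) x) = (\<Sum>i\<in>UNIV. (1/2 * (\<Sum>j\<in>UNIV. pd j P x * pd j P x)) * pd i (Uc i) x)
      + (\<Sum>i\<in>UNIV. \<Sum>j\<in>UNIV. pd j P x * pd i (pd j P) x * U x $ i)"
      by (simp only: pd_mult[OF C1pD(2)[OF c] C1pD(2)[OF C1p_U(2)]] pc sum.distrib sum_distrib_right)
    also have "(\<Sum>i\<in>UNIV. \<Sum>j\<in>UNIV. pd j P x * pd i (pd j P) x * U x $ i) = grad P x \<bullet> (hess P x *v U x)"
      unfolding inner_matrix_sum by (subst sum.swap) (simp add: hess_def grad_def mult.assoc)
    also have "(\<Sum>i\<in>UNIV. (1/2 * (\<Sum>j\<in>UNIV. pd j P x * pd j P x)) * pd i (Uc i) x) = (grad P x \<bullet> grad P x) * d x / 2"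
      by (simp only: sum_distrib_left[symmetric]) (simp add: div_vec_def inner_vec_def grad_def)
    finally show ?thesis .
  qed
  then show ?thesis
    using integral_div_zero[of ?F] C1p_mult[OF c C1p_U(2)] by simp
qed

text \<open>The integrand is the divergence of \<open>p (P x) *\<^sub>R U x\<close>.\<close>

lemma pressure_div_identity:
  assumes p: "\<And>s. 0 < s \<Longrightarrow> (p has_real_derivative p' s) (at s)" and p': "continuous_on {0<..} p'"
  shows "(LINT x|tor. p (P x) * d x + p' (P x) * (grad P x \<bullet> U x)) = 0"
proof -
  have c: "C1p (\<lambda>x. p (P x))"
    by (rule C1p_compose[OF C1p_P(1), where F' = p']) (auto intro: p P_pos continuous_on_subset[OF p'])
  have "(\<Sum>i\<in>UNIV. pd i (\<lambda>x. p (P x) * U x $ i) x) = p (P x) * d x + p' (P x) * (grad P x \<bullet> U x)" for x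
    by (simp add: pd_mult[OF C1pD(2)[OF c] C1pD(2)[OF C1p_U(2)]] pd_compose(1)[OF C1pD(2)[OF C1p_P(1)] p[OF P_pos]]
        sum.distrib div_vec_def inner_vec_def grad_def sum_distrib_left mult.assoc)
  then show ?thesis
    using integral_div_zero[of "\<lambda>i x. p (P x) * U x $ i"] C1p_mult[OF c C1p_U(2)] by simp
qed

end

section \<open>Power-law pressure, relative enthalpy, and tensor algebra\<close>

lemma powr_derivative:
  fixes s \<gamma> :: real
  assumes "0 < s"
  shows "((\<lambda>s. s powr \<gamma>) has_real_derivative \<gamma> * s powr (\<gamma> - 1)) (at s)"
  using has_real_derivative_powr[OF assms, of \<gamma>] .

lemma deriv_powr:
  fixes s \<gamma> :: real
  assumes "0 < s"
  shows "deriv (\<lambda>s. s powr \<gamma>) s = \<gamma> * s powr (\<gamma> - 1)"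
  by (rule DERIV_imp_deriv[OF powr_derivative[OF assms]])

text \<open>At \<open>r = 0\<close> the factor \<open>r\<close> removes whatever value
  \<open>deriv\<close> takes there, so the formula reaches vacuum.\<close>

lemma pressure_powr:
  fixes r \<gamma> :: real
  assumes "0 \<le> r"
  shows "pressure (\<lambda>s. s powr \<gamma>) r = (\<gamma> - 1) * r powr \<gamma>"
proof (cases "r = 0")
  case False
  then have "r * r powr (\<gamma> - 1) = r powr \<gamma>"
    using assms by (simp add: powr_diff)
  then show ?thesis
    using assms False by (simp add: pressure_def deriv_powr algebra_simps)
qed (simp add: pressure_def)

lemma rel_enthalpy_powr:
  fixes r s \<gamma> :: real
  assumes "0 < s"
  shows "rel_enthalpy (\<lambda>s. s powr \<gamma>) r s = r powr \<gamma> - s powr \<gamma> - \<gamma> * s powr (\<gamma> - 1) * (r - s)"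
  using assms by (simp add: rel_enthalpy_def deriv_powr)

text \<open>A convex function lies above its tangents. Convexity is used on the open half-line,
  where both derivatives are available; the vacuum value is computed directly as
  \<open>(\<gamma> - 1) * s powr \<gamma>\<close>.\<close>

lemma rel_enthalpy_nonneg:
  fixes r s \<gamma> :: real
  assumes \<gamma>: "1 < \<gamma>" and r: "0 \<le> r" and s: "0 < s"
  shows "0 \<le> rel_enthalpy (\<lambda>s. s powr \<gamma>) r s"
proof (cases "r = 0")
  case True
  have "s powr (\<gamma> - 1) * s = s powr \<gamma>" using s by (simp add: powr_diff)
  then have "rel_enthalpy (\<lambda>s. s powr \<gamma>) r s = (\<gamma> - 1) * s powr \<gamma>"
    using True s by (simp add: rel_enthalpy_powr algebra_simps)
  then show ?thesis using \<gamma> by simp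
next
  case False
  then have r: "0 < r" using r by simp
  have "convex_on {0<..} (\<lambda>s. s powr \<gamma>)"
  proof (rule f''_ge0_imp_convex)
    show "((\<lambda>s. s powr \<gamma>) has_real_derivative \<gamma> * x powr (\<gamma> - 1)) (at x)" if "x \<in> {0<..}" for x :: real
      using that by (simp add: powr_derivative)
    show "((\<lambda>x. \<gamma> * x powr (\<gamma> - 1)) has_real_derivative \<gamma> * ((\<gamma> - 1) * x powr (\<gamma> - 1 - 1))) (at x)"
      if "x \<in> {0<..}" for x :: real
      using that by (intro DERIV_cmult powr_derivative) simp
  qed (use \<gamma> in auto)
  then have "r powr \<gamma> - s powr \<gamma> \<ge> \<gamma> * s powr (\<gamma> - 1) * (r - s)"
    by (rule convex_on_imp_above_tangent[where A = "{0<..}"])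
      (use r s in \<open>auto simp: interior_open intro: has_field_derivative_at_within powr_derivative\<close>)
  then show ?thesis using s by (simp add: rel_enthalpy_powr)
qed

lemma outer_inner:
  fixes a b :: "real ^ 'n"
  shows "outer a b \<bullet> M = a \<bullet> (M *v b)"
  unfolding inner_matrix_sum by (simp add: inner_vec_def outer_def mult_ac)

lemma outer_quotient_inner:
  fixes m :: "real ^ 'n"
  shows "(outer m m /\<^sub>R r) \<bullet> M = (m \<bullet> (M *v m)) / r"
  unfolding inner_scaleR_left outer_inner divide_inverse by (rule mult.commute)

text \<open>In vacuum \<open>m = 0\<close> and the quotient is 0 by convention, so both sides vanish
  there.\<close>

lemma kinetic_expand:
  fixes v U m :: "real ^ 'n"
  assumes "m = r *\<^sub>R v"
  shows "r * (norm (v - U))\<^sup>2 = (norm m)\<^sup>2 / r - 2 * (m \<bullet> U) + r * (norm U)\<^sup>2"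
  unfolding assms dot_square_norm[symmetric]
  by (cases "r = 0") (simp_all add: inner_diff_left inner_diff_right inner_commute algebra_simps)

context smooth_state
begin

lemma mat_inner_J: "mat 1 \<bullet> J x = d x"
proof -
  have "mat 1 \<bullet> J x = (\<Sum>i\<in>UNIV. \<Sum>j\<in>UNIV. (if i = j then 1 else 0) * (J x $ i $ j))"
    by (simp add: inner_vec_def mat_def)
  also have "\<dots> = (\<Sum>i\<in>UNIV. J x $ i $ i)"
    by (intro sum.cong refl) (simp add: of_bool_def[symmetric])
  finally show ?thesis by (simp add: J_nth div_vec_def)
qed

lemma stress_inner_J:
  "stress h (\<lambda>_. k) \<epsilon> r g q \<bullet> J x
    = (- pressure h r - \<epsilon> * k / 2 * (norm g)\<^sup>2 + \<epsilon> * q) * d x - \<epsilon> * k * (g \<bullet> (J x *v g))"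
  by (simp add: stress_def inner_diff_left mat_inner_J outer_inner)

lemma classical_weak_gradient:
  assumes "C1p \<phi>"
  shows "(LINT x|tor. P x * pd i \<phi> x) = - (LINT x|tor. \<phi> x * pd i P x)"
proof -
  have "(LINT x|tor. pd i (\<lambda>x. P x * \<phi> x) x) = 0"
    by (rule integral_pd_zero[OF C1p_mult[OF C1p_P(1) assms]])
  then have "(LINT x|tor. P x * pd i \<phi> x + pd i P x * \<phi> x) = 0"
    by (simp add: pd_mult[OF C1pD(2)[OF C1p_P(1)] C1pD(2)[OF assms]])
  moreover have "integrable tor (\<lambda>x. P x * pd i \<phi> x)" "integrable tor (\<lambda>x. pd i P x * \<phi> x)"
    using continuous_on_subset[OF C1pD(3)[OF assms] subset_UNIV]
    by (auto intro!: continuous_imp_integrable_tor continuous_on_mult intro: cont_cell C1p_P assms)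
  ultimately show ?thesis by (simp add: mult.commute)
qed

text \<open>The Euler part of the rate of change. The kinetic terms complete to the quadratic form
  of \<open>J x\<close> in \<open>v - U x\<close>, the pressure terms assemble to the relative
  enthalpy, and the last bracket is the divergence covered by
  \<open>pressure_div_identity\<close>.\<close>

lemma euler_pointwise:
  assumes m: "m = r *\<^sub>R v" and r: "0 \<le> r"
  shows "- ((m \<bullet> (J x *v m)) / r) - pressure (\<lambda>s. s powr \<gamma>) r * d x + m \<bullet> (U x v* J x + J x *v U x)
      + r * ((\<gamma> - 1) * (\<gamma> * P x powr (\<gamma> - 1)) * d x - U x \<bullet> (J x *v U x))
      - (\<gamma> - 1) * (\<gamma> * P x powr (\<gamma> - 1)) * (U x \<bullet> grad P x + P x * d x)
    = - (r * ((v - U x) \<bullet> (J x *v (v - U x)))) - (\<gamma> - 1) * rel_enthalpy (\<lambda>s. s powr \<gamma>) r (P x) * d x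
      - ((\<gamma> - 1) * P x powr \<gamma> * d x + (\<gamma> - 1) * (\<gamma> * P x powr (\<gamma> - 1)) * (grad P x \<bullet> U x))"
proof -
  have 1: "(m \<bullet> (J x *v m)) / r = r * (v \<bullet> (J x *v v))"
    using m by (simp add: scaleR_matrix_vector_assoc[symmetric] matrix_vector_mult_scaleR)
  have 2: "m \<bullet> (U x v* J x + J x *v U x) = r * (U x \<bullet> (J x *v v)) + r * (v \<bullet> (J x *v U x))"
    using m by (simp add: inner_add_right inner_commute[of v "U x v* J x"] dot_lmul_matrix distrib_left)
  have 3: "r * ((v - U x) \<bullet> (J x *v (v - U x)))
    = r * (v \<bullet> (J x *v v)) - r * (U x \<bullet> (J x *v v)) - r * (v \<bullet> (J x *v U x)) + r * (U x \<bullet> (J x *v U x))"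
    by (simp add: matrix_vector_mult_diff_distrib inner_diff_left inner_diff_right algebra_simps)
  show ?thesis
    unfolding 1 2 3 pressure_powr[OF r] rel_enthalpy_powr[OF P_pos] inner_commute[of "grad P x" "U x"]
    by (simp add: algebra_simps)
qed

text \<open>The capillary part, divided by \<open>\<epsilon> * k\<close>. Completing squares around
  \<open>grad P x\<close> leaves terms quadratic in the differences, one term linear in
  \<open>v - U x\<close>, and the integrands of the two Korteweg identities. The term
  \<open>r * (g \<bullet> grad d x)\<close> is what the weak divergence in the stress becomes when
  tested with \<open>d\<close>.\<close>

lemma korteweg_pointwise:
  assumes m: "m = r *\<^sub>R v"
  shows "- (norm g)\<^sup>2 / 2 * d x - g \<bullet> (J x *v g) - r * (g \<bullet> grad d x) + m \<bullet> grad (lap P) x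
      + (g - grad P x) \<bullet> grad (div_vec (\<lambda>y. P y *\<^sub>R U y)) x
    = r * ((v - U x) \<bullet> grad (lap P) x)
      - ((norm (g - grad P x))\<^sup>2 / 2 * d x + (g - grad P x) \<bullet> (J x *v (g - grad P x)) + (r - P x) * ((g - grad P x) \<bullet> grad d x))
      + (r * (U x \<bullet> grad (lap P) x - grad P x \<bullet> grad d x) + g \<bullet> (hess P x *v U x - J x *v grad P x))
      - ((grad P x \<bullet> grad P x) * d x / 2 + grad P x \<bullet> (hess P x *v U x))"
  unfolding grad_div_PU m dot_square_norm[symmetric]
  by (simp add: matrix_vector_mult_diff_distrib inner_diff_left inner_diff_right inner_commute algebra_simps)
    (simp add: field_simps)

text \<open>All contributions to the rate of change of the relative energy at one instant:
  \<open>N\<close> is the momentum flux minus stress tested with \<open>U\<close>, while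
  \<open>S1\<close>, \<open>S2\<close>, \<open>S3\<close> and \<open>Z\<close> stem from the motion
  of the classical fields. Time does not occur, since the Euler equations express that motion by
  spatial derivatives.\<close>

lemma relative_energy_static:
  fixes r q :: "real ^ 'n \<Rightarrow> real" and v m g :: "real ^ 'n \<Rightarrow> real ^ 'n" and \<gamma> \<epsilon> k K :: real
  defines "h \<equiv> \<lambda>s::real. s powr \<gamma>"
  defines "N \<equiv> \<lambda>x. (outer (m x) (m x) /\<^sub>R r x) \<bullet> J x - stress h (\<lambda>_. k) \<epsilon> (r x) (g x) (q x) \<bullet> J x"
  defines "S1 \<equiv> \<lambda>x. U x v* J x + J x *v U x + (\<epsilon> * k) *\<^sub>R grad (lap P) x"
  defines "S2 \<equiv> \<lambda>x. (\<gamma> - 1) * (\<gamma> * P x powr (\<gamma> - 1)) * d x - U x \<bullet> (J x *v U x)"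
  defines "S3 \<equiv> \<lambda>x. - ((\<gamma> - 1) * (\<gamma> * P x powr (\<gamma> - 1)) * (U x \<bullet> grad P x + P x * d x))"
  defines "Z \<equiv> grad (div_vec (\<lambda>y. P y *\<^sub>R U y))"
  assumes \<gamma>: "1 < \<gamma>" and \<epsilon>: "0 < \<epsilon>" and k: "0 < k" and K: "0 \<le> K"
    and KJ: "\<And>x w. x \<in> torus_cell \<Longrightarrow> \<bar>w \<bullet> (J x *v w)\<bar> \<le> K * (norm w)\<^sup>2"
    and Kd: "\<And>x. x \<in> torus_cell \<Longrightarrow> \<bar>d x\<bar> \<le> K"
    and KD: "\<And>x. x \<in> torus_cell \<Longrightarrow> norm (grad d x) \<le> K"
    and KB: "\<And>x. x \<in> torus_cell \<Longrightarrow> norm (grad (lap P) x) \<le> K"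
    and m: "m = (\<lambda>x. r x *\<^sub>R v x)"
    and r0: "AE x in tor. 0 \<le> r x" and ri: "integrable tor r" and mi: "integrable tor m"
    and kin: "integrable tor (\<lambda>x. (norm (m x))\<^sup>2 / r x)" and hi: "integrable tor (\<lambda>x. r x powr \<gamma>)"
    and gi: "integrable tor g" and g2: "integrable tor (\<lambda>x. (norm (g x))\<^sup>2)"
    and weak: "\<And>\<phi> i. C1p \<phi> \<Longrightarrow> (LINT x|tor. r x * pd i \<phi> x) = - (LINT x|tor. \<phi> x * g x $ i)"
    and Fi: "integrable tor (\<lambda>x. (r x * k) *\<^sub>R g x)" and qi: "integrable tor q"
    and wdiv: "\<And>\<phi>. C1p \<phi> \<Longrightarrow> (LINT x|tor. ((r x * k) *\<^sub>R g x) \<bullet> grad \<phi> x) = - (LINT x|tor. \<phi> x * q x)"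
    and mean: "(LINT x|tor. r x) = (LINT x|tor. P x)" and Ni: "integrable tor N"
  shows "integrable tor (\<lambda>x. rel_enthalpy h (r x) (P x))" (is ?th1)
    and "integrable tor (\<lambda>x. r x * (norm (v x - U x))\<^sup>2)" (is ?th2)
    and "integrable tor (\<lambda>x. (norm (g x - grad P x))\<^sup>2)" (is ?th3)
    and "- (LINT x|tor. N x) + ((LINT x|tor. m x \<bullet> S1 x) + (LINT x|tor. r x * S2 x)
        + \<epsilon> * k * (LINT x|tor. (g x - grad P x) \<bullet> Z x) + (LINT x|tor. S3 x))
      \<le> (2 * K + 1 + (\<gamma> - 1) * K + 4 * K + K * (real CARD('n))\<^sup>2) *
          (LINT x|tor. rel_enthalpy h (r x) (P x) + r x / 2 * (norm (v x - U x))\<^sup>2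
            + \<epsilon> * k / 2 * (norm (g x - grad P x))\<^sup>2)
        + K\<^sup>2 * k\<^sup>2 / 2 * (LINT x|tor. P x) * \<epsilon>\<^sup>2" (is ?th4)
proof -
  note cP = cont_cell[OF C1p_P(1)] and cU = cont_cell[OF C1p_U(1)] and cd = cont_cell[OF C1p_d]
  note cG = grad_continuous[OF C1p_P(1)] and cD = grad_continuous[OF C1p_d] and cB = grad_continuous[OF C1p_lap]
  have cZ: "continuous_on torus_cell Z" unfolding Z_def by (rule grad_continuous[OF C1p_div_PU])
  have cpw: "continuous_on torus_cell (\<lambda>x. P x powr a)" for a
    by (intro continuous_on_powr continuous_on_const cP) (metis P_pos less_irrefl)
  have PU: "P x \<noteq> 0" for x using P_pos[of x] by simp
  have cJU: "continuous_on torus_cell (\<lambda>x. J x *v U x)"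
    by (rule matvec_continuous[OF J_continuous cU])
  have cUJ: "continuous_on torus_cell (\<lambda>x. U x v* J x)"
    unfolding vector_matrix_mult_def
    by (intro continuous_intros continuous_on_vec_lambda J_continuous cU)
  have cS1: "continuous_on torus_cell S1" unfolding S1_def by (intro continuous_intros cUJ cJU cB)
  have cS2: "continuous_on torus_cell S2" unfolding S2_def by (intro continuous_intros cpw cd cU cJU)
  have cS3: "continuous_on torus_cell S3" unfolding S3_def by (intro continuous_intros cpw cd cU cG cP)
  note [measurable] = borel_measurable_integrable[OF ri] borel_measurable_integrable[OF mi] borel_measurable_integrable[OF gi]
    continuous_imp_measurable_tor[OF cd]
  have re: "rel_enthalpy h (r x) (P x) = r x powr \<gamma> - P x powr \<gamma> - \<gamma> * P x powr (\<gamma> - 1) * (r x - P x)" for x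
    unfolding h_def by (rule rel_enthalpy_powr[OF P_pos])
  have ci: "integrable tor f" if "continuous_on torus_cell f" for f :: "real ^ 'n \<Rightarrow> real"
    by (rule continuous_imp_integrable_tor[OF that])
  have "integrable tor (\<lambda>x. (r x - P x) * (\<gamma> * P x powr (\<gamma> - 1)))"
    by (intro integrable_bounded_mult Bochner_Integration.integrable_diff ri ci cP continuous_intros cpw)
  then have "integrable tor (\<lambda>x. \<gamma> * P x powr (\<gamma> - 1) * (r x - P x))" by (simp only: mult.commute)
  then show th1: ?th1
    unfolding re by (rule Bochner_Integration.integrable_diff[OF Bochner_Integration.integrable_diff[OF hi ci[OF cpw]]])
  have ke: "r x * (norm (v x - U x))\<^sup>2 = (norm (m x))\<^sup>2 / r x - 2 * (m x \<bullet> U x) + r x * (norm (U x))\<^sup>2" for x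
    by (rule kinetic_expand) (simp add: m)
  show th2: ?th2
    unfolding ke
    by (intro Bochner_Integration.integrable_add Bochner_Integration.integrable_diff kin integrable_mult_right
        integrable_bounded_inner[OF mi cU] integrable_bounded_mult ri continuous_intros cU)
  have ge: "(norm (g x - grad P x))\<^sup>2 = (norm (g x))\<^sup>2 - 2 * (g x \<bullet> grad P x) + (norm (grad P x))\<^sup>2" for x
    unfolding dot_square_norm[symmetric] by (simp add: inner_diff_left inner_diff_right inner_commute algebra_simps)
  show th3: ?th3
    unfolding ge
    by (intro Bochner_Integration.integrable_add Bochner_Integration.integrable_diff g2 integrable_mult_right
        integrable_bounded_inner[OF gi cG] ci continuous_intros cG)
  define H where "H x = rel_enthalpy h (r x) (P x) + r x / 2 * (norm (v x - U x))\<^sup>2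
            + \<epsilon> * k / 2 * (norm (g x - grad P x))\<^sup>2" for x
  have Hi: "integrable tor H"
  proof -
    have "integrable tor (\<lambda>x. rel_enthalpy h (r x) (P x) + 1 / 2 * (r x * (norm (v x - U x))\<^sup>2)
            + \<epsilon> * k / 2 * (norm (g x - grad P x))\<^sup>2)"
      by (intro Bochner_Integration.integrable_add integrable_mult_right th1 th2 th3)
    then show ?thesis by (simp add: H_def[abs_def])
  qed
  have fi: "integrable tor (\<lambda>x. r x - P x)" by (intro Bochner_Integration.integrable_diff ri ci cP)
  have cGi: "integrable tor (grad P)" by (rule continuous_imp_integrable_tor[OF cG])
  have wi: "integrable tor (\<lambda>x. g x - grad P x)" by (intro Bochner_Integration.integrable_diff gi cGi)
  have wweak: "(LINT x|tor. (r x - P x) * pd i \<phi> x) = - (LINT x|tor. \<phi> x * (g x - grad P x) $ i)"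
    if \<phi>: "C1p \<phi>" for \<phi> i
  proof -
    have c: "continuous_on torus_cell (pd i \<phi>)" using C1pD(3)[OF \<phi>] continuous_on_subset by blast
    have "integrable tor (\<lambda>x. g x $ i)"
      using integrable_bounded_inner[OF gi continuous_on_const[of _ "axis i 1"]] by (simp add: inner_axis)
    from integrable_bounded_mult[OF this cont_cell[OF \<phi>]]
    have g': "integrable tor (\<lambda>x. \<phi> x * g x $ i)" by (simp add: mult.commute)
    have P': "integrable tor (\<lambda>x. \<phi> x * pd i P x)"
      by (intro ci continuous_intros cont_cell C1p_P \<phi>)
    have "(LINT x|tor. (r x - P x) * pd i \<phi> x) = (LINT x|tor. r x * pd i \<phi> x) - (LINT x|tor. P x * pd i \<phi> x)"
      by (simp add: left_diff_distrib integrable_bounded_mult[OF ri c] integrable_bounded_mult[OF ci[OF cP] c])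
    also have "\<dots> = - (LINT x|tor. \<phi> x * g x $ i) + (LINT x|tor. \<phi> x * pd i P x)"
      by (simp add: weak[OF \<phi>] classical_weak_gradient[OF \<phi>])
    also have "\<dots> = - (LINT x|tor. \<phi> x * (g x - grad P x) $ i)"
      by (simp add: right_diff_distrib grad_def g' P')
    finally show ?thesis .
  qed
  have mean0: "(LINT x|tor. r x - P x) = 0" using mean ri ci[OF cP] by simp
  \<comment> \<open>Both masses agree, so \<open>r x - P x\<close> has mean zero, and
    \<open>g x - grad P x\<close> is its weak gradient.\<close>
  have poin: "integrable tor (\<lambda>x. (r x - P x)\<^sup>2)"
    "(LINT x|tor. (r x - P x)\<^sup>2) \<le> (real CARD('n))\<^sup>2 * (LINT x|tor. (norm (g x - grad P x))\<^sup>2)"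
    using poincare[OF fi wi th3 wweak mean0] by blast+
  define W where "W = (LINT x|tor. (norm (g x - grad P x))\<^sup>2)"
  define V where "V = (LINT x|tor. r x * (norm (v x - U x))\<^sup>2)"
  define Q where "Q = (LINT x|tor. rel_enthalpy h (r x) (P x))"
  have W0: "0 \<le> W" by (simp add: W_def)
  have V0: "0 \<le> V" unfolding V_def by (rule integral_nonneg_AE) (use r0 in \<open>eventually_elim; simp\<close>)
  have re0: "AE x in tor. 0 \<le> rel_enthalpy h (r x) (P x)"
    using r0 by eventually_elim (simp add: h_def rel_enthalpy_nonneg \<gamma> P_pos)
  have Q0: "0 \<le> Q" unfolding Q_def by (rule integral_nonneg_AE[OF re0])
  have HI: "(LINT x|tor. H x) = Q + V / 2 + \<epsilon> * k / 2 * W"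
  proof -
    have "(LINT x|tor. H x) = (LINT x|tor. rel_enthalpy h (r x) (P x) + 1 / 2 * (r x * (norm (v x - U x))\<^sup>2)
            + \<epsilon> * k / 2 * (norm (g x - grad P x))\<^sup>2)" by (simp add: H_def)
    also have "\<dots> = Q + 1/2 * V + \<epsilon> * k / 2 * W"
      unfolding Q_def V_def W_def using th1 th2 th3 by simp
    finally show ?thesis by simp
  qed
  have JJ: "(outer (m x) (m x) /\<^sub>R r x) \<bullet> J x = (m x \<bullet> (J x *v m x)) / r x" for x
    by (rule outer_quotient_inner)
  have Ne: "N x = (m x \<bullet> (J x *v m x)) / r x + pressure h (r x) * d x + \<epsilon> * k * ((norm (g x))\<^sup>2 / 2 * d x)
      - \<epsilon> * (q x * d x) + \<epsilon> * k * (g x \<bullet> (J x *v g x))" for x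
    unfolding N_def JJ stress_inner_J by (simp add: algebra_simps)
  define T where "T x = - N x + m x \<bullet> S1 x + r x * S2 x + \<epsilon> * k * ((g x - grad P x) \<bullet> Z x) + S3 x" for x
  have mS1: "integrable tor (\<lambda>x. m x \<bullet> S1 x)" by (rule integrable_bounded_inner[OF mi cS1])
  have rS2: "integrable tor (\<lambda>x. r x * S2 x)" by (rule integrable_bounded_mult[OF ri cS2])
  have wZ: "integrable tor (\<lambda>x. (g x - grad P x) \<bullet> Z x)" by (rule integrable_bounded_inner[OF wi cZ])
  have Ti: "integrable tor T"
    unfolding T_def[abs_def]
    by (intro Bochner_Integration.integrable_add integrable_minus Ni mS1 rS2 wZ integrable_mult_right ci cS3)
  have TI: "(LINT x|tor. T x) = - (LINT x|tor. N x) + ((LINT x|tor. m x \<bullet> S1 x) + (LINT x|tor. r x * S2 x)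
        + \<epsilon> * k * (LINT x|tor. (g x - grad P x) \<bullet> Z x) + (LINT x|tor. S3 x))"
    unfolding T_def using Ni mS1 rS2 wZ ci[OF cS3] by simp
  \<comment> \<open>Four integrands with integral 0: the two Korteweg identities, the divergence of
    the pressure flux, and the weak divergence of the capillary flux tested with \<open>d\<close>.
    Subtracting their combination \<open>br\<close> changes no integral and leaves the expressions
    of \<open>euler_pointwise\<close> and \<open>korteweg_pointwise\<close>.\<close>
  define t1 where "t1 x = r x * (U x \<bullet> grad (lap P) x - grad P x \<bullet> grad d x) + g x \<bullet> (hess P x *v U x - J x *v grad P x)" for x
  define t2 where "t2 x = (grad P x \<bullet> grad P x) * d x / 2 + grad P x \<bullet> (hess P x *v U x)" for x
  define t3 where "t3 x = (\<gamma> - 1) * P x powr \<gamma> * d x + (\<gamma> - 1) * (\<gamma> * P x powr (\<gamma> - 1)) * (grad P x \<bullet> U x)" for x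
  define t4 where "t4 x = q x * d x + ((r x * k) *\<^sub>R g x) \<bullet> grad d x" for x
  have chU: "continuous_on torus_cell (\<lambda>x. hess P x *v U x)"
    by (rule matvec_continuous[OF hess_continuous cU])
  have t1: "integrable tor t1" "(LINT x|tor. t1 x) = 0"
    unfolding t1_def[abs_def]
    by (intro Bochner_Integration.integrable_add integrable_bounded_mult[OF ri] integrable_bounded_inner[OF gi]
        continuous_intros cU cB cG cD chU matvec_continuous J_continuous)
      (rule korteweg_cross_identity[OF gi ri weak])
  have t2: "integrable tor t2" "(LINT x|tor. t2 x) = 0"
    unfolding t2_def[abs_def]
    by (intro ci continuous_intros cG cd chU) (simp, rule korteweg_quadratic_identity)
  have t3: "integrable tor t3" "(LINT x|tor. t3 x) = 0"
    unfolding t3_def[abs_def]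
  proof -
    show "integrable tor (\<lambda>x. (\<gamma> - 1) * P x powr \<gamma> * d x + (\<gamma> - 1) * (\<gamma> * P x powr (\<gamma> - 1)) * (grad P x \<bullet> U x))"
      by (intro ci continuous_intros cpw cd cG cU)
    show "(LINT x|tor. (\<gamma> - 1) * P x powr \<gamma> * d x + (\<gamma> - 1) * (\<gamma> * P x powr (\<gamma> - 1)) * (grad P x \<bullet> U x)) = 0"
      by (rule pressure_div_identity[where p = "\<lambda>s. (\<gamma> - 1) * s powr \<gamma>" and p' = "\<lambda>s. (\<gamma> - 1) * (\<gamma> * s powr (\<gamma> - 1))"])
        (auto intro!: DERIV_cmult powr_derivative continuous_intros)
  qed
  have t4: "integrable tor t4" "(LINT x|tor. t4 x) = 0"
  proof -
    have a: "integrable tor (\<lambda>x. q x * d x)" by (rule integrable_bounded_mult[OF qi cd])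
    have b: "integrable tor (\<lambda>x. ((r x * k) *\<^sub>R g x) \<bullet> grad d x)" by (rule integrable_bounded_inner[OF Fi cD])
    show "integrable tor t4" unfolding t4_def[abs_def] by (rule Bochner_Integration.integrable_add[OF a b])
    show "(LINT x|tor. t4 x) = 0"
      unfolding t4_def Bochner_Integration.integral_add[OF a b] wdiv[OF C1p_d] by (simp add: mult.commute)
  qed
  define br where "br x = \<epsilon> * k * t1 x - \<epsilon> * k * t2 x - t3 x + \<epsilon> * t4 x" for x
  have br: "integrable tor br" "(LINT x|tor. br x) = 0"
    unfolding br_def[abs_def] using t1 t2 t3 t4 by simp_all
  have T_br: "T x - br x = - (r x * ((v x - U x) \<bullet> (J x *v (v x - U x)))) - (\<gamma> - 1) * rel_enthalpy h (r x) (P x) * d x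
      + \<epsilon> * k * (r x * ((v x - U x) \<bullet> grad (lap P) x)
       - ((norm (g x - grad P x))\<^sup>2 / 2 * d x + (g x - grad P x) \<bullet> (J x *v (g x - grad P x))
          + (r x - P x) * ((g x - grad P x) \<bullet> grad d x)))" if "0 \<le> r x" for x
  proof -
    have mx: "m x = r x *\<^sub>R v x" by (simp add: m)
    have "T x = (- ((m x \<bullet> (J x *v m x)) / r x) - pressure h (r x) * d x + m x \<bullet> (U x v* J x + J x *v U x)
        + r x * ((\<gamma> - 1) * (\<gamma> * P x powr (\<gamma> - 1)) * d x - U x \<bullet> (J x *v U x))
        - (\<gamma> - 1) * (\<gamma> * P x powr (\<gamma> - 1)) * (U x \<bullet> grad P x + P x * d x))
      + \<epsilon> * k * (- (norm (g x))\<^sup>2 / 2 * d x - g x \<bullet> (J x *v g x) - r x * (g x \<bullet> grad d x) + m x \<bullet> grad (lap P) x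
          + (g x - grad P x) \<bullet> grad (div_vec (\<lambda>y. P y *\<^sub>R U y)) x) + \<epsilon> * t4 x"
      unfolding T_def Ne S1_def S2_def S3_def Z_def t4_def
      by (simp add: inner_add_right distrib_left right_diff_distrib)
    also have "\<dots> = - (r x * ((v x - U x) \<bullet> (J x *v (v x - U x)))) - (\<gamma> - 1) * rel_enthalpy h (r x) (P x) * d x
      - t3 x + \<epsilon> * k * (r x * ((v x - U x) \<bullet> grad (lap P) x)
       - ((norm (g x - grad P x))\<^sup>2 / 2 * d x + (g x - grad P x) \<bullet> (J x *v (g x - grad P x))
          + (r x - P x) * ((g x - grad P x) \<bullet> grad d x)) + t1 x - t2 x) + \<epsilon> * t4 x"
      unfolding euler_pointwise[OF mx that, where \<gamma> = \<gamma>, folded h_def] korteweg_pointwise[OF mx] t1_def t2_def t3_def by simp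
    finally show ?thesis by (simp add: br_def algebra_simps)
  qed
  \<comment> \<open>\<open>K + 1/2\<close> is the velocity gradient plus Young's share of the linear
    term. \<open>2 * K\<close> is \<open>K / 2\<close> from the divergence, \<open>K\<close> from
    the quadratic form and \<open>K / 2\<close> from the product with \<open>r x - P x\<close>,
    whose other half is the last term.\<close>
  define Bd where "Bd x = (K + 1/2) * (r x * (norm (v x - U x))\<^sup>2) + (\<gamma> - 1) * K * rel_enthalpy h (r x) (P x)
     + (\<epsilon> * k * K)\<^sup>2 / 2 * r x + \<epsilon> * k * (2 * K * (norm (g x - grad P x))\<^sup>2 + K / 2 * (r x - P x)\<^sup>2)" for x
  have Bdi: "integrable tor Bd"
    unfolding Bd_def[abs_def]
    by (intro Bochner_Integration.integrable_add integrable_mult_right th1 th2 th3 ri poin(1))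
  have le: "AE x in tor. T x - br x \<le> Bd x"
  proof -
    have pt: "T x - br x \<le> Bd x" if r: "0 \<le> r x" "0 \<le> rel_enthalpy h (r x) (P x)" and x: "x \<in> torus_cell" for x
    proof -
      let ?y = "v x - U x" and ?w = "g x - grad P x" and ?f = "r x - P x"
      have 1: "- (r x * (?y \<bullet> (J x *v ?y))) \<le> K * (r x * (norm ?y)\<^sup>2)"
      proof -
        have "r x * (- (?y \<bullet> (J x *v ?y))) \<le> r x * (K * (norm ?y)\<^sup>2)"
          by (rule mult_left_mono) (use KJ[OF x, of ?y] r(1) in linarith)+
        then show ?thesis by (simp only: mult_minus_right mult.left_commute)
      qed
      have 2: "- ((\<gamma> - 1) * rel_enthalpy h (r x) (P x) * d x) \<le> (\<gamma> - 1) * K * rel_enthalpy h (r x) (P x)"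
      proof -
        have "(\<gamma> - 1) * rel_enthalpy h (r x) (P x) * (- d x) \<le> (\<gamma> - 1) * rel_enthalpy h (r x) (P x) * K"
          using Kd[OF x] r \<gamma> by (intro mult_left_mono) auto
        then show ?thesis by (simp only: mult_minus_right mult.assoc mult.commute[of K])
      qed
      \<comment> \<open>The only term linear in the differences. Young's inequality puts the whole
        factor \<open>\<epsilon> * k * K\<close> into the second square, so the source is of order
        \<open>\<epsilon>\<^sup>2\<close> and the kinetic part carries no negative power of
        \<epsilon>.\<close>
      have 3: "\<epsilon> * k * (r x * (?y \<bullet> grad (lap P) x)) \<le> 1/2 * (r x * (norm ?y)\<^sup>2) + (\<epsilon> * k * K)\<^sup>2 / 2 * r x"
      proof -
        have "?y \<bullet> grad (lap P) x \<le> norm ?y * norm (grad (lap P) x)" by (rule norm_cauchy_schwarz)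
        also have "\<dots> \<le> norm ?y * K" by (intro mult_left_mono KB x) simp
        finally have "\<epsilon> * k * (?y \<bullet> grad (lap P) x) \<le> \<epsilon> * k * (norm ?y * K)"
          using \<epsilon> k by (intro mult_left_mono) auto
        also have "\<dots> \<le> ((norm ?y)\<^sup>2 + (\<epsilon> * k * K)\<^sup>2) / 2"
          using sum_squares_bound[of "norm ?y" "\<epsilon> * k * K"] by (simp add: mult_ac)
        finally have "r x * (\<epsilon> * k * (?y \<bullet> grad (lap P) x)) \<le> r x * (((norm ?y)\<^sup>2 + (\<epsilon> * k * K)\<^sup>2) / 2)"
          using r(1) by (intro mult_left_mono) auto
        then show ?thesis by (simp add: field_simps)
      qed
      have 4: "- ((norm ?w)\<^sup>2 / 2 * d x) \<le> K / 2 * (norm ?w)\<^sup>2"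
      proof -
        have "(norm ?w)\<^sup>2 / 2 * (- d x) \<le> (norm ?w)\<^sup>2 / 2 * K"
          using Kd[OF x] by (intro mult_left_mono) auto
        then show ?thesis by (simp add: mult_ac)
      qed
      have 5: "- (?w \<bullet> (J x *v ?w)) \<le> K * (norm ?w)\<^sup>2" using KJ[OF x, of ?w] by linarith
      have 6: "- (?f * (?w \<bullet> grad d x)) \<le> K / 2 * ?f\<^sup>2 + K / 2 * (norm ?w)\<^sup>2"
      proof -
        have "\<bar>?w \<bullet> grad d x\<bar> \<le> norm ?w * norm (grad d x)" by (rule Cauchy_Schwarz_ineq2)
        also have "\<dots> \<le> norm ?w * K" by (intro mult_left_mono KD x) simp
        finally have "\<bar>?f\<bar> * \<bar>?w \<bullet> grad d x\<bar> \<le> \<bar>?f\<bar> * (norm ?w * K)" by (intro mult_left_mono) auto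
        also have "\<dots> = K * (\<bar>?f\<bar> * norm ?w)" by simp
        also have "\<dots> \<le> K * ((?f\<^sup>2 + (norm ?w)\<^sup>2) / 2)"
          using sum_squares_bound[of "\<bar>?f\<bar>" "norm ?w"] K by (intro mult_left_mono) auto
        finally have "\<bar>?f * (?w \<bullet> grad d x)\<bar> \<le> K * ((?f\<^sup>2 + (norm ?w)\<^sup>2) / 2)" by (simp add: abs_mult)
        then have "- (?f * (?w \<bullet> grad d x)) \<le> K * ((?f\<^sup>2 + (norm ?w)\<^sup>2) / 2)" by linarith
        then show ?thesis by (simp add: field_simps)
      qed
      have "- ((norm ?w)\<^sup>2 / 2 * d x + ?w \<bullet> (J x *v ?w) + ?f * (?w \<bullet> grad d x)) \<le> 2 * K * (norm ?w)\<^sup>2 + K / 2 * ?f\<^sup>2"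
        using 4 5 6 by linarith
      then have "\<epsilon> * k * (- ((norm ?w)\<^sup>2 / 2 * d x + ?w \<bullet> (J x *v ?w) + ?f * (?w \<bullet> grad d x)))
         \<le> \<epsilon> * k * (2 * K * (norm ?w)\<^sup>2 + K / 2 * ?f\<^sup>2)"
        using \<epsilon> k by (intro mult_left_mono) auto
      then show ?thesis
        using 1 2 3 unfolding T_br[OF r(1)] Bd_def right_diff_distrib[of "\<epsilon> * k"] distrib_right[of K] by linarith
    qed
    show ?thesis using r0 re0 AE_space by eventually_elim (simp add: pt)
  qed
  have "(LINT x|tor. T x) = (LINT x|tor. T x - br x)" using Ti br by simp
  also have "\<dots> \<le> (LINT x|tor. Bd x)"
    by (intro integral_mono_AE le Bdi Bochner_Integration.integrable_diff Ti br)
  also have "\<dots> = (K + 1/2) * V + (\<gamma> - 1) * K * Q + (\<epsilon> * k * K)\<^sup>2 / 2 * (LINT x|tor. r x)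
      + \<epsilon> * k * (2 * K * W + K / 2 * (LINT x|tor. (r x - P x)\<^sup>2))"
    unfolding Bd_def V_def Q_def W_def using th1 th2 th3 ri poin(1) by simp
  also have "\<dots> \<le> (K + 1/2) * V + (\<gamma> - 1) * K * Q + (\<epsilon> * k * K)\<^sup>2 / 2 * (LINT x|tor. r x)
      + \<epsilon> * k * (2 * K * W + K / 2 * ((real CARD('n))\<^sup>2 * W))"
    using poin(2) K \<epsilon> k by (intro add_left_mono mult_left_mono) (auto simp: W_def)
  also have "\<dots> \<le> (2 * K + 1 + (\<gamma> - 1) * K + 4 * K + K * (real CARD('n))\<^sup>2) * (Q + V / 2 + \<epsilon> * k / 2 * W)
      + (\<epsilon> * k * K)\<^sup>2 / 2 * (LINT x|tor. r x)"
  proof -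
    \<comment> \<open>The constant is a sum of three: \<open>2 * K + 1\<close> serves
      \<open>V / 2\<close>, \<open>(\<gamma> - 1) * K\<close> serves \<open>Q\<close>, and
      \<open>4 * K + K * D\<close> serves \<open>X / 2\<close>. The surplus products are
      nonnegative.\<close>
    define D where "D = (real CARD('n))\<^sup>2"
    define X where "X = \<epsilon> * k * W"
    have X: "0 \<le> X" using \<epsilon> k W0 by (simp add: X_def)
    have D: "0 \<le> D" by (simp add: D_def)
    have "0 \<le> (2 * K + 1 + 4 * K + K * D) * Q + ((\<gamma> - 1) * K + 4 * K + K * D) * (V / 2)
        + (2 * K + 1 + (\<gamma> - 1) * K) * (X / 2)"
      using K \<gamma> D X V0 Q0 by (intro add_nonneg_nonneg mult_nonneg_nonneg) auto
    moreover have "(2 * K + 1 + (\<gamma> - 1) * K + 4 * K + K * D) * (Q + V / 2 + X / 2)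
       - ((K + 1/2) * V + (\<gamma> - 1) * K * Q + (2 * K + K / 2 * D) * X)
       = (2 * K + 1 + 4 * K + K * D) * Q + ((\<gamma> - 1) * K + 4 * K + K * D) * (V / 2)
        + (2 * K + 1 + (\<gamma> - 1) * K) * (X / 2)"
      by (simp add: field_simps)
    ultimately have "(K + 1/2) * V + (\<gamma> - 1) * K * Q + (2 * K + K / 2 * D) * X
       \<le> (2 * K + 1 + (\<gamma> - 1) * K + 4 * K + K * D) * (Q + V / 2 + X / 2)" by linarith
    moreover have "\<epsilon> * k * (2 * K * W + K / 2 * (D * W)) = (2 * K + K / 2 * D) * X"
      by (simp add: X_def algebra_simps)
    moreover have "\<epsilon> * k / 2 * W = X / 2" by (simp add: X_def)
    ultimately show ?thesis unfolding D_def[symmetric] by simp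
  qed
  finally show ?th4
    unfolding TI HI[unfolded H_def] mean by (simp add: power_mult_distrib mult_ac)
qed

end

section \<open>Weak formulations integrated in time\<close>

subsection \<open>A continuously differentiable cut-off in time\<close>

text \<open>A C^1 spline, \<open>1 - 2 * s\<^sup>2\<close> on [0, 1/2] and
  \<open>2 * (1 - s)\<^sup>2\<close> on [1/2, 1], constant outside. Positive parts write it without
  cases. A piecewise linear ramp would be admissible in the energy inequality, but the mass and
  momentum identities accept only test functions that are C^1 in time.\<close>

definition ramp :: "real \<Rightarrow> real" where
  "ramp s = 1 - 2 * (max 0 s)\<^sup>2 + 4 * (max 0 (s - 1/2))\<^sup>2 - 2 * (max 0 (s - 1))\<^sup>2"

definition ramp' :: "real \<Rightarrow> real" where
  "ramp' s = - 4 * max 0 s + 8 * max 0 (s - 1/2) - 4 * max 0 (s - 1)"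

text \<open>At the corner the difference quotient is bounded by \<open>\<bar>y - a\<bar>\<close>, so
  squaring the positive part removes the kink.\<close>

lemma max_square_derivative: "((\<lambda>s. (max 0 (s - a))\<^sup>2) has_real_derivative 2 * max 0 (s - a)) (at (s :: real))"
proof -
  consider "s < a" | "s = a" | "a < s" by linarith
  then show ?thesis
  proof cases
    case 1
    have "((\<lambda>s. 0) has_real_derivative 2 * max 0 (s - a)) (at s)" using 1 by simp
    then show ?thesis
      by (rule has_field_derivative_transform_within_open[where S = "{..<a}"]) (use 1 in auto)
  next
    case 3
    have "((\<lambda>s. (s - a)\<^sup>2) has_real_derivative 2 * max 0 (s - a)) (at s)"
      using 3 by (auto intro!: derivative_eq_intros)
    then show ?thesis
      by (rule has_field_derivative_transform_within_open[where S = "{a<..}"]) (use 3 in auto)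
  next
    case 2
    have "((\<lambda>y. ((max 0 (y - a))\<^sup>2 - (max 0 (a - a))\<^sup>2) / (y - a)) \<longlongrightarrow> 0) (at a)"
    proof (rule Lim_null_comparison)
      show "\<forall>\<^sub>F y in at a. norm (((max 0 (y - a))\<^sup>2 - (max 0 (a - a))\<^sup>2) / (y - a)) \<le> \<bar>y - a\<bar>"
        by (intro always_eventually allI) (auto simp: max_def power2_eq_square)
      show "((\<lambda>y. \<bar>y - a\<bar>) \<longlongrightarrow> 0) (at a)" by (auto intro!: tendsto_eq_intros)
    qed
    then show ?thesis using 2 by (simp add: has_field_derivative_iff)
  qed
qed

lemma ramp_derivative: "(ramp has_real_derivative ramp' s) (at s)"
proof -
  have "((\<lambda>s. 1 - 2 * (max 0 (s - 0))\<^sup>2 + 4 * (max 0 (s - 1/2))\<^sup>2 - 2 * (max 0 (s - 1))\<^sup>2) has_real_derivative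
     0 - 2 * (2 * max 0 (s - 0)) + 4 * (2 * max 0 (s - 1/2)) - 2 * (2 * max 0 (s - 1))) (at s)"
    by (intro DERIV_diff DERIV_add DERIV_cmult DERIV_const max_square_derivative)
  then show ?thesis by (simp add: ramp_def[abs_def] ramp'_def)
qed

lemma continuous_ramp': "continuous_on S ramp'"
  unfolding ramp'_def[abs_def] by (intro continuous_intros)

lemma ramp_simps: "s \<le> 0 \<Longrightarrow> ramp s = 1" "1 \<le> s \<Longrightarrow> ramp s = 0" "s \<le> 0 \<Longrightarrow> ramp' s = 0" "1 \<le> s \<Longrightarrow> ramp' s = 0"
  by (auto simp: ramp_def ramp'_def max_def power2_eq_square algebra_simps)

lemma ramp'_bounds: "ramp' s \<le> 0" "\<bar>ramp' s\<bar> \<le> 2"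
  by (auto simp: ramp'_def max_def)

lemma ramp_bounds: "0 \<le> ramp s" "ramp s \<le> 1"
proof -
  consider "s \<le> 0" | "0 < s" "s \<le> 1/2" | "1/2 < s" "s \<le> 1" | "1 < s" by linarith
  then show "0 \<le> ramp s"
  proof cases
    case 2
    then have "ramp s = 1 - 2 * s\<^sup>2" by (simp add: ramp_def max_def)
    moreover have "s\<^sup>2 \<le> (1/2)\<^sup>2" using 2 by (intro power_mono) auto
    ultimately show ?thesis by (simp add: power2_eq_square)
  next
    case 3
    then have "ramp s = 2 * (1 - s)\<^sup>2" by (simp add: ramp_def max_def power2_eq_square algebra_simps)
    then show ?thesis by simp
  qed (auto simp: ramp_simps)
  show "ramp s \<le> 1"
  proof (cases "s \<le> 0")
    case False
    have "ramp s \<le> ramp 0"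
      by (rule DERIV_nonpos_imp_nonincreasing) (use False ramp_derivative ramp'_bounds(1) in auto)
    then show ?thesis by (simp add: ramp_simps)
  qed (simp add: ramp_simps)
qed

text \<open>Equal to 1 up to \<open>t\<close> and falling to 0 within
  \<open>1 / real (Suc k)\<close>. The fall lies to the right of \<open>t\<close>, so
  \<open>t = 0\<close> is allowed and the value at time 0 is 1 for every \<open>t \<ge> 0\<close>,
  which reproduces the initial datum in the weak identities.\<close>

definition cutoff :: "real \<Rightarrow> nat \<Rightarrow> real \<Rightarrow> real" where
  "cutoff t k s = ramp (real (Suc k) * (s - t))"

definition cutoff' :: "real \<Rightarrow> nat \<Rightarrow> real \<Rightarrow> real" where
  "cutoff' t k s = real (Suc k) * ramp' (real (Suc k) * (s - t))"

lemma cutoff_derivative: "(cutoff t k has_real_derivative cutoff' t k s) (at s)"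
proof -
  have "((\<lambda>s. ramp (real (Suc k) * (s - t))) has_real_derivative ramp' (real (Suc k) * (s - t)) * real (Suc k)) (at s)"
    by (rule DERIV_chain2[OF ramp_derivative]) (auto intro!: derivative_eq_intros)
  then show ?thesis by (simp only: cutoff_def[abs_def] cutoff'_def mult.commute)
qed

lemma continuous_cutoff: "continuous_on S (cutoff t k)" "continuous_on S (cutoff' t k)"
proof -
  show "continuous_on S (cutoff t k)"
    by (rule DERIV_continuous_on, rule has_field_derivative_at_within, rule cutoff_derivative)
  show "continuous_on S (cutoff' t k)" unfolding cutoff'_def[abs_def]
    by (intro continuous_intros continuous_on_compose2[OF continuous_ramp'[of UNIV]]) auto
qed

lemma cutoff_simps:
  "s \<le> t \<Longrightarrow> cutoff t k s = 1" "s \<le> t \<Longrightarrow> cutoff' t k s = 0"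
  "t + 1 / real (Suc k) \<le> s \<Longrightarrow> cutoff t k s = 0" "t + 1 / real (Suc k) \<le> s \<Longrightarrow> cutoff' t k s = 0"
proof -
  have "real (Suc k) * (s - t) \<le> 0" if "s \<le> t" using that by (intro mult_nonneg_nonpos) auto
  then show "s \<le> t \<Longrightarrow> cutoff t k s = 1" "s \<le> t \<Longrightarrow> cutoff' t k s = 0"
    by (simp_all only: cutoff_def cutoff'_def ramp_simps mult_zero_right)
  have "1 \<le> real (Suc k) * (s - t)" if "t + 1 / real (Suc k) \<le> s"
  proof -
    have "real (Suc k) * (1 / real (Suc k)) \<le> real (Suc k) * (s - t)"
      using that by (intro mult_left_mono) linarith+
    then show ?thesis by simp
  qed
  then show "t + 1 / real (Suc k) \<le> s \<Longrightarrow> cutoff t k s = 0" "t + 1 / real (Suc k) \<le> s \<Longrightarrow> cutoff' t k s = 0"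
    by (simp_all only: cutoff_def cutoff'_def ramp_simps mult_zero_right)
qed

lemma cutoff_bounds: "0 \<le> cutoff t k s" "cutoff t k s \<le> 1" "\<bar>cutoff' t k s\<bar> \<le> 2 * real (Suc k)"
  using ramp_bounds ramp'_bounds(2)[of "real (Suc k) * (s - t)"]
  by (auto simp: cutoff_def cutoff'_def abs_mult simp del: of_nat_Suc)

lemma cutoff_late:
  assumes "t + 1 \<le> s"
  shows "cutoff t k s = 0" "cutoff' t k s = 0"
proof -
  have "1 / real (Suc k) \<le> 1" by simp
  then have "t + 1 / real (Suc k) \<le> s" using assms by linarith
  then show "cutoff t k s = 0" "cutoff' t k s = 0" by (rule cutoff_simps(3), rule cutoff_simps(4))
qed

lemma set_integrable_half_line:
  fixes f :: "real \<Rightarrow> real"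
  assumes "continuous_on {0..R} f" "\<And>s. R < s \<Longrightarrow> f s = 0"
  shows "set_integrable lborel {0..} f" "(LINT s:{0..}|lborel. f s) = integral {0..R} f"
proof -
  have e: "indicator {0..} s *\<^sub>R f s = indicator {0..R} s *\<^sub>R f s" for s
    using assms(2)[of s] by (auto simp: indicator_def)
  have i: "set_integrable lborel {0..R} f"
    by (rule borel_integrable_atLeastAtMost') (rule assms(1))
  then show "set_integrable lborel {0..} f" by (simp only: set_integrable_def e)
  show "(LINT s:{0..}|lborel. f s) = integral {0..R} f"
    using set_borel_integral_eq_integral(2)[OF i] by (simp only: set_lebesgue_integral_def e)
qed

lemma cutoff_mass:
  assumes "0 \<le> t"
  shows "set_integrable lborel {0..} (cutoff' t k)" "(LINT s:{0..}|lborel. cutoff' t k s) = - 1"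
proof -
  note h = set_integrable_half_line[of "t + 1" "cutoff' t k", OF continuous_cutoff(2)]
  show "set_integrable lborel {0..} (cutoff' t k)" by (rule h(1)) (simp add: cutoff_late)
  have "(cutoff' t k has_integral (cutoff t k (t + 1) - cutoff t k 0)) {0..t + 1}"
    using assms
    by (intro fundamental_theorem_of_calculus)
     (auto simp only: has_real_derivative_iff_has_vector_derivative[symmetric]
        intro: has_field_derivative_at_within[OF cutoff_derivative])
  then have "integral {0..t + 1} (cutoff' t k) = - 1"
    using assms by (simp add: integral_unique cutoff_late cutoff_simps)
  then show "(LINT s:{0..}|lborel. cutoff' t k s) = - 1"
    using h(2) by (simp add: cutoff_late)
qed

text \<open>The function \<open>- cutoff' t k\<close> has integral 1, lives on an interval of length
  \<open>1 / real (Suc k)\<close> to the right of \<open>t\<close> and has size at most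
  \<open>2 * real (Suc k)\<close>: it is an approximate identity for continuous \<open>b\<close>. An
  oscillation of \<open>e / 4\<close> thus costs at most \<open>e / 2\<close>.\<close>

lemma cutoff_kernel_limit:
  fixes b :: "real \<Rightarrow> real"
  assumes b: "continuous_on {0..} b" and t: "0 \<le> t"
  shows "(\<lambda>k. - (LINT s:{0..}|lborel. cutoff' t k s * b s)) \<longlonglongrightarrow> b t"
  unfolding LIMSEQ_iff
proof (intro allI impI)
  fix e :: real assume e: "0 < e"
  have "t \<in> {0..}" "0 < e / 4" using t e by auto
  then have "\<exists>d>0. \<forall>s\<in>{0..}. dist s t < d \<longrightarrow> dist (b s) (b t) < e / 4"
    using b unfolding continuous_on_iff by blast
  then obtain d where d: "0 < d" "\<And>s. 0 \<le> s \<Longrightarrow> \<bar>s - t\<bar> < d \<Longrightarrow> \<bar>b s - b t\<bar> < e / 4"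
    by (auto simp: dist_real_def)
  obtain k0 :: nat where k0: "1 / real (Suc k0) < d" using nat_approx_posE[OF d(1)] by blast
  have "norm (- (LINT s:{0..}|lborel. cutoff' t k s * b s) - b t) < e" if k: "k0 \<le> k" for k
  proof -
    have kd: "1 / real (Suc k) < d"
    proof -
      have "1 / real (Suc k) \<le> 1 / real (Suc k0)" using k by (intro divide_left_mono) auto
      then show ?thesis using k0 by linarith
    qed
    have cb: "continuous_on {0..t + 1} b" by (rule continuous_on_subset[OF b]) auto
    have i1: "set_integrable lborel {0..} (\<lambda>s. cutoff' t k s * b s)"
      by (rule set_integrable_half_line(1)[of "t + 1"]) (auto intro!: continuous_intros continuous_cutoff cb simp: cutoff_late)
    have i2: "set_integrable lborel {0..} (\<lambda>s. cutoff' t k s * b t)"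
      using cutoff_mass(1)[OF t, of k] by simp
    have "- (LINT s:{0..}|lborel. cutoff' t k s * b s) - b t
      = - (LINT s:{0..}|lborel. cutoff' t k s * b s) + (LINT s:{0..}|lborel. cutoff' t k s * b t)"
      using cutoff_mass(2)[OF t] by simp
    also have "\<dots> = - (LINT s:{0..}|lborel. cutoff' t k s * b s - cutoff' t k s * b t)"
      by (simp add: set_integral_diff(2)[OF i1 i2])
    finally have eq: "- (LINT s:{0..}|lborel. cutoff' t k s * b s) - b t = \<dots>" .
    let ?I = "{t..t + 1 / real (Suc k)}"
    have "norm (LINT s:{0..}|lborel. cutoff' t k s * b s - cutoff' t k s * b t) \<le> (LINT s:?I|lborel. 2 * real (Suc k) * (e / 4))"
      unfolding set_lebesgue_integral_def
    proof (rule Bochner_Integration.integral_norm_bound_integral)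
      show "integrable lborel (\<lambda>s. indicat_real {0..} s *\<^sub>R (cutoff' t k s * b s - cutoff' t k s * b t))"
        using set_integral_diff(1)[OF i1 i2] by (simp add: set_integrable_def)
      show "integrable lborel (\<lambda>s. indicat_real ?I s *\<^sub>R (2 * real (Suc k) * (e / 4)))"
        by simp
      fix s
      show "norm (indicat_real {0..} s *\<^sub>R (cutoff' t k s * b s - cutoff' t k s * b t))
         \<le> indicat_real ?I s *\<^sub>R (2 * real (Suc k) * (e / 4))"
      proof (cases "s \<in> ?I")
        case True
        then have "\<bar>b s - b t\<bar> < e / 4" using kd t by (intro d(2)) auto
        then have "\<bar>cutoff' t k s\<bar> * \<bar>b s - b t\<bar> \<le> 2 * real (Suc k) * (e / 4)"
          using cutoff_bounds(3)[of t k s] by (intro mult_mono) auto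
        then show ?thesis using True t by (simp add: abs_mult[symmetric] right_diff_distrib)
      next
        case False
        then have "cutoff' t k s = 0" 
          using cutoff_simps(2)[of s t k] cutoff_simps(4)[of t k s] by (cases "s \<le> t") auto
        then show ?thesis using False by simp
      qed
    qed
    also have "\<dots> = 1 / real (Suc k) * (2 * real (Suc k) * (e / 4))"
      unfolding set_lebesgue_integral_def by (simp del: of_nat_Suc)
    also have "\<dots> = e / 2" by (simp del: of_nat_Suc)
    finally show ?thesis unfolding eq using e by simp
  qed
  then show "\<exists>no. \<forall>n\<ge>no. norm (- (LINT s:{0..}|lborel. cutoff' t n s * b s) - b t) < e" by blast
qed

text \<open>Dominated convergence: the cutoffs are bounded by 1, vanish after \<open>t + 1\<close>,
  and converge pointwise to the indicator of \<open>{..t}\<close>.\<close>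

lemma cutoff_source_limit:
  fixes L :: "real \<Rightarrow> real"
  assumes L: "\<And>R. set_integrable lborel {0..R} L" and t: "0 \<le> t"
  shows "(\<lambda>k. LINT s:{0..}|lborel. cutoff t k s * L s) \<longlonglongrightarrow> (LINT s:{0..t}|lborel. L s)"
  unfolding set_lebesgue_integral_def
proof (rule integral_dominated_convergence)
  have Lt: "integrable lborel (\<lambda>s. indicator {0..t + 1} s *\<^sub>R L s)" "integrable lborel (\<lambda>s. indicator {0..t} s *\<^sub>R L s)"
    using L by (simp_all add: set_integrable_def)
  note [measurable] = borel_measurable_integrable[OF Lt(1)] borel_measurable_integrable[OF Lt(2)]
  have [measurable]: "cutoff t k \<in> borel_measurable borel" for k
    by (rule borel_measurable_continuous_onI[OF continuous_cutoff(1)])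
  have e: "indicator {0..} s *\<^sub>R (cutoff t k s * L s) = cutoff t k s * (indicator {0..t + 1} s *\<^sub>R L s)" for k s
    using cutoff_late(1)[of t s k] by (auto simp: indicator_def)
  show "(\<lambda>s. indicator {0..t} s *\<^sub>R L s) \<in> borel_measurable lborel" by measurable
  show "(\<lambda>s. indicator {0..} s *\<^sub>R (cutoff t k s * L s)) \<in> borel_measurable lborel" for k unfolding e by measurable
  show "integrable lborel (\<lambda>s. norm (indicator {0..t + 1} s *\<^sub>R L s))" using Lt(1) by (rule integrable_norm)
  show "AE s in lborel. norm (indicator {0..} s *\<^sub>R (cutoff t k s * L s)) \<le> norm (indicator {0..t + 1} s *\<^sub>R L s)" for k
    unfolding e using cutoff_bounds[of t k] by (intro AE_I2) (auto simp: abs_mult intro!: mult_left_le_one_le)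
  show "AE s in lborel. (\<lambda>k. indicator {0..} s *\<^sub>R (cutoff t k s * L s)) \<longlonglongrightarrow> indicator {0..t} s *\<^sub>R L s"
  proof (intro AE_I2)
    fix s
    have "\<forall>\<^sub>F k in sequentially. cutoff t k s = indicator {..t} s"
    proof (cases "s \<le> t")
      case False
      then obtain k0 :: nat where k0: "1 / real (Suc k0) < s - t" using nat_approx_posE[of "s - t"] by auto
      have "cutoff t k s = 0" if "k0 \<le> k" for k
      proof (rule cutoff_simps(3))
        have "1 / real (Suc k) \<le> 1 / real (Suc k0)" using that by (intro divide_left_mono) auto
        then show "t + 1 / real (Suc k) \<le> s" using k0 by linarith
      qed
      then show ?thesis using False by (auto simp: eventually_sequentially)
    qed (simp add: cutoff_simps)
    then have "\<forall>\<^sub>F k in sequentially. indicator {0..} s *\<^sub>R (cutoff t k s * L s) = indicator {0..t} s *\<^sub>R L s"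
      by eventually_elim (auto simp: indicator_def)
    then show "(\<lambda>k. indicator {0..} s *\<^sub>R (cutoff t k s * L s)) \<longlonglongrightarrow> indicator {0..t} s *\<^sub>R L s"
      by (rule tendsto_eventually)
  qed
qed

subsection \<open>Admissible test functions\<close>

text \<open>Continuous periodic functions are bounded, so convergence of the scalar factor is
  uniform in space; a product test function inherits its regularity in time from that
  factor.\<close>

lemma Ck_tendsto_scaled:
  fixes \<phi> :: "real ^ 'n \<Rightarrow> 'b::real_normed_vector"
  assumes \<phi>: "C1p \<phi>" and c: "(c \<longlongrightarrow> c0) F"
  shows "Ck_tendsto 1 (\<lambda>s x. c s *\<^sub>R \<phi> x) (\<lambda>x. c0 *\<^sub>R \<phi> x) F"
proof -
  have u: "uniform_limit UNIV (\<lambda>s x. c s *\<^sub>R f x) (\<lambda>x. c0 *\<^sub>R f x) F"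
    if f: "torus_fun f" "continuous_on UNIV f" for f :: "real ^ 'n \<Rightarrow> 'b"
  proof -
    obtain B where B: "0 \<le> B" "\<And>x. norm (f x) \<le> B" by (rule torus_fun_bounded[OF f]) blast
    show ?thesis
    proof (rule uniform_limitI)
      fix e :: real assume "0 < e"
      then have "\<forall>\<^sub>F s in F. dist (c s) c0 < e / (B + 1)" using B(1) by (intro tendstoD[OF c]) auto
      then show "\<forall>\<^sub>F s in F. \<forall>x\<in>UNIV. dist (c s *\<^sub>R f x) (c0 *\<^sub>R f x) < e"
      proof eventually_elim
        case (elim s)
        have "dist (c s *\<^sub>R f x) (c0 *\<^sub>R f x) < e" for x
        proof -
          have "dist (c s *\<^sub>R f x) (c0 *\<^sub>R f x) = dist (c s) c0 * norm (f x)"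
            by (simp add: dist_norm scaleR_left_diff_distrib[symmetric])
          also have "\<dots> \<le> dist (c s) c0 * (B + 1)" using B(2)[of x] by (intro mult_left_mono) auto
          also have "\<dots> < e" using elim B(1) by (simp add: less_divide_eq)
          finally show ?thesis .
        qed
        then show ?case by simp
      qed
    qed
  qed
  have p: "pds [i] (\<lambda>x. a *\<^sub>R \<phi> x) = (\<lambda>x. a *\<^sub>R pds [i] \<phi> x)" for a i
    by (auto simp: pd_scaleR C1pD(2)[OF \<phi>])
  show ?thesis unfolding Ck_tendsto_def
  proof (intro allI impI)
    fix l :: "'n list" assume "length l \<le> 1"
    then consider "l = []" | i where "l = [i]" by (cases l) auto
    then show "uniform_limit UNIV (\<lambda>s. pds l (\<lambda>x. c s *\<^sub>R \<phi> x)) (pds l (\<lambda>x. c0 *\<^sub>R \<phi> x)) F"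
    proof cases
      case 1
      then show ?thesis using u[OF C1pD(1,4)[OF \<phi>]] by simp
    next
      case (2 i)
      show ?thesis unfolding 2 p using u[OF C1pD(5,3)[OF \<phi>]] by simp
    qed
  qed
qed

lemma test_fun_product:
  fixes \<phi> :: "real ^ 'n \<Rightarrow> 'b::real_normed_vector"
  assumes \<phi>: "C1p \<phi>" and \<theta>: "\<And>s. (\<theta> has_real_derivative \<theta>' s) (at s)" "continuous_on UNIV \<theta>'"
    and R: "\<And>s. R \<le> s \<Longrightarrow> \<theta> s = 0"
  shows "test_fun (\<lambda>s x. \<theta> s *\<^sub>R \<phi> x) (\<lambda>s x. \<theta>' s *\<^sub>R \<phi> x)"
proof -
  have C: "C0_Ck {0..} 1 (\<lambda>s x. c s *\<^sub>R \<phi> x)" if "continuous_on UNIV c" for c :: "real \<Rightarrow> real"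
    unfolding C0_Ck_def
  proof (intro conjI ballI)
    fix t :: real assume t: "t \<in> {0..}"
    show "Ck_torus 1 (\<lambda>x. c t *\<^sub>R \<phi> x)" using C1p_scaleR[OF \<phi>] by simp
    have "(c \<longlongrightarrow> c t) (at t within {0..})"
      using continuous_on_subset[OF that subset_UNIV] t unfolding continuous_on_def by blast
    then show "Ck_tendsto 1 (\<lambda>s x. c s *\<^sub>R \<phi> x) (\<lambda>x. c t *\<^sub>R \<phi> x) (at t within {0..})"
      by (rule Ck_tendsto_scaled[OF \<phi>])
  qed
  have c: "continuous_on UNIV \<theta>"
    by (rule DERIV_continuous_on, rule has_field_derivative_at_within, rule \<theta>(1))
  have q: "(\<lambda>s x. (\<theta> s *\<^sub>R \<phi> x - \<theta> t *\<^sub>R \<phi> x) /\<^sub>R (s - t)) = (\<lambda>s x. ((\<theta> s - \<theta> t) / (s - t)) *\<^sub>R \<phi> x)" for t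
    by (auto simp: fun_eq_iff scaleR_left_diff_distrib[symmetric] divide_inverse mult.commute)
  have "Ck_tendsto 1 (\<lambda>s x. (\<theta> s *\<^sub>R \<phi> x - \<theta> t *\<^sub>R \<phi> x) /\<^sub>R (s - t)) (\<lambda>x. \<theta>' t *\<^sub>R \<phi> x) (at t within {0..})" for t
    unfolding q
    by (rule Ck_tendsto_scaled[OF \<phi>])
      (use has_field_derivative_at_within[OF \<theta>(1)] in \<open>simp add: has_field_derivative_iff\<close>)
  then show ?thesis
    unfolding test_fun_def C1_Ck_deriv_def using C[OF c] C[OF \<theta>(2)] R by auto
qed

lemma W1inf_cutoff:
  assumes t: "0 \<le> t"
  shows "W1inf (cutoff t k) (cutoff' t k)"
  unfolding W1inf_def
proof (intro conjI allI impI)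
  show "continuous_on {0..} (cutoff t k)" by (rule continuous_cutoff)
  show "bounded (cutoff t k ` {0..})"
    unfolding bounded_iff using cutoff_bounds[of t k] by (intro exI[of _ 1]) auto
  have "cutoff' t k \<in> borel_measurable borel"
    by (rule borel_measurable_continuous_onI[OF continuous_cutoff(2)])
  then show "set_borel_measurable borel {0..} (cutoff' t k)"
    unfolding set_borel_measurable_def by measurable
  show "\<exists>B. AE s in lborel. 0 \<le> s \<longrightarrow> \<bar>cutoff' t k s\<bar> \<le> B"
    using cutoff_bounds(3)[of t k] by (intro exI[of _ "2 * real (Suc k)"]) (simp del: of_nat_Suc)
  fix \<eta> \<eta>' :: "real \<Rightarrow> real"
  assume "(\<forall>s. (\<eta> has_real_derivative \<eta>' s) (at s)) \<and> continuous_on UNIV \<eta>' \<and> (\<exists>a b. 0 < a \<and> (\<forall>s. s \<notin> {a..b} \<longrightarrow> \<eta> s = 0))"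
  then obtain a b where d: "\<And>s. (\<eta> has_real_derivative \<eta>' s) (at s)" and c: "continuous_on UNIV \<eta>'"
    and ab: "0 < a" "\<And>s. s \<notin> {a..b} \<Longrightarrow> \<eta> s = 0" by blast
  have c\<eta>: "continuous_on S \<eta>" "continuous_on S \<eta>'" for S
    by (rule DERIV_continuous_on, rule has_field_derivative_at_within, rule d)
      (rule continuous_on_subset[OF c subset_UNIV])
  let ?R = "t + 1"
  have i1: "(LINT s:{0..}|lborel. cutoff t k s * \<eta>' s) = integral {0..?R} (\<lambda>s. cutoff t k s * \<eta>' s)"
    by (rule set_integrable_half_line) (auto intro!: continuous_intros continuous_cutoff c\<eta> simp: cutoff_late)
  have i2: "(LINT s:{0..}|lborel. cutoff' t k s * \<eta> s) = integral {0..?R} (\<lambda>s. cutoff' t k s * \<eta> s)"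
    by (rule set_integrable_half_line) (auto intro!: continuous_intros continuous_cutoff c\<eta> simp: cutoff_late)
  have "((\<lambda>s. cutoff t k s * \<eta>' s + cutoff' t k s * \<eta> s) has_integral cutoff t k ?R * \<eta> ?R - cutoff t k 0 * \<eta> 0) {0..?R}"
    using t by (intro fundamental_theorem_of_calculus,
      auto simp only: has_real_derivative_iff_has_vector_derivative[symmetric])
     (rule has_field_derivative_at_within, rule DERIV_mult'[OF cutoff_derivative d])
  \<comment> \<open>The boundary terms: \<eta> vanishes at 0 because its support starts at
    \<open>a > 0\<close>, and the cutoff vanishes at the upper end.\<close>
  moreover have "\<eta> 0 = 0" using ab by simp
  ultimately have "integral {0..?R} (\<lambda>s. cutoff t k s * \<eta>' s + cutoff' t k s * \<eta> s) = 0"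
    by (simp add: integral_unique cutoff_late)
  moreover have "integral {0..?R} (\<lambda>s. cutoff t k s * \<eta>' s + cutoff' t k s * \<eta> s)
     = integral {0..?R} (\<lambda>s. cutoff t k s * \<eta>' s) + integral {0..?R} (\<lambda>s. cutoff' t k s * \<eta> s)"
    by (intro Henstock_Kurzweil_Integration.integral_add integrable_continuous_interval continuous_intros continuous_cutoff c\<eta>)
  ultimately show "(LINT s:{0..}|lborel. cutoff t k s * \<eta>' s) = - (LINT s:{0..}|lborel. cutoff' t k s * \<eta> s)"
    unfolding i1 i2 by linarith
qed

subsection \<open>Continuous curves in the space of integrable functions\<close>

lemma C0_L1D:
  fixes f :: "real \<Rightarrow> real ^ 'n \<Rightarrow> 'b::euclidean_space"
  assumes "C0_L1 f"
  shows "st_measurable f" "\<And>t. 0 \<le> t \<Longrightarrow> integrable tor (f t)" "\<And>t. 0 \<le> t \<Longrightarrow> L1_cont_at f t {0..}"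
proof -
  show "st_measurable f" using assms by (simp add: C0_L1_def)
  show i: "integrable tor (f t)" if "0 \<le> t" for t
    using assms that by (simp add: C0_L1_def set_integrable_tor)
  show "L1_cont_at f t {0..}" if "0 \<le> t" for t
    using assms that i by (simp add: C0_L1_def L1_cont_at_def set_integral_tor)
qed

lemma C0_L1_pairing_continuous:
  fixes f :: "real \<Rightarrow> real ^ 'n \<Rightarrow> 'b::euclidean_space"
  assumes f: "C0_L1 f" and F: "continuous_on torus_cell F"
  shows "continuous_on {0..} (\<lambda>t. LINT x|tor. f t x \<bullet> F x)"
proof -
  have "continuous_on ({0..} \<times> torus_cell) (\<lambda>(s :: real, x). F x)"
    unfolding split_beta by (rule continuous_on_compose2[OF F]) (auto intro!: continuous_intros)
  from L1_cont_pairing[OF C0_L1D(3)[OF f] _ this] show ?thesis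
    unfolding continuous_on_def[of "{0 :: real..}"] by blast
qed

lemma C0_L1_norm_bounded:
  fixes f :: "real \<Rightarrow> real ^ 'n \<Rightarrow> 'b::euclidean_space"
  assumes f: "C0_L1 f"
  shows "\<exists>C. \<forall>t\<in>{0..R}. (LINT x|tor. norm (f t x)) \<le> C"
proof -
  have "continuous_on {0..} (\<lambda>t. LINT x|tor. norm (f t x))"
    unfolding continuous_on_def
  proof
    fix t :: real assume t: "t \<in> {0..}"
    have "((\<lambda>s. (LINT x|tor. norm (f s x)) - (LINT x|tor. norm (f t x))) \<longlongrightarrow> 0) (at t within {0..})"
    proof (rule Lim_null_comparison)
      show "((\<lambda>s. LINT x|tor. norm (f s x - f t x)) \<longlongrightarrow> 0) (at t within {0..})"
        using C0_L1D(3)[OF f] t by (simp add: L1_cont_at_def)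
      have "norm ((LINT x|tor. norm (f s x)) - (LINT x|tor. norm (f t x))) \<le> (LINT x|tor. norm (f s x - f t x))"
        if s: "s \<in> {0..}" for s
      proof -
        have i: "integrable tor (f s)" "integrable tor (f t)" using C0_L1D(2)[OF f] s t by auto
        have "(LINT x|tor. norm (f s x)) - (LINT x|tor. norm (f t x)) = (LINT x|tor. norm (f s x) - norm (f t x))"
          using i by (intro Bochner_Integration.integral_diff[symmetric]) auto
        then show ?thesis
          using i norm_triangle_ineq3
          by (simp only:) (intro Bochner_Integration.integral_norm_bound_integral, auto)
      qed
      then show "\<forall>\<^sub>F s in at t within {0..}. norm ((LINT x|tor. norm (f s x)) - (LINT x|tor. norm (f t x)))
          \<le> (LINT x|tor. norm (f s x - f t x))"
        unfolding eventually_at by (intro exI[of _ 1]) auto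
    qed
    then show "((\<lambda>t. LINT x|tor. norm (f t x)) \<longlongrightarrow> (LINT x|tor. norm (f t x))) (at t within {0..})"
      by (simp add: LIM_zero_cancel)
  qed
  then have "continuous_on {0..R} (\<lambda>t. LINT x|tor. norm (f t x))" by (rule continuous_on_subset) auto
  then have "bounded ((\<lambda>t. LINT x|tor. norm (f t x)) ` {0..R})"
    by (intro compact_imp_bounded compact_continuous_image) auto
  then show ?thesis by (auto simp: bounded_iff)
qed

lemma set_Fubini:
  fixes G :: "real \<Rightarrow> real ^ 'n \<Rightarrow> real"
  assumes G: "set_integrable lborel ({0..} \<times> torus_cell) (\<lambda>(t, x). G t x)"
  shows "AE t in lborel. 0 \<le> t \<longrightarrow> integrable tor (G t)"
    and "set_integrable lborel {0..} (\<lambda>t. LINT x|tor. G t x)"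
    and "(LINT (t, x):{0..} \<times> torus_cell|lborel. G t x) = (LINT t:{0..}|lborel. LINT x|tor. G t x)"
proof -
  have e: "indicator ({0..} \<times> torus_cell) z *\<^sub>R (case z of (t, x) \<Rightarrow> G t x)
      = (case z of (t, x) \<Rightarrow> indicator {0..} t *\<^sub>R (indicator torus_cell x *\<^sub>R G t x))" for z :: "real \<times> (real ^ 'n)"
    by (cases z) (auto simp: indicator_def)
  have i: "integrable (lborel \<Otimes>\<^sub>M lborel) (\<lambda>(t, x). indicator {0..} t *\<^sub>R (indicator torus_cell x *\<^sub>R G t x))"
    using G unfolding set_integrable_def e lborel_prod .
  have inner: "(LINT x|lborel. indicator {0..} t *\<^sub>R (indicator torus_cell x *\<^sub>R G t x))
     = indicator {0..} t *\<^sub>R (LINT x|tor. G t x)" for t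
    by (simp flip: set_integral_tor add: set_lebesgue_integral_def)
  show "AE t in lborel. 0 \<le> t \<longrightarrow> integrable tor (G t)"
    using lborel_pair.AE_integrable_fst'[OF i]
    by eventually_elim (auto simp flip: set_integrable_tor simp: set_integrable_def)
  show "set_integrable lborel {0..} (\<lambda>t. LINT x|tor. G t x)"
    using lborel_pair.integrable_fst'[OF i] by (simp only: set_integrable_def prod.case inner)
  show "(LINT (t, x):{0..} \<times> torus_cell|lborel. G t x) = (LINT t:{0..}|lborel. LINT x|tor. G t x)"
    using lborel_pair.integral_fst'[OF i]
    by (simp only: set_lebesgue_integral_def e lborel_prod prod.case inner)
qed

text \<open>Joint measurability of \<open>f\<close>, together with the bound on its L^1 norm over
  bounded times, gives integrability in space-time; times after \<open>R\<close> are removed by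
  \<open>c\<close>.\<close>

lemma st_pairing:
  fixes f :: "real \<Rightarrow> real ^ 'n \<Rightarrow> 'b::euclidean_space"
  assumes f: "C0_L1 f" and F: "continuous_on UNIV F"
    and c: "continuous_on UNIV c" "\<And>s. R < s \<Longrightarrow> c s = 0"
  shows "set_integrable lborel ({0..} \<times> torus_cell) (\<lambda>(t, x). c t * (f t x \<bullet> F x))"
proof -
  let ?g = "\<lambda>(t, x). indicator {0..} t *\<^sub>R (indicator torus_cell x *\<^sub>R (c t * (f t x \<bullet> F x)))"
  have e: "indicator ({0..} \<times> torus_cell) z *\<^sub>R (case z of (t, x) \<Rightarrow> c t * (f t x \<bullet> F x)) = ?g z" for z :: "real \<times> (real ^ 'n)"
    by (cases z) (auto simp: indicator_def)
  have Fc: "continuous_on torus_cell F" using F continuous_on_subset by blast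
  obtain B where B: "0 \<le> B" "\<And>x. x \<in> torus_cell \<Longrightarrow> norm (F x) \<le> B"
    by (rule continuous_bounded_cell[OF Fc]) blast
  obtain C where C: "\<And>t. t \<in> {0..R} \<Longrightarrow> (LINT x|tor. norm (f t x)) \<le> C"
    using C0_L1_norm_bounded[OF f] by blast
  obtain D where D: "\<And>t. t \<in> {0..R} \<Longrightarrow> \<bar>c t\<bar> \<le> D" "0 \<le> D"
  proof -
    have "bounded (c ` {0..R})"
      by (intro compact_imp_bounded compact_continuous_image) (use c(1) continuous_on_subset in auto)
    then obtain D where "\<forall>t\<in>{0..R}. \<bar>c t\<bar> \<le> D" unfolding bounded_iff by auto
    then show ?thesis by (intro that[of "max D 0"]) (auto simp: le_max_iff_disj)
  qed
  have [measurable]: "F \<in> borel_measurable borel" "c \<in> borel_measurable borel"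
    using F c(1) by (auto intro: borel_measurable_continuous_onI)
  have [measurable]: "(\<lambda>(t, x). indicator ({0..} \<times> UNIV) (t, x) *\<^sub>R f t x) \<in> borel_measurable (borel :: (real \<times> (real ^ 'n)) measure)"
  proof -
    have "(\<lambda>(t, x). indicator ({0..} \<times> UNIV) (t, x) *\<^sub>R f t x)
       = (\<lambda>z. indicator ({0..} \<times> UNIV) z *\<^sub>R (case z of (t, x) \<Rightarrow> f t x))" by auto
    then show ?thesis
      using C0_L1D(1)[OF f] by (simp only: st_measurable_def set_borel_measurable_def)
  qed
  \<comment> \<open>Measurability is available for \<open>f\<close> times the indicator of
    nonnegative times; this factorisation isolates that product.\<close>
  have ge: "?g = (\<lambda>z. indicator torus_cell (snd z) * (c (fst z) * ((case z of (t, x) \<Rightarrow> indicator ({0..} \<times> UNIV) (t, x) *\<^sub>R f t x) \<bullet> F (snd z))))"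
    by (auto simp: fun_eq_iff indicator_def)
  have gm: "?g \<in> borel_measurable (lborel \<Otimes>\<^sub>M lborel)"
  proof -
    have [measurable]: "(\<lambda>z :: real \<times> (real ^ 'n). c (fst z)) \<in> borel_measurable borel"
      "(\<lambda>z :: real \<times> (real ^ 'n). F (snd z)) \<in> borel_measurable borel"
      by (auto intro!: borel_measurable_continuous_onI continuous_on_compose2[OF c(1)] continuous_on_compose2[OF F] continuous_intros)
    have "indicator torus_cell (snd z) = (indicator (UNIV \<times> torus_cell) z :: real)" for z :: "real \<times> (real ^ 'n)"
      by (cases z) (simp add: indicator_def)
    moreover have "closed (UNIV \<times> torus_cell :: (real \<times> (real ^ 'n)) set)"
      by (rule closed_Times[OF closed_UNIV compact_imp_closed[OF compact_torus_cell]])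
    ultimately have [measurable]: "(\<lambda>z :: real \<times> (real ^ 'n). indicator torus_cell (snd z) :: real) \<in> borel_measurable borel"
      by (simp add: borel_measurable_indicator borel_closed)
    show ?thesis unfolding ge lborel_prod measurable_lborel2 by measurable
  qed
  have ii: "integrable lborel (\<lambda>x. ?g (t, x))" for t
  proof (cases "0 \<le> t")
    case True
    have "integrable tor (\<lambda>x. c t * (f t x \<bullet> F x))"
      using integrable_bounded_inner[OF C0_L1D(2)[OF f True] Fc] by simp
    then have "integrable lborel (\<lambda>x. indicator torus_cell x *\<^sub>R (c t * (f t x \<bullet> F x)))"
      by (simp only: set_integrable_tor[symmetric] set_integrable_def)
    moreover have "(\<lambda>x. ?g (t, x)) = (\<lambda>x. indicator torus_cell x *\<^sub>R (c t * (f t x \<bullet> F x)))"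
      using True by (auto simp: indicator_def)
    ultimately show ?thesis by (simp only:)
  qed simp
  have "integrable (lborel \<Otimes>\<^sub>M lborel) ?g"
  proof (rule lborel_pair.Fubini_integrable[OF gm])
    show "integrable lborel (\<lambda>t. LINT x|lborel. norm (?g (t, x)))"
    proof (rule Bochner_Integration.integrable_bound)
      show "integrable lborel (\<lambda>t. indicator {0..R} t *\<^sub>R (D * (B * C)))"
        using borel_integrable_atLeastAtMost'[OF continuous_on_const] by (simp only: set_integrable_def)
      show "(\<lambda>t. LINT x|lborel. norm (?g (t, x))) \<in> borel_measurable lborel"
        using gm by measurable
      have "norm (LINT x|lborel. norm (?g (t, x))) \<le> norm (indicat_real {0..R} t *\<^sub>R (D * (B * C)))" for t
      proof (cases "t \<in> {0..R}")
        case True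
        then have t: "0 \<le> t" by simp
        have "(LINT x|lborel. norm (?g (t, x))) = (LINT x:torus_cell|lborel. \<bar>c t\<bar> * \<bar>f t x \<bullet> F x\<bar>)"
          unfolding set_lebesgue_integral_def using t
          by (intro Bochner_Integration.integral_cong) (auto simp: abs_mult indicator_def)
        also have "\<dots> = \<bar>c t\<bar> * (LINT x|tor. \<bar>f t x \<bullet> F x\<bar>)"
          by (simp add: set_integral_tor)
        also have "\<dots> \<le> D * (B * C)"
        proof (rule mult_mono)
          have "(LINT x|tor. \<bar>f t x \<bullet> F x\<bar>) \<le> (LINT x|tor. B * norm (f t x))"
          proof (rule integral_mono)
            show "integrable tor (\<lambda>x. \<bar>f t x \<bullet> F x\<bar>)"
              using integrable_bounded_inner[OF C0_L1D(2)[OF f t] Fc] by simp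
            show "integrable tor (\<lambda>x. B * norm (f t x))" using C0_L1D(2)[OF f t] by simp
            fix x :: "real ^ 'n" assume "x \<in> space tor"
            then have "norm (f t x) * norm (F x) \<le> norm (f t x) * B" using B(2) by (intro mult_left_mono) auto
            then show "\<bar>f t x \<bullet> F x\<bar> \<le> B * norm (f t x)"
              using Cauchy_Schwarz_ineq2[of "f t x" "F x"] by (simp add: mult.commute)
          qed
          also have "\<dots> \<le> B * C" using C[OF True] B(1) by (simp add: mult_left_mono)
          finally show "(LINT x|tor. \<bar>f t x \<bullet> F x\<bar>) \<le> B * C" .
        qed (use D True in auto)
        finally show ?thesis using True by (simp add: indicator_def)
      next
        case False
        then have "?g (t, x) = 0" for x using c(2)[of t] by (auto simp: indicator_def)
        then have "(LINT x|lborel. norm (?g (t, x))) = 0" by (simp only: norm_zero) simp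
        then show ?thesis by (simp only: norm_zero norm_ge_zero)
      qed
      then show "AE t in lborel. norm (LINT x|lborel. norm (?g (t, x))) \<le> norm (indicat_real {0..R} t *\<^sub>R (D * (B * C)))"
        by (intro AE_I2)
    qed
    show "AE t in lborel. integrable lborel (\<lambda>x. ?g (t, x))" using ii by (intro AE_I2)
  qed
  then show ?thesis unfolding set_integrable_def e lborel_prod .
qed

lemma set_integral_increment:
  fixes L :: "real \<Rightarrow> real"
  assumes L: "\<And>R. set_integrable lborel {0..R} L" and t: "0 \<le> t" "t \<le> t'"
  shows "(LINT s:{0..t'}|lborel. L s) - (LINT s:{0..t}|lborel. L s) = (LINT s:{t<..t'}|lborel. L s)"
    and "set_integrable lborel {t<..t'} L"
proof -
  show i: "set_integrable lborel {t<..t'} L"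
    by (rule set_integrable_subset[OF L[of t']]) (use t in auto)
  have "{0..t'} = {0..t} \<union> {t<..t'}" using t by auto
  then show "(LINT s:{0..t'}|lborel. L s) - (LINT s:{0..t}|lborel. L s) = (LINT s:{t<..t'}|lborel. L s)"
    using set_integral_Un[OF _ L[of t] i] by (simp add: ivl_disj_int)
qed

subsection \<open>Balance laws between two times\<close>

text \<open>Sharpening the cutoffs gives \<open>b t\<close> as \<open>b0\<close> plus the integral
  of \<open>L\<close> over \<open>{0..t}\<close>, at every \<open>t\<close> because \<open>b\<close>
  is continuous. The term \<open>b0\<close> cancels in the difference.\<close>

lemma balance_between_times:
  fixes b L :: "real \<Rightarrow> real"
  assumes b: "continuous_on {0..} b" and L: "\<And>R. set_integrable lborel {0..R} L"
    and weak: "\<And>t k. 0 \<le> t \<Longrightarrow> - ((LINT s:{0..}|lborel. cutoff' t k s * b s) + (LINT s:{0..}|lborel. cutoff t k s * L s)) = b0"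
    and t: "0 \<le> t" "t \<le> t'"
  shows "b t' - b t = (LINT s:{t<..t'}|lborel. L s)"
proof -
  have "b t = b0 + (LINT s:{0..t}|lborel. L s)" if t: "0 \<le> t" for t
  proof -
    have e: "- (LINT s:{0..}|lborel. cutoff' t k s * b s) = b0 + (LINT s:{0..}|lborel. cutoff t k s * L s)" for k
      using weak[OF t, of k] by linarith
    have "(\<lambda>k. b0 + (LINT s:{0..}|lborel. cutoff t k s * L s)) \<longlonglongrightarrow> b t"
      using cutoff_kernel_limit[OF b t] unfolding e .
    moreover have "(\<lambda>k. b0 + (LINT s:{0..}|lborel. cutoff t k s * L s)) \<longlonglongrightarrow> b0 + (LINT s:{0..t}|lborel. L s)"
      by (intro tendsto_intros cutoff_source_limit L t)
    ultimately show ?thesis by (rule LIMSEQ_unique)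
  qed
  then show ?thesis using set_integral_increment(1)[OF L t] t by simp
qed

lemma continuous_imp_set_integrable:
  fixes L :: "real \<Rightarrow> real"
  assumes "continuous_on {0..} L"
  shows "set_integrable lborel {0..R} L"
  by (rule borel_integrable_atLeastAtMost') (rule continuous_on_subset[OF assms], auto)

lemma grad_scaleR:
  assumes "C1p \<phi>"
  shows "grad (\<lambda>x. c *\<^sub>R \<phi> x) x = c *\<^sub>R grad \<phi> x"
  by (simp add: grad_def vec_eq_iff pd_cmult[OF C1pD(2)[OF assms]])

lemma grad_continuous_UNIV: "C1p f \<Longrightarrow> continuous_on UNIV (grad f)"
  unfolding grad_def[abs_def] by (intro continuous_on_vec_lambda C1pD(3))

lemma cutoff_test_fun: "C1p \<phi> \<Longrightarrow> test_fun (\<lambda>s x. cutoff t k s *\<^sub>R \<phi> x) (\<lambda>s x. cutoff' t k s *\<^sub>R \<phi> x)"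
  by (rule test_fun_product[OF _ cutoff_derivative continuous_cutoff(2) cutoff_late(1)])

lemma mass_balance:
  fixes \<rho> :: "real \<Rightarrow> real ^ 'n \<Rightarrow> real" and m :: "real \<Rightarrow> real ^ 'n \<Rightarrow> real ^ 'n"
  assumes \<rho>: "C0_L1 \<rho>" and m: "C0_L1 m"
    and weak: "\<And>\<psi> \<psi>'. test_fun \<psi> \<psi>' \<Longrightarrow>
        - (LINT (t, x):{0..} \<times> torus_cell|lborel. \<rho> t x * \<psi>' t x + m t x \<bullet> grad (\<psi> t) x)
        = (LINT x:torus_cell|lborel. \<rho> 0 x * \<psi> 0 x)"
    and \<phi>: "C1p \<phi>" and t: "0 \<le> t" "t \<le> t'"
  shows "(LINT x|tor. \<rho> t' x * \<phi> x) - (LINT x|tor. \<rho> t x * \<phi> x)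
    = (LINT s:{t<..t'}|lborel. LINT x|tor. m s x \<bullet> grad \<phi> x)"
proof -
  have gc: "continuous_on torus_cell (grad \<phi>)" "continuous_on torus_cell \<phi>"
    using grad_continuous_UNIV[OF \<phi>] C1pD(4)[OF \<phi>] continuous_on_subset by blast+
  have L: "continuous_on {0..} (\<lambda>s. LINT x|tor. m s x \<bullet> grad \<phi> x)"
    by (rule C0_L1_pairing_continuous[OF m gc(1)])
  have b: "continuous_on {0..} (\<lambda>s. LINT x|tor. \<rho> s x \<bullet> \<phi> x)"
    by (rule C0_L1_pairing_continuous[OF \<rho> gc(2)])
  have "(LINT x|tor. \<rho> t' x \<bullet> \<phi> x) - (LINT x|tor. \<rho> t x \<bullet> \<phi> x)
    = (LINT s:{t<..t'}|lborel. LINT x|tor. m s x \<bullet> grad \<phi> x)"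
  proof (rule balance_between_times[OF b continuous_imp_set_integrable[OF L] _ t])
    fix t :: real and k :: nat assume t: "0 \<le> t"
    let ?A = "\<lambda>s x. cutoff' t k s * (\<rho> s x \<bullet> \<phi> x)" and ?B = "\<lambda>s x. cutoff t k s * (m s x \<bullet> grad \<phi> x)"
    have A: "set_integrable lborel ({0..} \<times> torus_cell) (\<lambda>(s, x). ?A s x)"
      by (rule st_pairing[OF \<rho> C1pD(4)[OF \<phi>] continuous_cutoff(2), of "t + 1"]) (simp add: cutoff_late)
    have B: "set_integrable lborel ({0..} \<times> torus_cell) (\<lambda>(s, x). ?B s x)"
      by (rule st_pairing[OF m grad_continuous_UNIV[OF \<phi>] continuous_cutoff(1), of "t + 1"]) (simp add: cutoff_late)
    have "(LINT (s, x):{0..} \<times> torus_cell|lborel. \<rho> s x * (cutoff' t k s *\<^sub>R \<phi> x) + m s x \<bullet> grad (\<lambda>x. cutoff t k s *\<^sub>R \<phi> x) x)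
      = (LINT z:{0..} \<times> torus_cell|lborel. (case z of (s, x) \<Rightarrow> ?A s x) + (case z of (s, x) \<Rightarrow> ?B s x))"
      unfolding grad_scaleR[OF \<phi>] by (intro arg_cong[where f = "set_lebesgue_integral _ _"]) (auto simp: fun_eq_iff)
    also have "\<dots> = (LINT (s, x):{0..} \<times> torus_cell|lborel. ?A s x) + (LINT (s, x):{0..} \<times> torus_cell|lborel. ?B s x)"
      by (rule set_integral_add(2)[OF A B])
    also have "\<dots> = (LINT s:{0..}|lborel. cutoff' t k s * (LINT x|tor. \<rho> s x \<bullet> \<phi> x)) + (LINT s:{0..}|lborel. cutoff t k s * (LINT x|tor. m s x \<bullet> grad \<phi> x))"
      unfolding set_Fubini(3)[OF A] set_Fubini(3)[OF B] by simp
    finally show "- ((LINT s:{0..}|lborel. cutoff' t k s * (LINT x|tor. \<rho> s x \<bullet> \<phi> x)) + (LINT s:{0..}|lborel. cutoff t k s * (LINT x|tor. m s x \<bullet> grad \<phi> x)))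
       = (LINT x|tor. \<rho> 0 x * \<phi> x)"
      using weak[OF cutoff_test_fun[OF \<phi>, of t k]] t by (simp add: set_integral_tor cutoff_simps)
  qed
  then show ?thesis by simp
qed

text \<open>\<open>A\<close> stands for flux minus stress. Its pairing with a fixed jacobian is
  shown to be integrable up to time 0, extracted from the integrability asserted in the weak
  formulation; no continuity in time of this pairing is claimed.\<close>

lemma momentum_balance:
  fixes m :: "real \<Rightarrow> real ^ 'n \<Rightarrow> real ^ 'n" and A :: "real \<Rightarrow> real ^ 'n \<Rightarrow> real ^ 'n ^ 'n" and \<phi> :: "real ^ 'n \<Rightarrow> real ^ 'n"
  assumes m: "C0_L1 m"
    and weak: "\<And>\<phi> \<phi>'. test_fun \<phi> \<phi>' \<Longrightarrow>
        set_integrable lborel ({0..} \<times> torus_cell) (\<lambda>(t, x). m t x \<bullet> \<phi>' t x + A t x \<bullet> jacobian (\<phi> t) (at x)) \<and>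
        - (LINT (t, x):{0..} \<times> torus_cell|lborel. m t x \<bullet> \<phi>' t x + A t x \<bullet> jacobian (\<phi> t) (at x))
        = (LINT x:torus_cell|lborel. m 0 x \<bullet> \<phi> 0 x)"
    and \<phi>: "C1p \<phi>"
  shows "AE s in lborel. 0 \<le> s \<longrightarrow> integrable tor (\<lambda>x. A s x \<bullet> jacobian \<phi> (at x))"
    and "\<And>t t'. 0 \<le> t \<Longrightarrow> t \<le> t' \<Longrightarrow> set_integrable lborel {t<..t'} (\<lambda>s. LINT x|tor. A s x \<bullet> jacobian \<phi> (at x))"
    and "\<And>t t'. 0 \<le> t \<Longrightarrow> t \<le> t' \<Longrightarrow> (LINT x|tor. m t' x \<bullet> \<phi> x) - (LINT x|tor. m t x \<bullet> \<phi> x)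
      = (LINT s:{t<..t'}|lborel. LINT x|tor. A s x \<bullet> jacobian \<phi> (at x))"
proof -
  define N where "N s x = A s x \<bullet> jacobian \<phi> (at x)" for s x
  have jac: "jacobian (\<lambda>x. c *\<^sub>R \<phi> x) (at x) = c *\<^sub>R jacobian \<phi> (at x)" for c x
    using jacobian_nth[OF C1pD(2)[OF C1p_scaleR[OF \<phi>]]] jacobian_nth[OF C1pD(2)[OF \<phi>]]
    by (simp add: vec_eq_iff pd_scaleR[OF C1pD(2)[OF \<phi>]])
  have \<phi>c: "continuous_on torus_cell \<phi>" using C1pD(4)[OF \<phi>] continuous_on_subset by blast
  let ?A = "\<lambda>t k s x. cutoff' t k s * (m s x \<bullet> \<phi> x)" and ?B = "\<lambda>t k s x. cutoff t k s * N s x"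
  have F: "(\<lambda>(s, x). m s x \<bullet> (cutoff' t k s *\<^sub>R \<phi> x) + A s x \<bullet> jacobian (\<lambda>x. cutoff t k s *\<^sub>R \<phi> x) (at x))
     = (\<lambda>z. (case z of (s, x) \<Rightarrow> ?A t k s x) + (case z of (s, x) \<Rightarrow> ?B t k s x))" for t k
    by (auto simp: fun_eq_iff jac N_def)
  have iA: "set_integrable lborel ({0..} \<times> torus_cell) (\<lambda>(s, x). ?A t k s x)" for t k
    by (rule st_pairing[OF m C1pD(4)[OF \<phi>] continuous_cutoff(2), of "t + 1"]) (simp add: cutoff_late)
  have iF: "set_integrable lborel ({0..} \<times> torus_cell) (\<lambda>z. (case z of (s, x) \<Rightarrow> ?A t k s x) + (case z of (s, x) \<Rightarrow> ?B t k s x))" for t k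
    using weak[OF cutoff_test_fun[OF \<phi>, of t k]] unfolding F by blast
  \<comment> \<open>Integrable as a difference, since the part with \<open>m\<close> is integrable
    by \<open>st_pairing\<close>.\<close>
  have iB: "set_integrable lborel ({0..} \<times> torus_cell) (\<lambda>(s, x). ?B t k s x)" for t k
  proof -
    have "(\<lambda>(s, x). ?B t k s x) = (\<lambda>z. (case z of (s, x) \<Rightarrow> ?A t k s x) + (case z of (s, x) \<Rightarrow> ?B t k s x)
        - (case z of (s, x) \<Rightarrow> ?A t k s x))" by (auto simp: fun_eq_iff)
    then show ?thesis using set_integral_diff(1)[OF iF[of t k] iA[of t k]] by (simp only:)
  qed
  \<comment> \<open>The cutoff at time \<open>n\<close> equals 1 up to \<open>n\<close>; the
    exceptional sets for different \<open>n\<close> form a countable union.\<close>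
  have AEt: "AE s in lborel. 0 \<le> s \<and> s \<le> real n \<longrightarrow> integrable tor (N s)" for n :: nat
    using set_Fubini(1)[OF iB[of "real n" 0]] by eventually_elim (auto simp: cutoff_simps)
  then have "AE s in lborel. \<forall>n::nat. 0 \<le> s \<and> s \<le> real n \<longrightarrow> integrable tor (N s)"
    unfolding AE_all_countable by blast
  then show "AE s in lborel. 0 \<le> s \<longrightarrow> integrable tor (\<lambda>x. A s x \<bullet> jacobian \<phi> (at x))"
    unfolding N_def[abs_def] by eventually_elim (use real_arch_simple in blast)
  have L: "set_integrable lborel {0..R} (\<lambda>s. LINT x|tor. N s x)" for R
  proof -
    have "set_integrable lborel {0..R} (\<lambda>s. LINT x|tor. ?B R 0 s x)"
      by (rule set_integrable_subset[OF set_Fubini(2)[OF iB[of R 0]]]) auto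
    moreover have "indicator {0..R} s *\<^sub>R (LINT x|tor. ?B R 0 s x) = indicator {0..R} s *\<^sub>R (LINT x|tor. N s x)" for s
      by (auto simp: indicator_def cutoff_simps)
    ultimately show ?thesis by (simp only: set_integrable_def)
  qed
  show "set_integrable lborel {t<..t'} (\<lambda>s. LINT x|tor. A s x \<bullet> jacobian \<phi> (at x))" if "0 \<le> t" "t \<le> t'" for t t'
    using set_integral_increment(2)[OF L that] by (simp add: N_def)
  show "(LINT x|tor. m t' x \<bullet> \<phi> x) - (LINT x|tor. m t x \<bullet> \<phi> x)
      = (LINT s:{t<..t'}|lborel. LINT x|tor. A s x \<bullet> jacobian \<phi> (at x))" if tt: "0 \<le> t" "t \<le> t'" for t t'
    unfolding N_def[symmetric]
  proof (rule balance_between_times[OF C0_L1_pairing_continuous[OF m \<phi>c] L _ tt])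
    fix t :: real and k :: nat assume t: "0 \<le> t"
    have "(LINT z:{0..} \<times> torus_cell|lborel. (case z of (s, x) \<Rightarrow> ?A t k s x) + (case z of (s, x) \<Rightarrow> ?B t k s x))
      = (LINT s:{0..}|lborel. cutoff' t k s * (LINT x|tor. m s x \<bullet> \<phi> x)) + (LINT s:{0..}|lborel. cutoff t k s * (LINT x|tor. N s x))"
      unfolding set_integral_add(2)[OF iA iB] set_Fubini(3)[OF iA] set_Fubini(3)[OF iB] by simp
    then show "- ((LINT s:{0..}|lborel. cutoff' t k s * (LINT x|tor. m s x \<bullet> \<phi> x)) + (LINT s:{0..}|lborel. cutoff t k s * (LINT x|tor. N s x)))
       = (LINT x|tor. m 0 x \<bullet> \<phi> x)"
      using weak[OF cutoff_test_fun[OF \<phi>, of t k]] t unfolding F by (simp add: set_integral_tor cutoff_simps)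
  qed
qed

text \<open>A comparison with time 0, from cutoffs that start at 1 and drop just after
  \<open>t\<close>. Continuity of the energy in L^1 makes it valid at every
  \<open>t\<close>.\<close>

lemma energy_nonincreasing:
  fixes E :: "real \<Rightarrow> real ^ 'n \<Rightarrow> real"
  assumes E: "C0_L1 E"
    and weak: "\<And>\<theta> \<theta>'. W1inf \<theta> \<theta>' \<Longrightarrow> (\<And>t. 0 \<le> t \<Longrightarrow> 0 \<le> \<theta> t) \<Longrightarrow> (\<exists>R. \<forall>t\<ge>R. \<theta> t = 0) \<Longrightarrow>
           - (LINT (t, x):{0..} \<times> torus_cell|lborel. E t x * \<theta>' t) \<le> (LINT x:torus_cell|lborel. E 0 x * \<theta> 0)"
    and t: "0 \<le> t"
  shows "(LINT x|tor. E t x) \<le> (LINT x|tor. E 0 x)"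
proof (rule LIMSEQ_le_const2)
  show "(\<lambda>k. - (LINT s:{0..}|lborel. cutoff' t k s * (LINT x|tor. E s x \<bullet> 1))) \<longlonglongrightarrow> (LINT x|tor. E t x)"
    using cutoff_kernel_limit[OF C0_L1_pairing_continuous[OF E continuous_on_const[of _ 1]] t] by simp
  have "- (LINT s:{0..}|lborel. cutoff' t k s * (LINT x|tor. E s x \<bullet> 1)) \<le> (LINT x|tor. E 0 x)" for k
  proof -
    have A: "set_integrable lborel ({0..} \<times> torus_cell) (\<lambda>(s, x). cutoff' t k s * (E s x \<bullet> 1))"
      by (rule st_pairing[OF E continuous_on_const continuous_cutoff(2), of "t + 1"]) (simp add: cutoff_late)
    have "(LINT (s, x):{0..} \<times> torus_cell|lborel. E s x * cutoff' t k s)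
       = (LINT s:{0..}|lborel. cutoff' t k s * (LINT x|tor. E s x \<bullet> 1))"
      using set_Fubini(3)[OF A] by (simp add: mult.commute)
    then show ?thesis
      using weak[OF W1inf_cutoff[OF t, of k]] cutoff_bounds(1)[of t k] cutoff_late(1)[of t _ k] t
      by (auto simp: set_integral_tor cutoff_simps)
  qed
  then show "\<exists>N. \<forall>k\<ge>N. - (LINT s:{0..}|lborel. cutoff' t k s * (LINT x|tor. E s x \<bullet> 1)) \<le> (LINT x|tor. E 0 x)" by blast
qed

section \<open>A differential inequality for Dini derivatives\<close>

text \<open>The set of times at which \<open>Z t - Z a\<close> is at most
  \<open>\<eta> * (t - a)\<close> is closed, so it has a largest element, and the Dini bound extends
  it further to the right unless it is \<open>b\<close>.\<close>

lemma dini_nonincreasing: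
  fixes Z :: "real \<Rightarrow> real"
  assumes c: "continuous_on {a..b} Z" and ab: "a \<le> b"
    and D: "\<And>t \<eta>. a \<le> t \<Longrightarrow> t < b \<Longrightarrow> 0 < \<eta> \<Longrightarrow> \<exists>\<delta>>0. \<forall>s. t < s \<longrightarrow> s < t + \<delta> \<longrightarrow> s \<le> b \<longrightarrow> Z s - Z t \<le> \<eta> * (s - t)"
  shows "Z b \<le> Z a"
proof (rule field_le_epsilon)
  fix e :: real assume e: "0 < e"
  define \<eta> where "\<eta> = e / (b - a + 1)"
  have \<eta>: "0 < \<eta>" "\<eta> * (b - a) \<le> e" using e ab by (auto simp: \<eta>_def field_simps)
  let ?A = "{t \<in> {a..b}. Z t - \<eta> * t \<le> Z a - \<eta> * a}"
  have cl: "closed ?A"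
    by (intro continuous_on_closed_Collect_le continuous_intros c closed_atLeastAtMost)
  have ne: "?A \<noteq> {}" using ab by auto
  have bdd: "bdd_above ?A" by (rule bdd_above_mono[of "{a..b}"]) auto
  have t: "Sup ?A \<in> ?A" by (rule closed_contains_Sup[OF ne bdd cl])
  define t where "t = Sup ?A"
  have tA: "a \<le> t" "t \<le> b" "Z t - \<eta> * t \<le> Z a - \<eta> * a" using t by (auto simp: t_def)
  have "t = b"
  proof (rule ccontr)
    assume "t \<noteq> b"
    then have tb: "t < b" using tA by simp
    then obtain \<delta> where \<delta>: "0 < \<delta>" "\<And>s. t < s \<Longrightarrow> s < t + \<delta> \<Longrightarrow> s \<le> b \<Longrightarrow> Z s - Z t \<le> \<eta> * (s - t)"
      using D[OF tA(1) _ \<eta>(1)] by blast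
    define s where "s = min b (t + \<delta> / 2)"
    have s: "t < s" "s < t + \<delta>" "s \<le> b" using \<delta>(1) tb by (auto simp: s_def)
    have "s \<in> ?A" using \<delta>(2)[OF s] s tA by (auto simp: algebra_simps)
    then have "s \<le> t" unfolding t_def by (rule cSup_upper[OF _ bdd])
    then show False using s by simp
  qed
  then have "Z b \<le> Z a + \<eta> * (b - a)" using tA by (simp add: algebra_simps)
  then show "Z b \<le> Z a + e" using \<eta>(2) by linarith
qed

text \<open>The product of \<open>Y + C / K\<close> with the usual integrating factor satisfies the
  condition of \<open>dini_nonincreasing\<close>. The Dini condition is imposed at positive times;
  time 0 is reached by continuity.\<close>

lemma dini_gronwall:
  fixes Y :: "real \<Rightarrow> real"
  assumes c: "continuous_on {0..<T} Y" and Y0: "Y 0 \<le> 0" and K: "0 < K" and c0: "0 \<le> C"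
    and D: "\<And>t \<eta>. 0 < t \<Longrightarrow> t < T \<Longrightarrow> 0 < \<eta> \<Longrightarrow>
      \<exists>\<delta>>0. \<forall>s. t < s \<longrightarrow> s < t + \<delta> \<longrightarrow> s < T \<longrightarrow> Y s - Y t \<le> (s - t) * (K * Y t + C + \<eta>)"
    and t: "0 \<le> t" "t < T"
  shows "Y t \<le> exp (K * T) * C / K"
proof -
  define Z where "Z s = exp (- K * s) * (Y s + C / K)" for s
  have Zc: "continuous_on {0..<T} Z" unfolding Z_def[abs_def] by (intro continuous_intros c)
  have Z_le: "Z t \<le> Z a" if a: "0 < a" "a \<le> t" for a
  proof (rule dini_nonincreasing[OF _ a(2)])
    show "continuous_on {a..t} Z" by (rule continuous_on_subset[OF Zc]) (use a t in auto)
    fix \<tau> \<eta> :: real assume \<tau>: "a \<le> \<tau>" "\<tau> < t" and \<eta>: "0 < \<eta>"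
    have \<tau>': "0 < \<tau>" "\<tau> < T" using \<tau> a t by auto
    obtain \<delta> where \<delta>: "0 < \<delta>" "\<And>s. \<tau> < s \<Longrightarrow> s < \<tau> + \<delta> \<Longrightarrow> s < T \<Longrightarrow> Y s - Y \<tau> \<le> (s - \<tau>) * (K * Y \<tau> + C + \<eta> / 2)"
      using D[OF \<tau>', of "\<eta> / 2"] \<eta> by auto
    \<comment> \<open>\<open>(s - \<tau>) * R s\<close> dominates the increment of \<open>Z\<close>.
      In the limit at \<tau> the Gronwall terms cancel and
      \<open>exp (- K * \<tau>) * (\<eta> / 2)\<close> is left, strictly below \<eta>; this is why
      the condition is invoked with \<open>\<eta> / 2\<close>.\<close>
    define R where "R s = exp (- K * s) * (K * Y \<tau> + C + \<eta> / 2) + (exp (- K * s) - exp (- K * \<tau>)) / (s - \<tau>) * (Y \<tau> + C / K)" for s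
    have "((\<lambda>s. exp (- K * s)) has_real_derivative - K * exp (- K * \<tau>)) (at \<tau>)"
      by (auto intro!: derivative_eq_intros)
    then have "((\<lambda>s. (exp (- K * s) - exp (- K * \<tau>)) / (s - \<tau>)) \<longlongrightarrow> - K * exp (- K * \<tau>)) (at \<tau>)"
      by (simp add: has_field_derivative_iff)
    then have "(R \<longlongrightarrow> exp (- K * \<tau>) * (K * Y \<tau> + C + \<eta> / 2) + (- K * exp (- K * \<tau>)) * (Y \<tau> + C / K)) (at \<tau>)"
      unfolding R_def by (intro tendsto_intros) 
    moreover have "exp (- K * \<tau>) * (K * Y \<tau> + C + \<eta> / 2) + (- K * exp (- K * \<tau>)) * (Y \<tau> + C / K) = exp (- K * \<tau>) * (\<eta> / 2)"
      using K by (simp add: algebra_simps)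
    moreover have "exp (- K * \<tau>) * (\<eta> / 2) < \<eta>"
    proof -
      have e1: "exp (- K * \<tau>) \<le> 1" using K \<tau>' by simp
      have "exp (- K * \<tau>) * (\<eta> / 2) \<le> 1 * (\<eta> / 2)" by (rule mult_right_mono[OF e1]) (use \<eta> in simp)
      also have "\<dots> < \<eta>" using \<eta> by simp
      finally show ?thesis .
    qed
    ultimately have "\<forall>\<^sub>F s in at \<tau>. R s < \<eta>" by (metis order_tendstoD(2))
    then obtain d where d: "0 < d" "\<And>s. s \<noteq> \<tau> \<Longrightarrow> dist s \<tau> < d \<Longrightarrow> R s < \<eta>"
      unfolding eventually_at by auto
    show "\<exists>\<delta>>0. \<forall>s. \<tau> < s \<longrightarrow> s < \<tau> + \<delta> \<longrightarrow> s \<le> t \<longrightarrow> Z s - Z \<tau> \<le> \<eta> * (s - \<tau>)"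
    proof (intro exI[of _ "min \<delta> d"] conjI allI impI)
      show "0 < min \<delta> d" using \<delta> d by simp
      fix s assume s: "\<tau> < s" "s < \<tau> + min \<delta> d" "s \<le> t"
      have "Z s - Z \<tau> = exp (- K * s) * (Y s - Y \<tau>) + (exp (- K * s) - exp (- K * \<tau>)) * (Y \<tau> + C / K)"
        by (simp add: Z_def algebra_simps)
      also have "\<dots> \<le> exp (- K * s) * ((s - \<tau>) * (K * Y \<tau> + C + \<eta> / 2)) + (exp (- K * s) - exp (- K * \<tau>)) * (Y \<tau> + C / K)"
        using \<delta>(2)[of s] s t by (intro add_right_mono mult_left_mono) auto
      also have "\<dots> = (s - \<tau>) * R s"
        using s by (simp add: R_def distrib_left mult_ac)
      also have "\<dots> \<le> (s - \<tau>) * \<eta>"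
        using d(2)[of s] s by (intro mult_left_mono) (auto simp: dist_real_def less_imp_le)
      finally show "Z s - Z \<tau> \<le> \<eta> * (s - \<tau>)" by (simp add: mult.commute)
    qed
  qed
  have "Z t \<le> Z 0"
  proof (cases "t = 0")
    case False
    then have t0: "0 < t" using t by simp
    have "(Z \<longlongrightarrow> Z 0) (at 0 within {0..<T})" using Zc t by (auto simp: continuous_on_def)
    then have lim: "(Z \<longlongrightarrow> Z 0) (at 0 within {0<..<t})"
      by (rule tendsto_within_subset) (use t in auto)
    have "\<forall>\<^sub>F a in at 0 within {0<..<t}. Z t \<le> Z a"
      unfolding eventually_at using t0 Z_le by (intro exI[of _ t]) auto
    moreover have "at 0 within {0<..<t} \<noteq> bot"
      using t0 by (simp add: at_within_eq_bot_iff)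
    ultimately show ?thesis using tendsto_lowerbound[OF lim] by blast
  qed simp
  also have "Z 0 \<le> C / K" using Y0 by (simp add: Z_def)
  finally have "exp (- K * t) * (Y t + C / K) \<le> C / K" by (simp add: Z_def)
  then have "exp (K * t) * (exp (- K * t) * (Y t + C / K)) \<le> exp (K * t) * (C / K)"
    by (intro mult_left_mono) auto
  then have "Y t + C / K \<le> exp (K * t) * (C / K)"
    by (simp add: mult.assoc[symmetric] exp_add[symmetric])
  also have "\<dots> \<le> exp (K * T) * (C / K)"
    using t K c0 by (intro mult_right_mono) auto
  moreover have "0 \<le> C / K" using K c0 by simp
  ultimately show ?thesis by simp
qed

section \<open>Regularity of the classical solution\<close>

lemma Ck_pds:
  assumes "Ck k f" "length l \<le> k"
  shows "Ck (k - length l) (pds l f)"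
  using assms(2)
proof (induction l)
  case (Cons i l)
  then have "Ck (Suc (k - length (i # l))) (pds l f)" by (simp add: Suc_diff_Suc del: Ck.simps)
  then show ?case by simp
qed (simp add: assms(1))

lemma Ck_imp_continuous: "Ck k f \<Longrightarrow> continuous_on UNIV f"
  by (cases k) (auto simp: continuous_at_imp_continuous_on differentiable_imp_continuous_within)

text \<open>Continuity of each slice combined with uniform convergence of the slices as time
  varies.\<close>

lemma C0_Ck_joint_continuous:
  fixes f :: "real \<Rightarrow> real ^ 'n \<Rightarrow> 'b::real_normed_vector"
  assumes f: "C0_Ck I k f" and l: "length l \<le> k"
  shows "continuous_on (I \<times> UNIV) (\<lambda>z. pds l (f (fst z)) (snd z))"
  unfolding continuous_on_iff
proof (intro ballI allI impI)
  fix z e assume z: "z \<in> I \<times> (UNIV :: (real ^ 'n) set)" and e: "(0::real) < e"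
  obtain t x where tx: "z = (t, x)" "t \<in> I" using z by auto
  have "Ck k (f t)" using f tx(2) by (auto simp: C0_Ck_def Ck_torus_def)
  then have "continuous_on UNIV (pds l (f t))" by (rule Ck_imp_continuous[OF Ck_pds[OF _ l]])
  then obtain d1 where d1: "0 < d1" "\<And>y. dist y x < d1 \<Longrightarrow> dist (pds l (f t) y) (pds l (f t) x) < e / 2"
    unfolding continuous_on_iff using e by (metis UNIV_I half_gt_zero)
  have "uniform_limit UNIV (\<lambda>s. pds l (f s)) (pds l (f t)) (at t within I)"
    using f tx(2) l by (auto simp: C0_Ck_def Ck_tendsto_def)
  then have "\<forall>\<^sub>F s in at t within I. \<forall>y\<in>UNIV. dist (pds l (f s) y) (pds l (f t) y) < e / 2"
    using e by (intro uniform_limitD) auto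
  then obtain d2 where d2: "0 < d2" "\<And>s y. s \<in> I \<Longrightarrow> s \<noteq> t \<Longrightarrow> dist s t < d2 \<Longrightarrow> dist (pds l (f s) y) (pds l (f t) y) < e / 2"
    unfolding eventually_at by auto
  show "\<exists>d>0. \<forall>z'\<in>I \<times> UNIV. dist z' z < d \<longrightarrow> dist (pds l (f (fst z')) (snd z')) (pds l (f (fst z)) (snd z)) < e"
  proof (intro exI[of _ "min d1 d2"] conjI ballI impI)
    show "0 < min d1 d2" using d1 d2 by simp
    fix z' assume z': "z' \<in> I \<times> (UNIV :: (real ^ 'n) set)" "dist z' z < min d1 d2"
    obtain s y where sy: "z' = (s, y)" "s \<in> I" using z' by auto
    have "dist s t \<le> dist z' z" "dist y x \<le> dist z' z"
      unfolding sy tx using dist_fst_le[of "(s, y)" "(t, x)"] dist_snd_le[of "(s, y)" "(t, x)"] by auto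
    then have "dist s t < d2" "dist y x < d1" using z'(2) by auto
    have "dist (pds l (f s) y) (pds l (f t) y) < e / 2"
      using \<open>dist s t < d2\<close> d2(2)[OF sy(2), of y] e by (cases "s = t") simp_all
    moreover have "dist (pds l (f t) y) (pds l (f t) x) < e / 2"
      by (rule d1(2)[OF \<open>dist y x < d1\<close>])
    ultimately have "dist (pds l (f s) y) (pds l (f t) x) < e"
      using dist_triangle[of "pds l (f s) y" "pds l (f t) x" "pds l (f t) y"] by linarith
    then show "dist (pds l (f (fst z')) (snd z')) (pds l (f (fst z)) (snd z)) < e" by (simp add: sy tx)
  qed
qed

lemma has_vector_derivative_quotient:
  fixes f :: "real \<Rightarrow> 'b::real_normed_vector"
  assumes "((\<lambda>s. (f s - f t) /\<^sub>R (s - t)) \<longlongrightarrow> D) (at t)"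
  shows "(f has_vector_derivative D) (at t)"
proof -
  have "((\<lambda>s. norm ((f s - f t) /\<^sub>R (s - t) - D)) \<longlongrightarrow> 0) (at t)"
    using assms by (intro tendsto_norm_zero) (simp add: LIM_zero)
  moreover have "\<forall>\<^sub>F s in at t. norm ((f s - f t) /\<^sub>R (s - t) - D) = norm ((f s - f t - (s - t) *\<^sub>R D) /\<^sub>R norm (s - t))"
  proof -
    have "norm ((f s - f t) /\<^sub>R (s - t) - D) = norm ((f s - f t - (s - t) *\<^sub>R D) /\<^sub>R norm (s - t))" if "s \<noteq> t" for s
    proof -
      have "(f s - f t) /\<^sub>R (s - t) - D = (f s - f t - (s - t) *\<^sub>R D) /\<^sub>R (s - t)"
        using that by (simp add: scaleR_diff_right)
      then show ?thesis by simp
    qed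
    then show ?thesis by (simp add: eventually_at_filter)
  qed
  ultimately have "((\<lambda>s. norm ((f s - f t - (s - t) *\<^sub>R D) /\<^sub>R norm (s - t))) \<longlongrightarrow> 0) (at t)"
    by (rule Lim_transform_eventually)
  then show ?thesis
    unfolding has_vector_derivative_def has_derivative_def
    by (auto intro: tendsto_norm_zero_cancel bounded_linear_scaleR_left simp: netlimit_at)
qed

lemma C1_Ck_has_derivative:
  fixes f :: "real \<Rightarrow> real ^ 'n \<Rightarrow> 'b::real_normed_vector"
  assumes f: "C1_Ck_deriv I k f f'" and I: "open I" "t \<in> I"
  shows "((\<lambda>s. f s x) has_vector_derivative f' t x) (at t)"
proof (rule has_vector_derivative_quotient)
  have "Ck_tendsto k (\<lambda>s x. (f s x - f t x) /\<^sub>R (s - t)) (f' t) (at t within I)"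
    using f I by (auto simp: C1_Ck_deriv_def)
  then have "uniform_limit UNIV (\<lambda>s. pds [] (\<lambda>x. (f s x - f t x) /\<^sub>R (s - t))) (pds [] (f' t)) (at t within I)"
  proof -
    assume *: "Ck_tendsto k (\<lambda>s x. (f s x - f t x) /\<^sub>R (s - t)) (f' t) (at t within I)"
    show ?thesis by (rule mp[OF spec[OF *[unfolded Ck_tendsto_def], of "[]"]]) simp
  qed
  from tendsto_uniform_limitI[OF this UNIV_I, of x]
  show "((\<lambda>s. (f s x - f t x) /\<^sub>R (s - t)) \<longlongrightarrow> f' t x) (at t)"
    by (simp only: pds.simps at_within_open[OF I(2,1)])
qed

lemma scaleR_inverse_eq_divide: "a /\<^sub>R b = (a / b :: real)"
  unfolding real_scaleR_def divide_inverse by (rule mult.commute)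

text \<open>Convergence of difference quotients in C^1 contains uniform convergence of their
  gradients. Besides the time derivative of the gradient this supplies uniform approximants of the
  field \<open>grad (f' t)\<close> that are as smooth in space as the gradient of
  \<open>f\<close>.\<close>

lemma C1_C1p_quotient_gradient:
  fixes f :: "real \<Rightarrow> real ^ 'n \<Rightarrow> real"
  assumes f: "C1_Ck_deriv I 1 f f'" and I: "open I" "t \<in> I"
  shows "uniform_limit UNIV (\<lambda>s x. (pd i (f s) x - pd i (f t) x) / (s - t)) (pd i (f' t)) (at t)"
proof -
  have "Ck_tendsto 1 (\<lambda>s x. (f s x - f t x) /\<^sub>R (s - t)) (f' t) (at t within I)"
    using f I by (auto simp: C1_Ck_deriv_def)
  then have u: "uniform_limit UNIV (\<lambda>s. pds [i] (\<lambda>x. (f s x - f t x) /\<^sub>R (s - t))) (pds [i] (f' t)) (at t)"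
  proof -
    assume *: "Ck_tendsto 1 (\<lambda>s x. (f s x - f t x) /\<^sub>R (s - t)) (f' t) (at t within I)"
    show ?thesis by (rule mp[OF spec[OF *[unfolded Ck_tendsto_def at_within_open[OF I(2,1)]], of "[i]"]]) simp
  qed
  have "C1p (f s)" if "s \<in> I" for s using f that by (auto simp: C1_Ck_deriv_def C0_Ck_def)
  then have d: "f s differentiable (at x)" if "s \<in> I" for s x using that C1pD(2) by blast
  have e: "pds [i] (\<lambda>x. (f s x - f t x) /\<^sub>R (s - t)) x = (pd i (f s) x - pd i (f t) x) / (s - t)" if "s \<in> I" for s x
  proof -
    have "(\<lambda>x. f s x - f t x) differentiable (at x)" using d[OF that, of x] d[OF I(2), of x] by simp
    then have "pds [i] (\<lambda>x. (f s x - f t x) /\<^sub>R (s - t)) x = (pd i (f s) x - pd i (f t) x) /\<^sub>R (s - t)"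
      by (simp only: pds.simps pd_scaleR pd_diff[OF d[OF that] d[OF I(2)]])
    then show ?thesis by (simp only: scaleR_inverse_eq_divide)
  qed
  have "\<forall>\<^sub>F s in at t. s \<in> I" using eventually_at_in_open'[OF I] .
  then have ev: "\<forall>\<^sub>F s in at t. \<forall>x\<in>UNIV. pds [i] (\<lambda>x. (f s x - f t x) /\<^sub>R (s - t)) x = (pd i (f s) x - pd i (f t) x) / (s - t)"
    by eventually_elim (intro ballI e)
  have "pds [i] (f' t) x = pd i (f' t) x" for x by simp
  then have "uniform_limit UNIV (\<lambda>s. pds [i] (\<lambda>x. (f s x - f t x) /\<^sub>R (s - t))) (pds [i] (f' t)) (at t)
    \<longleftrightarrow> uniform_limit UNIV (\<lambda>s x. (pd i (f s) x - pd i (f t) x) / (s - t)) (pd i (f' t)) (at t)"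
    by (rule uniform_limit_cong[OF ev])
  from iffD1[OF this u] show ?thesis .
qed

lemma C1_C1p_pd_has_derivative:
  fixes f :: "real \<Rightarrow> real ^ 'n \<Rightarrow> real"
  assumes f: "C1_Ck_deriv I 1 f f'" and I: "open I" "t \<in> I"
  shows "((\<lambda>s. pd i (f s) x) has_vector_derivative pd i (f' t) x) (at t)"
proof (rule has_vector_derivative_quotient)
  show "((\<lambda>s. (pd i (f s) x - pd i (f t) x) /\<^sub>R (s - t)) \<longlongrightarrow> pd i (f' t) x) (at t)"
    unfolding scaleR_inverse_eq_divide
    by (rule tendsto_uniform_limitI[OF C1_C1p_quotient_gradient[OF assms] UNIV_I])
qed

text \<open>The density \<open>\<rho>\<^sup>\<epsilon>\<close> is continuous in time with values in \<open>L^1\<close> and its gradient is bounded in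
  \<open>L^1\<close>, so the gradient is weakly continuous in time when tested with uniform limits of gradients.\<close>

lemma weakly_continuous_pairing:
  fixes g :: "real \<Rightarrow> real ^ 'n \<Rightarrow> real ^ 'n" and Z :: "real ^ 'n \<Rightarrow> real ^ 'n"
  assumes gi: "\<And>s. 0 \<le> s \<Longrightarrow> integrable tor (g s)" and C: "\<And>s. 0 \<le> s \<Longrightarrow> (LINT x|tor. norm (g s x)) \<le> C"
    and Z: "continuous_on torus_cell Z"
    and approx: "\<And>e. 0 < e \<Longrightarrow> \<exists>F. continuous_on torus_cell F \<and> continuous_on {0..} (\<lambda>s. LINT x|tor. g s x \<bullet> F x)
      \<and> (\<forall>x\<in>torus_cell. norm (F x - Z x) \<le> e)"
  shows "continuous_on {0..} (\<lambda>s. LINT x|tor. g s x \<bullet> Z x)"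
  unfolding continuous_on_iff
proof (intro ballI allI impI)
  fix t e :: real assume t: "t \<in> {0..}" and e: "0 < e"
  have "0 \<le> (LINT x|tor. norm (g 0 x))" by simp
  also have "\<dots> \<le> C" by (rule C) simp
  finally have C0: "0 \<le> C" .
  define e1 where "e1 = e / (4 * (C + 1))"
  have e1p: "0 < e1" using e C0 by (simp add: e1_def)
  have "e1 * C \<le> e1 * (C + 1)" using e1p by simp
  also have "\<dots> = e / 4"
  proof -
    have "C + 1 \<noteq> 0" using C0 by linarith
    then show ?thesis unfolding e1_def by (simp add: divide_simps)
  qed
  finally have e1: "0 < e1" "e1 * C \<le> e / 4" using e1p by blast+
  obtain F where F: "continuous_on torus_cell F" "continuous_on {0..} (\<lambda>s. LINT x|tor. g s x \<bullet> F x)"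
    "\<And>x. x \<in> torus_cell \<Longrightarrow> norm (F x - Z x) \<le> e1" using approx[OF e1(1)] by blast
  have close: "\<bar>(LINT x|tor. g s x \<bullet> F x) - (LINT x|tor. g s x \<bullet> Z x)\<bar> \<le> e / 4" if s: "0 \<le> s" for s
  proof -
    have "(LINT x|tor. g s x \<bullet> F x) - (LINT x|tor. g s x \<bullet> Z x) = (LINT x|tor. g s x \<bullet> (F x - Z x))"
      unfolding inner_diff_right
      by (rule Bochner_Integration.integral_diff[symmetric, OF integrable_bounded_inner[OF gi[OF s] F(1)] integrable_bounded_inner[OF gi[OF s] Z]])
    also have "\<bar>\<dots>\<bar> \<le> e1 * (LINT x|tor. norm (g s x))"
      by (rule integral_abs_le[OF gi[OF s] continuous_imp_measurable_tor[OF continuous_on_diff[OF F(1) Z]] F(3)])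
    also have "\<dots> \<le> e1 * C" using C[OF s] e1 by (intro mult_left_mono) auto
    finally show ?thesis using e1(2) by linarith
  qed
  have "0 < e / 4" using e by simp
  then obtain d where d: "0 < d" "\<And>s. s \<in> {0..} \<Longrightarrow> dist s t < d \<Longrightarrow>
    dist (LINT x|tor. g s x \<bullet> F x) (LINT x|tor. g t x \<bullet> F x) < e / 4"
    using F(2) t unfolding continuous_on_iff by blast
  show "\<exists>d>0. \<forall>s\<in>{0..}. dist s t < d \<longrightarrow> dist (LINT x|tor. g s x \<bullet> Z x) (LINT x|tor. g t x \<bullet> Z x) < e"
  proof (intro exI[of _ d] conjI ballI impI d(1))
    fix s assume s: "s \<in> {0..}" "dist s t < d"
    show "dist (LINT x|tor. g s x \<bullet> Z x) (LINT x|tor. g t x \<bullet> Z x) < e"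
    proof -
      have st: "0 \<le> s" "0 \<le> t" using s t by auto
      show ?thesis
        using d(2)[OF s] close[OF st(1)] close[OF st(2)] e unfolding dist_real_def by linarith
    qed
  qed
qed

lemma pd_pds_commute_nth:
  fixes f :: "real ^ 'n \<Rightarrow> real ^ 'm"
  assumes f: "Ck_torus (Suc (Suc 0)) f"
  shows "pd i (\<lambda>x. f x $ k) x = pds [i] f x $ k"
    and "pd j (pd i (\<lambda>x. f x $ k)) x = pds [j, i] f x $ k"
proof -
  have d: "f differentiable (at x)" "pd i f differentiable (at x)" for x
    using f by (auto simp: Ck_torus_def)
  show "pd i (\<lambda>x. f x $ k) x = pds [i] f x $ k" by (simp add: pd_nth(1)[OF d(1)])
  have "pd i (\<lambda>x. f x $ k) = (\<lambda>x. pd i f x $ k)" by (rule ext) (rule pd_nth(1)[OF d(1)])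
  then show "pd j (pd i (\<lambda>x. f x $ k)) x = pds [j, i] f x $ k" by (simp add: pd_nth(1)[OF d(2)])
qed

section \<open>The classical solution: joint continuity, uniform bounds, time derivatives\<close>

locale euler_solution =
  fixes T \<gamma> :: real and \<rho> :: "real \<Rightarrow> real ^ 'n \<Rightarrow> real" and u :: "real \<Rightarrow> real ^ 'n \<Rightarrow> real ^ 'n"
  assumes T: "0 < T" and \<gamma>: "1 < \<gamma>"
    and euler: "euler_classical (\<lambda>r. r powr \<gamma>) T \<rho> u"
    and \<rho>_C3: "C0_Ck {0..T} 3 \<rho>" and \<rho>_C1: "C1_Ck {0<..<T} 1 \<rho>"
    and \<rho>_pos: "\<And>t x. t \<in> {0..T} \<Longrightarrow> 0 < \<rho> t x"
    and u_C2: "C0_Ck {0..T} 2 u" and u_C1: "C1_Ck {0<..<T} 0 u"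
begin

lemma state: "t \<in> {0..T} \<Longrightarrow> smooth_state (\<rho> t) (u t)"
  using \<rho>_C3 u_C2 \<rho>_pos by unfold_locales (auto simp: C0_Ck_def eval_nat_numeral)

abbreviation "S \<equiv> {0..T} \<times> (UNIV :: (real ^ 'n) set)"

lemma \<rho>_joint: "length l \<le> 3 \<Longrightarrow> continuous_on S (\<lambda>z. pds l (\<rho> (fst z)) (snd z))"
  by (rule C0_Ck_joint_continuous[OF \<rho>_C3])

lemma u_joint: "length l \<le> 2 \<Longrightarrow> continuous_on S (\<lambda>z. pds l (u (fst z)) (snd z))"
  by (rule C0_Ck_joint_continuous[OF u_C2])

lemma joint_rho: "continuous_on S (\<lambda>z. \<rho> (fst z) (snd z))"
  using \<rho>_joint[of "[]"] by simp

lemma joint_u: "continuous_on S (\<lambda>z. u (fst z) (snd z))"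
  using u_joint[of "[]"] by simp

lemma joint_grad: "continuous_on S (\<lambda>z. grad (\<rho> (fst z)) (snd z))"
  unfolding grad_def using \<rho>_joint[of "[_]"] by (intro continuous_on_vec_lambda) simp

lemma joint_lap: "continuous_on S (\<lambda>z. lap (\<rho> (fst z)) (snd z))"
  unfolding lap_def using \<rho>_joint[of "[_, _]"] by (intro continuous_intros) simp

text \<open>The highest derivative of the density that occurs; it uses up all three derivatives
  assumed for \<rho>.\<close>

lemma joint_grad_lap: "continuous_on S (\<lambda>z. grad (lap (\<rho> (fst z))) (snd z))"
  unfolding grad_def
proof (intro continuous_on_vec_lambda)
  fix j
  have "continuous_on S (\<lambda>z. \<Sum>i\<in>UNIV. pds [i, j, i] (\<rho> (fst z)) (snd z))"
    by (intro continuous_on_sum \<rho>_joint) simp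
  then show "continuous_on S (\<lambda>z. pd j (lap (\<rho> (fst z))) (snd z))"
    by (rule continuous_on_eq) (auto simp: smooth_state.pd_lap[OF state])
qed

lemma u_torus: "t \<in> {0..T} \<Longrightarrow> Ck_torus (Suc (Suc 0)) (u t)"
  by (rule smooth_state.U2[OF state])

lemma joint_J: "continuous_on S (\<lambda>z. jacobian (u (fst z)) (at (snd z)))"
proof -
  have "continuous_on S (\<lambda>z. (\<chi> i j. pds [j] (u (fst z)) (snd z) $ i) :: real ^ 'n ^ 'n)"
    by (intro continuous_on_vec_lambda continuous_intros u_joint) simp
  then show ?thesis
    by (rule continuous_on_eq)
      (auto simp: vec_eq_iff smooth_state.J_nth[OF state] pd_pds_commute_nth(1)[OF u_torus])
qed

lemma joint_d: "continuous_on S (\<lambda>z. div_vec (u (fst z)) (snd z))"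
proof -
  have "continuous_on S (\<lambda>z. \<Sum>i\<in>UNIV. pds [i] (u (fst z)) (snd z) $ i)"
    by (intro continuous_on_sum continuous_intros u_joint) simp
  then show ?thesis
    by (rule continuous_on_eq) (auto simp: div_vec_def pd_pds_commute_nth(1)[OF u_torus])
qed

lemma joint_grad_d: "continuous_on S (\<lambda>z. grad (div_vec (u (fst z))) (snd z))"
  unfolding grad_def
proof (intro continuous_on_vec_lambda)
  fix j
  have "continuous_on S (\<lambda>z. \<Sum>i\<in>UNIV. pds [i, j] (u (fst z)) (snd z) $ i)"
    by (intro continuous_on_sum continuous_intros u_joint) simp
  then show "continuous_on S (\<lambda>z. pd j (div_vec (u (fst z))) (snd z))"
    by (rule continuous_on_eq) (auto simp: smooth_state.pd_d[OF state] pd_pds_commute_nth(2)[OF u_torus])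
qed

lemma joint_powr: "continuous_on S (\<lambda>z. \<rho> (fst z) (snd z) powr a)"
  by (intro continuous_on_powr joint_rho continuous_on_const) (auto simp: less_imp_neq[OF \<rho>_pos, symmetric])

lemmas joint = joint_rho joint_u joint_grad joint_lap joint_grad_lap joint_J joint_d joint_grad_d joint_powr

lemma joint_cell: "continuous_on S (\<lambda>z. F (fst z) (snd z)) \<Longrightarrow> I \<subseteq> {0..T} \<Longrightarrow> continuous_on (I \<times> torus_cell) (\<lambda>(t, x). F t x)"
  unfolding split_beta by (erule continuous_on_subset) auto

lemma joint_slice: "continuous_on S (\<lambda>z. F (fst z) (snd z)) \<Longrightarrow> t \<in> {0..T} \<Longrightarrow> continuous_on torus_cell (F t)"
  by (rule continuous_on_slice[OF joint_cell]) auto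

lemma matvec_joint:
  fixes A :: "'a::topological_space \<Rightarrow> real ^ 'n ^ 'n"
  assumes "continuous_on X A" "continuous_on X b"
  shows "continuous_on X (\<lambda>x. A x *v b x)"
  unfolding matrix_vector_mult_def by (intro continuous_intros continuous_on_vec_lambda assms)

lemma quadratic_form_bound:
  fixes A :: "real ^ 'n ^ 'n"
  shows "\<bar>w \<bullet> (A *v w)\<bar> \<le> (\<Sum>i\<in>UNIV. \<Sum>j\<in>UNIV. \<bar>A $ i $ j\<bar>) * (norm w)\<^sup>2"
proof -
  have "\<bar>w \<bullet> (A *v w)\<bar> \<le> (\<Sum>i\<in>UNIV. \<Sum>j\<in>UNIV. \<bar>w $ i * (A $ i $ j * w $ j)\<bar>)"
    unfolding inner_matrix_sum by (intro order_trans[OF sum_abs] sum_mono) simp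
  also have "\<dots> \<le> (\<Sum>i\<in>UNIV. \<Sum>j\<in>UNIV. \<bar>A $ i $ j\<bar> * (norm w)\<^sup>2)"
  proof (intro sum_mono)
    fix i j
    have "\<bar>w $ i\<bar> * \<bar>w $ j\<bar> \<le> norm w * norm w"
      by (intro mult_mono component_le_norm_cart) auto
    then have "\<bar>A $ i $ j\<bar> * (\<bar>w $ i\<bar> * \<bar>w $ j\<bar>) \<le> \<bar>A $ i $ j\<bar> * (norm w)\<^sup>2"
      unfolding power2_eq_square by (intro mult_left_mono) auto
    then show "\<bar>w $ i * (A $ i $ j * w $ j)\<bar> \<le> \<bar>A $ i $ j\<bar> * (norm w)\<^sup>2"
      by (simp add: abs_mult mult_ac)
  qed
  finally show ?thesis by (simp add: sum_distrib_right)
qed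

text \<open>Joint continuity up to both end points bounds the sum of all relevant quantities on the
  compact set \<open>{0..T} \<times> torus_cell\<close>. The bound involves the classical solution
  alone, whence its independence of \<epsilon>.\<close>

lemma uniform_bounds:
  obtains K where "0 \<le> K"
    "\<And>t (x :: real ^ 'n) w. t \<in> {0..T} \<Longrightarrow> x \<in> torus_cell \<Longrightarrow> \<bar>w \<bullet> (jacobian (u t) (at x) *v w)\<bar> \<le> K * (norm w)\<^sup>2"
    "\<And>t (x :: real ^ 'n). t \<in> {0..T} \<Longrightarrow> x \<in> torus_cell \<Longrightarrow> \<bar>div_vec (u t) x\<bar> \<le> K"
    "\<And>t (x :: real ^ 'n). t \<in> {0..T} \<Longrightarrow> x \<in> torus_cell \<Longrightarrow> norm (grad (div_vec (u t)) x) \<le> K"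
    "\<And>t (x :: real ^ 'n). t \<in> {0..T} \<Longrightarrow> x \<in> torus_cell \<Longrightarrow> norm (grad (lap (\<rho> t)) x) \<le> K"
proof -
  let ?Q = "\<lambda>t x. (\<Sum>i\<in>UNIV. \<Sum>j\<in>UNIV. \<bar>jacobian (u t) (at x) $ i $ j\<bar>) + \<bar>div_vec (u t) x\<bar>
    + norm (grad (div_vec (u t)) x) + norm (grad (lap (\<rho> t)) x)"
  have "continuous_on ({0..T} \<times> torus_cell) (\<lambda>(t, x). ?Q t x)"
    by (rule joint_cell) (intro continuous_intros joint, simp)
  moreover have "compact ({0..T} \<times> (torus_cell :: (real ^ 'n) set))" by (intro compact_Times compact_torus_cell) simp
  ultimately have "bounded ((\<lambda>(t, x). ?Q t x) ` ({0..T} \<times> torus_cell))"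
    by (intro compact_imp_bounded compact_continuous_image)
  then obtain K where K: "\<And>t (x :: real ^ 'n). t \<in> {0..T} \<Longrightarrow> x \<in> torus_cell \<Longrightarrow> \<bar>?Q t x\<bar> \<le> K"
    by (fastforce simp: bounded_iff)
  have s: "0 \<le> (\<Sum>i\<in>UNIV. \<Sum>j\<in>UNIV. \<bar>jacobian (u t) (at x) $ i $ j\<bar>)" for t and x :: "real ^ 'n" by (intro sum_nonneg) simp
  have K': "(\<Sum>i\<in>UNIV. \<Sum>j\<in>UNIV. \<bar>jacobian (u t) (at x) $ i $ j\<bar>) \<le> K" "\<bar>div_vec (u t) x\<bar> \<le> K"
    "norm (grad (div_vec (u t)) x) \<le> K" "norm (grad (lap (\<rho> t)) x) \<le> K" "0 \<le> K"
    if "t \<in> {0..T}" "x \<in> torus_cell" for t and x :: "real ^ 'n"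
  proof -
    have q: "?Q t x \<le> K" using K[OF that] by (meson abs_le_D1)
    note nn = s[of t x] abs_ge_zero[of "div_vec (u t) x"] norm_ge_zero[of "grad (div_vec (u t)) x"] norm_ge_zero[of "grad (lap (\<rho> t)) x"]
    show "(\<Sum>i\<in>UNIV. \<Sum>j\<in>UNIV. \<bar>jacobian (u t) (at x) $ i $ j\<bar>) \<le> K" "\<bar>div_vec (u t) x\<bar> \<le> K"
    "norm (grad (div_vec (u t)) x) \<le> K" "norm (grad (lap (\<rho> t)) x) \<le> K" "0 \<le> K"
      using q nn by linarith+
  qed
  have "(0 :: real ^ 'n) \<in> torus_cell" by (simp add: torus_cell_def mem_box_cart)
  then have K0: "0 \<le> K" using K'(5)[of 0] T by auto
  show ?thesis
  proof (rule that[OF K0 _ K'(2-4)])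
    fix t and x w :: "real ^ 'n" assume "t \<in> {0..T}" "x \<in> torus_cell"
    then have "(\<Sum>i\<in>UNIV. \<Sum>j\<in>UNIV. \<bar>jacobian (u t) (at x) $ i $ j\<bar>) * (norm w)\<^sup>2 \<le> K * (norm w)\<^sup>2"
      by (intro mult_right_mono K') auto
    then show "\<bar>w \<bullet> (jacobian (u t) (at x) *v w)\<bar> \<le> K * (norm w)\<^sup>2"
      using quadratic_form_bound[of w "jacobian (u t) (at x)"] by linarith
  qed
qed

subsection \<open>Time derivatives\<close>

text \<open>Given by the mass equation instead of as a derivative, so it makes sense at both end
  times and inherits its continuity from the spatial regularity.\<close>

definition \<rho>_t :: "real \<Rightarrow> real ^ 'n \<Rightarrow> real" where
  "\<rho>_t t x = - div_vec (\<lambda>y. \<rho> t y *\<^sub>R u t y) x"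

text \<open>The velocity equation in non-conservative form,
  \<open>u_t + (u \<cdot> \<nabla>) u = - \<nabla> h'(\<rho>)\<close>; the scalar factor is the
  second derivative of \<open>h\<close>.\<close>

definition u_t :: "real \<Rightarrow> real ^ 'n \<Rightarrow> real ^ 'n" where
  "u_t t x = - (jacobian (u t) (at x) *v u t x) - (\<gamma> * ((\<gamma> - 1) * \<rho> t x powr (\<gamma> - 1 - 1))) *\<^sub>R grad (\<rho> t) x"

text \<open>\<open>C1_Ck\<close> asserts only that some derivative exists; the mass equation
  identifies it with \<open>\<rho>_t\<close> on the open interval.\<close>

lemma \<rho>_t_C1: "\<exists>\<rho>'. C1_Ck_deriv {0<..<T} 1 \<rho> \<rho>' \<and> (\<forall>t\<in>{0<..<T}. \<rho>' t = \<rho>_t t)"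
proof -
  obtain \<rho>' where \<rho>': "C1_Ck_deriv {0<..<T} 1 \<rho> \<rho>'" using \<rho>_C1 by (auto simp: C1_Ck_def)
  have "\<rho>' t x = \<rho>_t t x" if t: "t \<in> {0<..<T}" for t x
  proof -
    have "((\<lambda>s. \<rho> s x) has_vector_derivative \<rho>' t x) (at t)"
      by (rule C1_Ck_has_derivative[OF \<rho>' _ t]) simp
    then have "deriv (\<lambda>s. \<rho> s x) t = \<rho>' t x"
      by (intro DERIV_imp_deriv) (simp add: has_real_derivative_iff_has_vector_derivative)
    moreover have "deriv (\<lambda>s. \<rho> s x) t + div_vec (\<lambda>y. \<rho> t y *\<^sub>R u t y) x = 0"
      using euler t unfolding euler_classical_def by blast
    ultimately show ?thesis unfolding \<rho>_t_def by linarith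
  qed
  then show ?thesis using \<rho>' by blast
qed

lemma \<rho>_t_eq: "t \<in> {0..T} \<Longrightarrow> \<rho>_t t x = - (u t x \<bullet> grad (\<rho> t) x + \<rho> t x * div_vec (u t) x)"
  by (simp add: \<rho>_t_def smooth_state.div_PU[OF state])

lemma has_derivative_\<rho>: "t \<in> {0<..<T} \<Longrightarrow> ((\<lambda>s. \<rho> s x) has_vector_derivative \<rho>_t t x) (at t)"
proof -
  assume t: "t \<in> {0<..<T}"
  obtain \<rho>' where \<rho>': "C1_Ck_deriv {0<..<T} 1 \<rho> \<rho>'" "\<forall>t\<in>{0<..<T}. \<rho>' t = \<rho>_t t" using \<rho>_t_C1 by blast
  from C1_Ck_has_derivative[OF \<rho>'(1) open_greaterThanLessThan t, of x] bspec[OF \<rho>'(2) t]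
  show ?thesis by (simp only:)
qed

lemma grad_\<rho>_t: "t \<in> {0..T} \<Longrightarrow> grad (\<rho>_t t) x = - grad (div_vec (\<lambda>y. \<rho> t y *\<^sub>R u t y)) x"
  using pd_uminus[OF C1pD(2)[OF smooth_state.C1p_div_PU[OF state]]]
  by (simp add: grad_def vec_eq_iff \<rho>_t_def[abs_def])

lemma has_derivative_grad_\<rho>:
  assumes t: "t \<in> {0<..<T}"
  shows "((\<lambda>s. grad (\<rho> s) x) has_vector_derivative grad (\<rho>_t t) x) (at t)"
proof -
  obtain \<rho>' where \<rho>': "C1_Ck_deriv {0<..<T} 1 \<rho> \<rho>'" "\<And>t. t \<in> {0<..<T} \<Longrightarrow> \<rho>' t = \<rho>_t t" using \<rho>_t_C1 by blast
  have c: "((\<lambda>s. pd i (\<rho> s) x) has_derivative (\<lambda>h. h * pd i (\<rho>_t t) x)) (at t)" for i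
    using C1_C1p_pd_has_derivative[OF \<rho>'(1) _ t, of i x] \<rho>'(2)[OF t] by (simp add: has_vector_derivative_def)
  have "((\<lambda>s. grad (\<rho> s) x) has_derivative (\<lambda>h. h *\<^sub>R grad (\<rho>_t t) x)) (at t)"
    unfolding has_derivative_componentwise_within[of "\<lambda>s. grad (\<rho> s) x"]
    using c by (auto simp: Basis_vec_def inner_axis grad_def)
  then show ?thesis by (simp add: has_vector_derivative_def)
qed

lemma joint_\<rho>_t: "continuous_on S (\<lambda>z. \<rho>_t (fst z) (snd z))"
proof -
  have "continuous_on S (\<lambda>z. - (u (fst z) (snd z) \<bullet> grad (\<rho> (fst z)) (snd z) + \<rho> (fst z) (snd z) * div_vec (u (fst z)) (snd z)))"
    by (intro continuous_intros joint)
  then show ?thesis by (rule continuous_on_eq) (auto simp: \<rho>_t_eq)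
qed

lemma joint_grad_\<rho>_t: "continuous_on ({0<..<T} \<times> UNIV) (\<lambda>z. grad (\<rho>_t (fst z)) (snd z))"
  unfolding grad_def
proof (intro continuous_on_vec_lambda)
  fix i
  obtain \<rho>' where \<rho>': "C1_Ck_deriv {0<..<T} 1 \<rho> \<rho>'" "\<And>t. t \<in> {0<..<T} \<Longrightarrow> \<rho>' t = \<rho>_t t" using \<rho>_t_C1 by blast
  have "C0_Ck {0<..<T} 1 \<rho>'" using \<rho>'(1) by (simp add: C1_Ck_deriv_def)
  from C0_Ck_joint_continuous[OF this, of "[i]"]
  have "continuous_on ({0<..<T} \<times> UNIV) (\<lambda>z. pd i (\<rho>' (fst z)) (snd z))" by simp
  then show "continuous_on ({0<..<T} \<times> UNIV) (\<lambda>z. pd i (\<rho>_t (fst z)) (snd z))"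
    by (rule continuous_on_eq) (auto simp: \<rho>'(2))
qed

lemma joint_u_t: "continuous_on S (\<lambda>z. u_t (fst z) (snd z))"
  unfolding u_t_def by (intro continuous_intros matvec_joint joint)

text \<open>Grouping each entry as \<open>u t y $ i * (\<rho> t y * u t y $ j)\<close> separates the
  mass flux, which the mass equation cancels afterwards.\<close>

lemma div_mat_momentum:
  assumes t: "t \<in> {0..T}"
  shows "div_mat (\<lambda>y. \<rho> t y *\<^sub>R outer (u t y) (u t y)) x
    = div_vec (\<lambda>y. \<rho> t y *\<^sub>R u t y) x *\<^sub>R u t x + \<rho> t x *\<^sub>R (jacobian (u t) (at x) *v u t x)"
proof -
  interpret smooth_state "\<rho> t" "u t" by (rule state[OF t])
  have PU: "C1p (\<lambda>y. \<rho> t y * u t y $ j)" for j by (intro C1p_mult C1p_P C1p_U)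
  have p: "pd j (\<lambda>y. u t y $ i * (\<rho> t y * u t y $ j)) x = u t x $ i * pd j (\<lambda>y. \<rho> t y * u t y $ j) x + pd j (Uc i) x * (\<rho> t x * u t x $ j)" for i j
    by (rule pd_mult) (rule C1pD(2)[OF C1p_U(2)] C1pD(2)[OF PU])+
  have o: "(\<lambda>y. (\<rho> t y *\<^sub>R outer (u t y) (u t y)) $ i $ j) = (\<lambda>y. u t y $ i * (\<rho> t y * u t y $ j))" for i j
    by (auto simp: outer_def)
  show ?thesis
    unfolding vec_eq_iff
  proof
    fix i
    have "div_mat (\<lambda>y. \<rho> t y *\<^sub>R outer (u t y) (u t y)) x $ i
      = (\<Sum>j\<in>UNIV. u t x $ i * pd j (\<lambda>y. \<rho> t y * u t y $ j) x) + (\<Sum>j\<in>UNIV. \<rho> t x * (pd j (Uc i) x * u t x $ j))"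
      unfolding div_mat_def vec_lambda_beta o p sum.distrib by (simp only: mult.left_commute)
    then show "div_mat (\<lambda>y. \<rho> t y *\<^sub>R outer (u t y) (u t y)) x $ i
      = (div_vec (\<lambda>y. \<rho> t y *\<^sub>R u t y) x *\<^sub>R u t x + \<rho> t x *\<^sub>R (jacobian (u t) (at x) *v u t x)) $ i"
      by (simp add: div_vec_def matrix_vector_mult_def J_nth mult.commute flip: sum_distrib_left)
  qed
qed

text \<open>The momentum equation minus \<open>u\<close> times the mass equation is \<rho> times the
  velocity equation, and \<rho> is positive.\<close>

lemma has_derivative_u:
  assumes t: "t \<in> {0<..<T}"
  shows "((\<lambda>s. u s x) has_vector_derivative u_t t x) (at t)"
proof -
  interpret smooth_state "\<rho> t" "u t" by (rule state) (use t in simp)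
  have t': "t \<in> {0..T}" using t by simp
  obtain u' where u': "C1_Ck_deriv {0<..<T} 0 u u'" using u_C1 by (auto simp: C1_Ck_def)
  have du: "((\<lambda>s. u s x) has_vector_derivative u' t x) (at t)"
    by (rule C1_Ck_has_derivative[OF u' _ t]) simp
  have "((\<lambda>s. \<rho> s x *\<^sub>R u s x) has_vector_derivative (\<rho> t x *\<^sub>R u' t x + \<rho>_t t x *\<^sub>R u t x)) (at t)"
    using has_vector_derivative_scaleR[OF _ du, of "\<lambda>s. \<rho> s x" "\<rho>_t t x"] has_derivative_\<rho>[OF t, of x]
    by (simp add: has_real_derivative_iff_has_vector_derivative)
  then have vd: "vector_derivative (\<lambda>s. \<rho> s x *\<^sub>R u s x) (at t) = \<rho> t x *\<^sub>R u' t x + \<rho>_t t x *\<^sub>R u t x"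
    by (rule vector_derivative_at)
  have eu: "vector_derivative (\<lambda>s. \<rho> s x *\<^sub>R u s x) (at t) + div_mat (\<lambda>y. \<rho> t y *\<^sub>R outer (u t y) (u t y)) x
       = - (\<rho> t x *\<^sub>R grad (\<lambda>y. deriv (\<lambda>r. r powr \<gamma>) (\<rho> t y)) x)"
    using euler t unfolding euler_classical_def by blast
  have gr: "grad (\<lambda>y. deriv (\<lambda>r. r powr \<gamma>) (\<rho> t y)) x = (\<gamma> * ((\<gamma> - 1) * \<rho> t x powr (\<gamma> - 1 - 1))) *\<^sub>R grad (\<rho> t) x"
  proof -
    have "(\<lambda>y. deriv (\<lambda>r. r powr \<gamma>) (\<rho> t y)) = (\<lambda>y. \<gamma> * \<rho> t y powr (\<gamma> - 1))"
      by (simp add: deriv_powr P_pos)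
    moreover have "pd i (\<lambda>y. \<gamma> * \<rho> t y powr (\<gamma> - 1)) x = \<gamma> * ((\<gamma> - 1) * \<rho> t x powr (\<gamma> - 1 - 1)) * pd i (\<rho> t) x" for i
      by (rule pd_compose(1)[where F = "\<lambda>s. \<gamma> * s powr (\<gamma> - 1)"])
        (rule C1pD(2)[OF C1p_P(1)], rule DERIV_cmult, rule powr_derivative, rule P_pos)
    ultimately show ?thesis by (simp add: grad_def vec_eq_iff)
  qed
  let ?G = "(\<gamma> * ((\<gamma> - 1) * \<rho> t x powr (\<gamma> - 1 - 1))) *\<^sub>R grad (\<rho> t) x"
  have "\<rho> t x *\<^sub>R (u' t x + J x *v u t x + ?G)
    = (\<rho> t x *\<^sub>R u' t x + \<rho>_t t x *\<^sub>R u t x)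
      + (div_vec (\<lambda>y. \<rho> t y *\<^sub>R u t y) x *\<^sub>R u t x + \<rho> t x *\<^sub>R (J x *v u t x)) + \<rho> t x *\<^sub>R ?G"
    by (simp only: \<rho>_t_def scaleR_add_right scaleR_minus_left) simp
  also have "\<dots> = 0"
    using eu unfolding vd gr div_mat_momentum[OF t'] by (simp only:) simp
  finally have "\<rho> t x *\<^sub>R (u' t x + J x *v u t x + ?G) = 0" .
  then have "u' t x = u_t t x"
    using P_pos[of x] by (simp add: u_t_def add_eq_0_iff)
  then show ?thesis using du by simp
qed

text \<open>At interior times the mass has derivative 0, as the integral of a divergence; continuity
  extends the constancy to time 0.\<close>

lemma mass_conserved:
  assumes t: "t \<in> {0..<T}"
  shows "(LINT x|tor. \<rho> t x) = (LINT x|tor. \<rho> 0 x)"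
proof -
  have c: "continuous_on {0..t} (\<lambda>s. LINT x|tor. \<rho> s x)"
  proof -
    have "((\<lambda>s. LINT x|tor. 1 \<bullet> \<rho> s x) \<longlongrightarrow> (LINT x|tor. 1 \<bullet> \<rho> s0 x)) (at s0 within {0..T})" if "s0 \<in> {0..T}" for s0
      by (rule L1_cont_pairing[OF L1_cont_at_const that joint_cell[OF joint_rho]]) auto
    then have "continuous_on {0..T} (\<lambda>s. LINT x|tor. \<rho> s x)" by (simp add: continuous_on_def)
    then show ?thesis by (rule continuous_on_subset) (use t in auto)
  qed
  have D: "((\<lambda>s. LINT x|tor. \<rho> s x) has_real_derivative 0) (at s)" if s: "s \<in> {0<..<T}" for s
  proof -
    interpret smooth_state "\<rho> s" "u s" by (rule state) (use s in simp)
    have "((\<lambda>s. LINT x|tor. 1 \<bullet> \<rho> s x) has_real_derivative (LINT x|tor. 1 \<bullet> \<rho>_t s x)) (at s within {0<..<T})"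
      by (rule integral_pairing_derivative[OF _ _ s])
        (auto intro!: has_vector_derivative_at_within has_derivative_\<rho> joint_slice[OF joint_rho] joint_cell[OF joint_\<rho>_t])
    moreover have "(LINT x|tor. \<rho>_t s x) = 0"
      using integral_div_zero[of "\<lambda>i y. \<rho> s y * u s y $ i"] C1p_mult[OF C1p_P(1) C1p_U(2)]
      by (simp add: \<rho>_t_def div_vec_def)
    ultimately show ?thesis unfolding at_within_open[OF s open_greaterThanLessThan] by simp
  qed
  show ?thesis
  proof (cases "t = 0")
    case False
    then show ?thesis
      using t by (intro DERIV_isconst_end[OF _ c]) (auto intro: D)
  qed simp
qed

end

section \<open>Comparison of a weak solution with the classical solution\<close>

lemma integrable_scaleR_continuous:
  fixes f :: "real ^ 'n \<Rightarrow> real" and F :: "real ^ 'n \<Rightarrow> real ^ 'n"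
  assumes f: "integrable tor f" and F: "continuous_on torus_cell F"
  shows "integrable tor (\<lambda>x. f x *\<^sub>R F x)"
proof -
  obtain B where B: "0 \<le> B" "\<And>x. x \<in> torus_cell \<Longrightarrow> norm (F x) \<le> B"
    by (rule continuous_bounded_cell[OF F]) blast
  note [measurable] = borel_measurable_integrable[OF f] continuous_imp_measurable_tor[OF F]
  show ?thesis
  proof (rule Bochner_Integration.integrable_bound)
    show "integrable tor (\<lambda>x. B * f x)" using f by simp
    show "(\<lambda>x. f x *\<^sub>R F x) \<in> borel_measurable tor" by measurable
    have "norm (f x *\<^sub>R F x) \<le> norm (B * f x)" if "x \<in> torus_cell" for x
      using mult_left_mono[OF B(2)[OF that], of "\<bar>f x\<bar>"] B(1) by (simp add: abs_mult mult.commute)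
    then show "AE x in tor. norm (f x *\<^sub>R F x) \<le> norm (B * f x)" by (intro AE_I2) simp
  qed
qed

lemma integrable_scaleR_continuous':
  fixes g :: "real ^ 'n \<Rightarrow> real ^ 'n" and \<phi> :: "real ^ 'n \<Rightarrow> real"
  assumes g: "integrable tor g" and \<phi>: "continuous_on torus_cell \<phi>"
  shows "integrable tor (\<lambda>x. \<phi> x *\<^sub>R g x)"
proof -
  obtain B where B: "0 \<le> B" "\<And>x. x \<in> torus_cell \<Longrightarrow> norm (\<phi> x) \<le> B"
    by (rule continuous_bounded_cell[OF \<phi>]) blast
  note [measurable] = borel_measurable_integrable[OF g] continuous_imp_measurable_tor[OF \<phi>]
  show ?thesis
  proof (rule Bochner_Integration.integrable_bound)
    show "integrable tor (\<lambda>x. B *\<^sub>R g x)" using g by simp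
    show "(\<lambda>x. \<phi> x *\<^sub>R g x) \<in> borel_measurable tor" by measurable
    have "norm (\<phi> x *\<^sub>R g x) \<le> norm (B *\<^sub>R g x)" if "x \<in> torus_cell" for x
      using mult_right_mono[OF B(2)[OF that], of "norm (g x)"] B(1) by simp
    then show "AE x in tor. norm (\<phi> x *\<^sub>R g x) \<le> norm (B *\<^sub>R g x)" by (intro AE_I2) simp
  qed
qed

lemma integral_vec_nth:
  fixes F :: "'a \<Rightarrow> real ^ 'n"
  assumes "integrable M F"
  shows "(LINT x|M. F x) $ i = (LINT x|M. F x $ i)" "integrable M (\<lambda>x. F x $ i)"
  using integral_bounded_linear[OF bounded_linear_vec_nth assms]
    integrable_bounded_linear[OF bounded_linear_vec_nth assms] by simp_all

lemma weak_gradD: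
  assumes w: "weak_grad f g"
  shows "integrable tor f" "integrable tor g"
    "\<And>\<phi> i. C1p \<phi> \<Longrightarrow> (LINT x|tor. f x * pd i \<phi> x) = - (LINT x|tor. \<phi> x * g x $ i)"
proof -
  show f: "integrable tor f" and g: "integrable tor g"
    using w by (auto simp: weak_grad_def set_integrable_tor)
  fix \<phi> :: "real ^ 'a \<Rightarrow> real" and i assume \<phi>: "C1p \<phi>"
  have c: "continuous_on torus_cell (grad \<phi>)" "continuous_on torus_cell \<phi>"
    using grad_continuous_UNIV[OF \<phi>] C1pD(4)[OF \<phi>] continuous_on_subset by blast+
  have "(LINT x|tor. f x *\<^sub>R grad \<phi> x) = - (LINT x|tor. \<phi> x *\<^sub>R g x)"
    using w \<phi> by (simp add: weak_grad_def set_integral_tor)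
  then have "(LINT x|tor. f x *\<^sub>R grad \<phi> x) $ i = - ((LINT x|tor. \<phi> x *\<^sub>R g x) $ i)"
    by simp
  then show "(LINT x|tor. f x * pd i \<phi> x) = - (LINT x|tor. \<phi> x * g x $ i)"
    unfolding integral_vec_nth(1)[OF integrable_scaleR_continuous[OF f c(1)]]
      integral_vec_nth(1)[OF integrable_scaleR_continuous'[OF g c(2)]]
    by (simp add: grad_def)
qed

lemma weak_divD:
  assumes w: "weak_div F q"
  shows "integrable tor F" "integrable tor q"
    "\<And>\<phi>. C1p \<phi> \<Longrightarrow> (LINT x|tor. F x \<bullet> grad \<phi> x) = - (LINT x|tor. \<phi> x * q x)"
  using w by (auto simp: weak_div_def set_integrable_tor set_integral_tor)

text \<open>The fundamental lemma in each component. It reconciles the gradient of the weak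
  formulation with that of the energy, and identifies the initial gradient.\<close>

lemma weak_gradient_unique:
  fixes f :: "real ^ 'n \<Rightarrow> real"
  assumes g: "integrable tor g" "integrable tor g'"
    and w: "\<And>\<phi> i. C1p \<phi> \<Longrightarrow> (LINT x|tor. f x * pd i \<phi> x) = - (LINT x|tor. \<phi> x * g x $ i)"
    and w': "\<And>\<phi> i. C1p \<phi> \<Longrightarrow> (LINT x|tor. f x * pd i \<phi> x) = - (LINT x|tor. \<phi> x * g' x $ i)"
  shows "AE x in tor. g x = (g' x :: real ^ 'n)"
proof -
  have "AE x in tor. g x $ i - g' x $ i = 0" for i
  proof (rule fundamental_lemma)
    note gi = integral_vec_nth(2)[OF g(1), of i] and gi' = integral_vec_nth(2)[OF g(2), of i]
    show "integrable tor (\<lambda>x. g x $ i - g' x $ i)" using gi gi' by simp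
    fix \<phi> :: "real ^ 'n \<Rightarrow> real" assume \<phi>: "C1p \<phi>"
    have c: "continuous_on torus_cell \<phi>" using C1pD(4)[OF \<phi>] continuous_on_subset by blast
    have "(LINT x|tor. (g x $ i - g' x $ i) * \<phi> x) = (LINT x|tor. g x $ i * \<phi> x) - (LINT x|tor. g' x $ i * \<phi> x)"
      unfolding left_diff_distrib
      by (rule Bochner_Integration.integral_diff[OF integrable_bounded_mult[OF gi c] integrable_bounded_mult[OF gi' c]])
    also have "\<dots> = 0" using w[OF \<phi>, of i] w'[OF \<phi>, of i] by (simp add: mult.commute)
    finally show "(LINT x|tor. (g x $ i - g' x $ i) * \<phi> x) = 0" .
  qed
  then have "AE x in tor. \<forall>i. g x $ i - g' x $ i = 0" by (simp add: AE_all_countable)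
  then show ?thesis by eventually_elim (simp add: vec_eq_iff)
qed

text \<open>Two gradients occur because the weak formulation and the energy each provide one:
  \<open>g0\<close> is a weak gradient at almost every positive time, \<open>g\<close> at every time
  including 0. \<open>E_le\<close> is the consequence of the energy balance that dissipative and
  conservative solutions share.\<close>

locale ek_comparison = euler_solution T \<gamma> \<rho> u
  for T \<gamma> :: real and \<rho> :: "real \<Rightarrow> real ^ 'n \<Rightarrow> real" and u :: "real \<Rightarrow> real ^ 'n \<Rightarrow> real ^ 'n" +
  fixes \<epsilon> k :: real and r q :: "real \<Rightarrow> real ^ 'n \<Rightarrow> real" and v m g0 g :: "real \<Rightarrow> real ^ 'n \<Rightarrow> real ^ 'n"
  assumes \<epsilon>: "0 < \<epsilon>" and k: "0 < k" and mv: "m = (\<lambda>t x. r t x *\<^sub>R v t x)"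
    and weak: "EK_weak (\<lambda>s. s powr \<gamma>) (\<lambda>_. k) \<epsilon> r m g0 q"
    and gw: "\<And>t. 0 \<le> t \<Longrightarrow> weak_grad (r t) (g t)"
    and E_C0: "C0_L1 (\<lambda>t x. energy_density (\<lambda>s. s powr \<gamma>) (\<lambda>_. k) \<epsilon> (r t x) (m t x) (g t x))"
    and E_le: "\<And>t. 0 \<le> t \<Longrightarrow> (LINT x|tor. energy_density (\<lambda>s. s powr \<gamma>) (\<lambda>_. k) \<epsilon> (r t x) (m t x) (g t x))
      \<le> (LINT x|tor. energy_density (\<lambda>s. s powr \<gamma>) (\<lambda>_. k) \<epsilon> (r 0 x) (m 0 x) (g 0 x))"
    and init_r: "AE x in lborel. r 0 x = \<rho> 0 x" and init_m: "AE x in lborel. m 0 x = \<rho> 0 x *\<^sub>R u 0 x"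
begin

abbreviation "E t x \<equiv> energy_density (\<lambda>s. s powr \<gamma>) (\<lambda>_. k) \<epsilon> (r t x) (m t x) (g t x)"

definition "e t = (LINT x|tor. E t x)"

lemma r_C0: "C0_L1 r" and m_C0: "C0_L1 m"
  using weak by (auto simp: EK_weak_def)

lemma r_nonneg: "0 \<le> t \<Longrightarrow> AE x in tor. 0 \<le> r t x"
  using weak by (auto simp: EK_weak_def intro: AE_torI)

lemma ri: "0 \<le> t \<Longrightarrow> integrable tor (r t)" and mi: "0 \<le> t \<Longrightarrow> integrable tor (m t)"
  using C0_L1D(2)[OF r_C0] C0_L1D(2)[OF m_C0] by auto

lemmas gi = weak_gradD(2)[OF gw] and g_weak = weak_gradD(3)[OF gw]

lemma E_eq: "E t x = 1 / 2 * ((norm (m t x))\<^sup>2 / r t x) + r t x powr \<gamma> + \<epsilon> * k / 2 * (norm (g t x))\<^sup>2"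
  by (simp add: energy_density_def)

text \<open>Where the density is nonnegative, so are the three parts of the energy density, and each
  is dominated by a multiple of the integrable \<open>E t\<close>.\<close>

lemma energy_parts:
  assumes t: "0 \<le> t"
  shows "integrable tor (\<lambda>x. (norm (m t x))\<^sup>2 / r t x)" "integrable tor (\<lambda>x. r t x powr \<gamma>)"
    "integrable tor (\<lambda>x. (norm (g t x))\<^sup>2)"
proof -
  note Ei = C0_L1D(2)[OF E_C0 t]
  note [measurable] = borel_measurable_integrable[OF ri[OF t]] borel_measurable_integrable[OF mi[OF t]]
    borel_measurable_integrable[OF gi[OF t]]
  have nn: "0 \<le> \<epsilon> * k / 2 * (norm (g t x))\<^sup>2" for x using \<epsilon> k by simp
  have b: "(norm (m t x))\<^sup>2 / r t x \<le> 2 * E t x" "r t x powr \<gamma> \<le> E t x" "\<epsilon> * k / 2 * (norm (g t x))\<^sup>2 \<le> E t x"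
    "0 \<le> (norm (m t x))\<^sup>2 / r t x" "0 \<le> E t x" if "0 \<le> r t x" for x
  proof -
    have 1: "0 \<le> (norm (m t x))\<^sup>2 / r t x" "0 \<le> r t x powr \<gamma>" using that by simp_all
    show "0 \<le> (norm (m t x))\<^sup>2 / r t x" by (rule 1)
    have "a \<le> 2 * (1 / 2 * a + b + c)" if "0 \<le> b" "0 \<le> c" for a b c :: real using that by (simp add: distrib_left)
    from this[OF 1(2) nn[of x]] show "(norm (m t x))\<^sup>2 / r t x \<le> 2 * E t x" unfolding E_eq .
    show "r t x powr \<gamma> \<le> E t x" unfolding E_eq using 1 nn[of x] by linarith
    show "\<epsilon> * k / 2 * (norm (g t x))\<^sup>2 \<le> E t x" unfolding E_eq using 1 nn[of x] by linarith
    show "0 \<le> E t x" unfolding E_eq using 1 nn[of x] by linarith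
  qed
  show "integrable tor (\<lambda>x. (norm (m t x))\<^sup>2 / r t x)"
  proof (rule Bochner_Integration.integrable_bound)
    show "integrable tor (\<lambda>x. 2 * E t x)" using Ei by simp
    show "AE x in tor. norm ((norm (m t x))\<^sup>2 / r t x) \<le> norm (2 * E t x)"
      using r_nonneg[OF t]
    proof eventually_elim
      case (elim x)
      show ?case using b(1,4,5)[OF elim] by simp
    qed
  qed measurable
  show "integrable tor (\<lambda>x. r t x powr \<gamma>)"
  proof (rule Bochner_Integration.integrable_bound[OF Ei])
    show "AE x in tor. norm (r t x powr \<gamma>) \<le> norm (E t x)"
      using r_nonneg[OF t]
    proof eventually_elim
      case (elim x)
      show ?case using b(2,5)[OF elim] by simp
    qed
  qed measurable
  have "integrable tor (\<lambda>x. \<epsilon> * k / 2 * (norm (g t x))\<^sup>2)"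
  proof (rule Bochner_Integration.integrable_bound[OF Ei])
    show "AE x in tor. norm (\<epsilon> * k / 2 * (norm (g t x))\<^sup>2) \<le> norm (E t x)"
      using r_nonneg[OF t]
    proof eventually_elim
      case (elim x)
      show ?case using b(3,5)[OF elim] nn[of x] by simp
    qed
  qed measurable
  then have "integrable tor (\<lambda>x. 2 / (\<epsilon> * k) * (\<epsilon> * k / 2 * (norm (g t x))\<^sup>2))"
    by - (rule integrable_mult_right)
  moreover have "2 / (\<epsilon> * k) * (\<epsilon> * k / 2 * (norm (g t x))\<^sup>2) = (norm (g t x))\<^sup>2" for x
    using \<epsilon> k by simp
  ultimately show "integrable tor (\<lambda>x. (norm (g t x))\<^sup>2)" by (simp only:)
qed

text \<open>The bound may degenerate as \<epsilon> tends to 0. This is harmless: it serves to show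
  continuity in time for one fixed \<epsilon> and enters no constant of the final estimate.\<close>

lemma gradient_L1_bound:
  assumes t: "0 \<le> t"
  shows "(LINT x|tor. norm (g t x)) \<le> 1 + 2 / (\<epsilon> * k) * e 0"
proof -
  note p = energy_parts[OF t]
  have nn: "0 \<le> (LINT x|tor. (norm (m t x))\<^sup>2 / r t x)" "0 \<le> (LINT x|tor. r t x powr \<gamma>)"
    by (rule integral_nonneg_AE, use r_nonneg[OF t] in \<open>eventually_elim; simp\<close>) simp
  have ek: "0 < \<epsilon> * k" using \<epsilon> k by simp
  have "(LINT x|tor. norm (g t x)) \<le> (LINT x|tor. 1 + (norm (g t x))\<^sup>2)"
  proof (rule integral_mono)
    fix x
    show "norm (g t x) \<le> 1 + (norm (g t x))\<^sup>2"
      using sum_squares_bound[of 1 "norm (g t x)"] by simp (smt (verit) norm_ge_zero)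
  qed (use gi[OF t] p(3) in auto)
  also have "\<dots> = 1 + (LINT x|tor. (norm (g t x))\<^sup>2)" using p(3) by (simp add: measure_tor)
  also have "(LINT x|tor. (norm (g t x))\<^sup>2) \<le> 2 / (\<epsilon> * k) * e 0"
  proof -
    have "e t = 1 / 2 * (LINT x|tor. (norm (m t x))\<^sup>2 / r t x) + (LINT x|tor. r t x powr \<gamma>) + \<epsilon> * k / 2 * (LINT x|tor. (norm (g t x))\<^sup>2)"
    proof -
      have i: "integrable tor (\<lambda>x. 1 / 2 * ((norm (m t x))\<^sup>2 / r t x))" "integrable tor (\<lambda>x. \<epsilon> * k / 2 * (norm (g t x))\<^sup>2)"
        by (rule integrable_mult_right, rule p)+
      show ?thesis
        unfolding e_def E_eq Bochner_Integration.integral_add[OF Bochner_Integration.integrable_add[OF i(1) p(2)] i(2)]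
          Bochner_Integration.integral_add[OF i(1) p(2)] integral_mult_right_zero by (rule refl)
    qed
    then have "\<epsilon> * k / 2 * (LINT x|tor. (norm (g t x))\<^sup>2) \<le> e 0"
      using nn E_le[OF t] unfolding e_def by linarith
    then have "2 / (\<epsilon> * k) * (\<epsilon> * k / 2 * (LINT x|tor. (norm (g t x))\<^sup>2)) \<le> 2 / (\<epsilon> * k) * e 0"
      using ek by (intro mult_left_mono) auto
    then show ?thesis using \<epsilon> k by simp
  qed
  finally show ?thesis by simp
qed

lemma r_mass_balance:
  assumes "C1p \<phi>" "0 \<le> t" "t \<le> t'"
  shows "(LINT x|tor. r t' x * \<phi> x) - (LINT x|tor. r t x * \<phi> x) = (LINT s:{t<..t'}|lborel. LINT x|tor. m s x \<bullet> grad \<phi> x)"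
  by (rule mass_balance[OF r_C0 m_C0 _ assms]) (use weak in \<open>auto simp: EK_weak_def\<close>)

lemma mean_eq:
  assumes s: "0 \<le> s" and t: "t \<in> {0..<T}"
  shows "(LINT x|tor. r s x) = (LINT x|tor. \<rho> t x)"
proof -
  have "grad (\<lambda>x. 1 :: real) = (\<lambda>x :: real ^ 'n. 0)" by (simp add: grad_def[abs_def] pd_const zero_vec_def)
  then have "(LINT x|tor. r s x) = (LINT x|tor. r 0 x)"
    using r_mass_balance[OF C1p_const[of 1] _ s] by (simp add: set_lebesgue_integral_def)
  also have "\<dots> = (LINT x|tor. \<rho> 0 x)"
  proof (rule integral_cong_AE)
    show "AE x in tor. r 0 x = \<rho> 0 x" by (rule AE_torI[OF init_r])
    show "\<rho> 0 \<in> borel_measurable tor"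
      by (rule continuous_imp_measurable_tor[OF joint_slice[OF joint_rho]]) (use T in simp)
  qed (use ri[of 0] in auto)
  also have "\<dots> = (LINT x|tor. \<rho> t x)" by (rule mass_conserved[OF t, symmetric])
  finally show ?thesis .
qed

definition "A s x = outer (m s x) (m s x) /\<^sub>R r s x - stress (\<lambda>s. s powr \<gamma>) (\<lambda>_. k) \<epsilon> (r s x) (g0 s x) (q s x)"

lemma momentum:
  assumes \<phi>: "C1p \<phi>"
  shows "AE s in lborel. 0 \<le> s \<longrightarrow> integrable tor (\<lambda>x. A s x \<bullet> jacobian \<phi> (at x))"
    and "\<And>t t'. 0 \<le> t \<Longrightarrow> t \<le> t' \<Longrightarrow> set_integrable lborel {t<..t'} (\<lambda>s. LINT x|tor. A s x \<bullet> jacobian \<phi> (at x))"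
    and "\<And>t t'. 0 \<le> t \<Longrightarrow> t \<le> t' \<Longrightarrow> (LINT x|tor. m t' x \<bullet> \<phi> x) - (LINT x|tor. m t x \<bullet> \<phi> x)
      = (LINT s:{t<..t'}|lborel. LINT x|tor. A s x \<bullet> jacobian \<phi> (at x))"
proof -
  have w: "set_integrable lborel ({0..} \<times> torus_cell) (\<lambda>(t, x). m t x \<bullet> \<phi>' t x + A t x \<bullet> jacobian (\<phi> t) (at x)) \<and>
        - (LINT (t, x):{0..} \<times> torus_cell|lborel. m t x \<bullet> \<phi>' t x + A t x \<bullet> jacobian (\<phi> t) (at x))
        = (LINT x:torus_cell|lborel. m 0 x \<bullet> \<phi> 0 x)" if "test_fun \<phi> \<phi>'" for \<phi> \<phi>'
  proof -
    have "(\<lambda>(t, x). m t x \<bullet> \<phi>' t x + A t x \<bullet> jacobian (\<phi> t) (at x))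
      = (\<lambda>(t, x). m t x \<bullet> \<phi>' t x + (outer (m t x) (m t x) /\<^sub>R r t x) \<bullet> jacobian (\<phi> t) (at x)
                    - stress (\<lambda>s. s powr \<gamma>) (\<lambda>_. k) \<epsilon> (r t x) (g0 t x) (q t x) \<bullet> jacobian (\<phi> t) (at x))"
      by (simp add: A_def inner_diff_left add_diff_eq)
    then show ?thesis using weak that unfolding EK_weak_def Let_def by (simp only:)
  qed
  show "AE s in lborel. 0 \<le> s \<longrightarrow> integrable tor (\<lambda>x. A s x \<bullet> jacobian \<phi> (at x))"
    by (rule momentum_balance(1)[OF m_C0 w \<phi>])
  show "set_integrable lborel {t<..t'} (\<lambda>s. LINT x|tor. A s x \<bullet> jacobian \<phi> (at x))" if "0 \<le> t" "t \<le> t'" for t t'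
    by (rule momentum_balance(2)[OF m_C0 w \<phi> that])
  show "(LINT x|tor. m t' x \<bullet> \<phi> x) - (LINT x|tor. m t x \<bullet> \<phi> x)
      = (LINT s:{t<..t'}|lborel. LINT x|tor. A s x \<bullet> jacobian \<phi> (at x))" if "0 \<le> t" "t \<le> t'" for t t'
    by (rule momentum_balance(3)[OF m_C0 w \<phi> that])
qed

subsection \<open>The relative energy\<close>

text \<open>Expanding the relative energy leaves \<open>E\<close> plus terms at most linear in the
  weak solution. \<psi>0 is the coefficient of the density apart from the capillary one,
  \<open>cc\<close> contains only classical fields, and in \<open>X\<close> the cross term of the
  gradients has been integrated by parts. So \<open>X\<close> contains no derivative of the weak
  solution and can be followed in time through the balance laws.\<close>

definition "\<psi>0 t x = (u t x \<bullet> u t x) / 2 - \<gamma> * \<rho> t x powr (\<gamma> - 1)"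
definition "cc t x = (\<gamma> - 1) * \<rho> t x powr \<gamma> + \<epsilon> * k / 2 * (grad (\<rho> t) x \<bullet> grad (\<rho> t) x)"
definition "X s t = - (LINT x|tor. m s x \<bullet> u t x) + (LINT x|tor. r s x * \<psi>0 t x)
  + \<epsilon> * k * (LINT x|tor. r s x * lap (\<rho> t) x) + (LINT x|tor. cc t x)"

text \<open>The state of the weak solution at time \<open>s\<close> is compared with the classical solution frozen at
  time \<open>t\<close>, so that only time-independent test functions are needed.\<close>

definition "H s t x = rel_enthalpy (\<lambda>s. s powr \<gamma>) (r s x) (\<rho> t x) + r s x / 2 * (norm (v s x - u t x))\<^sup>2
  + \<epsilon> * k / 2 * (norm (g s x - grad (\<rho> t) x))\<^sup>2"

lemma joint_\<psi>0: "continuous_on S (\<lambda>z. \<psi>0 (fst z) (snd z))"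
  unfolding \<psi>0_def by (intro continuous_intros joint) simp

lemma joint_cc: "continuous_on S (\<lambda>z. cc (fst z) (snd z))"
  unfolding cc_def by (intro continuous_intros joint)

lemma gradient_pairing:
  assumes s: "0 \<le> s" and t: "t \<in> {0..T}"
  shows "(LINT x|tor. g s x \<bullet> grad (\<rho> t) x) = - (LINT x|tor. r s x * lap (\<rho> t) x)"
proof -
  interpret smooth_state "\<rho> t" "u t" by (rule state[OF t])
  show ?thesis
    using weak_gradient_vector_field[where \<Phi> = "\<lambda>i. pd i (\<rho> t)", OF gi[OF s] ri[OF s] g_weak[OF s] C1p_P(2)]
    by (simp add: grad_def lap_def)
qed

lemma relative_energy_eq:
  assumes s: "0 \<le> s" and t: "t \<in> {0..T}"
  shows "integrable tor (H s t)" "(LINT x|tor. H s t x) = e s + X s t"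
proof -
  note c = joint_slice[OF _ t]
  have p: "\<rho> t x powr (\<gamma> - 1) * \<rho> t x = \<rho> t x powr \<gamma>" for x
    using \<rho>_pos[OF t, of x] by (simp add: powr_diff)
  have Heq: "H s t x = E s x - m s x \<bullet> u t x + r s x * \<psi>0 t x - \<epsilon> * k * (g s x \<bullet> grad (\<rho> t) x) + cc t x" for x
  proof -
    have 1: "r s x / 2 * (norm (v s x - u t x))\<^sup>2
      = 1 / 2 * ((norm (m s x))\<^sup>2 / r s x) - m s x \<bullet> u t x + r s x * ((u t x \<bullet> u t x) / 2)"
      using kinetic_expand[of "m s x" "r s x" "v s x" "u t x"] mv by (simp add: dot_square_norm field_simps)
    have 2: "\<epsilon> * k / 2 * (norm (g s x - grad (\<rho> t) x))\<^sup>2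
      = \<epsilon> * k / 2 * (norm (g s x))\<^sup>2 - \<epsilon> * k * (g s x \<bullet> grad (\<rho> t) x) + \<epsilon> * k / 2 * (grad (\<rho> t) x \<bullet> grad (\<rho> t) x)"
      unfolding dot_square_norm[symmetric]
      by (simp add: inner_diff_left inner_diff_right inner_commute algebra_simps)
    have 3: "rel_enthalpy (\<lambda>s. s powr \<gamma>) (r s x) (\<rho> t x)
      = r s x powr \<gamma> - r s x * (\<gamma> * \<rho> t x powr (\<gamma> - 1)) + (\<gamma> - 1) * \<rho> t x powr \<gamma>"
      unfolding rel_enthalpy_powr[OF \<rho>_pos[OF t]] p[of x, symmetric] by (simp add: algebra_simps)
    show ?thesis unfolding H_def 1 2 3 E_eq \<psi>0_def cc_def by (simp add: algebra_simps)
  qed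
  have i: "integrable tor (\<lambda>x. E s x)" "integrable tor (\<lambda>x. m s x \<bullet> u t x)" "integrable tor (\<lambda>x. r s x * \<psi>0 t x)"
    "integrable tor (\<lambda>x. g s x \<bullet> grad (\<rho> t) x)" "integrable tor (cc t)"
    by (rule C0_L1D(2)[OF E_C0 s], rule integrable_bounded_inner[OF mi[OF s] c[OF joint_u]],
        rule integrable_bounded_mult[OF ri[OF s] c[OF joint_\<psi>0]],
        rule integrable_bounded_inner[OF gi[OF s] c[OF joint_grad]], rule continuous_imp_integrable_tor[OF c[OF joint_cc]])
  show "integrable tor (H s t)"
    unfolding Heq[abs_def] using i by simp
  have "(LINT x|tor. H s t x) = e s - (LINT x|tor. m s x \<bullet> u t x) + (LINT x|tor. r s x * \<psi>0 t x)
     - \<epsilon> * k * (LINT x|tor. g s x \<bullet> grad (\<rho> t) x) + (LINT x|tor. cc t x)"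
    unfolding Heq e_def using i by simp
  then show "(LINT x|tor. H s t x) = e s + X s t"
    unfolding gradient_pairing[OF s t] X_def by simp
qed

text \<open>Equal density and momentum give equal velocity because \<rho> is positive, and equal
  gradients because weak gradients are unique; hence the capillary part vanishes as well.\<close>

lemma initial_relative_energy: "e 0 + X 0 0 = 0"
proof -
  have t0: "0 \<in> {0..T}" using T by simp
  interpret smooth_state "\<rho> 0" "u 0" by (rule state[OF t0])
  have rm: "AE x in tor. r 0 x = \<rho> 0 x" "AE x in tor. m 0 x = \<rho> 0 x *\<^sub>R u 0 x"
    using init_r init_m by (auto intro: AE_torI)
  have "AE x in tor. g 0 x = grad (\<rho> 0) x"
  proof (rule weak_gradient_unique)
    show "integrable tor (g 0)" by (rule gi) simp
    show "integrable tor (grad (\<rho> 0))" by (rule continuous_imp_integrable_tor[OF joint_slice[OF joint_grad t0]])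
    fix \<phi> :: "real ^ 'n \<Rightarrow> real" and i assume \<phi>: "C1p \<phi>"
    show "(LINT x|tor. r 0 x * pd i \<phi> x) = - (LINT x|tor. \<phi> x * g 0 x $ i)" by (rule g_weak[OF _ \<phi>]) simp
    have c: "continuous_on torus_cell (pd i \<phi>)" using C1pD(3)[OF \<phi>] continuous_on_subset by blast
    have "(LINT x|tor. r 0 x * pd i \<phi> x) = (LINT x|tor. \<rho> 0 x * pd i \<phi> x)"
    proof (rule integral_cong_AE)
      have cm: "pd i \<phi> \<in> borel_measurable tor" by (rule continuous_imp_measurable_tor[OF c])
      have "r 0 \<in> borel_measurable tor" by (rule borel_measurable_integrable[OF ri]) simp
      then show "(\<lambda>x. r 0 x * pd i \<phi> x) \<in> borel_measurable tor" using cm by (rule borel_measurable_times)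
      have "\<rho> 0 \<in> borel_measurable tor" by (rule continuous_imp_measurable_tor[OF joint_slice[OF joint_rho t0]])
      then show "(\<lambda>x. \<rho> 0 x * pd i \<phi> x) \<in> borel_measurable tor" using cm by (rule borel_measurable_times)
      show "AE x in tor. r 0 x * pd i \<phi> x = \<rho> 0 x * pd i \<phi> x" using rm(1) by eventually_elim simp
    qed
    then show "(LINT x|tor. r 0 x * pd i \<phi> x) = - (LINT x|tor. \<phi> x * grad (\<rho> 0) x $ i)"
      using classical_weak_gradient[OF \<phi>, of i] by (simp add: grad_def)
  qed
  with rm have "AE x in tor. H 0 0 x = 0"
  proof eventually_elim
    case (elim x)
    then have "\<rho> 0 x *\<^sub>R v 0 x = \<rho> 0 x *\<^sub>R u 0 x" using mv by simp
    then have "v 0 x = u 0 x" using P_pos[of x] by simp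
    then show ?case using elim by (simp add: H_def rel_enthalpy_def)
  qed
  then have "(LINT x|tor. H 0 0 x) = 0" by (rule integral_eq_zero_AE)
  then show ?thesis using relative_energy_eq(2)[OF _ t0, of 0] by simp
qed

text \<open>Expressions free of time derivatives, of the shape used in
  \<open>relative_energy_static\<close>; \<open>classical_identities\<close> relates them to the
  time derivatives of \<psi>0 and \<open>cc\<close>, and \<open>Z t\<close> is minus the gradient of
  \<open>\<rho>_t t\<close>.\<close>

definition "S1 t x = u t x v* jacobian (u t) (at x) + jacobian (u t) (at x) *v u t x + (\<epsilon> * k) *\<^sub>R grad (lap (\<rho> t)) x"
definition "S2 t x = (\<gamma> - 1) * (\<gamma> * \<rho> t x powr (\<gamma> - 1)) * div_vec (u t) x - u t x \<bullet> (jacobian (u t) (at x) *v u t x)"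
definition "S3 t x = - ((\<gamma> - 1) * (\<gamma> * \<rho> t x powr (\<gamma> - 1)) * (u t x \<bullet> grad (\<rho> t) x + \<rho> t x * div_vec (u t) x))"
definition "Z t = grad (div_vec (\<lambda>y. \<rho> t y *\<^sub>R u t y))"

definition "rest s t = (LINT x|tor. m s x \<bullet> S1 t x) + (LINT x|tor. r s x * S2 t x)
  + \<epsilon> * k * (LINT x|tor. (g s x - grad (\<rho> t) x) \<bullet> Z t x) + (LINT x|tor. S3 t x)"

lemma vecmat_joint:
  fixes B :: "'a::topological_space \<Rightarrow> real ^ 'n ^ 'n"
  assumes "continuous_on Y b" "continuous_on Y B"
  shows "continuous_on Y (\<lambda>x. b x v* B x)"
  unfolding vector_matrix_mult_def by (intro continuous_intros continuous_on_vec_lambda assms)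

lemma joint_S1: "continuous_on S (\<lambda>z. S1 (fst z) (snd z))"
  unfolding S1_def by (intro continuous_intros vecmat_joint matvec_joint joint)

lemma joint_S2: "continuous_on S (\<lambda>z. S2 (fst z) (snd z))"
  unfolding S2_def by (intro continuous_intros matvec_joint joint)

lemma Z_continuous: "t \<in> {0..T} \<Longrightarrow> continuous_on torus_cell (Z t)"
  unfolding Z_def by (rule smooth_state.grad_continuous[OF state smooth_state.C1p_div_PU[OF state]])

text \<open>\<open>relative_energy_static\<close> with the weak solution at time \<open>s\<close>
  and the classical one frozen at \<open>t\<close>. The stress contains \<open>g0\<close> while
  \<open>rest\<close> and the relative energy contain \<open>g\<close>; at almost every time the two
  agree almost everywhere in space.\<close>

lemma stress_bound_ae:
  assumes t: "t \<in> {0<..<T}" and K: "0 \<le> K"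
    and KJ: "\<And>x w. x \<in> torus_cell \<Longrightarrow> \<bar>w \<bullet> (jacobian (u t) (at x) *v w)\<bar> \<le> K * (norm w)\<^sup>2"
    and Kd: "\<And>x. x \<in> torus_cell \<Longrightarrow> \<bar>div_vec (u t) x\<bar> \<le> K"
    and KD: "\<And>x. x \<in> torus_cell \<Longrightarrow> norm (grad (div_vec (u t)) x) \<le> K"
    and KB: "\<And>x. x \<in> torus_cell \<Longrightarrow> norm (grad (lap (\<rho> t)) x) \<le> K"
  shows "AE s in lborel. 0 < s \<longrightarrow> - (LINT x|tor. A s x \<bullet> jacobian (u t) (at x)) + rest s t
    \<le> (2 * K + 1 + (\<gamma> - 1) * K + 4 * K + K * (real CARD('n))\<^sup>2) * (e s + X s t)
      + K\<^sup>2 * k\<^sup>2 / 2 * (LINT x|tor. \<rho> 0 x) * \<epsilon>\<^sup>2"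
proof -
  have t': "t \<in> {0..T}" "t \<in> {0..<T}" using t by auto
  interpret smooth_state "\<rho> t" "u t" by (rule state[OF t'(1)])
  have "AE s in lborel. 0 < s \<longrightarrow>
        weak_grad (r s) (g0 s) \<and> weak_div (\<lambda>x. (r s x * k) *\<^sub>R g0 s x) (q s)"
    using weak unfolding EK_weak_def by (auto elim: eventually_mono)
  then show ?thesis using momentum(1)[OF C1p_U(1)]
  proof eventually_elim
    case (elim s)
    show ?case
    proof
      assume s: "0 < s"
      then have s0: "0 \<le> s" by simp
      note w0 = weak_gradD[OF conjunct1[OF elim(1)[rule_format, OF s]]]
      note d0 = weak_divD[OF conjunct2[OF elim(1)[rule_format, OF s]]]
      have Ni: "integrable tor (\<lambda>x. A s x \<bullet> J x)" using elim(2) s0 by blast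
      have gg: "AE x in tor. g s x = g0 s x"
        by (rule weak_gradient_unique[OF gi[OF s0] w0(2) g_weak[OF s0] w0(3)])
      note [measurable] = borel_measurable_integrable[OF gi[OF s0]] borel_measurable_integrable[OF w0(2)]
        borel_measurable_integrable[OF ri[OF s0]]
      have g02: "integrable tor (\<lambda>x. (norm (g0 s x))\<^sup>2)"
      proof (rule integrable_cong_AE_imp[OF energy_parts(3)[OF s0]])
        show "AE x in tor. (norm (g s x))\<^sup>2 = (norm (g0 s x))\<^sup>2" using gg by eventually_elim simp
      qed measurable
      define N where "N x = (outer (m s x) (m s x) /\<^sub>R r s x) \<bullet> J x - stress (\<lambda>s. s powr \<gamma>) (\<lambda>_. k) \<epsilon> (r s x) (g0 s x) (q s x) \<bullet> J x" for x
      have NA: "N = (\<lambda>x. A s x \<bullet> J x)" by (auto simp: N_def A_def inner_diff_left)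
      have Ni': "integrable tor N" unfolding NA by (rule Ni)
      have msv: "m s = (\<lambda>x. r s x *\<^sub>R v s x)" by (simp add: mv)
      note static = relative_energy_static[OF \<gamma> \<epsilon> k K KJ Kd KD KB msv r_nonneg[OF s0] ri[OF s0] mi[OF s0]
          energy_parts(1,2)[OF s0] w0(2) g02 w0(3) d0 mean_eq[OF s0 t'(2)] Ni'[unfolded N_def[abs_def]]]
      have wg: "integrable tor (\<lambda>x. (norm (g0 s x - grad (\<rho> t) x))\<^sup>2)" by (rule static(3))
      define H0 where "H0 x = rel_enthalpy (\<lambda>s. s powr \<gamma>) (r s x) (\<rho> t x) + r s x / 2 * (norm (v s x - u t x))\<^sup>2
            + \<epsilon> * k / 2 * (norm (g0 s x - grad (\<rho> t) x))\<^sup>2" for x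
      have H0i: "integrable tor H0"
      proof -
        have "integrable tor (\<lambda>x. rel_enthalpy (\<lambda>s. s powr \<gamma>) (r s x) (\<rho> t x) + 1 / 2 * (r s x * (norm (v s x - u t x))\<^sup>2)
            + \<epsilon> * k / 2 * (norm (g0 s x - grad (\<rho> t) x))\<^sup>2)"
          by (intro Bochner_Integration.integrable_add integrable_mult_right static(1-3))
        then show ?thesis by (simp add: H0_def[abs_def])
      qed
      have HH: "(LINT x|tor. H0 x) = (LINT x|tor. H s t x)"
      proof (rule integral_cong_AE)
        show "AE x in tor. H0 x = H s t x" using gg by eventually_elim (simp add: H0_def H_def)
      qed (use H0i relative_energy_eq(1)[OF s0 t'(1)] in auto)
      have ZZ: "(LINT x|tor. (g0 s x - grad (\<rho> t) x) \<bullet> Z t x) = (LINT x|tor. (g s x - grad (\<rho> t) x) \<bullet> Z t x)"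
      proof (rule integral_cong_AE)
        have [measurable]: "grad (\<rho> t) \<in> borel_measurable tor" "Z t \<in> borel_measurable tor"
          by (rule continuous_imp_measurable_tor[OF joint_slice[OF joint_grad t'(1)]],
              rule continuous_imp_measurable_tor[OF Z_continuous[OF t'(1)]])
        show "(\<lambda>x. (g0 s x - grad (\<rho> t) x) \<bullet> Z t x) \<in> borel_measurable tor"
          "(\<lambda>x. (g s x - grad (\<rho> t) x) \<bullet> Z t x) \<in> borel_measurable tor" by measurable
        show "AE x in tor. (g0 s x - grad (\<rho> t) x) \<bullet> Z t x = (g s x - grad (\<rho> t) x) \<bullet> Z t x"
          using gg by eventually_elim simp
      qed
      have "- (LINT x|tor. N x) + ((LINT x|tor. m s x \<bullet> S1 t x) + (LINT x|tor. r s x * S2 t x)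
        + \<epsilon> * k * (LINT x|tor. (g0 s x - grad (\<rho> t) x) \<bullet> Z t x) + (LINT x|tor. S3 t x))
      \<le> (2 * K + 1 + (\<gamma> - 1) * K + 4 * K + K * (real CARD('n))\<^sup>2) * (LINT x|tor. H0 x)
        + K\<^sup>2 * k\<^sup>2 / 2 * (LINT x|tor. \<rho> t x) * \<epsilon>\<^sup>2"
        using static(4) unfolding N_def H0_def S1_def S2_def S3_def Z_def .
      then show "- (LINT x|tor. A s x \<bullet> J x) + rest s t
         \<le> (2 * K + 1 + (\<gamma> - 1) * K + 4 * K + K * (real CARD('n))\<^sup>2) * (e s + X s t)
           + K\<^sup>2 * k\<^sup>2 / 2 * (LINT x|tor. \<rho> 0 x) * \<epsilon>\<^sup>2"
        unfolding NA HH ZZ rest_def relative_energy_eq(2)[OF s0 t'(1)] mass_conserved[OF t'(2)] .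
    qed
  qed
qed

subsection \<open>Continuity in the time of the weak solution\<close>

text \<open>\<open>Z t\<close> is known only as a continuous field, so \<open>g s\<close> is not
  integrated by parts against it. Difference quotients in time of the gradient of \<rho> are C^1 in
  space and approximate \<open>- Z t\<close> uniformly; for them the pairing reduces to one with
  \<open>r s\<close>, which is continuous in \<open>s\<close>.\<close>

lemma gradient_pairing_continuous:
  assumes t: "t \<in> {0<..<T}"
  shows "continuous_on {0..} (\<lambda>s. LINT x|tor. g s x \<bullet> Z t x)"
proof (rule weakly_continuous_pairing[OF gi gradient_L1_bound])
  have t': "t \<in> {0..T}" using t by simp
  show "continuous_on torus_cell (Z t)" by (rule Z_continuous[OF t'])
  fix e1 :: real assume e1: "0 < e1"
  obtain \<rho>' where \<rho>': "C1_Ck_deriv {0<..<T} 1 \<rho> \<rho>'" "\<And>t. t \<in> {0<..<T} \<Longrightarrow> \<rho>' t = \<rho>_t t" using \<rho>_t_C1 by blast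
  define n where "n = real CARD('n)"
  have n: "0 < n" by (simp add: n_def)
  have "\<forall>\<^sub>F s in at t. \<forall>x\<in>UNIV. dist ((pd i (\<rho> s) x - pd i (\<rho> t) x) / (s - t)) (pd i (\<rho>_t t) x) < e1 / n" for i
    using uniform_limitD[OF C1_C1p_quotient_gradient[OF \<rho>'(1) open_greaterThanLessThan t]] e1 n
    unfolding \<rho>'(2)[OF t] by simp
  then have "\<forall>\<^sub>F s in at t. \<forall>i. \<forall>x\<in>UNIV. dist ((pd i (\<rho> s) x - pd i (\<rho> t) x) / (s - t)) (pd i (\<rho>_t t) x) < e1 / n"
    by (rule eventually_all_finite)
  moreover have "\<forall>\<^sub>F s in at t. s \<in> {0<..<T}" using eventually_at_in_open'[OF open_greaterThanLessThan t] .
  ultimately have "\<exists>s. (\<forall>i. \<forall>x\<in>UNIV. dist ((pd i (\<rho> s) x - pd i (\<rho> t) x) / (s - t)) (pd i (\<rho>_t t) x) < e1 / n) \<and> s \<in> {0<..<T}"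
    by (intro eventually_happens'[of "at t"] eventually_conj) auto
  then obtain s where s: "\<And>i x. dist ((pd i (\<rho> s) x - pd i (\<rho> t) x) / (s - t)) (pd i (\<rho>_t t) x) < e1 / n" "s \<in> {0<..<T}"
    by blast
  have s': "s \<in> {0..T}" using s(2) by simp
  \<comment> \<open>One difference quotient, at a fixed time \<open>s\<close> close to
    \<open>t\<close>, with the sign of \<open>Z t\<close>. The tolerance \<open>e1 / n\<close> per
    component adds up to \<open>e1\<close>.\<close>
  let ?\<Phi> = "\<lambda>i x. - (inverse (s - t) * (pd i (\<rho> s) x - pd i (\<rho> t) x))"
  have \<Phi>: "C1p (?\<Phi> i)" for i
    by (intro C1p_uminus C1p_cmult C1p_diff smooth_state.C1p_P(2)[OF state[OF s']] smooth_state.C1p_P(2)[OF state[OF t']])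
  let ?F = "\<lambda>x. (\<chi> i. ?\<Phi> i x) :: real ^ 'n"
  have F: "continuous_on torus_cell ?F"
    using C1pD(4)[OF \<Phi>] by (intro continuous_on_vec_lambda) (blast intro: continuous_on_subset)
  have "(\<Sum>i\<in>UNIV. \<bar>(?F x - Z t x) $ i\<bar>) \<le> e1" for x
  proof -
    have "\<bar>(?F x - Z t x) $ i\<bar> \<le> e1 / n" for i
    proof -
      have z: "Z t x $ i = - pd i (\<rho>_t t) x"
        using grad_\<rho>_t[OF t', of x] unfolding Z_def grad_def by (simp add: vec_eq_iff)
      have "(?F x - Z t x) $ i = - ((pd i (\<rho> s) x - pd i (\<rho> t) x) / (s - t) - pd i (\<rho>_t t) x)"
        by (simp add: z divide_inverse_commute)
      then show ?thesis using s(1)[of i x] by (simp only: abs_minus_cancel dist_real_def less_imp_le)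
    qed
    then have "(\<Sum>i\<in>UNIV. \<bar>(?F x - Z t x) $ i\<bar>) \<le> (\<Sum>i\<in>(UNIV :: 'n set). e1 / n)" by (rule sum_mono)
    then show ?thesis using n by (simp add: n_def)
  qed
  then have close: "norm (?F x - Z t x) \<le> e1" for x
    using norm_le_l1_cart[of "?F x - Z t x"] order_trans by blast
  have "continuous_on {0..} (\<lambda>\<tau>. - (LINT x|tor. r \<tau> x \<bullet> (\<Sum>i\<in>UNIV. pd i (?\<Phi> i) x)))"
  proof (intro continuous_on_minus C0_L1_pairing_continuous r_C0 continuous_on_sum)
    fix i show "continuous_on torus_cell (pd i (?\<Phi> i))" using C1pD(3)[OF \<Phi>] continuous_on_subset by blast
  qed
  moreover have "(LINT x|tor. g \<tau> x \<bullet> ?F x) = - (LINT x|tor. r \<tau> x \<bullet> (\<Sum>i\<in>UNIV. pd i (?\<Phi> i) x))" if "\<tau> \<in> {0..}" for \<tau>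
    using smooth_state.weak_gradient_vector_field[where \<Phi> = ?\<Phi>, OF state[OF t'] gi ri g_weak \<Phi>, of \<tau>] that by simp
  ultimately have "continuous_on {0..} (\<lambda>\<tau>. LINT x|tor. g \<tau> x \<bullet> ?F x)"
    by (subst continuous_on_cong[OF refl])
  then show "\<exists>F. continuous_on torus_cell F \<and> continuous_on {0..} (\<lambda>s. LINT x|tor. g s x \<bullet> F x)
      \<and> (\<forall>x\<in>torus_cell. norm (F x - Z t x) \<le> e1)"
    using F close by blast
qed

text \<open>Continuity in \<open>s\<close>, with \<open>t\<close> frozen, lets a bound for almost
  every \<open>s\<close> near \<open>t\<close> be compared with its value at
  \<open>s = t\<close>.\<close>

lemma rest_continuous:
  assumes t: "t \<in> {0<..<T}"
  shows "continuous_on {0..} (\<lambda>s. rest s t)"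
proof -
  have t': "t \<in> {0..T}" using t by simp
  have 1: "continuous_on {0..} (\<lambda>s. LINT x|tor. m s x \<bullet> S1 t x)"
    by (rule C0_L1_pairing_continuous[OF m_C0 joint_slice[OF joint_S1 t']])
  have 2: "continuous_on {0..} (\<lambda>s. LINT x|tor. r s x * S2 t x)"
    using C0_L1_pairing_continuous[OF r_C0 joint_slice[OF joint_S2 t']] by simp
  have "(LINT x|tor. (g s x - grad (\<rho> t) x) \<bullet> Z t x) = (LINT x|tor. g s x \<bullet> Z t x) - (LINT x|tor. grad (\<rho> t) x \<bullet> Z t x)"
    if "s \<in> {0..}" for s
    unfolding inner_diff_left
    using that by (intro Bochner_Integration.integral_diff[OF integrable_bounded_inner[OF gi Z_continuous[OF t']]
      integrable_bounded_inner[OF continuous_imp_integrable_tor[OF joint_slice[OF joint_grad t']] Z_continuous[OF t']]]) simp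
  moreover have "continuous_on {0..} (\<lambda>s. (LINT x|tor. g s x \<bullet> Z t x) - (LINT x|tor. grad (\<rho> t) x \<bullet> Z t x))"
    by (intro continuous_intros gradient_pairing_continuous t)
  ultimately have 3: "continuous_on {0..} (\<lambda>s. LINT x|tor. (g s x - grad (\<rho> t) x) \<bullet> Z t x)"
    by (subst continuous_on_cong[OF refl])
  show ?thesis unfolding rest_def by (intro continuous_intros 1 2 3)
qed

lemma relative_energy_continuous:
  assumes t: "t \<in> {0..T}"
  shows "continuous_on {0..} (\<lambda>s. e s + X s t)"
proof -
  have 0: "continuous_on {0..} e"
    using C0_L1_pairing_continuous[OF E_C0 continuous_on_const[of _ 1]] by (simp add: e_def[abs_def])
  have 1: "continuous_on {0..} (\<lambda>s. LINT x|tor. m s x \<bullet> u t x)"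
    by (rule C0_L1_pairing_continuous[OF m_C0 joint_slice[OF joint_u t]])
  have 2: "continuous_on {0..} (\<lambda>s. LINT x|tor. r s x * \<psi>0 t x)"
    using C0_L1_pairing_continuous[OF r_C0 joint_slice[OF joint_\<psi>0 t]] by simp
  have 3: "continuous_on {0..} (\<lambda>s. LINT x|tor. r s x * lap (\<rho> t) x)"
    using C0_L1_pairing_continuous[OF r_C0 joint_slice[OF joint_lap t]] by simp
  show ?thesis unfolding X_def by (intro continuous_intros 0 1 2 3)
qed

lemma L1_cont_on: "C0_L1 f \<Longrightarrow> 0 \<le> t \<Longrightarrow> I \<subseteq> {0..} \<Longrightarrow> L1_cont_at f t I"
  by (rule L1_cont_at_subset[OF C0_L1D(3)])

lemma diagonal_continuous: "continuous_on {0..<T} (\<lambda>t. X t t)"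
proof -
  have c: "continuous_on {0..<T} (\<lambda>t. LINT x|tor. f t x \<bullet> F t x)"
    if f: "C0_L1 f" and F: "continuous_on S (\<lambda>z. F (fst z) (snd z))" for f F :: "real \<Rightarrow> real ^ 'n \<Rightarrow> 'b::euclidean_space"
    unfolding continuous_on_def
  proof
    fix t assume t: "t \<in> {0..<T}"
    show "((\<lambda>t. LINT x|tor. f t x \<bullet> F t x) \<longlongrightarrow> (LINT x|tor. f t x \<bullet> F t x)) (at t within {0..<T})"
      by (rule L1_cont_pairing[OF L1_cont_on[OF f] t joint_cell[OF F]]) (use t in auto)
  qed
  have cc: "continuous_on {0..<T} (\<lambda>t. LINT x|tor. cc t x)"
    unfolding continuous_on_def
  proof
    fix t assume t: "t \<in> {0..<T}"
    have "((\<lambda>t. LINT x|tor. 1 \<bullet> cc t x) \<longlongrightarrow> (LINT x|tor. 1 \<bullet> cc t x)) (at t within {0..<T})"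
      by (rule L1_cont_pairing[OF L1_cont_at_const t joint_cell[OF joint_cc]]) auto
    then show "((\<lambda>t. LINT x|tor. cc t x) \<longlongrightarrow> (LINT x|tor. cc t x)) (at t within {0..<T})" by simp
  qed
  show ?thesis
    unfolding X_def
    using c[OF m_C0 joint_u] c[OF r_C0 joint_\<psi>0] c[OF r_C0 joint_lap] cc
    by (intro continuous_intros) simp_all
qed

end

section \<open>One-sided derivatives on the diagonal and the Gronwall argument\<close>

lemma set_integral_le_const:
  fixes L :: "real \<Rightarrow> real"
  assumes L: "set_integrable lborel {t<..s} L" and le: "AE \<tau> in lborel. \<tau> \<in> {t<..s} \<longrightarrow> L \<tau> \<le> c" and ts: "t \<le> s"
  shows "(LINT \<tau>:{t<..s}|lborel. L \<tau>) \<le> (s - t) * c"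
proof -
  have c: "set_integrable lborel {t<..s} (\<lambda>\<tau>. c)"
    by (rule set_integrable_subset[OF borel_integrable_atLeastAtMost'[of t s, OF continuous_on_const]]) auto
  have "(LINT \<tau>:{t<..s}|lborel. L \<tau>) \<le> (LINT \<tau>:{t<..s}|lborel. c)"
    by (rule set_integral_mono_AE[OF L c le])
  also have "\<dots> = (s - t) * c" using ts by (simp add: set_lebesgue_integral_def)
  finally show ?thesis .
qed

lemma set_integral_near_const:
  fixes L :: "real \<Rightarrow> real"
  assumes L: "set_integrable lborel {t<..s} L" and le: "\<And>\<tau>. \<tau> \<in> {t<..s} \<Longrightarrow> \<bar>L \<tau> - c\<bar> \<le> a" and ts: "t \<le> s"
  shows "\<bar>(LINT \<tau>:{t<..s}|lborel. L \<tau>) - (s - t) * c\<bar> \<le> (s - t) * a"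
proof -
  have u: "L \<tau> \<le> c + a" "- L \<tau> \<le> - c + a" if "\<tau> \<in> {t<..s}" for \<tau> using le[OF that] by linarith+
  have "(LINT \<tau>:{t<..s}|lborel. L \<tau>) \<le> (s - t) * (c + a)"
    by (rule set_integral_le_const[OF L _ ts]) (use u(1) in auto)
  moreover have "(LINT \<tau>:{t<..s}|lborel. - L \<tau>) \<le> (s - t) * (- c + a)"
    by (rule set_integral_le_const[OF _ _ ts]) (use L u(2) in \<open>auto simp: set_integrable_def\<close>)
  moreover have "(LINT \<tau>:{t<..s}|lborel. - L \<tau>) = - (LINT \<tau>:{t<..s}|lborel. L \<tau>)"
    by (simp add: set_lebesgue_integral_def)
  ultimately show ?thesis by (simp add: abs_le_iff algebra_simps)
qed

lemma has_real_derivative_withinI: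
  fixes F :: "real \<Rightarrow> real"
  assumes "\<And>a. 0 < a \<Longrightarrow> \<exists>\<delta>>0. \<forall>s\<in>I. t < s \<longrightarrow> s < t + \<delta> \<longrightarrow> \<bar>F s - F t - (s - t) * c\<bar> \<le> (s - t) * a"
    and I: "I \<subseteq> {t..}"
  shows "(F has_real_derivative c) (at t within I)"
  unfolding has_field_derivative_iff tendsto_iff
proof (intro allI impI)
  fix b :: real assume b: "0 < b"
  obtain \<delta> where \<delta>: "0 < \<delta>" "\<And>s. s \<in> I \<Longrightarrow> t < s \<Longrightarrow> s < t + \<delta> \<Longrightarrow> \<bar>F s - F t - (s - t) * c\<bar> \<le> (s - t) * (b / 2)"
    using assms(1)[of "b / 2"] b by auto
  have "dist ((F s - F t) / (s - t)) c < b" if s: "s \<in> I" "s \<noteq> t" "dist s t < \<delta>" for s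
  proof -
    have ts: "t < s" "s < t + \<delta>" using s I by (auto simp: dist_real_def)
    have "(F s - F t) / (s - t) - c = (F s - F t - (s - t) * c) / (s - t)" using ts by (simp add: field_simps)
    then have "\<bar>(F s - F t) / (s - t) - c\<bar> = \<bar>F s - F t - (s - t) * c\<bar> / (s - t)" using ts by simp
    also have "\<dots> \<le> b / 2" using \<delta>(2)[OF s(1) ts] ts by (simp add: divide_le_eq mult.commute)
    finally show ?thesis using b by (simp add: dist_real_def)
  qed
  then show "\<forall>\<^sub>F s in at t within I. dist ((F s - F t) / (s - t)) c < b"
    unfolding eventually_at using \<delta>(1) by blast
qed

context ek_comparison
begin

text \<open>In the mass balance the flux is continuous in time, so a right derivative exists at
  every time, and a right derivative is what the Dini argument asks for.\<close>

lemma r_pairing_derivative: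
  assumes \<phi>: "C1p \<phi>" and t: "0 \<le> t"
  shows "((\<lambda>s. LINT x|tor. r s x * \<phi> x) has_real_derivative (LINT x|tor. m t x \<bullet> grad \<phi> x)) (at t within {t..<T})"
proof (rule has_real_derivative_withinI)
  let ?L = "\<lambda>s. LINT x|tor. m s x \<bullet> grad \<phi> x"
  have gc: "continuous_on torus_cell (grad \<phi>)"
    using grad_continuous_UNIV[OF \<phi>] continuous_on_subset by blast
  have L: "continuous_on {0..} ?L" by (rule C0_L1_pairing_continuous[OF m_C0 gc])
  fix a :: real assume a: "0 < a"
  obtain \<delta> where \<delta>: "0 < \<delta>" "\<And>s. 0 \<le> s \<Longrightarrow> \<bar>s - t\<bar> < \<delta> \<Longrightarrow> \<bar>?L s - ?L t\<bar> < a"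
    using L[unfolded continuous_on_iff, rule_format, of t a] t a by (auto simp: dist_real_def)
  show "\<exists>\<delta>>0. \<forall>s\<in>{t..<T}. t < s \<longrightarrow> s < t + \<delta> \<longrightarrow>
    \<bar>(LINT x|tor. r s x * \<phi> x) - (LINT x|tor. r t x * \<phi> x) - (s - t) * ?L t\<bar> \<le> (s - t) * a"
  proof (intro exI[of _ \<delta>] conjI ballI impI \<delta>(1))
    fix s assume s: "t < s" "s < t + \<delta>"
    have "set_integrable lborel {t<..s} ?L"
      by (rule set_integral_increment(2)[OF continuous_imp_set_integrable[OF L] t]) (use s in simp)
    then show "\<bar>(LINT x|tor. r s x * \<phi> x) - (LINT x|tor. r t x * \<phi> x) - (s - t) * ?L t\<bar> \<le> (s - t) * a"
      unfolding r_mass_balance[OF \<phi> t less_imp_le[OF s(1)]]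
      by (rule set_integral_near_const) (use s t \<delta>(2) in \<open>auto intro!: less_imp_le\<close>)
  qed
qed auto

text \<open>A product of two increments, handled without a time derivative of the Laplacian: by the
  mass balance it is the integral over \<open>{t<..s}\<close> of the momentum against the increment
  of the gradient of the Laplacian, and that increment tends to 0 uniformly in space.\<close>

lemma lap_increment_derivative:
  assumes t: "t \<in> {0<..<T}"
  shows "((\<lambda>s. (LINT x|tor. r s x * (lap (\<rho> s) x - lap (\<rho> t) x)) - (LINT x|tor. r t x * (lap (\<rho> s) x - lap (\<rho> t) x)))
    has_real_derivative 0) (at t within {t..<T})"
proof (rule has_real_derivative_withinI)
  have t': "t \<in> {0..T}" "0 \<le> t" using t by auto
  obtain C where C: "\<And>s. s \<in> {0..T} \<Longrightarrow> (LINT x|tor. norm (m s x)) \<le> C"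
    using C0_L1_norm_bounded[OF m_C0] by blast
  have "0 \<le> (LINT x|tor. norm (m t x))" by simp
  also have "\<dots> \<le> C" by (rule C[OF t'(1)])
  finally have C0: "0 \<le> C" .
  fix a :: real assume a: "0 < a"
  define b where "b = a / (C + 1)"
  have b: "0 < b" "b * C \<le> a"
  proof -
    show b0: "0 < b" using a C0 by (simp add: b_def)
    have "b * C \<le> b * (C + 1)" using b0 by simp
    also have "\<dots> = a" using C0 by (simp add: b_def divide_simps)
    finally show "b * C \<le> a" .
  qed
  obtain \<delta> where \<delta>: "0 < \<delta>" "\<And>s x. s \<in> {0..T} \<Longrightarrow> \<bar>s - t\<bar> < \<delta> \<Longrightarrow> x \<in> torus_cell \<Longrightarrow>
      norm (grad (lap (\<rho> s)) x - grad (lap (\<rho> t)) x) \<le> b"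
    using uniform_on_cell[OF joint_cell[OF joint_grad_lap order_refl] t'(1) b(1)] by blast
  show "\<exists>\<delta>>0. \<forall>s\<in>{t..<T}. t < s \<longrightarrow> s < t + \<delta> \<longrightarrow>
    \<bar>((LINT x|tor. r s x * (lap (\<rho> s) x - lap (\<rho> t) x)) - (LINT x|tor. r t x * (lap (\<rho> s) x - lap (\<rho> t) x)))
     - ((LINT x|tor. r t x * (lap (\<rho> t) x - lap (\<rho> t) x)) - (LINT x|tor. r t x * (lap (\<rho> t) x - lap (\<rho> t) x)))
     - (s - t) * 0\<bar> \<le> (s - t) * a"
  proof (intro exI[of _ \<delta>] conjI ballI impI \<delta>(1))
    fix s assume sT: "s \<in> {t..<T}" and s: "t < s" "s < t + \<delta>"
    have s': "s \<in> {0..T}" using sT t by auto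
    let ?\<phi> = "\<lambda>x. lap (\<rho> s) x - lap (\<rho> t) x"
    have cl: "C1p (lap (\<rho> s))" "C1p (lap (\<rho> t))"
      using smooth_state.C1p_lap[OF state] s' t'(1) by auto
    have \<phi>: "C1p ?\<phi>" by (rule C1p_diff[OF cl])
    have g\<phi>: "grad ?\<phi> x = grad (lap (\<rho> s)) x - grad (lap (\<rho> t)) x" for x
      by (simp add: grad_def vec_eq_iff pd_diff[OF C1pD(2)[OF cl(1)] C1pD(2)[OF cl(2)]])
    have gc: "continuous_on torus_cell (grad ?\<phi>)"
      using grad_continuous_UNIV[OF \<phi>] continuous_on_subset by blast
    let ?L = "\<lambda>\<tau>. LINT x|tor. m \<tau> x \<bullet> grad ?\<phi> x"
    have i: "set_integrable lborel {t<..s} ?L"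
      by (rule set_integral_increment(2)[OF continuous_imp_set_integrable[OF C0_L1_pairing_continuous[OF m_C0 gc]] t'(2)]) (use s in simp)
    have "\<bar>?L \<tau> - 0\<bar> \<le> a" if \<tau>: "\<tau> \<in> {t<..s}" for \<tau>
    proof -
      have \<tau>': "\<tau> \<in> {0..T}" "0 \<le> \<tau>" using \<tau> t s' by auto
      have "\<bar>?L \<tau>\<bar> \<le> b * (LINT x|tor. norm (m \<tau> x))"
      proof (rule integral_abs_le[OF mi[OF \<tau>'(2)] continuous_imp_measurable_tor[OF gc]])
        fix x :: "real ^ 'n" assume "x \<in> torus_cell"
        then show "norm (grad ?\<phi> x) \<le> b" unfolding g\<phi> using s by (intro \<delta>(2)[OF s']) auto
      qed
      also have "\<dots> \<le> b * C" using C[OF \<tau>'(1)] b(1) by (intro mult_left_mono) auto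
      finally show ?thesis using b(2) by simp
    qed
    from set_integral_near_const[OF i this less_imp_le[OF s(1)]]
    show "\<bar>((LINT x|tor. r s x * (lap (\<rho> s) x - lap (\<rho> t) x)) - (LINT x|tor. r t x * (lap (\<rho> s) x - lap (\<rho> t) x)))
     - ((LINT x|tor. r t x * (lap (\<rho> t) x - lap (\<rho> t) x)) - (LINT x|tor. r t x * (lap (\<rho> t) x - lap (\<rho> t) x)))
     - (s - t) * 0\<bar> \<le> (s - t) * a"
      unfolding r_mass_balance[OF \<phi> t'(2) less_imp_le[OF s(1)], symmetric] by simp
  qed
qed auto

definition "\<psi>0_t t x = u t x \<bullet> u_t t x - \<gamma> * ((\<gamma> - 1) * \<rho> t x powr (\<gamma> - 1 - 1)) * \<rho>_t t x"
definition "cc_t t x = (\<gamma> - 1) * (\<gamma> * \<rho> t x powr (\<gamma> - 1)) * \<rho>_t t x + \<epsilon> * k * (grad (\<rho> t) x \<bullet> grad (\<rho>_t t) x)"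

lemma powr_\<rho>_derivative:
  assumes t: "t \<in> {0<..<T}"
  shows "((\<lambda>s. \<rho> s x powr a) has_real_derivative a * \<rho> t x powr (a - 1) * \<rho>_t t x) (at t)"
proof -
  have "((\<lambda>s. \<rho> s x) has_real_derivative \<rho>_t t x) (at t)"
    using has_derivative_\<rho>[OF t] by (simp add: has_real_derivative_iff_has_vector_derivative)
  then show ?thesis
    by (rule DERIV_chain2[OF powr_derivative, rotated]) (use \<rho>_pos t in simp)
qed

lemma square_derivative:
  fixes f :: "real \<Rightarrow> real ^ 'n"
  assumes f: "(f has_vector_derivative f') (at t)"
  shows "((\<lambda>s. f s \<bullet> f s) has_real_derivative 2 * (f t \<bullet> f')) (at t)"
proof -
  have "((\<lambda>s. f s \<bullet> f s) has_derivative (\<lambda>h. f t \<bullet> (h *\<^sub>R f') + (h *\<^sub>R f') \<bullet> f t)) (at t)"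
    by (rule has_derivative_inner; rule f[unfolded has_vector_derivative_def])
  moreover have "(\<lambda>h. f t \<bullet> (h *\<^sub>R f') + (h *\<^sub>R f') \<bullet> f t) = (*) (2 * (f t \<bullet> f'))"
    by (auto simp: inner_commute[of f'])
  ultimately show ?thesis by (simp only: has_field_derivative_def)
qed

lemma \<psi>0_derivative:
  assumes t: "t \<in> {0<..<T}"
  shows "((\<lambda>s. \<psi>0 s x) has_vector_derivative \<psi>0_t t x) (at t)"
proof -
  have "((\<lambda>s. (u s x \<bullet> u s x) / 2 - \<gamma> * \<rho> s x powr (\<gamma> - 1)) has_real_derivative
    (2 * (u t x \<bullet> u_t t x)) / 2 - \<gamma> * ((\<gamma> - 1) * \<rho> t x powr (\<gamma> - 1 - 1) * \<rho>_t t x)) (at t)"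
    by (intro DERIV_diff DERIV_cdivide DERIV_cmult square_derivative has_derivative_u powr_\<rho>_derivative t)
  then show ?thesis
    by (simp only: \<psi>0_def \<psi>0_t_def has_real_derivative_iff_has_vector_derivative[symmetric] mult.assoc) simp
qed

lemma cc_derivative:
  assumes t: "t \<in> {0<..<T}"
  shows "((\<lambda>s. cc s x) has_vector_derivative cc_t t x) (at t)"
proof -
  have "((\<lambda>s. (\<gamma> - 1) * \<rho> s x powr \<gamma> + \<epsilon> * k / 2 * (grad (\<rho> s) x \<bullet> grad (\<rho> s) x)) has_real_derivative
    (\<gamma> - 1) * (\<gamma> * \<rho> t x powr (\<gamma> - 1) * \<rho>_t t x) + \<epsilon> * k / 2 * (2 * (grad (\<rho> t) x \<bullet> grad (\<rho>_t t) x))) (at t)"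
    by (intro DERIV_add DERIV_cmult square_derivative has_derivative_grad_\<rho> powr_\<rho>_derivative t)
  then show ?thesis
    by (simp only: cc_def cc_t_def has_real_derivative_iff_has_vector_derivative[symmetric] mult.assoc) simp
qed

text \<open>Here the Euler equations are inserted. In \<open>S1\<close> the pressure gradients of
  \<open>grad (\<psi>0 t)\<close> and \<open>u_t t\<close> cancel, leaving the two transport terms
  and the capillary one; in \<open>S2\<close> and \<open>S3\<close> the mass equation turns
  \<open>\<rho>_t\<close> into spatial derivatives.\<close>

lemma classical_identities:
  assumes t: "t \<in> {0..T}"
  shows "S1 t x = grad (\<psi>0 t) x - u_t t x + (\<epsilon> * k) *\<^sub>R grad (lap (\<rho> t)) x"
    and "S2 t x = \<psi>0_t t x"
    and "S3 t x = cc_t t x + \<epsilon> * k * (grad (\<rho> t) x \<bullet> Z t x)"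
    and "C1p (\<psi>0 t)" and "grad (\<rho>_t t) x = - Z t x"
proof -
  interpret smooth_state "\<rho> t" "u t" by (rule state[OF t])
  have p: "\<rho> t x powr (\<gamma> - 1 - 1) * \<rho> t x = \<rho> t x powr (\<gamma> - 1)"
    using P_pos[of x] by (simp add: powr_diff power2_eq_square)
  have pc: "C1p (\<lambda>x. \<rho> t x powr (\<gamma> - 1))"
    by (rule C1p_compose[OF C1p_P(1) powr_derivative[OF P_pos]])
      (auto intro!: continuous_intros simp: less_imp_neq[OF P_pos, symmetric])
  have \<psi>: "\<psi>0 t = (\<lambda>x. 1 / 2 * (\<Sum>j\<in>UNIV. u t x $ j * u t x $ j) - \<gamma> * \<rho> t x powr (\<gamma> - 1))"
    by (auto simp: \<psi>0_def inner_vec_def)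
  have c1: "C1p (\<lambda>x. \<Sum>j\<in>UNIV. u t x $ j * u t x $ j)" by (intro C1p_sum C1p_mult C1p_U)
  show "C1p (\<psi>0 t)" unfolding \<psi> by (intro C1p_diff C1p_cmult c1 pc)
  have "pd i (\<psi>0 t) x = (\<Sum>j\<in>UNIV. u t x $ j * pd i (Uc j) x) - \<gamma> * ((\<gamma> - 1) * \<rho> t x powr (\<gamma> - 1 - 1) * pd i (\<rho> t) x)" for i
  proof -
    have "pd i (\<psi>0 t) x = 1 / 2 * pd i (\<lambda>x. \<Sum>j\<in>UNIV. u t x $ j * u t x $ j) x - \<gamma> * pd i (\<lambda>x. \<rho> t x powr (\<gamma> - 1)) x"
      unfolding \<psi> pd_diff[OF C1pD(2)[OF C1p_cmult[OF c1]] C1pD(2)[OF C1p_cmult[OF pc]]]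
        pd_cmult[OF C1pD(2)[OF c1]] pd_cmult[OF C1pD(2)[OF pc]] ..
    then show ?thesis
      unfolding pd_sum_mult[OF C1p_U(2) C1p_U(2)] pd_compose(1)[OF C1pD(2)[OF C1p_P(1)] powr_derivative[OF P_pos]]
      by (simp add: sum_distrib_left[symmetric] mult_ac)
  qed
  then have g: "grad (\<psi>0 t) x = u t x v* J x - (\<gamma> * ((\<gamma> - 1) * \<rho> t x powr (\<gamma> - 1 - 1))) *\<^sub>R grad (\<rho> t) x"
    by (simp add: vec_eq_iff grad_def vector_matrix_mult_def J_nth mult_ac)
  show "S1 t x = grad (\<psi>0 t) x - u_t t x + (\<epsilon> * k) *\<^sub>R grad (lap (\<rho> t)) x"
    unfolding S1_def g u_t_def by simp
  show "S2 t x = \<psi>0_t t x"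
    unfolding S2_def \<psi>0_t_def u_t_def \<rho>_t_eq[OF t] p[symmetric]
    by (simp add: inner_diff_right algebra_simps)
  show z: "grad (\<rho>_t t) x = - Z t x" unfolding Z_def by (rule grad_\<rho>_t[OF t])
  show "S3 t x = cc_t t x + \<epsilon> * k * (grad (\<rho> t) x \<bullet> Z t x)"
    unfolding S3_def cc_t_def z \<rho>_t_eq[OF t] by (simp add: algebra_simps)
qed

lemma joint_\<psi>0_t: "continuous_on S (\<lambda>z. \<psi>0_t (fst z) (snd z))"
  unfolding \<psi>0_t_def by (intro continuous_intros joint joint_u_t joint_\<rho>_t)

lemma cell_cc_t:
  assumes "I \<subseteq> {0<..<T}"
  shows "continuous_on (I \<times> torus_cell) (\<lambda>(t, x). cc_t t x)"
proof -
  have "{0<..<T} \<times> UNIV \<subseteq> S" by auto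
  then have "continuous_on ({0<..<T} \<times> UNIV) (\<lambda>z. cc_t (fst z) (snd z))"
    unfolding cc_t_def by (intro continuous_intros joint_grad_\<rho>_t continuous_on_subset[OF joint_powr]
      continuous_on_subset[OF joint_\<rho>_t] continuous_on_subset[OF joint_grad])
  then show ?thesis unfolding split_beta by (rule continuous_on_subset) (use assms in auto)
qed

lemma smooth_part_derivative:
  assumes t: "t \<in> {0<..<T}"
  shows "((\<lambda>s. - (LINT x|tor. m s x \<bullet> (u s x - u t x)) + (LINT x|tor. r s x * \<psi>0 s x)
    + \<epsilon> * k * (LINT x|tor. r s x * lap (\<rho> s) x) + (LINT x|tor. cc s x)) has_real_derivative rest t t) (at t within {t..<T})"
proof -
  let ?J = "{t..<T}"
  have t': "t \<in> {0..T}" "0 \<le> t" "t \<in> ?J" and J: "?J \<subseteq> {0..}" "?J \<subseteq> {0<..<T}" "?J \<subseteq> {0..T}" and cJ: "convex ?J"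
    using t by auto
  have in': "s \<in> {0<..<T}" "s \<in> {0..T}" "0 \<le> s" if "s \<in> ?J" for s using that t by auto
  note ci = classical_identities[OF t'(1)]
  have d1: "((\<lambda>s. LINT x|tor. m s x \<bullet> (u s x - u t x)) has_real_derivative (LINT x|tor. m t x \<bullet> u_t t x)) (at t within ?J)"
    by (rule L1_cont_increment_derivative[OF L1_cont_on[OF m_C0 t'(2) J(1)] cJ t'(3)])
      (auto intro!: joint_slice[OF joint_u] in' joint_cell[OF joint_u_t] has_vector_derivative_at_within has_derivative_u J)
  have d2: "((\<lambda>s. LINT x|tor. r s x \<bullet> (\<psi>0 s x - \<psi>0 t x)) has_real_derivative (LINT x|tor. r t x \<bullet> \<psi>0_t t x)) (at t within ?J)"
    by (rule L1_cont_increment_derivative[OF L1_cont_on[OF r_C0 t'(2) J(1)] cJ t'(3)])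
      (auto intro!: joint_slice[OF joint_\<psi>0] in' joint_cell[OF joint_\<psi>0_t] has_vector_derivative_at_within \<psi>0_derivative J)
  have d3: "((\<lambda>s. LINT x|tor. r s x * \<psi>0 t x) has_real_derivative (LINT x|tor. m t x \<bullet> grad (\<psi>0 t) x)) (at t within ?J)"
    by (rule r_pairing_derivative[OF ci(4) t'(2)])
  have d4: "((\<lambda>s. LINT x|tor. r s x * lap (\<rho> t) x) has_real_derivative (LINT x|tor. m t x \<bullet> grad (lap (\<rho> t)) x)) (at t within ?J)"
    by (rule r_pairing_derivative[OF smooth_state.C1p_lap[OF state[OF t'(1)]] t'(2)])
  have d5: "((\<lambda>s. LINT x|tor. g t x \<bullet> grad (\<rho> s) x) has_real_derivative (LINT x|tor. g t x \<bullet> grad (\<rho>_t t) x)) (at t within ?J)"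
  proof (rule integral_pairing_derivative[OF gi[OF t'(2)] cJ t'(3)])
    show "continuous_on torus_cell (grad (\<rho> s))" if "s \<in> ?J" for s by (rule joint_slice[OF joint_grad in'(2)[OF that]])
    show "((\<lambda>s. grad (\<rho> s) x) has_vector_derivative grad (\<rho>_t s) x) (at s within ?J)" if "s \<in> ?J" for s x
      by (rule has_vector_derivative_at_within[OF has_derivative_grad_\<rho>[OF in'(1)[OF that]]])
    show "continuous_on (?J \<times> torus_cell) (\<lambda>(s, x). grad (\<rho>_t s) x)"
      unfolding split_beta by (rule continuous_on_subset[OF joint_grad_\<rho>_t]) (use J in auto)
  qed
  note d6 = lap_increment_derivative[OF t]
  have d7: "((\<lambda>s. LINT x|tor. 1 \<bullet> cc s x) has_real_derivative (LINT x|tor. 1 \<bullet> cc_t t x)) (at t within ?J)"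
    by (rule integral_pairing_derivative[OF _ cJ t'(3)])
      (auto intro!: joint_slice[OF joint_cc] in' cell_cc_t has_vector_derivative_at_within cc_derivative J)
  let ?D = "- (LINT x|tor. m t x \<bullet> u_t t x) + ((LINT x|tor. r t x \<bullet> \<psi>0_t t x) + (LINT x|tor. m t x \<bullet> grad (\<psi>0 t) x))
    + \<epsilon> * k * (0 + (LINT x|tor. m t x \<bullet> grad (lap (\<rho> t)) x) - (LINT x|tor. g t x \<bullet> grad (\<rho>_t t) x) - 0) + (LINT x|tor. 1 \<bullet> cc_t t x)"
  \<comment> \<open>With L the Laplacian of \<rho>, the split is r(s)L(s) = (r(s) - r(t))(L(s) -
    L(t)) + r(s)L(t) + r(t)L(s) - r(t)L(t). In the third term one derivative is moved onto
    \<open>g t\<close>, leaving \<open>grad (\<rho> s)\<close>, which is differentiable in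
    time.\<close>
  let ?W = "\<lambda>s. - (LINT x|tor. m s x \<bullet> (u s x - u t x)) + ((LINT x|tor. r s x \<bullet> (\<psi>0 s x - \<psi>0 t x)) + (LINT x|tor. r s x * \<psi>0 t x))
    + \<epsilon> * k * (((LINT x|tor. r s x * (lap (\<rho> s) x - lap (\<rho> t) x)) - (LINT x|tor. r t x * (lap (\<rho> s) x - lap (\<rho> t) x)))
       + (LINT x|tor. r s x * lap (\<rho> t) x) - (LINT x|tor. g t x \<bullet> grad (\<rho> s) x) - (LINT x|tor. r t x * lap (\<rho> t) x)) + (LINT x|tor. 1 \<bullet> cc s x)"
  have W: "(?W has_real_derivative ?D) (at t within ?J)"
    by (intro DERIV_add DERIV_minus DERIV_cmult DERIV_diff d1 d2 d3 d4 d5 d6 d7 DERIV_const)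
  have D: "?D = rest t t"
  proof -
    have mc: "integrable tor (\<lambda>x. m t x \<bullet> F x)" if "continuous_on torus_cell F" for F
      by (rule integrable_bounded_inner[OF mi[OF t'(2)] that])
    have cu: "continuous_on torus_cell (u_t t)" "continuous_on torus_cell (grad (\<psi>0 t))" "continuous_on torus_cell (grad (lap (\<rho> t)))"
      using grad_continuous_UNIV[OF ci(4)] continuous_on_subset
      by (auto intro: joint_slice[OF joint_u_t t'(1)] joint_slice[OF joint_grad_lap t'(1)])
    have 1: "(LINT x|tor. m t x \<bullet> S1 t x) = (LINT x|tor. m t x \<bullet> grad (\<psi>0 t) x) - (LINT x|tor. m t x \<bullet> u_t t x)
      + \<epsilon> * k * (LINT x|tor. m t x \<bullet> grad (lap (\<rho> t)) x)"
      unfolding ci(1) inner_add_right inner_diff_right inner_scaleR_right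
      using mc[OF cu(1)] mc[OF cu(2)] mc[OF cu(3)] by simp
    have cZ: "continuous_on torus_cell (Z t)" by (rule Z_continuous[OF t'(1)])
    have cG: "continuous_on torus_cell (grad (\<rho> t))" by (rule joint_slice[OF joint_grad t'(1)])
    have 2: "(LINT x|tor. (g t x - grad (\<rho> t) x) \<bullet> Z t x) = (LINT x|tor. g t x \<bullet> Z t x) - (LINT x|tor. grad (\<rho> t) x \<bullet> Z t x)"
      unfolding inner_diff_left
      by (rule Bochner_Integration.integral_diff[OF integrable_bounded_inner[OF gi[OF t'(2)] cZ]
            integrable_bounded_inner[OF continuous_imp_integrable_tor[OF cG] cZ]])
    have cct: "continuous_on torus_cell (cc_t t)" by (rule continuous_on_slice[OF cell_cc_t[OF order_refl] t])
    have 3: "(LINT x|tor. S3 t x) = (LINT x|tor. cc_t t x) + \<epsilon> * k * (LINT x|tor. grad (\<rho> t) x \<bullet> Z t x)"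
      unfolding ci(3)
      using continuous_imp_integrable_tor[OF cct] integrable_bounded_inner[OF continuous_imp_integrable_tor[OF cG] cZ] by simp
    have 4: "(LINT x|tor. g t x \<bullet> grad (\<rho>_t t) x) = - (LINT x|tor. g t x \<bullet> Z t x)"
      by (simp add: ci(5))
    show ?thesis unfolding rest_def 1 2 3 4 ci(2) by (simp add: algebra_simps)
  qed
  show ?thesis
  proof (rule has_field_derivative_transform_within[OF W[unfolded D] zero_less_one t'(3)])
    fix s assume s: "s \<in> ?J"
    note s' = in'[OF s]
    have rr: "integrable tor (\<lambda>x. r \<tau> x * F x)" if "0 \<le> \<tau>" "continuous_on torus_cell F" for \<tau> F
      by (rule integrable_bounded_mult[OF ri[OF that(1)] that(2)])
    note c\<psi> = joint_slice[OF joint_\<psi>0 s'(2)] joint_slice[OF joint_\<psi>0 t'(1)]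
    note cl = joint_slice[OF joint_lap s'(2)] joint_slice[OF joint_lap t'(1)]
    have 1: "(LINT x|tor. r s x \<bullet> (\<psi>0 s x - \<psi>0 t x)) = (LINT x|tor. r s x * \<psi>0 s x) - (LINT x|tor. r s x * \<psi>0 t x)"
      unfolding inner_real_def right_diff_distrib
      by (rule Bochner_Integration.integral_diff[OF rr[OF s'(3) c\<psi>(1)] rr[OF s'(3) c\<psi>(2)]])
    have 2: "(LINT x|tor. r \<tau> x * (lap (\<rho> s) x - lap (\<rho> t) x)) = (LINT x|tor. r \<tau> x * lap (\<rho> s) x) - (LINT x|tor. r \<tau> x * lap (\<rho> t) x)"
      if "0 \<le> \<tau>" for \<tau>
      unfolding right_diff_distrib
      by (rule Bochner_Integration.integral_diff[OF rr[OF that cl(1)] rr[OF that cl(2)]])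
    show "?W s = - (LINT x|tor. m s x \<bullet> (u s x - u t x)) + (LINT x|tor. r s x * \<psi>0 s x)
      + \<epsilon> * k * (LINT x|tor. r s x * lap (\<rho> s) x) + (LINT x|tor. cc s x)"
      unfolding 1 2[OF s'(3)] 2[OF t'(2)] gradient_pairing[OF t'(2) s'(2)] by simp
  qed
qed

lemma dini_step:
  fixes K :: real
  defines "K1 \<equiv> 2 * K + 1 + (\<gamma> - 1) * K + 4 * K + K * (real CARD('n))\<^sup>2"
  defines "K2 \<equiv> K\<^sup>2 * k\<^sup>2 / 2 * (LINT x|tor. \<rho> 0 x)"
  assumes t: "t \<in> {0<..<T}" and K: "0 \<le> K" and \<eta>: "0 < \<eta>"
    and KJ: "\<And>x w. x \<in> torus_cell \<Longrightarrow> \<bar>w \<bullet> (jacobian (u t) (at x) *v w)\<bar> \<le> K * (norm w)\<^sup>2"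
    and Kd: "\<And>x. x \<in> torus_cell \<Longrightarrow> \<bar>div_vec (u t) x\<bar> \<le> K"
    and KD: "\<And>x. x \<in> torus_cell \<Longrightarrow> norm (grad (div_vec (u t)) x) \<le> K"
    and KB: "\<And>x. x \<in> torus_cell \<Longrightarrow> norm (grad (lap (\<rho> t)) x) \<le> K"
  shows "\<exists>\<delta>>0. \<forall>s. t < s \<longrightarrow> s < t + \<delta> \<longrightarrow> s < T \<longrightarrow>
    (e 0 + X s s) - (e 0 + X t t) \<le> (s - t) * (K1 * (e 0 + X t t) + K2 * \<epsilon>\<^sup>2 + \<eta>)"
proof -
  have t': "t \<in> {0..T}" "0 \<le> t" using t by auto
  interpret smooth_state "\<rho> t" "u t" by (rule state[OF t'(1)])
  have K1: "0 \<le> K1" using K \<gamma> by (simp add: K1_def)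
  let ?W = "\<lambda>s. - (LINT x|tor. m s x \<bullet> (u s x - u t x)) + (LINT x|tor. r s x * \<psi>0 s x)
    + \<epsilon> * k * (LINT x|tor. r s x * lap (\<rho> s) x) + (LINT x|tor. cc s x)"
  let ?b = "\<lambda>s. LINT x|tor. m s x \<bullet> u t x"
  let ?L = "\<lambda>s. LINT x|tor. A s x \<bullet> J x"
  define R where "R s = K1 * (e s + X s t) + K2 * \<epsilon>\<^sup>2 - rest s t" for s
  have ae: "AE s in lborel. 0 < s \<longrightarrow> - ?L s \<le> R s"
  proof -
    have "AE s in lborel. 0 < s \<longrightarrow> - ?L s + rest s t \<le> K1 * (e s + X s t) + K2 * \<epsilon>\<^sup>2"
      unfolding K1_def K2_def by (rule stress_bound_ae[OF t K]) (fact KJ Kd KD KB)+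
    then show ?thesis by eventually_elim (auto simp: R_def)
  qed
  have "continuous_on {0..} R"
    unfolding R_def[abs_def] by (intro continuous_intros relative_energy_continuous[OF t'(1)] rest_continuous[OF t])
  from this[unfolded continuous_on_iff, rule_format, of t "\<eta> / 2"]
  obtain \<delta>1 where \<delta>1: "0 < \<delta>1" "\<And>s. s \<in> {0..} \<Longrightarrow> dist s t < \<delta>1 \<Longrightarrow> dist (R s) (R t) < \<eta> / 2"
    using t'(2) \<eta> by auto
  have "((\<lambda>s. (?W s - ?W t) / (s - t)) \<longlongrightarrow> rest t t) (at t within {t..<T})"
    using smooth_part_derivative[OF t] by (simp add: has_field_derivative_iff)
  then have "\<forall>\<^sub>F s in at t within {t..<T}. dist ((?W s - ?W t) / (s - t)) (rest t t) < \<eta> / 2"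
    using \<eta> by (intro tendstoD) auto
  then obtain \<delta>2 where \<delta>2: "0 < \<delta>2" "\<And>s. s \<in> {t..<T} \<Longrightarrow> s \<noteq> t \<Longrightarrow> dist s t < \<delta>2 \<Longrightarrow>
      dist ((?W s - ?W t) / (s - t)) (rest t t) < \<eta> / 2"
    unfolding eventually_at by blast
  show ?thesis
  proof (intro exI[of _ "min \<delta>1 \<delta>2"] conjI allI impI)
    show "0 < min \<delta>1 \<delta>2" using \<delta>1 \<delta>2 by simp
    fix s assume s: "t < s" "s < t + min \<delta>1 \<delta>2" "s < T"
    have sT: "s \<in> {0..T}" "0 \<le> s" using s t by auto
    have mb: "?b s - ?b t = (LINT \<tau>:{t<..s}|lborel. ?L \<tau>)"
      by (rule momentum(3)[OF C1p_U(1) t'(2) less_imp_le[OF s(1)]])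
    have i: "set_integrable lborel {t<..s} (\<lambda>\<tau>. - ?L \<tau>)"
      using momentum(2)[OF C1p_U(1) t'(2) less_imp_le[OF s(1)]] by (simp add: set_integrable_def)
    have "(LINT \<tau>:{t<..s}|lborel. - ?L \<tau>) \<le> (s - t) * (R t + \<eta> / 2)"
    proof (rule set_integral_le_const[OF i _ less_imp_le[OF s(1)]])
      show "AE \<tau> in lborel. \<tau> \<in> {t<..s} \<longrightarrow> - ?L \<tau> \<le> R t + \<eta> / 2"
        using ae
      proof eventually_elim
        case (elim \<tau>)
        show ?case
        proof
          assume \<tau>: "\<tau> \<in> {t<..s}"
          then have "dist (R \<tau>) (R t) < \<eta> / 2" using t' s by (intro \<delta>1(2)) (auto simp: dist_real_def)
          moreover have "- ?L \<tau> \<le> R \<tau>" using elim \<tau> t' by auto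
          ultimately show "- ?L \<tau> \<le> R t + \<eta> / 2" unfolding dist_real_def by linarith
        qed
      qed
    qed
    moreover have "(LINT \<tau>:{t<..s}|lborel. - ?L \<tau>) = - (?b s - ?b t)"
      unfolding mb by (simp add: set_lebesgue_integral_def)
    ultimately have 1: "- (?b s - ?b t) \<le> (s - t) * (R t + \<eta> / 2)" by linarith
    have "dist ((?W s - ?W t) / (s - t)) (rest t t) < \<eta> / 2"
      using s by (intro \<delta>2(2)) (auto simp: dist_real_def)
    then have "(?W s - ?W t) / (s - t) \<le> rest t t + \<eta> / 2" unfolding dist_real_def by linarith
    then have "?W s - ?W t \<le> (rest t t + \<eta> / 2) * (s - t)"
      using s(1) pos_divide_le_eq[of "s - t" "?W s - ?W t"] by (simp only: diff_gt_0_iff_gt)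
    then have 2: "?W s - ?W t \<le> (s - t) * (rest t t + \<eta> / 2)" by (simp only: mult.commute)
    have inc: "(LINT x|tor. m s x \<bullet> (u s x - u t x)) = (LINT x|tor. m s x \<bullet> u s x) - ?b s"
      unfolding inner_diff_right
      by (rule Bochner_Integration.integral_diff[OF integrable_bounded_inner[OF mi[OF sT(2)] joint_slice[OF joint_u sT(1)]]
           integrable_bounded_inner[OF mi[OF sT(2)] joint_slice[OF joint_u t'(1)]]])
    have inc0: "(LINT x|tor. m t x \<bullet> (u t x - u t x)) = 0" by simp
    have "X s s - X t t = - (?b s - ?b t) + (?W s - ?W t)"
      unfolding X_def inc inc0 by simp
    also have "\<dots> \<le> (s - t) * (R t + \<eta> / 2) + (s - t) * (rest t t + \<eta> / 2)" using 1 2 by linarith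
    also have "\<dots> = (s - t) * (K1 * (e t + X t t) + K2 * \<epsilon>\<^sup>2 + \<eta>)"
      by (simp add: R_def distrib_left[symmetric])
    \<comment> \<open>Here \<open>e t \<le> e 0\<close> and \<open>0 \<le> K1\<close> suffice; the
      energy is never differentiated.\<close>
    also have "\<dots> \<le> (s - t) * (K1 * (e 0 + X t t) + K2 * \<epsilon>\<^sup>2 + \<eta>)"
      using s(1) K1 E_le[OF t'(2)] unfolding e_def
      by (intro mult_left_mono add_right_mono) auto
    finally show "(e 0 + X s s) - (e 0 + X t t) \<le> (s - t) * (K1 * (e 0 + X t t) + K2 * \<epsilon>\<^sup>2 + \<eta>)" by simp
  qed
qed

text \<open>Gronwall is applied to \<open>e 0 + X t t\<close>, which bounds the relative energy from
  above; dropping the nonnegative capillary part leaves the integrand of the claim. The initial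
  value is at most 0 and the source is \<open>K2 * \<epsilon>\<^sup>2\<close>, with
  \<open>K1\<close> and \<open>K2\<close> free of \<epsilon>.\<close>

lemma relative_energy_bound:
  fixes K :: real
  defines "K1 \<equiv> 2 * K + 1 + (\<gamma> - 1) * K + 4 * K + K * (real CARD('n))\<^sup>2"
  defines "K2 \<equiv> K\<^sup>2 * k\<^sup>2 / 2 * (LINT x|tor. \<rho> 0 x)"
  assumes K: "0 \<le> K"
    and KJ: "\<And>t x w. t \<in> {0..T} \<Longrightarrow> x \<in> torus_cell \<Longrightarrow> \<bar>w \<bullet> (jacobian (u t) (at x) *v w)\<bar> \<le> K * (norm w)\<^sup>2"
    and Kd: "\<And>t x. t \<in> {0..T} \<Longrightarrow> x \<in> torus_cell \<Longrightarrow> \<bar>div_vec (u t) x\<bar> \<le> K"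
    and KD: "\<And>t x. t \<in> {0..T} \<Longrightarrow> x \<in> torus_cell \<Longrightarrow> norm (grad (div_vec (u t)) x) \<le> K"
    and KB: "\<And>t x. t \<in> {0..T} \<Longrightarrow> x \<in> torus_cell \<Longrightarrow> norm (grad (lap (\<rho> t)) x) \<le> K"
    and t: "t \<in> {0..<T}"
  shows "integrable tor (\<lambda>x. rel_enthalpy (\<lambda>s. s powr \<gamma>) (r t x) (\<rho> t x) + r t x / 2 * (norm (v t x - u t x))\<^sup>2)"
    and "(LINT x|tor. rel_enthalpy (\<lambda>s. s powr \<gamma>) (r t x) (\<rho> t x) + r t x / 2 * (norm (v t x - u t x))\<^sup>2)
      \<le> exp (K1 * T) * K2 / K1 * \<epsilon>\<^sup>2"
proof -
  have t': "0 \<le> t" "t \<in> {0..T}" "t < T" using t by auto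
  have "0 \<le> (\<gamma> - 1) * K" "0 \<le> K * (real CARD('n))\<^sup>2" using K \<gamma> by auto
  then have K1: "0 < K1" using K unfolding K1_def by linarith
  have \<rho>0: "0 \<le> (LINT x|tor. \<rho> 0 x)"
    by (rule Bochner_Integration.integral_nonneg) (use \<rho>_pos[of 0] T in \<open>auto simp: less_imp_le\<close>)
  then have K2: "0 \<le> K2 * \<epsilon>\<^sup>2" by (simp add: K2_def)
  have Y: "e 0 + X t t \<le> exp (K1 * T) * (K2 * \<epsilon>\<^sup>2) / K1"
  proof (rule dini_gronwall[OF _ _ K1 K2 _ t'(1,3)])
    show "continuous_on {0..<T} (\<lambda>t. e 0 + X t t)" by (intro continuous_intros diagonal_continuous)
    show "e 0 + X 0 0 \<le> 0" using initial_relative_energy by simp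
    fix \<tau> \<eta> :: real assume \<tau>: "0 < \<tau>" "\<tau> < T" "0 < \<eta>"
    then have "\<tau> \<in> {0<..<T}" "\<tau> \<in> {0..T}" by auto
    then show "\<exists>\<delta>>0. \<forall>s. \<tau> < s \<longrightarrow> s < \<tau> + \<delta> \<longrightarrow> s < T \<longrightarrow>
      (e 0 + X s s) - (e 0 + X \<tau> \<tau>) \<le> (s - \<tau>) * (K1 * (e 0 + X \<tau> \<tau>) + K2 * \<epsilon>\<^sup>2 + \<eta>)"
      unfolding K1_def K2_def using K \<tau>(3) by (intro dini_step KJ Kd KD KB)
  qed
  have ge: "(norm (g t x - grad (\<rho> t) x))\<^sup>2 = (norm (g t x))\<^sup>2 - 2 * (g t x \<bullet> grad (\<rho> t) x) + (norm (grad (\<rho> t) x))\<^sup>2" for x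
    unfolding dot_square_norm[symmetric] by (simp add: inner_diff_left inner_diff_right inner_commute algebra_simps)
  have cG: "continuous_on torus_cell (grad (\<rho> t))" by (rule joint_slice[OF joint_grad t'(2)])
  have w: "integrable tor (\<lambda>x. (norm (g t x - grad (\<rho> t) x))\<^sup>2)"
    unfolding ge
    by (intro Bochner_Integration.integrable_add Bochner_Integration.integrable_diff energy_parts(3)[OF t'(1)] integrable_mult_right
        integrable_bounded_inner[OF gi[OF t'(1)] cG] continuous_imp_integrable_tor continuous_intros cG)
  note H = relative_energy_eq[OF t'(1,2)]
  have wk: "integrable tor (\<lambda>x. \<epsilon> * k / 2 * (norm (g t x - grad (\<rho> t) x))\<^sup>2)"
    by (rule integrable_mult_right) (rule w)
  let ?I = "\<lambda>x. rel_enthalpy (\<lambda>s. s powr \<gamma>) (r t x) (\<rho> t x) + r t x / 2 * (norm (v t x - u t x))\<^sup>2"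
  have I: "?I x = H t t x - \<epsilon> * k / 2 * (norm (g t x - grad (\<rho> t) x))\<^sup>2" for x
    by (simp add: H_def)
  show int: "integrable tor ?I" unfolding I by (rule Bochner_Integration.integrable_diff[OF H(1) wk])
  have "(LINT x|tor. ?I x) \<le> (LINT x|tor. H t t x)"
    by (rule integral_mono[OF int H(1)]) (use \<epsilon> k in \<open>simp add: H_def\<close>)
  also have "\<dots> \<le> e 0 + X t t" using H(2) E_le[OF t'(1)] by (simp add: e_def)
  finally show "(LINT x|tor. ?I x) \<le> exp (K1 * T) * K2 / K1 * \<epsilon>\<^sup>2" using Y by (simp add: mult_ac)
qed

end

section \<open>From weak solutions to the comparison setting, and the final constant\<close>

lemma EK_imp_ek_comparison:
  fixes \<rho>e :: "real \<Rightarrow> real ^ 'n \<Rightarrow> real" and v m u :: "real \<Rightarrow> real ^ 'n \<Rightarrow> real ^ 'n"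
  assumes es: "euler_solution T \<gamma> \<rho> u" and \<epsilon>: "0 < \<epsilon>" and k: "0 < k" and mv: "m = (\<lambda>t x. r t x *\<^sub>R v t x)"
    and EK: "EK_dissipative (\<lambda>s. s powr \<gamma>) (\<lambda>_. k) \<epsilon> r m \<or> EK_conservative (\<lambda>s. s powr \<gamma>) (\<lambda>_. k) \<epsilon> r m"
    and r0: "AE x in lborel. r 0 x = \<rho> 0 x" and m0: "AE x in lborel. m 0 x = \<rho> 0 x *\<^sub>R u 0 x"
  obtains q g0 g where "ek_comparison T \<gamma> \<rho> u \<epsilon> k r q v m g0 g"
proof -
  have "EK_weak_solution (\<lambda>s. s powr \<gamma>) (\<lambda>_. k) \<epsilon> r m"
    using EK by (auto simp: EK_dissipative_def EK_conservative_def)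
  then obtain g0 q where weak: "EK_weak (\<lambda>s. s powr \<gamma>) (\<lambda>_. k) \<epsilon> r m g0 q"
    unfolding EK_weak_solution_def by blast
  obtain E where E: "EK_energy (\<lambda>s. s powr \<gamma>) (\<lambda>_. k) \<epsilon> r m E" "C0_L1 E"
    and le: "\<And>\<theta> \<theta>'. W1inf \<theta> \<theta>' \<Longrightarrow> (\<And>t. 0 \<le> t \<Longrightarrow> 0 \<le> \<theta> t) \<Longrightarrow> (\<exists>R. \<forall>t\<ge>R. \<theta> t = 0) \<Longrightarrow>
      - (LINT (t, x):{0..} \<times> torus_cell|lborel. E t x * \<theta>' t) \<le> (LINT x:torus_cell|lborel. E 0 x * \<theta> 0)"
  proof -
    from EK show thesis
    proof
      assume "EK_dissipative (\<lambda>s. s powr \<gamma>) (\<lambda>_. k) \<epsilon> r m"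
      then show thesis unfolding EK_dissipative_def using that by blast
    next
      assume "EK_conservative (\<lambda>s. s powr \<gamma>) (\<lambda>_. k) \<epsilon> r m"
      then obtain E where "EK_energy (\<lambda>s. s powr \<gamma>) (\<lambda>_. k) \<epsilon> r m E" "C0_L1 E"
        and "\<And>\<theta> \<theta>'. W1inf \<theta> \<theta>' \<Longrightarrow> (\<And>t. 0 \<le> t \<Longrightarrow> 0 \<le> \<theta> t) \<Longrightarrow> (\<exists>R. \<forall>t\<ge>R. \<theta> t = 0) \<Longrightarrow>
          - (LINT (t, x):{0..} \<times> torus_cell|lborel. E t x * \<theta>' t) = (LINT x:torus_cell|lborel. E 0 x * \<theta> 0)"
        unfolding EK_conservative_def by blast
      \<comment> \<open>An equality is in particular an inequality, so conservative solutions are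
        treated like dissipative ones.\<close>
      then show thesis using that[OF _ _ eq_refl] by blast
    qed
  qed
  have E_le: "(LINT x|tor. E t x) \<le> (LINT x|tor. E 0 x)" if "0 \<le> t" for t
    using E(2) _ that by (rule energy_nonincreasing) (fact le)
  obtain g where g: "\<And>t. 0 \<le> t \<Longrightarrow> weak_grad (r t) (g t)"
    and Eg: "E = (\<lambda>t x. energy_density (\<lambda>s. s powr \<gamma>) (\<lambda>_. k) \<epsilon> (r t x) (m t x) (g t x))"
    using E(1) unfolding EK_energy_def by blast
  show thesis
  proof (rule that, intro ek_comparison.intro ek_comparison_axioms.intro)
    show "(LINT x|tor. energy_density (\<lambda>s. s powr \<gamma>) (\<lambda>_. k) \<epsilon> (r t x) (m t x) (g t x))
      \<le> (LINT x|tor. energy_density (\<lambda>s. s powr \<gamma>) (\<lambda>_. k) \<epsilon> (r 0 x) (m 0 x) (g 0 x))" if "0 \<le> t" for t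
      using E_le[OF that] unfolding Eg .
  qed (use es \<epsilon> k mv weak g E(2) r0 m0 in \<open>simp_all only: Eg\<close>)
qed

theorem theorem5p3:
  fixes T \<gamma> C\<^sub>\<kappa> :: real
    and h \<kappa> :: "real \<Rightarrow> real"
    and \<rho> :: "real \<Rightarrow> real ^ 'n \<Rightarrow> real"
    and u :: "real \<Rightarrow> real ^ 'n \<Rightarrow> real ^ 'n"
    and \<rho>\<^sub>0 :: "real ^ 'n \<Rightarrow> real"
    and u\<^sub>0 :: "real ^ 'n \<Rightarrow> real ^ 'n"
  assumes "0 < T" and "1 < \<gamma>" and "h = (\<lambda>r. r powr \<gamma>)"
    and "0 < C\<^sub>\<kappa>" and "\<kappa> = (\<lambda>r. C\<^sub>\<kappa>)"
    and "euler_classical h T \<rho> u" and "\<rho> 0 = \<rho>\<^sub>0" and "u 0 = u\<^sub>0"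
    and "C0_Ck {0..T} 3 \<rho>" and "C1_Ck {0<..<T} 1 \<rho>" and "\<forall>t\<in>{0..T}. \<forall>x. 0 < \<rho> t x"
    and "C0_Ck {0..T} 2 u" and "C1_Ck {0<..<T} 0 u"
  shows "\<exists>C>0. \<forall>(\<rho>e :: real \<Rightarrow> real \<Rightarrow> real ^ 'n \<Rightarrow> real)
                  (ue :: real \<Rightarrow> real \<Rightarrow> real ^ 'n \<Rightarrow> real ^ 'n)
                  (me :: real \<Rightarrow> real \<Rightarrow> real ^ 'n \<Rightarrow> real ^ 'n).
           (\<forall>\<epsilon>>0. me \<epsilon> = (\<lambda>t x. \<rho>e \<epsilon> t x *\<^sub>R ue \<epsilon> t x) \<and>
              (EK_dissipative h \<kappa> \<epsilon> (\<rho>e \<epsilon>) (me \<epsilon>) \<or> EK_conservative h \<kappa> \<epsilon> (\<rho>e \<epsilon>) (me \<epsilon>)) \<and>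
              finite_mass_energy h \<kappa> \<epsilon> (\<rho>e \<epsilon>) (me \<epsilon>) \<and>
              (AE x in lborel. \<rho>e \<epsilon> 0 x = \<rho>\<^sub>0 x) \<and>
              (AE x in lborel. me \<epsilon> 0 x = \<rho>\<^sub>0 x *\<^sub>R u\<^sub>0 x)) \<longrightarrow>
           (\<forall>\<epsilon>>0. AE t in lborel. t \<in> {0..T} \<longrightarrow>
              (let I = (\<lambda>x. rel_enthalpy h (\<rho>e \<epsilon> t x) (\<rho> t x)
                              + \<rho>e \<epsilon> t x / 2 * (norm (ue \<epsilon> t x - u t x))\<^sup>2)
               in set_integrable lborel torus_cell I \<and>
                  (LINT x:torus_cell|lborel. I x) \<le> C * \<epsilon>\<^sup>2))"
proof -
  note h = \<open>h = (\<lambda>r. r powr \<gamma>)\<close> and \<kappa> = \<open>\<kappa> = (\<lambda>r. C\<^sub>\<kappa>)\<close>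
  have es: "euler_solution T \<gamma> \<rho> u"
    using assms unfolding h by (intro euler_solution.intro) auto
  obtain K where K: "0 \<le> K"
    "\<And>t (x :: real ^ 'n) w. t \<in> {0..T} \<Longrightarrow> x \<in> torus_cell \<Longrightarrow> \<bar>w \<bullet> (jacobian (u t) (at x) *v w)\<bar> \<le> K * (norm w)\<^sup>2"
    "\<And>t (x :: real ^ 'n). t \<in> {0..T} \<Longrightarrow> x \<in> torus_cell \<Longrightarrow> \<bar>div_vec (u t) x\<bar> \<le> K"
    "\<And>t (x :: real ^ 'n). t \<in> {0..T} \<Longrightarrow> x \<in> torus_cell \<Longrightarrow> norm (grad (div_vec (u t)) x) \<le> K"
    "\<And>t (x :: real ^ 'n). t \<in> {0..T} \<Longrightarrow> x \<in> torus_cell \<Longrightarrow> norm (grad (lap (\<rho> t)) x) \<le> K"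
    by (rule euler_solution.uniform_bounds[OF es]) (erule that; blast)
  define K1 where "K1 = 2 * K + 1 + (\<gamma> - 1) * K + 4 * K + K * (real CARD('n))\<^sup>2"
  define K2 where "K2 = K\<^sup>2 * C\<^sub>\<kappa>\<^sup>2 / 2 * (LINT x|tor. \<rho> 0 x)"
  \<comment> \<open>\<open>K2\<close> vanishes if \<open>K\<close> does; the added 1 keeps the
    constant positive.\<close>
  let ?C = "\<bar>exp (K1 * T) * K2 / K1\<bar> + 1"
  have bound: "integrable tor (\<lambda>x. rel_enthalpy h (r t x) (\<rho> t x) + r t x / 2 * (norm (v t x - u t x))\<^sup>2)
      \<and> (LINT x|tor. rel_enthalpy h (r t x) (\<rho> t x) + r t x / 2 * (norm (v t x - u t x))\<^sup>2) \<le> ?C * \<epsilon>\<^sup>2"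
    if \<epsilon>: "0 < \<epsilon>" and mv: "m = (\<lambda>t x. r t x *\<^sub>R v t x)"
      and EK: "EK_dissipative h \<kappa> \<epsilon> r m \<or> EK_conservative h \<kappa> \<epsilon> r m"
      and r0: "AE x in lborel. r 0 x = \<rho>\<^sub>0 x" and m0: "AE x in lborel. m 0 x = \<rho>\<^sub>0 x *\<^sub>R u\<^sub>0 x"
      and t: "t \<in> {0..<T}"
    for \<epsilon> t and r :: "real \<Rightarrow> real ^ 'n \<Rightarrow> real" and v m :: "real \<Rightarrow> real ^ 'n \<Rightarrow> real ^ 'n"
  proof -
    obtain q g0 g where ek: "ek_comparison T \<gamma> \<rho> u \<epsilon> C\<^sub>\<kappa> r q v m g0 g"
      by (rule EK_imp_ek_comparison[OF es \<epsilon> \<open>0 < C\<^sub>\<kappa>\<close> mv EK[unfolded h \<kappa>]])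
        (use r0 m0 \<open>\<rho> 0 = \<rho>\<^sub>0\<close> \<open>u 0 = u\<^sub>0\<close> in auto)
    note b = ek_comparison.relative_energy_bound[OF ek K t, folded h K1_def K2_def]
    have "exp (K1 * T) * K2 / K1 * \<epsilon>\<^sup>2 \<le> ?C * \<epsilon>\<^sup>2"
      by (rule mult_right_mono[OF add_increasing2[OF zero_le_one abs_ge_self] zero_le_power2])
    with b show ?thesis by auto
  qed
  show ?thesis
  proof (intro exI[of _ ?C] conjI allI impI)
    show "0 < ?C" by (rule add_nonneg_pos[OF abs_ge_zero zero_less_one])
    fix \<rho>e :: "real \<Rightarrow> real \<Rightarrow> real ^ 'n \<Rightarrow> real" and ue me :: "real \<Rightarrow> real \<Rightarrow> real ^ 'n \<Rightarrow> real ^ 'n" and \<epsilon> :: real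
    assume fam: "\<forall>\<epsilon>>0. me \<epsilon> = (\<lambda>t x. \<rho>e \<epsilon> t x *\<^sub>R ue \<epsilon> t x) \<and>
              (EK_dissipative h \<kappa> \<epsilon> (\<rho>e \<epsilon>) (me \<epsilon>) \<or> EK_conservative h \<kappa> \<epsilon> (\<rho>e \<epsilon>) (me \<epsilon>)) \<and>
              finite_mass_energy h \<kappa> \<epsilon> (\<rho>e \<epsilon>) (me \<epsilon>) \<and>
              (AE x in lborel. \<rho>e \<epsilon> 0 x = \<rho>\<^sub>0 x) \<and>
              (AE x in lborel. me \<epsilon> 0 x = \<rho>\<^sub>0 x *\<^sub>R u\<^sub>0 x)" and \<epsilon>: "0 < \<epsilon>"
    note f = fam[rule_format, OF \<epsilon>]
    note b = bound[OF \<epsilon> f[THEN conjunct1] f[THEN conjunct2, THEN conjunct1]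
        f[THEN conjunct2, THEN conjunct2, THEN conjunct2, THEN conjunct1]
        f[THEN conjunct2, THEN conjunct2, THEN conjunct2, THEN conjunct2]]
    \<comment> \<open>The estimate is available on \<open>{0..<T}\<close>; the single time
      \<open>T\<close> is a null set.\<close>
    have "AE t in lborel. t \<noteq> T" by (rule AE_lborel_singleton)
    then show "AE t in lborel. t \<in> {0..T} \<longrightarrow>
              (let I = (\<lambda>x. rel_enthalpy h (\<rho>e \<epsilon> t x) (\<rho> t x)
                              + \<rho>e \<epsilon> t x / 2 * (norm (ue \<epsilon> t x - u t x))\<^sup>2)
               in set_integrable lborel torus_cell I \<and>
                  (LINT x:torus_cell|lborel. I x) \<le> ?C * \<epsilon>\<^sup>2)"
    proof eventually_elim
      case (elim t)
      show ?case unfolding Let_def set_integrable_tor set_integral_tor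
        using b[of t] elim by auto
    qed
  qed
qed

end
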